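(* Let $(J,E)\in D$ be such that $\det(\mathcal{H}_{J,E})<0$. Then the periodic wave profile $Q_{J,E}$ is a stable equilibrium of $$iQ_t+4ipkQ_z+4k^2Q_{zz}+(1-p^2)Q+|Q|^2Q=0,\qquad k=k(J,E),\ p=p(J,E),$$ in the following sense: there exist $C_0>0$ and $\epsilon_0>0$ such that, if $Q_0\in X$ satisfies $\rho(Q_0,Q_{J,E})\le\epsilon$ for some $\epsilon\le\epsilon_0$, then the solution $Q(z,t)$ of this equation with initial data $Q_0$ satisfies $\rho(Q(\cdot,t),Q_{J,E})\le C_0\epsilon$ for all $t\in\mathbb{R}$.
   Context: **Profiles.** Consider $W_{xx}+W+|W|^2W=0$ ($W:\mathbb{R}\to\mathbb{C}$), with conserved quantities $J=\mathrm{Im}(\overline{W}W_x)$ and $E=\frac12|W_x|^2+\frac12|W|^2+\frac14|W|^4$. Write $J=q(q^2-1)$ with $|q|\ge1$, set $E_-(J)=\frac14(q^2-1)(3q^2+1)$ and $D=\{(J,E)\in\mathbb{R}^2\mid E>E_-(J)\}$. For $(J,E)\in D$ let $y_3<0\le y_1<y_2$ be the roots of $-y^3-2y^2+4Ey-2J^2$, $s(\varphi)=y_1\cos^2\varphi+y_2\sin^2\varphi$, and $$T=2\sqrt2\int_0^{\pi/2}\frac{d\varphi}{\sqrt{s(\varphi)-y_3}},\qquad \Psi=-2\sqrt2\,J\int_0^{\pi/2}\frac{d\varphi}{\sqrt{-y_3}\sqrt{s(\varphi)-y_3}(\sqrt{-y_3}+\sqrt{s(\varphi)-y_3})}$$ ($T$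 is the minimal period of $|W|$ and $\pi+\Psi$ is, modulo $2\pi$, the phase increment of $W$ over a period). Put $k=k(J,E)=\pi/T$, $\ell=\Psi/T$, $p=p(J,E)=k+\ell$. Let $W_{J,E}$ be a solution with invariants $(J,E)$ (unique up to a translation and a constant phase factor), and define $Q_{J,E}$ by $W_{J,E}(x)=e^{ipx}Q_{J,E}(2kx)$; $Q_{J,E}$ is $2\pi$-periodic. **Function space.** $X=H^1_{\mathrm{per}}([0,2\pi],\mathbb{C})$ is the space of $2\pi$-periodic functions in $H^1_{\mathrm{loc}}(\mathbb{R},\mathbb{C})$ with $\|u\|_X^2=\int_0^{2\pi}(|u|^2+|u_z|^2)\,dz$, and $\rho(u,v)=\inf_{\phi,\xi\in\mathbb{R}/2\pi\mathbb{Z}}\|u-e^{-i\phi}v(\cdot+\xi)\|_X$. The Cauchy problem for the evolution equation is globally well-posed in $X$. **The matrix $\mathcal{H}_{J,E}$.** On $X$ let $N(Q)=\frac12\int_0^{2\pi}|Q|^2dz$, $M(Q)=\frac{i}{2}\int_0^{2\pi}\overline{Q}Q_z\,dz$, $\mathcal{E}(Q)=\int_0^{2\pi}\bigl(2k^2|Q_z|^2-\frac14|Q|^4\bigr)dz$, and, for fixed $(J,E)\in D$ with $k=k(J,E)$, $p=p(J,E)$, $\mathcal{E}_{J,E}(Q)=\mathcal{E}(Q)-(1-p^2)N(Q)-4pkM(Q)$. For $(\omega,c)\in\mathbb{R}^2$ sufficiently close to $(0,0)$ there is a unique $(J',E')\in D$ in a neighborhood of $(J,E)$ such that, with $k'=k(J',E')$,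 $p'=p(J',E')$, $\lambda=k/k'$, $$\omega=\lambda^2(1-p'^2)-(1-p^2),\qquad c=4\lambda^2k'p'-4kp.$$ Set $Q^{\omega,c}_{J,E}=\lambda Q_{J',E'}$ and $d_{J,E}(\omega,c)=\mathcal{E}_{J,E}(Q^{\omega,c}_{J,E})-\omega N(Q^{\omega,c}_{J,E})-cM(Q^{\omega,c}_{J,E})$. Then $\mathcal{H}_{J,E}$ is the $2\times2$ Hessian matrix of $d_{J,E}$ with respect to $(\omega,c)$ at $(\omega,c)=(0,0)$. *)

theory Defs
  imports "HOL-Analysis.Analysis"
begin

section \<open>Profiles and their parameters\<close>

definition E_minus :: "real \<Rightarrow> real" where
  "E_minus J = (let q = (SOME q. \<bar>q\<bar> \<ge> 1 \<and> J = q * (q\<^sup>2 - 1)) in (q\<^sup>2 - 1) * (3 * q\<^sup>2 + 1) / 4)"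
  (* q is unique, except that q = 1 and q = -1 both qualify when J = 0 *)

definition par_dom :: "(real \<times> real) set" where
  "par_dom = {(J, E). E > E_minus J}"

definition roots :: "real \<Rightarrow> real \<Rightarrow> real \<times> real \<times> real" where
  "roots J E = (THE (y1, y2, y3). y3 < 0 \<and> 0 \<le> y1 \<and> y1 < y2 \<and>
     {y. - (y^3) - 2 * y^2 + 4 * E * y - 2 * J^2 = 0} = {y1, y2, y3})"

definition y1 :: "real \<Rightarrow> real \<Rightarrow> real" where
  "y1 J E = fst (roots J E)"

definition y2 :: "real \<Rightarrow> real \<Rightarrow> real" where
  "y2 J E = fst (snd (roots J E))"

definition y3 :: "real \<Rightarrow> real \<Rightarrow> real" where
  "y3 J E = snd (snd (roots J E))"

definition s_fun :: "real \<Rightarrow> real \<Rightarrow> real \<Rightarrow> real" where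
  "s_fun J E \<phi> = y1 J E * (cos \<phi>)\<^sup>2 + y2 J E * (sin \<phi>)\<^sup>2"

definition T_per :: "real \<Rightarrow> real \<Rightarrow> real" where
  "T_per J E = 2 * sqrt 2 * (LINT \<phi>:{0..pi/2}|lborel. 1 / sqrt (s_fun J E \<phi> - y3 J E))"

definition Psi :: "real \<Rightarrow> real \<Rightarrow> real" where
  "Psi J E = - 2 * sqrt 2 * J * (LINT \<phi>:{0..pi/2}|lborel.
     1 / (sqrt (- y3 J E) * sqrt (s_fun J E \<phi> - y3 J E)
          * (sqrt (- y3 J E) + sqrt (s_fun J E \<phi> - y3 J E))))"

definition k_par :: "real \<Rightarrow> real \<Rightarrow> real" where
  "k_par J E = pi / T_per J E"

definition l_par :: "real \<Rightarrow> real \<Rightarrow> real" where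
  "l_par J E = Psi J E / T_per J E"

definition p_par :: "real \<Rightarrow> real \<Rightarrow> real" where
  "p_par J E = k_par J E + l_par J E"

definition is_profile :: "real \<Rightarrow> real \<Rightarrow> (real \<Rightarrow> complex) \<Rightarrow> bool" where
  "is_profile J E W \<longleftrightarrow> (\<exists>W'. \<forall>x.
     (W has_vector_derivative W' x) (at x) \<and>
     (W' has_vector_derivative (- W x - (cmod (W x))\<^sup>2 *\<^sub>R W x)) (at x) \<and>
     J = Im (cnj (W x) * W' x) \<and>
     E = (cmod (W' x))\<^sup>2 / 2 + (cmod (W x))\<^sup>2 / 2 + (cmod (W x))^4 / 4)"

definition W_prof :: "real \<Rightarrow> real \<Rightarrow> real \<Rightarrow> complex" where
  "W_prof J E = (SOME W. is_profile J E W)"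
  (* unique up to a translation and a constant phase factor; everything below is
     invariant under both *)

text \<open>The relation \<open>W x = exp (i p x) Q (2 k x)\<close>, solved for \<open>Q\<close>.\<close>

definition Q_prof :: "real \<Rightarrow> real \<Rightarrow> real \<Rightarrow> complex" where
  "Q_prof J E z = cis (- (p_par J E * (z / (2 * k_par J E)))) * W_prof J E (z / (2 * k_par J E))"


section \<open>The space of periodic \<open>H\<^sup>1\<close> functions\<close>

definition test_fun :: "(real \<Rightarrow> real) \<Rightarrow> bool" where
  "test_fun \<phi> \<longleftrightarrow> (\<forall>n x. (deriv ^^ n) \<phi> field_differentiable at x) \<and> bounded {x. \<phi> x \<noteq> 0}"

definition L2_loc :: "(real \<Rightarrow> complex) \<Rightarrow> bool" where
  "L2_loc u \<longleftrightarrow> u \<in> borel_measurable lborel \<and>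
     (\<forall>a b. set_integrable lborel {a..b} (\<lambda>x. (cmod (u x))\<^sup>2))"

definition is_weak_deriv :: "(real \<Rightarrow> complex) \<Rightarrow> (real \<Rightarrow> complex) \<Rightarrow> bool" where
  "is_weak_deriv u v \<longleftrightarrow> L2_loc v \<and>
     (\<forall>\<phi>. test_fun \<phi> \<longrightarrow> (LINT x|lborel. deriv \<phi> x *\<^sub>R u x) = - (LINT x|lborel. \<phi> x *\<^sub>R v x))"

definition wderiv :: "(real \<Rightarrow> complex) \<Rightarrow> real \<Rightarrow> complex" where
  "wderiv u = (SOME v. is_weak_deriv u v)"
  (* weak derivatives are unique up to null sets; wderiv is only used under integrals *)

text \<open>Every class of functions in \<open>H\<^sup>1\<^sub>l\<^sub>o\<^sub>c\<close> of the real line has exactly one continuous representative;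
  elements of \<open>X\<close> are these representatives (continuity implies \<open>L2_loc u\<close>).\<close>

definition X_space :: "(real \<Rightarrow> complex) set" where
  "X_space = {u. continuous_on UNIV u \<and> (\<forall>z. u (z + 2 * pi) = u z) \<and> (\<exists>v. is_weak_deriv u v)}"

definition X_norm :: "(real \<Rightarrow> complex) \<Rightarrow> real" where
  "X_norm u = sqrt (LINT z:{0..2*pi}|lborel. (cmod (u z))\<^sup>2 + (cmod (wderiv u z))\<^sup>2)"

definition X_dist :: "(real \<Rightarrow> complex) \<Rightarrow> (real \<Rightarrow> complex) \<Rightarrow> real" where
  "X_dist u v = X_norm (\<lambda>z. u z - v z)"

definition orbit_dist :: "(real \<Rightarrow> complex) \<Rightarrow> (real \<Rightarrow> complex) \<Rightarrow> real" where
  "orbit_dist u v = (INF (\<phi>, \<xi>) \<in> UNIV. X_dist u (\<lambda>z. cis (- \<phi>) * v (z + \<xi>)))"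


section \<open>The evolution equation\<close>

text \<open>Solutions in \<open>C(\<real>, X)\<close>, with the equation holding in the dual space of \<open>X\<close>: it is solved for
  \<open>Q\<^sub>t\<close>, paired with an arbitrary \<open>\<phi> \<in> X\<close>, and the second-order term is integrated by parts.\<close>

definition is_solution :: "real \<Rightarrow> real \<Rightarrow> (real \<Rightarrow> real \<Rightarrow> complex) \<Rightarrow> bool" where
  "is_solution J E Q \<longleftrightarrow> (let k = k_par J E; p = p_par J E in
     (\<forall>t. Q t \<in> X_space) \<and>
     (\<forall>t. ((\<lambda>\<tau>. X_dist (Q \<tau>) (Q t)) \<longlongrightarrow> 0) (at t)) \<and>
     (\<forall>\<phi>\<in>X_space. \<forall>t.
        ((\<lambda>\<tau>. LINT z:{0..2*pi}|lborel. Q \<tau> z * \<phi> z) has_vector_derivative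
           \<i> * (LINT z:{0..2*pi}|lborel.
                 4 * \<i> * of_real (p * k) * wderiv (Q t) z * \<phi> z
                 - 4 * of_real (k\<^sup>2) * wderiv (Q t) z * wderiv \<phi> z
                 + of_real (1 - p\<^sup>2) * Q t z * \<phi> z
                 + of_real ((cmod (Q t z))\<^sup>2) * Q t z * \<phi> z)) (at t)))"


section \<open>The matrix \<open>\<H>\<close>\<close>

definition N_fun :: "(real \<Rightarrow> complex) \<Rightarrow> real" where
  "N_fun Q = (LINT z:{0..2*pi}|lborel. (cmod (Q z))\<^sup>2) / 2"

text \<open>The quantity under \<open>Re\<close> is already real, by periodicity of \<open>Q\<close>.\<close>

definition M_fun :: "(real \<Rightarrow> complex) \<Rightarrow> real" where
  "M_fun Q = Re (\<i> / 2 * (LINT z:{0..2*pi}|lborel. cnj (Q z) * wderiv Q z))"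

definition En_fun :: "real \<Rightarrow> (real \<Rightarrow> complex) \<Rightarrow> real" where
  "En_fun k Q = (LINT z:{0..2*pi}|lborel. 2 * k\<^sup>2 * (cmod (wderiv Q z))\<^sup>2 - (cmod (Q z))^4 / 4)"

definition En_JE :: "real \<Rightarrow> real \<Rightarrow> (real \<Rightarrow> complex) \<Rightarrow> real" where
  "En_JE J E Q = En_fun (k_par J E) Q - (1 - (p_par J E)\<^sup>2) * N_fun Q
                 - 4 * p_par J E * k_par J E * M_fun Q"

definition omega_c :: "real \<Rightarrow> real \<Rightarrow> real \<times> real \<Rightarrow> real \<times> real" where
  "omega_c J E = (\<lambda>(J', E').
     let k = k_par J E; p = p_par J E; k' = k_par J' E'; p' = p_par J' E'; lam = k / k'
     in (lam\<^sup>2 * (1 - p'\<^sup>2) - (1 - p\<^sup>2), 4 * lam\<^sup>2 * k' * p' - 4 * k * p))"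

definition is_local_inverse :: "real \<Rightarrow> real \<Rightarrow> (real \<times> real \<Rightarrow> real \<times> real) \<Rightarrow> bool" where
  "is_local_inverse J E g \<longleftrightarrow> (\<exists>U V. open U \<and> (0, 0) \<in> U \<and> open V \<and> (J, E) \<in> V \<and>
     (\<forall>w\<in>U. g w \<in> V \<inter> par_dom \<and> omega_c J E (g w) = w \<and>
        (\<forall>x \<in> V \<inter> par_dom. omega_c J E x = w \<longrightarrow> x = g w)))"

definition JE_of :: "real \<Rightarrow> real \<Rightarrow> real \<times> real \<Rightarrow> real \<times> real" where
  "JE_of J E = (SOME g. is_local_inverse J E g)"
  (* only the germ at (0, 0) matters below *)

definition Q_omega_c :: "real \<Rightarrow> real \<Rightarrow> real \<times> real \<Rightarrow> real \<Rightarrow> complex" where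
  "Q_omega_c J E w = (case JE_of J E w of (J', E') \<Rightarrow>
     (\<lambda>z. of_real (k_par J E / k_par J' E') * Q_prof J' E' z))"

definition d_fun :: "real \<Rightarrow> real \<Rightarrow> real \<times> real \<Rightarrow> real" where
  "d_fun J E = (\<lambda>(\<omega>, c). En_JE J E (Q_omega_c J E (\<omega>, c))
     - \<omega> * N_fun (Q_omega_c J E (\<omega>, c)) - c * M_fun (Q_omega_c J E (\<omega>, c)))"

definition pd1 :: "(real \<times> real \<Rightarrow> real) \<Rightarrow> real \<times> real \<Rightarrow> real" where
  "pd1 f = (\<lambda>(a, b). deriv (\<lambda>x. f (x, b)) a)"

definition pd2 :: "(real \<times> real \<Rightarrow> real) \<Rightarrow> real \<times> real \<Rightarrow> real" where
  "pd2 f = (\<lambda>(a, b). deriv (\<lambda>x. f (a, x)) b)"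

definition hessian :: "(real \<times> real \<Rightarrow> real) \<Rightarrow> real \<times> real \<Rightarrow> real^2^2" where
  "hessian f w = vector [vector [pd1 (pd1 f) w, pd1 (pd2 f) w],
                         vector [pd2 (pd1 f) w, pd2 (pd2 f) w]]"

definition H_mat :: "real \<Rightarrow> real \<Rightarrow> real^2^2" where
  "H_mat J E = hessian (d_fun J E) (0, 0)"

end

theory Submission
  imports Defs "HOL-Complex_Analysis.Great_Picard"
begin

text \<open>The mass, momentum and energy of a solution are conserved, so it suffices to find a combination of
  them that controls the distance to the orbit of the profile. Take the action, of which the profile is a
  critical point, plus a positive multiple of the square of the deviation of a linear combination of mass and
  momentum from its value at the profile. In the frame of the profile \<open>W\<close>, the second variation of the
  action is an integral of a square on each half period, by a Jacobi identity based on the Jacobi fields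
  \<open>iW\<close> and \<open>W'\<close>; the boundary terms at the half periods leave a single negative direction, which is
  explicit in terms of \<open>W\<close>, and the squared constraint reverses its sign. The form is then nonnegative with
  kernel spanned by \<open>iW\<close> and \<open>W'\<close>, and compactness makes it coercive on the orthogonal complement.
  Minimizing over phase and translation provides the orthogonality, and a continuity argument in time keeps
  the solution close to the orbit. Weak solutions are handled with difference quotients in the conservation
  laws.\<close>

text \<open>The two Jacobi fields span the plane except where \<open>rx\<close>, half the derivative
  of |W|^2, vanishes: at \<open>0\<close>, \<open>T / 2\<close> and \<open>T\<close>. There the
  Jacobi identity has singular boundary terms, harmless if the perturbation lies on the line to
  which the frame collapses. That is one real condition at \<open>0\<close> (at \<open>T\<close> it
  is the same, by quasi-periodicity) and one at \<open>T / 2\<close>, and two special functions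
  absorb them. \<open>U\<close> is annihilated by the linearized operator but has a kink at the
  period, so pairing the form with it reads off \<open>Re (P 0)\<close>; it is built from the
  generators of scaling and Galilei boosts, corrected by quasi-periodic functions. \<open>vm\<close>
  is quasi-periodic and is mapped to a combination of \<open>W\<close> and \<open>i W'\<close>, the
  gradients of mass and momentum; this is what makes the penalty a conserved quantity. All signs
  reduce to two inequalities, \<open>dl_pos\<close> and \<open>fneg\<close>, for the mean of |W|^2,
  obtained by trapping that mean between two explicit numbers. Describing the wave by the angle
  \<open>ph\<close> instead of elliptic functions turns the identities into trigonometry and
  algebra.\<close>

abbreviation cmod2 :: "complex \<Rightarrow> real" where "cmod2 z \<equiv> (cmod z)\<^sup>2"
abbreviation intg :: "real \<Rightarrow> real \<Rightarrow> (real \<Rightarrow> 'a::{banach,second_countable_topology}) \<Rightarrow> bool" where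
  "intg a b f \<equiv> set_integrable lborel {a..b} f"

section \<open>Locally square integrable functions\<close>

lemma L2_loc_measurable [measurable_dest]: "L2_loc f \<Longrightarrow> f \<in> borel_measurable borel"
  by (simp add: L2_loc_def)

lemma L2_loc_sq_integrable: "L2_loc f \<Longrightarrow> intg a b (\<lambda>x. cmod2 (f x))"
  by (simp add: L2_loc_def)

lemma L2_loc_I:
  assumes "f \<in> borel_measurable borel" "\<And>a b. intg a b (\<lambda>x. cmod2 (f x))"
  shows "L2_loc f"
  using assms by (simp add: L2_loc_def)

lemma set_integral_pw_cong: "(\<And>x. f x = g x) \<Longrightarrow> set_lebesgue_integral lborel A f = set_lebesgue_integral lborel A g"
  by presburger

lemma set_integrable_dominated:
  fixes f :: "real \<Rightarrow> 'a::{banach, second_countable_topology}" and g :: "real \<Rightarrow> real"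
  assumes "intg a b g" "f \<in> borel_measurable borel"
    and "\<And>x. x \<in> {a..b} \<Longrightarrow> norm (f x) \<le> g x"
  shows "intg a b f"
  by (rule set_integrable_bound[OF assms(1)])
     (use assms(2,3) in \<open>auto simp: set_borel_measurable_def intro!: AE_I2 order_trans[OF assms(3)]\<close>)

lemma set_integrable_continuous:
  fixes f :: "real \<Rightarrow> 'a::euclidean_space"
  assumes "continuous_on UNIV f"
  shows "intg a b f"
  by (rule borel_integrable_atLeastAtMost') (rule continuous_on_subset[OF assms], simp)

lemma L2_loc_mult_integrable:
  assumes f: "L2_loc f" and g: "L2_loc g"
  shows "intg a b (\<lambda>x. f x * g x)"
proof (rule set_integrable_dominated)
  show "intg a b (\<lambda>x. cmod2 (f x) + cmod2 (g x))"
    by (intro set_integral_add L2_loc_sq_integrable f g)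
  show "(\<lambda>x. f x * g x) \<in> borel_measurable borel" using f g by measurable
  fix x
  have "0 \<le> (cmod (f x) - cmod (g x))\<^sup>2" by simp
  hence "2 * (cmod (f x) * cmod (g x)) \<le> cmod2 (f x) + cmod2 (g x)"
    by (simp add: power2_eq_square algebra_simps)
  moreover have "0 \<le> cmod (f x) * cmod (g x)" by simp
  ultimately show "norm (f x * g x) \<le> cmod2 (f x) + cmod2 (g x)"
    unfolding norm_mult by linarith
qed

lemma L2_loc_continuous: "continuous_on UNIV f \<Longrightarrow> L2_loc f"
  by (rule L2_loc_I)
     (auto intro!: borel_measurable_continuous_onI set_integrable_continuous continuous_intros)

lemma L2_loc_add:
  assumes f: "L2_loc f" and g: "L2_loc g"
  shows "L2_loc (\<lambda>x. f x + g x)"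
proof (rule L2_loc_I)
  show "(\<lambda>x. f x + g x) \<in> borel_measurable borel" using f g by measurable
  fix a b
  show "intg a b (\<lambda>x. cmod2 (f x + g x))"
  proof (rule set_integrable_dominated)
    show "intg a b (\<lambda>x. 2 * cmod2 (f x) + 2 * cmod2 (g x))"
      by (intro set_integral_add set_integrable_mult_right L2_loc_sq_integrable f g)
    show "(\<lambda>x. cmod2 (f x + g x)) \<in> borel_measurable borel" using f g by measurable
    fix x
    have "cmod2 (f x + g x) \<le> (cmod (f x) + cmod (g x))\<^sup>2"
      by (intro power_mono norm_triangle_ineq) simp
    also have "\<dots> \<le> 2 * cmod2 (f x) + 2 * cmod2 (g x)"
      using sum_squares_bound[of "cmod (f x)" "cmod (g x)"] by (simp add: power2_sum)
    finally show "norm (cmod2 (f x + g x)) \<le> 2 * cmod2 (f x) + 2 * cmod2 (g x)" by simp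
  qed
qed

lemma L2_loc_mult_bounded:
  assumes f: "L2_loc f" and g: "continuous_on UNIV g"
  shows "L2_loc (\<lambda>x. g x * f x)"
proof (rule L2_loc_I)
  have [measurable]: "g \<in> borel_measurable borel" using g by (rule borel_measurable_continuous_onI)
  show "(\<lambda>x. g x * f x) \<in> borel_measurable borel" using f by measurable
  fix a b :: real
  have "compact (g ` {a..b})"
    by (intro compact_continuous_image continuous_on_subset[OF g]) auto
  then obtain C where C: "\<And>x. x \<in> {a..b} \<Longrightarrow> cmod (g x) \<le> C"
    by (meson bounded_iff compact_imp_bounded imageI)
  show "intg a b (\<lambda>x. cmod2 (g x * f x))"
  proof (rule set_integrable_dominated)
    show "intg a b (\<lambda>x. C\<^sup>2 * cmod2 (f x))"
      by (intro set_integrable_mult_right L2_loc_sq_integrable f)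
    show "(\<lambda>x. cmod2 (g x * f x)) \<in> borel_measurable borel" using f by measurable
    fix x assume "x \<in> {a..b}"
    hence "cmod2 (g x) * cmod2 (f x) \<le> C\<^sup>2 * cmod2 (f x)"
      by (intro mult_right_mono power_mono C) auto
    thus "norm (cmod2 (g x * f x)) \<le> C\<^sup>2 * cmod2 (f x)"
      by (simp add: norm_mult power_mult_distrib)
  qed
qed

lemma L2_loc_cmult: "L2_loc f \<Longrightarrow> L2_loc (\<lambda>x. c * f x)"
  by (rule L2_loc_mult_bounded) auto

lemma L2_loc_cnj: "L2_loc f \<Longrightarrow> L2_loc (\<lambda>x. cnj (f x))"
  using borel_measurable_continuous_on[of cnj f borel]
  by (auto simp: L2_loc_def intro!: continuous_intros)

lemma L2_loc_minus: "L2_loc f \<Longrightarrow> L2_loc (\<lambda>x. - f x)"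
  by (auto simp: L2_loc_def)

lemma L2_loc_diff: "L2_loc f \<Longrightarrow> L2_loc g \<Longrightarrow> L2_loc (\<lambda>x. f x - g x)"
  using L2_loc_add[of f "\<lambda>x. - g x"] L2_loc_minus[of g] by simp

lemma L2_loc_integrable: "L2_loc f \<Longrightarrow> intg a b f"
  using L2_loc_mult_integrable[of f "\<lambda>_. 1"] L2_loc_continuous[of "\<lambda>_. 1"] by simp

section \<open>Change of variables, additivity and Fubini on a triangle\<close>

lemma set_integral_affine:
  fixes f :: "real \<Rightarrow> 'a::euclidean_space"
  assumes "c > 0"
  shows "(LINT x:{a..b}|lborel. f (t + c * x)) = (1 / c) *\<^sub>R (LINT x:{t + c * a..t + c * b}|lborel. f x)"
proof -
  have *: "indicator {t + c * a..t + c * b} (t + c * x) = (indicator {a..b} x :: real)" for x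
    using assms by (auto simp: indicator_def)
  show ?thesis
    unfolding set_lebesgue_integral_def
    by (subst (2) lborel_integral_real_affine[where c = c and t = t]) (use assms in \<open>auto simp: *\<close>)
qed

lemma set_integrable_affine:
  fixes f :: "real \<Rightarrow> 'a::euclidean_space"
  assumes "c > 0" "set_integrable lborel {t + c * a..t + c * b} f"
  shows "intg a b (\<lambda>x. f (t + c * x))"
proof -
  have *: "indicator {t + c * a..t + c * b} (t + c * x) = (indicator {a..b} x :: real)" for x
    using assms by (auto simp: indicator_def)
  show ?thesis
    using lborel_integrable_real_affine[OF assms(2)[unfolded set_integrable_def], of c t] assms(1)
    by (simp add: set_integrable_def *)
qed

lemma L2_loc_affine:
  assumes "L2_loc f" "c > 0" shows "L2_loc (\<lambda>x. f (t + c * x))"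
proof (rule L2_loc_I)
  show "(\<lambda>x. f (t + c * x)) \<in> borel_measurable borel"
    using L2_loc_measurable[OF assms(1)] by measurable
  show "intg a b (\<lambda>x. cmod2 (f (t + c * x)))" for a b
    by (rule set_integrable_affine[where f = "\<lambda>x. cmod2 (f x)"]) (use assms L2_loc_sq_integrable in auto)
qed

lemma set_integral_split:
  fixes f :: "real \<Rightarrow> 'a::euclidean_space"
  assumes "a \<le> b" "b \<le> c" "\<And>a b. intg a b f"
  shows "(LINT x:{a..c}|lborel. f x) = (LINT x:{a..b}|lborel. f x) + (LINT x:{b..c}|lborel. f x)"
proof -
  have "(LINT x:{a..c}|lborel. f x) = (LINT x:{a..b} \<union> {b..c}|lborel. f x)"
    using assms by (simp add: ivl_disj_un)
  also have "\<dots> = (LINT x:{a..b}|lborel. f x) + (LINT x:{b..c}|lborel. f x)"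
  proof (rule set_integral_Un_AE)
    have "AE x in lborel. x \<noteq> b" by (rule AE_lborel_singleton)
    thus "AE x in lborel. \<not> (x \<in> {a..b} \<and> x \<in> {b..c})" by eventually_elim auto
  qed (use assms in auto)
  finally show ?thesis .
qed

text \<open>The closed intervals form an intersection stable generator of the Borel sets, so the
  vanishing of the integrals extends to all Borel sets by a Dynkin argument; a density whose
  integrals all vanish is zero almost everywhere. Cutting off to \<open>{-N..N}\<close> supplies
  integrability.\<close>

lemma set_integral_zero_imp_AE_zero:
  fixes v :: "real \<Rightarrow> 'a::euclidean_space"
  assumes int: "\<And>a b. intg a b v"
    and zero: "\<And>a b. a \<le> b \<Longrightarrow> (LINT x:{a..b}|lborel. v x) = 0"
  shows "AE x in lborel. v x = 0"
proof -
  have main: "AE x in lborel. indicator {-real N..real N} x *\<^sub>R v x = 0" for N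
  proof (rule sigma_finite_measure.density_zero[OF sigma_finite_lborel])
    let ?w = "\<lambda>x. indicator {-real N..real N} x *\<^sub>R v x"
    show intw: "integrable lborel ?w" using int[of "-real N" "real N"] by (simp add: set_integrable_def)
    have si: "set_integrable lborel A ?w" if "A \<in> sets lborel" for A
      using integrable_mult_indicator[OF that intw] by (simp add: set_integrable_def)
    have all: "integral\<^sup>L lborel ?w = 0"
      using zero[of "-real N" "real N"] by (simp add: set_lebesgue_integral_def)
    fix A :: "real set" assume "A \<in> sets lborel"
    hence As: "A \<in> sigma_sets UNIV (range (\<lambda>(a, b). {a..b::real}))"
      by (simp add: borel_eq_atLeastAtMost sets_measure_of)
    have IS: "Int_stable (range (\<lambda>(a, b). {a..b::real}))"
      unfolding Int_stable_def by (force simp: Int_atLeastAtMost)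
    have CL: "range (\<lambda>(a, b). {a..b::real}) \<subseteq> Pow UNIV" by simp
    from As show "set_lebesgue_integral lborel A ?w = 0"
    proof (induction rule: sigma_sets_induct_disjoint[OF IS CL, consumes 1])
      fix A assume "A \<in> range (\<lambda>(a, b). {a..b::real})"
      then obtain a b where A: "A = {a..b}" by auto
      have "(LINT x:A|lborel. ?w x) = (LINT x:{max a (-real N)..min b (real N)}|lborel. v x)"
        unfolding set_lebesgue_integral_def A
        by (intro Bochner_Integration.integral_cong) (auto simp: indicator_def)
      thus "(LINT x:A|lborel. ?w x) = 0"
        using zero[of "max a (-real N)" "min b (real N)"]
        by (cases "max a (-real N) \<le> min b (real N)") (auto simp: set_lebesgue_integral_def)
    next
      show "(LINT x:{}|lborel. ?w x) = 0" by (simp add: set_lebesgue_integral_def)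
    next
      fix A assume A: "A \<in> sigma_sets UNIV (range (\<lambda>(a, b). {a..b::real}))"
        and z: "(LINT x:A|lborel. ?w x) = 0"
      hence Am: "A \<in> sets lborel" by (simp add: borel_eq_atLeastAtMost sets_measure_of)
      have "(LINT x:A \<union> (UNIV - A)|lborel. ?w x) = (LINT x:A|lborel. ?w x) + (LINT x:UNIV - A|lborel. ?w x)"
        by (rule set_integral_Un) (use Am si in auto)
      thus "(LINT x:UNIV - A|lborel. ?w x) = 0"
        using z all by (simp add: set_lebesgue_integral_def)
    next
      fix A :: "nat \<Rightarrow> real set"
      assume d: "disjoint_family A" and A: "range A \<subseteq> sigma_sets UNIV (range (\<lambda>(a, b). {a..b::real}))"
        and z: "\<And>i. (LINT x:A i|lborel. ?w x) = 0"
      hence Am: "A i \<in> sets lborel" for i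
        by (auto simp: borel_eq_atLeastAtMost sets_measure_of)
      have "(LINT x:(\<Union>i. A i)|lborel. ?w x) = (\<Sum>i. (LINT x:A i|lborel. ?w x))"
        by (rule lebesgue_integral_countable_add[OF Am])
           (use d si Am in \<open>auto simp: disjoint_family_on_def\<close>)
      thus "(LINT x:(\<Union>i. A i)|lborel. ?w x) = 0" using z by simp
    qed
  qed
  have "AE x in lborel. \<forall>N. indicator {-real N..real N} x *\<^sub>R v x = 0"
    unfolding AE_all_countable using main by blast
  thus ?thesis
  proof eventually_elim
    case (elim x)
    obtain N where "\<bar>x\<bar> \<le> real N" using real_arch_simple by blast
    thus ?case using elim[rule_format, of N] by (auto simp: indicator_def abs_le_iff)
  qed
qed

lemma of_real_indicator: "of_real (indicator A x) = indicator A x"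
  by (simp add: indicator_def)

text \<open>The two iterated integrals are the integrals of \<open>f x * g y\<close> over the two
  halves of the square cut along its diagonal. This is integration by parts for indefinite
  integrals.\<close>

lemma Fubini_triangle:
  fixes f g :: "real \<Rightarrow> complex"
  assumes f: "intg a b f" and g: "intg a b g"
  shows "(LINT x:{a..b}|lborel. f x * (LINT y:{a..x}|lborel. g y))
       + (LINT y:{a..b}|lborel. g y * (LINT x:{a..y}|lborel. f x))
       = (LINT x:{a..b}|lborel. f x) * (LINT y:{a..b}|lborel. g y)"
proof -
  define F where "F = (\<lambda>x. indicator {a..b} x *\<^sub>R f x)"
  define G where "G = (\<lambda>x. indicator {a..b} x *\<^sub>R g x)"
  have F: "integrable lborel F" and G: "integrable lborel G"
    using f g by (auto simp: set_integrable_def F_def G_def)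
  have [measurable]: "F \<in> borel_measurable borel" "G \<in> borel_measurable borel"
    using F G borel_measurable_integrable by force+
  define h where "h = (\<lambda>x y. F x * G y * (if y \<le> x then 1 else 0))"
  have h: "h = (\<lambda>x y. F x * G y * indicator {..x} y)"
    by (auto simp: h_def indicator_def fun_eq_iff)
  have GI: "integrable lborel (\<lambda>y. G y * indicator A y)" if "A \<in> sets borel" for A
    using integrable_mult_indicator[of A lborel G] that G
    by (simp add: scaleR_conv_of_real of_real_indicator mult.commute)
  have FI: "integrable lborel (\<lambda>y. F y * indicator A y)" if "A \<in> sets borel" for A
    using integrable_mult_indicator[of A lborel F] that F
    by (simp add: scaleR_conv_of_real of_real_indicator mult.commute)
  have hm [measurable]: "case_prod h \<in> borel_measurable (lborel \<Otimes>\<^sub>M lborel)"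
    unfolding h_def by measurable
  have int_h: "integrable (lborel \<Otimes>\<^sub>M lborel) (case_prod h)"
  proof (rule lborel_pair.Fubini_integrable)
    show "AE x in lborel. integrable lborel (\<lambda>y. case_prod h (x, y))"
      using GI by (auto simp: h mult.assoc intro!: AE_I2)
    have "integrable lborel (\<lambda>x. norm (F x) * (LINT y|lborel. norm (G y)))"
      using F by auto
    thus "integrable lborel (\<lambda>x. LINT y|lborel. norm (case_prod h (x, y)))"
    proof (rule Bochner_Integration.integrable_bound)
      show "AE x in lborel. norm (LINT y|lborel. norm (case_prod h (x, y)))
          \<le> norm (norm (F x) * (LINT y|lborel. norm (G y)))"
      proof (rule AE_I2)
        fix x
        have "(LINT y|lborel. norm (h x y)) \<le> (LINT y|lborel. norm (F x) * norm (G y))"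
        proof (rule integral_mono)
          show "integrable lborel (\<lambda>y. norm (h x y))"
            using GI[of "{..x}"] by (auto simp: h mult.assoc intro!: integrable_norm integrable_mult_right)
          show "integrable lborel (\<lambda>y. norm (F x) * norm (G y))" using G by auto
        qed (auto simp: h norm_mult indicator_def)
        thus "norm (LINT y|lborel. norm (case_prod h (x, y)))
          \<le> norm (norm (F x) * (LINT y|lborel. norm (G y)))"
          by (simp add: integral_nonneg)
      qed
    qed measurable
  qed simp
  have "(LINT y|lborel. LINT x|lborel. h x y) = (LINT x|lborel. LINT y|lborel. h x y)"
    using lborel_pair.Fubini_integral[OF int_h] by simp
  also have "(LINT x|lborel. LINT y|lborel. h x y) = (LINT x:{a..b}|lborel. f x * (LINT y:{a..x}|lborel. g y))"
    unfolding set_lebesgue_integral_def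
  proof (rule Bochner_Integration.integral_cong)
    fix x :: real
    have "(LINT y|lborel. h x y) = F x * (LINT y|lborel. G y * indicator {..x} y)"
      by (simp add: h mult.assoc)
    also have "\<dots> = F x * (LINT y|lborel. indicator {a..x} y *\<^sub>R g y)"
    proof (cases "x \<in> {a..b}")
      case True
      hence "G y * indicator {..x} y = indicator {a..x} y *\<^sub>R g y" for y
        by (auto simp: G_def indicator_def)
      thus ?thesis by simp
    qed (simp add: F_def)
    finally show "(LINT y|lborel. h x y) = indicator {a..b} x *\<^sub>R (f x * (LINT y|lborel. indicator {a..x} y *\<^sub>R g y))"
      by (simp add: F_def)
  qed simp
  finally have 1: "(LINT x:{a..b}|lborel. f x * (LINT y:{a..x}|lborel. g y)) = (LINT y|lborel. LINT x|lborel. h x y)"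
    by simp
  have 2: "(LINT y|lborel. G y * (LINT x|lborel. F x * indicator {..y} x)) = (LINT y:{a..b}|lborel. g y * (LINT x:{a..y}|lborel. f x))"
    unfolding set_lebesgue_integral_def
  proof (rule Bochner_Integration.integral_cong)
    fix x :: real
    have "G x * (LINT y|lborel. F y * indicator {..x} y) = G x * (LINT y|lborel. indicator {a..x} y *\<^sub>R f y)"
    proof (cases "x \<in> {a..b}")
      case True
      hence "F y * indicator {..x} y = indicator {a..x} y *\<^sub>R f y" for y
        by (auto simp: F_def indicator_def)
      thus ?thesis by simp
    qed (simp add: G_def)
    thus "G x * (LINT y|lborel. F y * indicator {..x} y) = indicator {a..b} x *\<^sub>R (g x * (LINT y|lborel. indicator {a..x} y *\<^sub>R f y))"
      by (simp add: G_def)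
  qed simp
  \<comment> \<open>For fixed \<open>y\<close> the two sections share only the point
    \<open>x = y\<close>, a null set.\<close>
  have 3: "(LINT x|lborel. h x y) + G y * (LINT x|lborel. F x * indicator {..y} x) = G y * (LINT x|lborel. F x)" for y
  proof -
    have "(LINT x|lborel. h x y) = G y * (LINT x|lborel. F x * indicator {y..} x)"
    proof -
      have "h x y = G y * (F x * indicator {y..} x)" for x by (auto simp: h indicator_def)
      thus ?thesis by simp
    qed
    moreover have "(LINT x|lborel. F x * indicator {y..} x) + (LINT x|lborel. F x * indicator {..y} x) = (LINT x|lborel. F x)"
    proof -
      have "(LINT x|lborel. F x * indicator {y..} x) + (LINT x|lborel. F x * indicator {..y} x)
          = (LINT x|lborel. F x * indicator {y..} x + F x * indicator {..y} x)"
        by (rule Bochner_Integration.integral_add[symmetric]) (auto intro: FI)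
      also have "\<dots> = (LINT x|lborel. F x)"
      proof (rule integral_cong_AE)
        have "AE x in lborel. x \<noteq> y" by (rule AE_lborel_singleton)
        thus "AE x in lborel. F x * indicator {y..} x + F x * indicator {..y} x = F x"
          by eventually_elim (auto simp: indicator_def)
      qed measurable
      finally show ?thesis .
    qed
    ultimately show ?thesis by (simp add: distrib_left[symmetric])
  qed
  have i1: "integrable lborel (\<lambda>y. LINT x|lborel. h x y)"
    using lborel_pair.integrable_snd[OF int_h] by simp
  have i2: "integrable lborel (\<lambda>y. G y * (LINT x|lborel. F x * indicator {..y} x))"
  proof -
    have "integrable lborel (\<lambda>y. G y * (LINT x|lborel. F x) - (LINT x|lborel. h x y))"
      using G i1 by auto
    moreover have "G y * (LINT x|lborel. F x * indicator {..y} x) = G y * (LINT x|lborel. F x) - (LINT x|lborel. h x y)" for y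
      using 3[of y] by (simp add: algebra_simps)
    ultimately show ?thesis by simp
  qed
  have "(LINT y|lborel. LINT x|lborel. h x y) + (LINT y|lborel. G y * (LINT x|lborel. F x * indicator {..y} x))
     = (LINT y|lborel. G y * (LINT x|lborel. F x))"
    by (subst Bochner_Integration.integral_add[symmetric, OF i1 i2]) (simp add: 3)
  also have "\<dots> = (LINT x|lborel. F x) * (LINT y|lborel. G y)" by (simp add: mult.commute)
  finally show ?thesis
    unfolding 1 2[symmetric] by (simp add: set_lebesgue_integral_def F_def[symmetric] G_def[symmetric])
qed

section \<open>Absolutely continuous functions with square integrable derivative\<close>

text \<open>Membership in \<open>H^1_loc\<close> together with a chosen representative of the
  derivative. Carrying the derivative as an argument allows explicit formulas where
  \<open>wderiv\<close> gives an arbitrary representative, and \<open>AC_unique\<close> moves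
  between the two.\<close>

definition AC :: "(real \<Rightarrow> complex) \<Rightarrow> (real \<Rightarrow> complex) \<Rightarrow> bool" where
  "AC u v \<longleftrightarrow> L2_loc v \<and> (\<forall>a b. a \<le> b \<longrightarrow> u b - u a = (LINT x:{a..b}|lborel. v x))"

lemma AC_L2: "AC u v \<Longrightarrow> L2_loc v"
  by (simp add: AC_def)

lemma AC_diff_eq: "AC u v \<Longrightarrow> a \<le> b \<Longrightarrow> u b - u a = (LINT x:{a..b}|lborel. v x)"
  by (simp add: AC_def)

text \<open>Discriminant argument for the nonnegative integral of the square of
  \<open>s f + t g\<close>.\<close>

lemma set_integral_Cauchy_Schwarz:
  fixes f g :: "real \<Rightarrow> real"
  assumes ff: "set_integrable lborel A (\<lambda>x. (f x)\<^sup>2)" and gg: "set_integrable lborel A (\<lambda>x. (g x)\<^sup>2)"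
    and fg: "set_integrable lborel A (\<lambda>x. f x * g x)"
  shows "(LINT x:A|lborel. f x * g x)\<^sup>2 \<le> (LINT x:A|lborel. (f x)\<^sup>2) * (LINT x:A|lborel. (g x)\<^sup>2)"
proof -
  define P Q R where "P = (LINT x:A|lborel. (f x)\<^sup>2)" and "Q = (LINT x:A|lborel. (g x)\<^sup>2)"
    and "R = (LINT x:A|lborel. f x * g x)"
  have quad: "0 \<le> s\<^sup>2 * P + 2 * s * t * R + t\<^sup>2 * Q" for s t
  proof -
    have "s\<^sup>2 * P + (2 * s * t) * R + t\<^sup>2 * Q
      = (LINT x:A|lborel. s\<^sup>2 * (f x)\<^sup>2 + (2 * s * t) * (f x * g x) + t\<^sup>2 * (g x)\<^sup>2)"
      unfolding P_def Q_def R_def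
      using ff gg fg by (subst set_integral_add | simp add: set_integral_add)+
    also have "\<dots> = (LINT x:A|lborel. (s * f x + t * g x)\<^sup>2)"
      by (rule set_integral_pw_cong) (auto simp: power2_eq_square algebra_simps)
    also have "\<dots> \<ge> 0"
      unfolding set_lebesgue_integral_def by (intro Bochner_Integration.integral_nonneg) auto
    finally show ?thesis by simp
  qed
  have P0: "0 \<le> P" and Q0: "0 \<le> Q" using quad[of 1 0] quad[of 0 1] by auto
  have "R\<^sup>2 \<le> P * Q"
  proof (cases "P = 0")
    case True
    have "R = 0"
    proof (rule ccontr)
      assume "R \<noteq> 0"
      \<comment> \<open>With \<open>P = 0\<close> the form is affine in \<open>s\<close>, and this
        \<open>s\<close> gives it the value -1.\<close>
      thus False using quad[of "- (Q + 1) / (2 * R)" 1] True by (simp add: field_simps)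
    qed
    thus ?thesis using P0 Q0 by simp
  next
    case False
    hence "P > 0" using P0 by simp
    \<comment> \<open>The vector \<open>R f - P g\<close> is, up to scale, the component of
      \<open>g\<close> orthogonal to \<open>f\<close>.\<close>
    moreover have "0 \<le> P * (P * Q - R\<^sup>2)"
      using quad[of R "- P"] by (simp add: power2_eq_square algebra_simps)
    ultimately show ?thesis by (simp add: zero_le_mult_iff)
  qed
  thus ?thesis by (simp add: P_def Q_def R_def)
qed

lemma set_integral_norm_bound:
  fixes f :: "real \<Rightarrow> 'a::euclidean_space"
  assumes "set_integrable lborel A f"
  shows "norm (LINT x:A|lborel. f x) \<le> (LINT x:A|lborel. norm (f x))"
  using integral_norm_bound[of lborel "\<lambda>x. indicator A x *\<^sub>R f x"]
  by (simp add: set_lebesgue_integral_def)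

lemma set_integral_nonneg:
  fixes f :: "real \<Rightarrow> real"
  assumes "\<And>x. x \<in> A \<Longrightarrow> 0 \<le> f x"
  shows "0 \<le> (LINT x:A|lborel. f x)"
  unfolding set_lebesgue_integral_def
  by (intro Bochner_Integration.integral_nonneg) (use assms in \<open>auto simp: indicator_def\<close>)

lemma set_integral_mono_set:
  fixes f :: "real \<Rightarrow> real"
  assumes "set_integrable lborel B f" "A \<in> sets borel" "A \<subseteq> B" "\<And>x. x \<in> B \<Longrightarrow> 0 \<le> f x"
  shows "(LINT x:A|lborel. f x) \<le> (LINT x:B|lborel. f x)"
proof -
  have "set_integrable lborel A f" using set_integrable_subset[OF assms(1)] assms(2,3) by simp
  thus ?thesis
    unfolding set_lebesgue_integral_def
    by (intro integral_mono) (use assms in \<open>auto simp: set_integrable_def indicator_def\<close>)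
qed

lemma L2_loc_norm_integrable: "L2_loc f \<Longrightarrow> intg a b (\<lambda>x. cmod (f x))"
  using set_integrable_norm[OF L2_loc_integrable] by simp

text \<open>Cauchy-Schwarz against the constant 1. This Holder bound of exponent 1/2 is the source
  of the later pointwise bounds, of equicontinuity and of the vanishing of boundary terms.\<close>

lemma AC_Holder:
  assumes "AC u v" "a \<le> b"
  shows "cmod2 (u b - u a) \<le> (b - a) * (LINT x:{a..b}|lborel. cmod2 (v x))"
proof -
  have v: "L2_loc v" using assms by (simp add: AC_def)
  have "cmod (u b - u a) \<le> (LINT x:{a..b}|lborel. 1 * cmod (v x))"
    using set_integral_norm_bound[OF L2_loc_integrable[OF v]] AC_diff_eq[OF assms] by simp
  hence "cmod2 (u b - u a) \<le> (LINT x:{a..b}|lborel. 1 * cmod (v x))\<^sup>2"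
    by (intro power_mono) auto
  also have "\<dots> \<le> (LINT x:{a..b}|lborel. 1\<^sup>2) * (LINT x:{a..b}|lborel. cmod2 (v x))"
    by (rule set_integral_Cauchy_Schwarz)
       (use v in \<open>auto intro: L2_loc_sq_integrable L2_loc_norm_integrable set_integrable_continuous\<close>)
  also have "(LINT x:{a..b}|lborel. 1\<^sup>2) = b - a"
    using assms(2) by (simp add: set_lebesgue_integral_def)
  finally show ?thesis .
qed

lemma AC_continuous:
  assumes "AC u v" shows "continuous_on UNIV u"
proof -
  have "isCont u x" for x
  proof -
    define c where "c = \<bar>x\<bar> + 1"
    have eq: "u y = u (-c) + integral {-c..y} v" if "y \<in> {-c..c}" for y
      using AC_diff_eq[OF assms, of "-c" y] that
        set_borel_integral_eq_integral(2)[OF L2_loc_integrable[OF AC_L2[OF assms]], of "-c" y]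
      by (simp add: algebra_simps)
    have "continuous_on {-c..c} (\<lambda>y. u (-c) + integral {-c..y} v)"
      by (intro continuous_intros indefinite_integral_continuous_1 set_borel_integral_eq_integral(1)
        L2_loc_integrable AC_L2[OF assms])
    hence "continuous_on {-c..c} u" by (rule continuous_on_eq) (rule eq[symmetric])
    thus ?thesis by (rule continuous_on_interior) (auto simp: c_def)
  qed
  thus ?thesis by (simp add: continuous_at_imp_continuous_on)
qed

lemma AC_add: "AC u v \<Longrightarrow> AC u' v' \<Longrightarrow> AC (\<lambda>x. u x + u' x) (\<lambda>x. v x + v' x)"
  unfolding AC_def
  by (auto intro!: L2_loc_add simp: set_integral_add L2_loc_integrable algebra_simps)

lemma AC_cmult: "AC u v \<Longrightarrow> AC (\<lambda>x. c * u x) (\<lambda>x. c * v x)"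
  unfolding AC_def by (auto intro!: L2_loc_cmult simp: right_diff_distrib[symmetric])

lemma AC_minus: "AC u v \<Longrightarrow> AC (\<lambda>x. - u x) (\<lambda>x. - v x)"
  using AC_cmult[of u v "-1"] by simp

lemma AC_diff: "AC u v \<Longrightarrow> AC u' v' \<Longrightarrow> AC (\<lambda>x. u x - u' x) (\<lambda>x. v x - v' x)"
  using AC_add[of u v "\<lambda>x. - u' x" "\<lambda>x. - v' x"] AC_minus by simp

lemma set_integral_cnj: "(LINT x:A|lborel. cnj (f x)) = cnj (LINT x:A|lborel. f x)"
  unfolding set_lebesgue_integral_def by (simp flip: Bochner_Integration.integral_cnj)

lemma AC_cnj: "AC u v \<Longrightarrow> AC (\<lambda>x. cnj (u x)) (\<lambda>x. cnj (v x))"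
  unfolding AC_def by (auto simp: L2_loc_cnj set_integral_cnj complex_cnj_diff[symmetric] simp del: complex_cnj_diff)

lemma AC_affine:
  assumes "AC u v" "c > 0"
  shows "AC (\<lambda>x. u (t + c * x)) (\<lambda>x. of_real c * v (t + c * x))"
  unfolding AC_def
proof (intro conjI allI impI)
  show "L2_loc (\<lambda>x. of_real c * v (t + c * x))"
    using assms by (intro L2_loc_cmult L2_loc_affine AC_L2)
  fix a b :: real assume "a \<le> b"
  thus "u (t + c * b) - u (t + c * a) = (LINT x:{a..b}|lborel. of_real c * v (t + c * x))"
    using assms by (simp add: set_integral_affine AC_diff_eq scaleR_conv_of_real)
qed

lemma AC_C1:
  assumes "\<And>x. (u has_vector_derivative v x) (at x)" "continuous_on UNIV v"
  shows "AC u v"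
  unfolding AC_def
proof (intro conjI allI impI)
  fix a b :: real assume "a \<le> b"
  thus "u b - u a = (LINT x:{a..b}|lborel. v x)"
    unfolding set_lebesgue_integral_def
    by (subst integral_FTC_Icc[where F = u])
       (use assms in \<open>auto intro: has_vector_derivative_at_within continuous_on_subset\<close>)
qed (use assms in \<open>auto intro: L2_loc_continuous\<close>)

text \<open>Each factor is its value at \<open>a\<close> plus an indefinite integral, so the product
  rule is \<open>Fubini_triangle\<close> for the two derivatives.\<close>

lemma AC_mult:
  assumes u: "AC u u'" and v: "AC v v'"
  shows "AC (\<lambda>x. u x * v x) (\<lambda>x. u' x * v x + u x * v' x)"
  unfolding AC_def
proof (intro conjI allI impI)
  have cu: "continuous_on UNIV u" and cv: "continuous_on UNIV v"
    using assms AC_continuous by auto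
  have l1: "L2_loc (\<lambda>x. u' x * v x)" and l2: "L2_loc (\<lambda>x. u x * v' x)"
    using L2_loc_mult_bounded[OF AC_L2[OF u] cv] L2_loc_mult_bounded[OF AC_L2[OF v] cu]
    by (auto simp: mult.commute)
  show "L2_loc (\<lambda>x. u' x * v x + u x * v' x)" by (intro L2_loc_add l1 l2)
  fix a b :: real assume ab: "a \<le> b"
  have iu: "intg c d u'" and iv: "intg c d v'" for c d
    using AC_L2[OF u] AC_L2[OF v] L2_loc_integrable by auto
  define U V where "U = (LINT x:{a..b}|lborel. u' x)" and "V = (LINT x:{a..b}|lborel. v' x)"
  have ub: "u b = u a + U" and vb: "v b = v a + V"
    using AC_diff_eq[OF u ab] AC_diff_eq[OF v ab] by (auto simp: U_def V_def algebra_simps)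
  have e1: "(LINT x:{a..b}|lborel. u' x * v x) = v a * U + (LINT x:{a..b}|lborel. u' x * (LINT y:{a..x}|lborel. v' y))"
  proof -
    have "(LINT x:{a..b}|lborel. u' x * (LINT y:{a..x}|lborel. v' y)) = (LINT x:{a..b}|lborel. u' x * v x - v a * u' x)"
      by (rule set_lebesgue_integral_cong) (auto simp: AC_diff_eq[OF v, symmetric] algebra_simps)
    also have "\<dots> = (LINT x:{a..b}|lborel. u' x * v x) - (LINT x:{a..b}|lborel. v a * u' x)"
      by (intro set_integral_diff L2_loc_integrable l1 L2_loc_cmult AC_L2[OF u])
    finally show ?thesis by (simp add: U_def)
  qed
  have e2: "(LINT x:{a..b}|lborel. u x * v' x) = u a * V + (LINT x:{a..b}|lborel. v' x * (LINT y:{a..x}|lborel. u' y))"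
  proof -
    have "(LINT x:{a..b}|lborel. v' x * (LINT y:{a..x}|lborel. u' y)) = (LINT x:{a..b}|lborel. u x * v' x - u a * v' x)"
      by (rule set_lebesgue_integral_cong) (auto simp: AC_diff_eq[OF u, symmetric] algebra_simps)
    also have "\<dots> = (LINT x:{a..b}|lborel. u x * v' x) - (LINT x:{a..b}|lborel. u a * v' x)"
      by (intro set_integral_diff L2_loc_integrable l2 L2_loc_cmult AC_L2[OF v])
    finally show ?thesis by (simp add: V_def)
  qed
  have "(LINT x:{a..b}|lborel. u' x * v x + u x * v' x)
     = (LINT x:{a..b}|lborel. u' x * v x) + (LINT x:{a..b}|lborel. u x * v' x)"
    by (intro set_integral_add L2_loc_integrable l1 l2)
  also have "\<dots> = v a * U + u a * V + U * V"
    unfolding e1 e2 using Fubini_triangle[OF iu iv, of a b] by (simp add: U_def V_def algebra_simps)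
  also have "\<dots> = u b * v b - u a * v a" by (simp add: ub vb algebra_simps)
  finally show "u b * v b - u a * v a = (LINT x:{a..b}|lborel. u' x * v x + u x * v' x)" by simp
qed

lemma AC_unique:
  assumes "AC u v" "AC u v'" shows "AE x in lborel. v x = v' x"
proof -
  have "AE x in lborel. v x - v' x = 0"
  proof (rule set_integral_zero_imp_AE_zero)
    show "intg a b (\<lambda>x. v x - v' x)" for a b
      using assms by (intro L2_loc_integrable L2_loc_diff AC_L2)
    show "(LINT x:{a..b}|lborel. v x - v' x) = 0" if "a \<le> b" for a b
      using assms by (simp add: set_integral_diff L2_loc_integrable AC_L2 AC_diff_eq[OF assms(1) that, symmetric]
          AC_diff_eq[OF assms(2) that, symmetric])
  qed
  thus ?thesis by simp
qed

section \<open>Weak derivatives\<close>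

text \<open>The powers of \<open>1 / x\<close> make the family closed under differentiation up to
  linear combinations, which gives smoothness by induction without computing higher
  derivatives.\<close>

definition exp_step :: "nat \<Rightarrow> real \<Rightarrow> real" where
  "exp_step a x = (if x > 0 then (1 / x) ^ a * exp (- (1 / x)) else 0)"

lemma exp_step_tendsto_0: "(exp_step a \<longlongrightarrow> 0) (at_right 0)"
proof -
  have "((\<lambda>y. y ^ a / exp y) \<longlongrightarrow> (0::real)) at_top" by (rule tendsto_power_div_exp_0)
  hence "((\<lambda>x. inverse x ^ a / exp (inverse x)) \<longlongrightarrow> (0::real)) (at_right 0)"
    by (rule filterlim_compose[OF _ filterlim_inverse_at_top_right])
  thus ?thesis
    by (rule Lim_transform_eventually)
       (auto simp: exp_step_def eventually_at_filter exp_minus field_simps)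
qed

lemma exp_step_deriv:
  "(exp_step a has_real_derivative (- real a * exp_step (a + 1) x + exp_step (a + 2) x)) (at x)"
proof -
  consider "x > 0" | "x < 0" | "x = 0" by linarith
  thus ?thesis
  proof cases
    case 1
    have "((\<lambda>x. (1 / x) ^ a * exp (- (1 / x))) has_real_derivative
       (- real a * exp_step (a + 1) x + exp_step (a + 2) x)) (at x)"
    proof -
      define y where "y = 1 / x"
      have inv: "((\<lambda>x. 1 / x) has_real_derivative - (y * y)) (at x)"
        using 1 by (auto intro!: derivative_eq_intros simp: y_def)
      have "((\<lambda>y. y ^ a * exp (- y)) has_real_derivative
          (real a * y ^ (a - 1)) * exp (- y) + (exp (- y) * (- 1)) * y ^ a) (at (1 / x))"
        unfolding y_def[symmetric]
        by (rule DERIV_mult) (auto intro!: derivative_eq_intros)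
      from DERIV_chain2[OF this inv]
      have "((\<lambda>x. (1 / x) ^ a * exp (- (1 / x))) has_real_derivative
          ((real a * y ^ (a - 1)) * exp (- y) + (exp (- y) * (- 1)) * y ^ a) * - (y * y)) (at x)" .
      moreover have "((real a * y ^ (a - 1)) * exp (- y) + (exp (- y) * (- 1)) * y ^ a) * - (y * y)
        = - real a * exp_step (a + 1) x + exp_step (a + 2) x"
        using 1 by (cases a) (simp_all add: exp_step_def y_def[symmetric] algebra_simps)
      ultimately show ?thesis by simp
    qed
    thus ?thesis
      by (rule DERIV_cong_ev[THEN iffD1, rotated -1])
         (use 1 eventually_nhds_in_open[of "{0<..}" x] in \<open>auto simp: exp_step_def elim!: eventually_mono\<close>)
  next
    case 2
    have "((\<lambda>x. 0) has_real_derivative 0) (at x)" by simp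
    hence "(exp_step a has_real_derivative 0) (at x)"
      by (rule DERIV_cong_ev[THEN iffD1, rotated -1])
         (use 2 eventually_nhds_in_open[of "{..<0}" x] in \<open>auto simp: exp_step_def elim!: eventually_mono\<close>)
    thus ?thesis using 2 by (simp add: exp_step_def)
  next
    case 3
    have "((\<lambda>y. (exp_step a y - exp_step a 0) / (y - 0)) \<longlongrightarrow> 0) (at 0)"
    proof (rule filterlim_split_at)
      show "((\<lambda>y. (exp_step a y - exp_step a 0) / (y - 0)) \<longlongrightarrow> 0) (at_left 0)"
        by (rule tendsto_eventually) (auto simp: eventually_at_filter exp_step_def)
      show "((\<lambda>y. (exp_step a y - exp_step a 0) / (y - 0)) \<longlongrightarrow> 0) (at_right 0)"
        \<comment> \<open>Dividing by \<open>y\<close> raises the power by one, so the right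
          difference quotient is again a member of the family.\<close>
        by (rule Lim_transform_eventually[OF exp_step_tendsto_0[of "a + 1"]])
           (auto simp: eventually_at_filter exp_step_def)
    qed
    thus ?thesis using 3 by (simp add: has_field_derivative_iff exp_step_def)
  qed
qed

text \<open>A family of functions on the line that is closed under differentiation, hence consists of
  smooth functions, and contains bumps supported in \<open>[\<alpha>, \<alpha> + \<epsilon>]\<close>.\<close>

inductive_set bump_span :: "real \<Rightarrow> (real \<Rightarrow> real) set" for \<epsilon> where
  base: "(\<lambda>x. exp_step a ((x - \<alpha>) / \<epsilon>) * exp_step b (1 - (x - \<alpha>) / \<epsilon>)) \<in> bump_span \<epsilon>"
| add: "f \<in> bump_span \<epsilon> \<Longrightarrow> g \<in> bump_span \<epsilon> \<Longrightarrow> (\<lambda>x. f x + g x) \<in> bump_span \<epsilon>"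
| scale: "f \<in> bump_span \<epsilon> \<Longrightarrow> (\<lambda>x. c * f x) \<in> bump_span \<epsilon>"

lemma bump_span_deriv:
  assumes "f \<in> bump_span \<epsilon>" "\<epsilon> > 0"
  shows "\<exists>f'\<in>bump_span \<epsilon>. \<forall>x. (f has_real_derivative f' x) (at x)"
  using assms(1)
proof induction
  case (base a \<alpha> b)
  let ?E = "\<lambda>a b x. exp_step a ((x - \<alpha>) / \<epsilon>) * exp_step b (1 - (x - \<alpha>) / \<epsilon>)"
  define f' where "f' = (\<lambda>x. (- real a / \<epsilon>) * ?E (a + 1) b x + ((1 / \<epsilon>) * ?E (a + 2) b x
      + ((real b / \<epsilon>) * ?E a (b + 1) x + (- 1 / \<epsilon>) * ?E a (b + 2) x)))"
  have "f' \<in> bump_span \<epsilon>" unfolding f'_def by (intro bump_span.intros)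
  moreover have "(?E a b has_real_derivative f' x) (at x)" for x
  proof -
    have 1: "((\<lambda>x. exp_step a ((x - \<alpha>) / \<epsilon>)) has_real_derivative
       (- real a * exp_step (a + 1) ((x - \<alpha>) / \<epsilon>) + exp_step (a + 2) ((x - \<alpha>) / \<epsilon>)) * (1 / \<epsilon>)) (at x)"
      by (rule DERIV_chain2[OF exp_step_deriv]) (use assms in \<open>auto intro!: derivative_eq_intros\<close>)
    have 2: "((\<lambda>x. exp_step b (1 - (x - \<alpha>) / \<epsilon>)) has_real_derivative
       (- real b * exp_step (b + 1) (1 - (x - \<alpha>) / \<epsilon>) + exp_step (b + 2) (1 - (x - \<alpha>) / \<epsilon>)) * (- 1 / \<epsilon>)) (at x)"
      by (rule DERIV_chain2[OF exp_step_deriv]) (use assms in \<open>auto intro!: derivative_eq_intros\<close>)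
    show ?thesis
    proof (rule DERIV_cong[OF DERIV_mult[OF 1 2]])
      have "(- ra * A1 + A2) * (1 / \<epsilon>) * B0 + (- rb * B1 + B2) * (- 1 / \<epsilon>) * A0
        = (- ra / \<epsilon>) * (A1 * B0) + ((1 / \<epsilon>) * (A2 * B0) + ((rb / \<epsilon>) * (A0 * B1) + (- 1 / \<epsilon>) * (A0 * B2)))"
        for ra rb A0 A1 A2 B0 B1 B2 :: real
        by (simp add: algebra_simps)
      thus "(- real a * exp_step (a + 1) ((x - \<alpha>) / \<epsilon>) + exp_step (a + 2) ((x - \<alpha>) / \<epsilon>)) * (1 / \<epsilon>) *
          exp_step b (1 - (x - \<alpha>) / \<epsilon>) +
          (- real b * exp_step (b + 1) (1 - (x - \<alpha>) / \<epsilon>) + exp_step (b + 2) (1 - (x - \<alpha>) / \<epsilon>)) *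
          (- 1 / \<epsilon>) * exp_step a ((x - \<alpha>) / \<epsilon>) = f' x"
        unfolding f'_def by blast
    qed
  qed
  ultimately show ?case by blast
next
  case (add f g)
  then obtain f' g' where "f' \<in> bump_span \<epsilon>" "g' \<in> bump_span \<epsilon>"
    "\<And>x. (f has_real_derivative f' x) (at x)" "\<And>x. (g has_real_derivative g' x) (at x)" by blast
  thus ?case
    by (intro bexI[of _ "\<lambda>x. f' x + g' x"]) (auto intro: DERIV_add bump_span.add)
next
  case (scale f c)
  then obtain f' where "f' \<in> bump_span \<epsilon>" "\<And>x. (f has_real_derivative f' x) (at x)" by blast
  thus ?case
    by (intro bexI[of _ "\<lambda>x. c * f' x"]) (auto intro: DERIV_cmult bump_span.scale)
qed

lemma bump_span_smooth:
  assumes "f \<in> bump_span \<epsilon>" "\<epsilon> > 0"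
  shows "(deriv ^^ n) f \<in> bump_span \<epsilon>"
  using assms(1)
proof (induction n)
  case (Suc n)
  then obtain f' where f': "f' \<in> bump_span \<epsilon>" "\<And>x. ((deriv ^^ n) f has_real_derivative f' x) (at x)"
    using bump_span_deriv[OF _ assms(2)] by meson
  hence "deriv ((deriv ^^ n) f) = f'" by (auto simp: fun_eq_iff intro: DERIV_imp_deriv)
  thus ?case using f' by simp
qed simp

section \<open>Mollifiers and smoothed steps\<close>

definition bump :: "real \<Rightarrow> real" where
  "bump x = exp_step 0 x * exp_step 0 (1 - x)"

lemma bump_nonneg: "0 \<le> bump x" by (simp add: bump_def exp_step_def)

lemma bump_zero: "x \<le> 0 \<or> 1 \<le> x \<Longrightarrow> bump x = 0" by (auto simp: bump_def exp_step_def)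

lemma bump_continuous: "continuous_on S bump"
proof -
  have "continuous_on UNIV (exp_step 0)"
    using exp_step_deriv by (meson DERIV_isCont continuous_at_imp_continuous_on)
  hence "continuous_on UNIV bump"
    unfolding bump_def by (auto intro!: continuous_intros intro: continuous_on_compose2)
  thus ?thesis by (rule continuous_on_subset) simp
qed

definition bump_mass :: real where "bump_mass = integral {0..1} bump"

text \<open>One-sided mollifier: for positive \<open>\<epsilon>\<close> it has unit mass and is
  supported in \<open>[c, c + \<epsilon>]\<close>.\<close>

abbreviation moll :: "real \<Rightarrow> real \<Rightarrow> real \<Rightarrow> real" where "moll \<epsilon> c x \<equiv> bump ((x - c) / \<epsilon>) / (bump_mass * \<epsilon>)"

lemma bump_mass_pos: "bump_mass > 0"
proof -
  have "bump_mass \<noteq> 0"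
  proof
    assume "bump_mass = 0"
    hence "bump (1/2) = 0"
      using integral_eq_0_iff[of 0 1 bump] bump_continuous bump_nonneg by (auto simp: bump_mass_def)
    thus False by (simp add: bump_def exp_step_def)
  qed
  moreover have "0 \<le> bump_mass"
    unfolding bump_mass_def by (intro Henstock_Kurzweil_Integration.integral_nonneg)
      (auto intro: integrable_continuous_interval bump_continuous bump_nonneg)
  ultimately show ?thesis by simp
qed

definition smooth_step :: "real \<Rightarrow> real" where
  "smooth_step x = (if x \<le> 0 then 0 else integral {0..x} bump / bump_mass)"

lemma smooth_step_ge_1: "1 \<le> x \<Longrightarrow> smooth_step x = 1"
proof -
  assume x: "1 \<le> x"
  have "integral {0..x} bump = integral {0..1} bump + integral {1..x} bump"
    by (rule Henstock_Kurzweil_Integration.integral_combine[symmetric])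
       (use x in \<open>auto intro: integrable_continuous_interval bump_continuous\<close>)
  also have "integral {1..x} bump = integral {1..x} (\<lambda>_. 0)"
    by (rule Henstock_Kurzweil_Integration.integral_cong) (auto simp: bump_zero)
  finally show ?thesis using x bump_mass_pos by (simp add: smooth_step_def bump_mass_def)
qed

lemma smooth_step_deriv: "(smooth_step has_real_derivative bump x / bump_mass) (at x)"
proof -
  define M where "M = \<bar>x\<bar> + 1"
  have M: "M \<ge> 1" "x \<in> {-M<..<M}" by (auto simp: M_def abs_if)
  have int: "bump integrable_on {c..d}" for c d
    by (intro integrable_continuous_interval bump_continuous)
  have "((\<lambda>y. integral {-M..y} bump) has_real_derivative bump x) (at x within {-M..M})"
    using integral_has_real_derivative[of "-M" M bump x] M bump_continuous by auto
  hence "((\<lambda>y. integral {-M..y} bump) has_real_derivative bump x) (at x)"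
    using M at_within_interior[of x "{-M..M}"] by (simp add: interior_atLeastAtMost_real)
  hence "((\<lambda>y. integral {-M..y} bump / bump_mass) has_real_derivative bump x / bump_mass) (at x)"
    by (rule DERIV_cdivide)
  moreover have "integral {-M..y} bump / bump_mass = smooth_step y" if "y \<in> {-M<..<M}" for y
  proof (cases "y \<le> 0")
    case True
    have "integral {-M..y} bump = integral {-M..y} (\<lambda>_. 0)"
      by (rule Henstock_Kurzweil_Integration.integral_cong) (use True in \<open>auto simp: bump_zero\<close>)
    thus ?thesis using True by (simp add: smooth_step_def)
  next
    case False
    have "integral {-M..y} bump = integral {-M..0} bump + integral {0..y} bump"
      by (rule Henstock_Kurzweil_Integration.integral_combine[symmetric]) (use False M int in auto)
    moreover have "integral {-M..0} bump = integral {-M..0} (\<lambda>_. 0)"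
      by (rule Henstock_Kurzweil_Integration.integral_cong) (auto simp: bump_zero)
    ultimately show ?thesis using False by (simp add: smooth_step_def)
  qed
  ultimately show ?thesis
    by (subst DERIV_cong_ev[symmetric, OF refl _ refl])
       (use M eventually_nhds_in_open[of "{-M<..<M}" x] in \<open>auto elim!: eventually_mono\<close>)
qed

lemma continuous_average_tendsto:
  fixes w :: "real \<Rightarrow> complex"
  assumes "continuous_on UNIV w"
  shows "((\<lambda>\<epsilon>. LINT x|lborel. moll \<epsilon> a x *\<^sub>R w x) \<longlongrightarrow> w a) (at_right 0)"
proof (rule tendstoI)
  fix e :: real assume e: "e > 0"
  obtain d where d: "d > 0" "\<And>x. \<bar>x - a\<bar> < d \<Longrightarrow> cmod (w x - w a) < e / 2"
    using assms[unfolded continuous_on_iff, rule_format, of a "e / 2"] e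
    by (auto simp: dist_norm)
  show "eventually (\<lambda>\<epsilon>. dist (LINT x|lborel. moll \<epsilon> a x *\<^sub>R w x) (w a) < e) (at_right 0)"
    unfolding eventually_at_right_field
  proof (intro exI[of _ d] conjI allI impI)
    fix \<epsilon> assume "0 < \<epsilon>" and "\<epsilon> < d"
    note E = this
    define r where "r = (\<lambda>x. moll \<epsilon> a x)"
    have r0: "r x = 0" if "x \<notin> {a..a + \<epsilon>}" for x
      using that E bump_zero[of "(x - a) / \<epsilon>"] by (auto simp: r_def field_simps)
    have rn: "0 \<le> r x" for x using E bump_mass_pos bump_nonneg by (simp add: r_def)
    have rc: "continuous_on S r" for S
      unfolding r_def using E bump_mass_pos
      by (intro continuous_intros continuous_on_compose2[OF bump_continuous[of UNIV]]) auto
    have ri: "(LINT x|lborel. r x *\<^sub>R g x) = (LINT x:{a..a+\<epsilon>}|lborel. r x *\<^sub>R g x)" for g :: "real \<Rightarrow> complex"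
      unfolding set_lebesgue_integral_def
    proof (intro Bochner_Integration.integral_cong refl)
      fix x show "r x *\<^sub>R g x = indicator {a..a+\<epsilon>} x *\<^sub>R (r x *\<^sub>R g x)"
        by (cases "x \<in> {a..a+\<epsilon>}") (auto simp: r0)
    qed
    have one: "(LINT x:{a..a+\<epsilon>}|lborel. r x) = 1"
    proof -
      have "(LINT x:{a..a+\<epsilon>}|lborel. r x) = smooth_step ((a + \<epsilon> - a) / \<epsilon>) - smooth_step ((a - a) / \<epsilon>)"
        unfolding set_lebesgue_integral_def
      proof (rule integral_FTC_Icc)
        fix x
        have "((\<lambda>x. smooth_step ((x - a) / \<epsilon>)) has_real_derivative r x) (at x)"
          by (rule DERIV_cong[OF DERIV_chain2[OF smooth_step_deriv]])
             (use E in \<open>auto intro!: derivative_eq_intros simp: r_def\<close>)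
        thus "((\<lambda>x. smooth_step ((x - a) / \<epsilon>)) has_vector_derivative r x) (at x within {a..a+\<epsilon>})"
          by (simp add: has_real_derivative_iff_has_vector_derivative has_vector_derivative_at_within)
      qed (use E rc in auto)
      thus ?thesis using E smooth_step_ge_1[of 1] by (simp add: smooth_step_def)
    qed
    have i1: "set_integrable lborel {a..a+\<epsilon>} (\<lambda>x. r x *\<^sub>R w x)"
      and i2: "set_integrable lborel {a..a+\<epsilon>} (\<lambda>x. r x *\<^sub>R w a)"
      by (intro set_integrable_continuous continuous_intros rc assms)+
    have "(LINT x|lborel. r x *\<^sub>R w x) - w a = (LINT x:{a..a+\<epsilon>}|lborel. r x *\<^sub>R w x) - (LINT x:{a..a+\<epsilon>}|lborel. r x *\<^sub>R w a)"
    proof -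
      have "(LINT x:{a..a+\<epsilon>}|lborel. r x *\<^sub>R w a) = (LINT x:{a..a+\<epsilon>}|lborel. r x) *\<^sub>R w a"
        using set_integrable_continuous[OF rc, of a "a+\<epsilon>"]
        unfolding set_lebesgue_integral_def set_integrable_def
        by (subst integral_scaleR_left[symmetric]) (auto simp: mult.commute)
      thus ?thesis unfolding ri by (simp add: one)
    qed
    also have "\<dots> = (LINT x:{a..a+\<epsilon>}|lborel. r x *\<^sub>R (w x - w a))"
      using set_integral_diff(2)[OF i1 i2] by (simp add: scaleR_diff_right)
    also have "norm \<dots> \<le> (LINT x:{a..a+\<epsilon>}|lborel. norm (r x *\<^sub>R (w x - w a)))"
      by (intro set_integral_norm_bound set_integrable_continuous continuous_intros rc assms)
    also have "\<dots> \<le> (LINT x:{a..a+\<epsilon>}|lborel. r x * (e / 2))"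
    proof (rule set_integral_mono)
      fix x assume "x \<in> {a..a+\<epsilon>}"
      hence "cmod (w x - w a) \<le> e / 2" using d(2)[of x] E by (simp add: less_imp_le)
      thus "norm (r x *\<^sub>R (w x - w a)) \<le> r x * (e / 2)"
        using rn mult_left_mono[of "cmod (w x - w a)" "e / 2" "r x"] by simp
    qed (intro set_integrable_continuous continuous_intros rc assms)+
    also have "\<dots> = e / 2" using one by simp
    also have "\<dots> < e" using e by simp
    finally show "dist (LINT x|lborel. moll \<epsilon> a x *\<^sub>R w x) (w a) < e"
      by (simp add: dist_norm r_def)
  qed (use d in auto)
qed

text \<open>A smoothed signed indicator of the interval between \<open>a\<close> and
  \<open>b\<close>. Its derivative is a mollifier at \<open>a\<close> minus one at \<open>b\<close>,
  so testing against it compares local averages at the two points.\<close>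

lemma test_fun_step:
  fixes a b \<epsilon> :: real
  assumes "\<epsilon> > 0"
  defines "\<phi> \<equiv> \<lambda>x. smooth_step ((x - a) / \<epsilon>) - smooth_step ((x - b) / \<epsilon>)"
  shows "test_fun \<phi>"
    and "deriv \<phi> = (\<lambda>x. moll \<epsilon> a x - moll \<epsilon> b x)"
proof -
  let ?d = "\<lambda>x. moll \<epsilon> a x - moll \<epsilon> b x"
  have D: "(\<phi> has_real_derivative ?d x) (at x)" for x
  proof -
    have 1: "((\<lambda>x. smooth_step ((x - c) / \<epsilon>)) has_real_derivative moll \<epsilon> c x) (at x)" for c
      by (rule DERIV_cong[OF DERIV_chain2[OF smooth_step_deriv]])
         (use assms(1) in \<open>auto intro!: derivative_eq_intros\<close>)
    show ?thesis unfolding \<phi>_def by (intro DERIV_diff 1)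
  qed
  thus *: "deriv \<phi> = ?d" by (auto simp: fun_eq_iff intro: DERIV_imp_deriv)
  have "?d = (\<lambda>x. (1 / (bump_mass * \<epsilon>)) * (exp_step 0 ((x - a) / \<epsilon>) * exp_step 0 (1 - (x - a) / \<epsilon>))
     + (- 1 / (bump_mass * \<epsilon>)) * (exp_step 0 ((x - b) / \<epsilon>) * exp_step 0 (1 - (x - b) / \<epsilon>)))"
    by (simp add: bump_def fun_eq_iff)
  also have "\<dots> \<in> bump_span \<epsilon>" by (intro bump_span.intros)
  finally have mem: "deriv \<phi> \<in> bump_span \<epsilon>" unfolding * .
  have "(deriv ^^ n) \<phi> field_differentiable at x" for n x
  proof (cases n)
    case 0
    thus ?thesis using D by (auto simp: field_differentiable_def)
  next
    case (Suc m)
    hence "(deriv ^^ n) \<phi> = (deriv ^^ m) (deriv \<phi>)" by (simp only: funpow_Suc_right o_def)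
    thus ?thesis
      using bump_span_deriv[OF bump_span_smooth[OF mem assms(1), of m] assms(1)]
      by (auto simp: field_differentiable_def)
  qed
  moreover have "bounded {x. \<phi> x \<noteq> 0}"
  proof (rule bounded_subset)
    show "bounded {min a b..max a b + \<epsilon>}" by simp
    show "{x. \<phi> x \<noteq> 0} \<subseteq> {min a b..max a b + \<epsilon>}"
    proof
      fix x assume x: "x \<in> {x. \<phi> x \<noteq> 0}"
      have "min a b \<le> x"
      proof (rule ccontr)
        assume "\<not> ?thesis"
        hence "(x - a) / \<epsilon> \<le> 0" "(x - b) / \<epsilon> \<le> 0" using assms(1) by (auto simp: field_simps)
        thus False using x by (simp add: \<phi>_def smooth_step_def)
      qed
      moreover have "x \<le> max a b + \<epsilon>"
      proof (rule ccontr)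
        assume "\<not> ?thesis"
        hence "(x - a) / \<epsilon> \<ge> 1" "(x - b) / \<epsilon> \<ge> 1" using assms(1) by (auto simp: field_simps)
        thus False using x smooth_step_ge_1 by (simp add: \<phi>_def)
      qed
      ultimately show "x \<in> {min a b..max a b + \<epsilon>}" by simp
    qed
  qed
  ultimately show "test_fun \<phi>" by (simp add: test_fun_def)
qed

text \<open>The lemma of du Bois-Reymond. Smoothed steps of width \<open>\<epsilon>\<close> show
  that the averages near \<open>a\<close> and \<open>b\<close> agree; continuity turns them into
  point values as the width shrinks.\<close>

lemma continuous_weak_const:
  fixes w :: "real \<Rightarrow> complex"
  assumes w: "continuous_on UNIV w"
    and z: "\<And>\<phi>. test_fun \<phi> \<Longrightarrow> (LINT x|lborel. deriv \<phi> x *\<^sub>R w x) = 0"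
  shows "w a = w b"
proof -
  let ?I = "\<lambda>a \<epsilon>. LINT x|lborel. moll \<epsilon> a x *\<^sub>R w x"
  have eq: "?I a \<epsilon> - ?I b \<epsilon> = 0" if "\<epsilon> > 0" for \<epsilon>
  proof -
    have int: "integrable lborel (\<lambda>x. moll \<epsilon> c x *\<^sub>R w x)" for c
    proof -
      have "set_integrable lborel {c..c+\<epsilon>} (\<lambda>x. moll \<epsilon> c x *\<^sub>R w x)"
        using that bump_mass_pos
        by (intro set_integrable_continuous continuous_intros w continuous_on_compose2[OF bump_continuous[of UNIV]]) auto
      moreover have "(\<lambda>x. indicator {c..c+\<epsilon>} x *\<^sub>R (moll \<epsilon> c x *\<^sub>R w x))
         = (\<lambda>x. moll \<epsilon> c x *\<^sub>R w x)"
      proof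
        fix x show "indicator {c..c+\<epsilon>} x *\<^sub>R (moll \<epsilon> c x *\<^sub>R w x)
         = moll \<epsilon> c x *\<^sub>R w x"
      proof (cases "x \<in> {c..c+\<epsilon>}")
        case False
        hence "(x - c) / \<epsilon> \<le> 0 \<or> 1 \<le> (x - c) / \<epsilon>" using that by (auto simp: field_simps)
        thus ?thesis by (auto simp: bump_zero)
      qed simp
      qed
      ultimately show ?thesis by (simp only: set_integrable_def)
    qed
    show ?thesis
      using z[OF test_fun_step(1)[OF that, of a b]] unfolding test_fun_step(2)[OF that]
      by (subst Bochner_Integration.integral_diff[symmetric, OF int int]) (simp add: scaleR_diff_left)
  qed
  have "((\<lambda>\<epsilon>. ?I a \<epsilon> - ?I b \<epsilon>) \<longlongrightarrow> w a - w b) (at_right 0)"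
    by (intro tendsto_diff continuous_average_tendsto w)
  moreover have "((\<lambda>\<epsilon>. ?I a \<epsilon> - ?I b \<epsilon>) \<longlongrightarrow> 0) (at_right 0)"
  proof (rule tendsto_eventually)
    have "eventually (\<lambda>\<epsilon>. \<epsilon> > (0::real)) (at_right 0)" by (simp add: eventually_at_filter)
    thus "eventually (\<lambda>\<epsilon>. ?I a \<epsilon> - ?I b \<epsilon> = 0) (at_right 0)"
      by eventually_elim (rule eq)
  qed
  ultimately have "w a - w b = 0"
    by (rule tendsto_unique[OF trivial_limit_at_right_real])
  thus ?thesis by simp
qed

lemma test_fun_AC:
  assumes "test_fun \<phi>"
  shows "(\<phi> has_real_derivative deriv \<phi> x) (at x)"
    and "AC (\<lambda>x. of_real (\<phi> x)) (\<lambda>x. of_real (deriv \<phi> x))"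
    and "\<exists>c>0. \<forall>x. \<bar>x\<bar> \<ge> c \<longrightarrow> \<phi> x = 0 \<and> deriv \<phi> x = 0"
proof -
  have d: "(deriv ^^ n) \<phi> field_differentiable at x" for n x using assms by (auto simp: test_fun_def)
  show D: "(\<phi> has_real_derivative deriv \<phi> x) (at x)" for x
    using d[of 0 x] by (simp add: DERIV_deriv_iff_field_differentiable)
  have "continuous_on UNIV (deriv \<phi>)"
    using d[of 1] by (auto intro!: continuous_at_imp_continuous_on field_differentiable_imp_continuous_at)
  thus "AC (\<lambda>x. of_real (\<phi> x)) (\<lambda>x. of_real (deriv \<phi> x))"
    using D
    by (intro AC_C1) (auto intro!: continuous_intros has_vector_derivative_of_real
        simp: has_real_derivative_iff_has_vector_derivative)
  obtain c where c: "\<And>x. \<phi> x \<noteq> 0 \<Longrightarrow> \<bar>x\<bar> \<le> c"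
    using assms by (auto simp: test_fun_def bounded_iff)
  show "\<exists>c>0. \<forall>x. \<bar>x\<bar> \<ge> c \<longrightarrow> \<phi> x = 0 \<and> deriv \<phi> x = 0"
  proof (intro exI[of _ "\<bar>c\<bar> + 1"] conjI allI impI)
    fix x assume x: "\<bar>c\<bar> + 1 \<le> \<bar>x\<bar>"
    show "\<phi> x = 0" using c[of x] x by (cases "\<phi> x = 0") auto
    have "((\<lambda>x. 0) has_real_derivative 0) (at x)" by simp
    hence "(\<phi> has_real_derivative 0) (at x)"
    proof (rule DERIV_cong_ev[THEN iffD1, rotated -1])
      have "eventually (\<lambda>y. y \<in> {y. \<bar>c\<bar> < \<bar>y\<bar>}) (nhds x)"
        by (rule eventually_nhds_in_open) (use x in \<open>auto intro!: open_Collect_less continuous_intros\<close>)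
      thus "eventually (\<lambda>y. 0 = \<phi> y) (nhds x)"
        by eventually_elim (use c in force)
    qed auto
    thus "deriv \<phi> x = 0" by (rule DERIV_imp_deriv)
  qed auto
qed

lemma integral_compact_support:
  fixes f :: "real \<Rightarrow> complex"
  assumes "\<And>x. \<bar>x\<bar> \<ge> c \<Longrightarrow> f x = 0"
  shows "(LINT x|lborel. f x) = (LINT x:{-c..c}|lborel. f x)"
  unfolding set_lebesgue_integral_def
proof (intro Bochner_Integration.integral_cong refl)
  fix x show "f x = indicator {-c..c} x *\<^sub>R f x"
    using assms[of x] by (cases "\<bar>x\<bar> \<ge> c") (auto simp: indicator_def)
qed

section \<open>Weak derivatives and absolute continuity\<close>

lemma AC_imp_weak_deriv:
  assumes "AC u v" shows "is_weak_deriv u v"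
  unfolding is_weak_deriv_def
proof (intro conjI allI impI)
  fix \<phi> assume t: "test_fun \<phi>"
  obtain c where c: "c > 0" "\<And>x. \<bar>x\<bar> \<ge> c \<Longrightarrow> \<phi> x = 0 \<and> deriv \<phi> x = 0"
    using test_fun_AC(3)[OF t] by blast
  have p: "AC (\<lambda>x. of_real (\<phi> x)) (\<lambda>x. of_real (deriv \<phi> x))" by (rule test_fun_AC(2)[OF t])
  have 1: "(LINT x|lborel. deriv \<phi> x *\<^sub>R u x) = (LINT x:{-c..c}|lborel. of_real (deriv \<phi> x) * u x)"
    by (subst integral_compact_support[of c]) (use c in \<open>auto simp: scaleR_conv_of_real\<close>)
  have 2: "(LINT x|lborel. \<phi> x *\<^sub>R v x) = (LINT x:{-c..c}|lborel. of_real (\<phi> x) * v x)"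
    by (subst integral_compact_support[of c]) (use c in \<open>auto simp: scaleR_conv_of_real\<close>)
  have i1: "set_integrable lborel {-c..c} (\<lambda>x. of_real (deriv \<phi> x) * u x)"
    by (intro L2_loc_mult_integrable AC_L2[OF p] L2_loc_continuous AC_continuous[OF assms])
  have i2: "set_integrable lborel {-c..c} (\<lambda>x. of_real (\<phi> x) * v x)"
    by (intro L2_loc_mult_integrable AC_L2[OF assms] L2_loc_continuous AC_continuous[OF p])
  have "of_real (\<phi> c) * u c - of_real (\<phi> (-c)) * u (-c)
    = (LINT x:{-c..c}|lborel. of_real (deriv \<phi> x) * u x + of_real (\<phi> x) * v x)"
    using AC_diff_eq[OF AC_mult[OF p assms], of "-c" c] c by simp
  also have "\<dots> = (LINT x:{-c..c}|lborel. of_real (deriv \<phi> x) * u x) + (LINT x:{-c..c}|lborel. of_real (\<phi> x) * v x)"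
    by (rule set_integral_add(2)[OF i1 i2])
  finally show "(LINT x|lborel. deriv \<phi> x *\<^sub>R u x) = - (LINT x|lborel. \<phi> x *\<^sub>R v x)"
    unfolding 1 2 using c(2)[of c] c(2)[of "-c"] c(1) by (simp add: eq_neg_iff_add_eq_0)
qed (rule AC_L2[OF assms])

text \<open>Subtracting a primitive of \<open>v\<close> leaves a continuous function whose weak
  derivative is zero, hence a constant.\<close>

lemma weak_deriv_imp_AC:
  assumes u: "continuous_on UNIV u" and w: "is_weak_deriv u v"
  shows "AC u v"
proof -
  have v: "L2_loc v" using w by (simp add: is_weak_deriv_def)
  define V where "V = (\<lambda>x. if 0 \<le> x then (LINT y:{0..x}|lborel. v y) else - (LINT y:{x..0}|lborel. v y))"
  have V: "AC V v"
    unfolding AC_def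
  proof (intro conjI allI impI)
    fix a b :: real assume ab: "a \<le> b"
    note sp = set_integral_split[where f = v, OF _ _ L2_loc_integrable[OF v]]
    have z: "(LINT y:{0..0}|lborel. v y) = 0" using sp[of 0 0 0] by simp
    consider "0 \<le> a" | "b \<le> 0" "a < 0" | "a < 0" "0 < b" by linarith
    thus "V b - V a = (LINT x:{a..b}|lborel. v x)"
    proof cases
      case 1 thus ?thesis using sp[OF 1 ab] ab by (simp add: V_def)
    next
      case 2
      thus ?thesis using sp[OF ab 2(1)] z by (cases "b = 0") (simp_all add: V_def)
    next
      case 3
      thus ?thesis using sp[of a 0 b] by (simp add: V_def)
    qed
  qed (rule v)
  have cont: "continuous_on UNIV (\<lambda>x. u x - V x)"
    by (intro continuous_intros u AC_continuous[OF V])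
  have const: "u a - V a = u b - V b" for a b
  proof (rule continuous_weak_const[OF cont])
    fix \<phi> assume t: "test_fun \<phi>"
    obtain c where c: "c > 0" "\<And>x. \<bar>x\<bar> \<ge> c \<Longrightarrow> \<phi> x = 0 \<and> deriv \<phi> x = 0"
      using test_fun_AC(3)[OF t] by blast
    have int: "integrable lborel (\<lambda>x. deriv \<phi> x *\<^sub>R g x)" if "continuous_on UNIV g" for g :: "real \<Rightarrow> complex"
    proof -
      have "set_integrable lborel {-c..c} (\<lambda>x. of_real (deriv \<phi> x) * g x)"
        by (intro L2_loc_mult_integrable AC_L2[OF test_fun_AC(2)[OF t]] L2_loc_continuous that)
      moreover have "indicator {-c..c} x *\<^sub>R (of_real (deriv \<phi> x) * g x) = deriv \<phi> x *\<^sub>R g x" for x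
        using c(2)[of x] by (cases "\<bar>x\<bar> \<ge> c") (auto simp: indicator_def scaleR_conv_of_real)
      ultimately show ?thesis by (simp add: set_integrable_def)
    qed
    have "(LINT x|lborel. deriv \<phi> x *\<^sub>R (u x - V x)) = (LINT x|lborel. deriv \<phi> x *\<^sub>R u x) - (LINT x|lborel. deriv \<phi> x *\<^sub>R V x)"
      unfolding scaleR_diff_right by (intro Bochner_Integration.integral_diff int u AC_continuous[OF V])
    also have "\<dots> = 0"
      using w AC_imp_weak_deriv[OF V] t by (simp add: is_weak_deriv_def)
    finally show "(LINT x|lborel. deriv \<phi> x *\<^sub>R (u x - V x)) = 0" .
  qed
  show ?thesis unfolding AC_def
  proof (intro conjI allI impI v)
    fix a b :: real assume "a \<le> b"
    thus "u b - u a = (LINT x:{a..b}|lborel. v x)"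
      using AC_diff_eq[OF V] const[of a b] by (simp add: algebra_simps)
  qed
qed

lemma AC_wderiv:
  assumes "AC u v" shows "AC u (wderiv u)"
proof -
  have "is_weak_deriv u (wderiv u)"
    unfolding wderiv_def by (metis AC_imp_weak_deriv[OF assms] someI_ex)
  thus ?thesis by (rule weak_deriv_imp_AC[OF AC_continuous[OF assms]])
qed

lemma X_space_AC: "u \<in> X_space \<Longrightarrow> AC u (wderiv u)"
  unfolding X_space_def using weak_deriv_imp_AC AC_wderiv by blast

lemma X_space_I: "AC u v \<Longrightarrow> (\<And>z. u (z + 2 * pi) = u z) \<Longrightarrow> u \<in> X_space"
  unfolding X_space_def using AC_continuous AC_imp_weak_deriv by blast

lemma wderiv_AE: "AC u v \<Longrightarrow> AE x in lborel. wderiv u x = v x"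
  using AC_unique[OF AC_wderiv] by blast

section \<open>The Hilbert space of periodic functions\<close>

abbreviation iper :: "(real \<Rightarrow> 'a::{banach, second_countable_topology}) \<Rightarrow> 'a" where
  "iper f \<equiv> (LINT z:{0..2*pi}|lborel. f z)"

lemma set_integral_AE_cong':
  fixes f g :: "real \<Rightarrow> 'a::euclidean_space"
  assumes "AE x in lborel. f x = g x" "set_integrable lborel A f" "set_integrable lborel A g"
  shows "(LINT x:A|lborel. f x) = (LINT x:A|lborel. g x)"
  unfolding set_lebesgue_integral_def
  by (rule integral_cong_AE) (use assms in \<open>auto simp: set_integrable_def dest: borel_measurable_integrable\<close>)

text \<open>Periodicity is asked almost everywhere because derivatives of periodic functions have it
  only in that sense.\<close>

lemma iper_shift:
  fixes f :: "real \<Rightarrow> 'a::euclidean_space"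
  assumes int: "\<And>a b. intg a b f" and per: "AE x in lborel. f (x + 2 * pi) = f x"
  shows "iper (\<lambda>z. f (z + t)) = iper f"
proof -
  note sp = set_integral_split[where f = f, OF _ _ int]
  have sh: "(LINT x:{a+2*pi..b+2*pi}|lborel. f x) = (LINT x:{a..b}|lborel. f x)" for a b
  proof -
    have "(LINT x:{a..b}|lborel. f (2 * pi + 1 * x)) = (LINT x:{2*pi+a..2*pi+b}|lborel. f x)"
      by (subst set_integral_affine) auto
    moreover have "(LINT x:{a..b}|lborel. f (2 * pi + 1 * x)) = (LINT x:{a..b}|lborel. f x)"
    proof (rule set_integral_AE_cong')
      show "AE x in lborel. f (2 * pi + 1 * x) = f x" using per by (simp add: add.commute)
      show "intg a b (\<lambda>x. f (2 * pi + 1 * x))"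
        by (rule set_integrable_affine) (auto intro: int)
    qed (rule int)
    ultimately show ?thesis by (simp add: add.commute)
  qed
  have "iper (\<lambda>z. f (z + t)) = (LINT x:{t..t+2*pi}|lborel. f x)"
    using set_integral_affine[of 1 0 "2*pi" f t] by (simp add: add.commute)
  also have "\<dots> = iper f"
  proof (cases "0 \<le> t")
    case True
    have "(LINT x:{0..t+2*pi}|lborel. f x) = (LINT x:{0..t}|lborel. f x) + (LINT x:{t..t+2*pi}|lborel. f x)"
      by (rule sp) (use True in auto)
    moreover have "(LINT x:{0..t+2*pi}|lborel. f x) = iper f + (LINT x:{0+2*pi..t+2*pi}|lborel. f x)"
      using sp[of 0 "2*pi" "t+2*pi"] True by simp
    ultimately show ?thesis using sh[of 0 t] by simp
  next
    case False
    have "(LINT x:{t..2*pi}|lborel. f x) = (LINT x:{t..0}|lborel. f x) + iper f"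
      by (rule sp) (use False in auto)
    moreover have "(LINT x:{t..2*pi}|lborel. f x) = (LINT x:{t..t+2*pi}|lborel. f x) + (LINT x:{t+2*pi..0+2*pi}|lborel. f x)"
      using sp[of t "t+2*pi" "2*pi"] False by simp
    ultimately show ?thesis using sh[of t 0] by simp
  qed
  finally show ?thesis .
qed

lemma set_integrable_Re: "set_integrable lborel A f \<Longrightarrow> set_integrable lborel A (\<lambda>x. Re (f x))"
  unfolding set_integrable_def by (drule integrable_Re) simp

lemma set_integrable_Im: "set_integrable lborel A f \<Longrightarrow> set_integrable lborel A (\<lambda>x. Im (f x))"
  unfolding set_integrable_def by (drule integrable_Im) simp

lemma set_integral_Re: "set_integrable lborel A f \<Longrightarrow> (LINT x:A|lborel. Re (f x)) = Re (LINT x:A|lborel. f x)"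
  unfolding set_integrable_def set_lebesgue_integral_def by (subst integral_Re[symmetric]) auto

lemma set_integral_Im: "set_integrable lborel A f \<Longrightarrow> (LINT x:A|lborel. Im (f x)) = Im (LINT x:A|lborel. f x)"
  unfolding set_integrable_def set_lebesgue_integral_def by (subst integral_Im[symmetric]) auto

lemma X_space_add: "u \<in> X_space \<Longrightarrow> v \<in> X_space \<Longrightarrow> (\<lambda>z. u z + v z) \<in> X_space"
  using X_space_I[OF AC_add[OF X_space_AC X_space_AC]] by (auto simp: X_space_def)

lemma X_space_cmult: "u \<in> X_space \<Longrightarrow> (\<lambda>z. c * u z) \<in> X_space"
  using X_space_I[OF AC_cmult[OF X_space_AC]] by (auto simp: X_space_def)

lemma X_space_mult: "u \<in> X_space \<Longrightarrow> v \<in> X_space \<Longrightarrow> (\<lambda>z. u z * v z) \<in> X_space"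
  using X_space_I[OF AC_mult[OF X_space_AC X_space_AC]] by (auto simp: X_space_def)

lemma X_space_cnj: "u \<in> X_space \<Longrightarrow> (\<lambda>z. cnj (u z)) \<in> X_space"
  using X_space_I[OF AC_cnj[OF X_space_AC]] by (auto simp: X_space_def)

lemma X_space_shift:
  assumes "u \<in> X_space" shows "(\<lambda>z. u (z + t)) \<in> X_space"
proof -
  have "(\<lambda>z. u (t + 1 * z)) \<in> X_space"
  proof (rule X_space_I[OF AC_affine[OF X_space_AC[OF assms], of 1 t]])
    show "u (t + 1 * (z + 2 * pi)) = u (t + 1 * z)" for z
      using assms by (simp add: X_space_def add.assoc[symmetric])
  qed simp
  thus ?thesis by (simp add: add.commute)
qed

lemma X_space_const: "(\<lambda>z. c) \<in> X_space"
  by (rule X_space_I[OF AC_C1[of _ "\<lambda>_. 0"]]) auto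

lemma Re_cnj_mult_self: "Re (cnj a * a) = cmod2 a"
  unfolding cmod_power2 by (simp add: power2_eq_square)

section \<open>The space X as a type with an inner product\<close>

typedef h1 = X_space morphisms fn H1
  using X_space_const[of 0] by blast

definition dv :: "h1 \<Rightarrow> real \<Rightarrow> complex" where "dv u = wderiv (fn u)"

lemma AC_fn: "AC (fn u) (dv u)"
  unfolding dv_def by (rule X_space_AC) (rule fn)

lemma fn_periodic: "fn u (z + 2 * pi) = fn u z"
  using fn[of u] by (simp add: X_space_def)

lemma fn_continuous: "continuous_on S (fn u)"
  using AC_continuous[OF AC_fn] by (rule continuous_on_subset) simp

lemma L2_dv: "L2_loc (dv u)" by (rule AC_L2[OF AC_fn])

lemma L2_fn: "L2_loc (fn u)" by (intro L2_loc_continuous fn_continuous)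

lemma dv_periodic: "AE z in lborel. dv u (z + 2 * pi) = dv u z"
proof -
  have "AC (\<lambda>z. fn u (2 * pi + 1 * z)) (\<lambda>z. of_real 1 * dv u (2 * pi + 1 * z))"
    by (rule AC_affine[OF AC_fn]) simp
  hence "AC (fn u) (\<lambda>z. dv u (z + 2 * pi))"
    using fn_periodic[of u] by (simp add: add.commute)
  thus ?thesis by (rule AC_unique) (rule AC_fn)
qed

lemma fn_H1: "f \<in> X_space \<Longrightarrow> fn (H1 f) = f"
  by (rule H1_inverse)

lemma fn_eqI: "(\<And>z. fn u z = fn v z) \<Longrightarrow> u = v"
  by (metis ext fn_inject)

lemma dv_AE: "AC (fn u) v \<Longrightarrow> AE z in lborel. dv u z = v z"
  unfolding dv_def by (rule wderiv_AE)

text \<open>The codomain is arbitrary since the lemma also serves for functions with values in sets,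
  in \<open>act_reduce\<close>.\<close>

lemma periodic_reduce:
  fixes f :: "real \<Rightarrow> 'a"
  assumes "\<And>z. f (z + 2 * pi) = f z"
  shows "\<exists>y\<in>{0..2*pi}. f z = f y"
proof -
  define m where "m = \<lfloor>z / (2 * pi)\<rfloor>"
  have sh: "f (y + 2 * pi * of_int n) = f y" for y and n :: int
  proof (induction n rule: int_induct[where k = 0])
    case (step1 i)
    thus ?case using assms[of "y + 2 * pi * of_int i"] by (simp add: algebra_simps)
  next
    case (step2 i)
    thus ?case using assms[of "y + 2 * pi * of_int (i - 1)"] by (simp add: algebra_simps)
  qed simp
  have "of_int m \<le> z / (2 * pi)" "z / (2 * pi) < of_int m + 1" unfolding m_def by linarith+
  hence "2 * pi * of_int m \<le> z" "z < 2 * pi * of_int m + 2 * pi" by (simp_all add: field_simps)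
  thus ?thesis using sh[of "z - 2 * pi * of_int m" m]
    by (intro bexI[of _ "z - 2 * pi * of_int m"]) auto
qed

instantiation h1 :: real_inner
begin

definition "0 = H1 (\<lambda>_. 0)"
definition "u + v = H1 (\<lambda>z. fn u z + fn v z)"
definition "- u = H1 (\<lambda>z. (-1) * fn u z)"
definition minus_h1_def0: "u - v = H1 (\<lambda>z. fn u z + (-1) * fn v z)"
definition "r *\<^sub>R u = H1 (\<lambda>z. of_real r * fn u z)"
definition "inner u v = iper (\<lambda>z. Re (cnj (fn u z) * fn v z + cnj (dv u z) * dv v z))"
definition norm_h1_def: "norm (u::h1) = sqrt (inner u u)"
definition "dist (u::h1) v = norm (u - v)"
definition "sgn (u::h1) = H1 (\<lambda>z. of_real (inverse (norm u)) * fn u z)"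
definition [code del]: "(uniformity :: (h1 \<times> h1) filter) = (INF e\<in>{0<..}. principal {(x, y). dist x y < e})"
definition [code del]: "open (U :: h1 set) \<longleftrightarrow> (\<forall>x\<in>U. \<forall>\<^sub>F (x', y) in uniformity. x' = x \<longrightarrow> y \<in> U)"

lemma fn_zero: "fn 0 z = 0"
  unfolding zero_h1_def by (subst fn_H1) (auto intro: X_space_const)

lemma fn_add: "fn (u + v) z = fn u z + fn v z"
  unfolding plus_h1_def by (subst fn_H1) (auto intro: X_space_add fn)

lemma fn_uminus: "fn (- u) z = - fn u z"
  unfolding uminus_h1_def by (subst fn_H1) (auto intro: X_space_cmult[of _ "-1", simplified] fn)

lemma fn_minus: "fn (u - v) z = fn u z - fn v z"
  unfolding minus_h1_def0
  by (subst fn_H1) (auto intro!: X_space_add[OF fn X_space_cmult[of _ "-1"], simplified] fn)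

lemma fn_scaleR: "fn (r *\<^sub>R u) z = of_real r * fn u z"
  unfolding scaleR_h1_def by (subst fn_H1) (auto intro: X_space_cmult fn)

lemma inner_integrable:
  assumes "L2_loc a" "L2_loc b"
  shows "intg x y (\<lambda>z. Re (cnj (a z) * b z))"
  by (intro set_integrable_Re L2_loc_mult_integrable L2_loc_cnj assms)

text \<open>\<open>dv\<close> is a choice of representative and respects sums and multiples only
  almost everywhere. This formula lets any representative be inserted, which yields
  bilinearity.\<close>

lemma inner_h1_AC:
  assumes "AC (fn u) u'" "AC (fn v) v'"
  shows "inner u v = iper (\<lambda>z. Re (cnj (fn u z) * fn v z)) + iper (\<lambda>z. Re (cnj (u' z) * v' z))"
proof -
  have "inner u v = iper (\<lambda>z. Re (cnj (fn u z) * fn v z)) + iper (\<lambda>z. Re (cnj (dv u z) * dv v z))"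
    unfolding inner_h1_def plus_complex.sel
    by (rule set_integral_add(2)) (intro inner_integrable L2_fn L2_dv)+
  also have "iper (\<lambda>z. Re (cnj (dv u z) * dv v z)) = iper (\<lambda>z. Re (cnj (u' z) * v' z))"
  proof (rule set_integral_AE_cong')
    show "AE z in lborel. Re (cnj (dv u z) * dv v z) = Re (cnj (u' z) * v' z)"
      using dv_AE[OF assms(1)] dv_AE[OF assms(2)] by eventually_elim simp
  qed (intro inner_integrable L2_dv AC_L2[OF assms(1)] AC_L2[OF assms(2)])+
  finally show ?thesis .
qed

lemma AC_fn_add: "AC (fn (u + v)) (\<lambda>z. dv u z + dv v z)"
  using AC_add[OF AC_fn AC_fn] by (simp add: fn_add[abs_def] fun_eq_iff)

lemma AC_fn_scaleR: "AC (fn (r *\<^sub>R u)) (\<lambda>z. of_real r * dv u z)"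
  using AC_cmult[OF AC_fn, of "of_real r" u] by (simp add: fn_scaleR[abs_def] fun_eq_iff)

instance
proof
  fix u v w :: h1 and r s :: real
  show "u + v + w = u + (v + w)" by (rule fn_eqI) (simp add: fn_add)
  show "u + v = v + u" by (rule fn_eqI) (simp add: fn_add)
  show "0 + u = u" by (rule fn_eqI) (simp add: fn_add fn_zero)
  show "- u + u = 0" by (rule fn_eqI) (simp add: fn_add fn_zero fn_uminus)
  show "u - v = u + - v" by (rule fn_eqI) (simp add: fn_add fn_uminus fn_minus)
  show "r *\<^sub>R (u + v) = r *\<^sub>R u + r *\<^sub>R v" by (rule fn_eqI) (simp add: fn_add fn_scaleR algebra_simps)
  show "(r + s) *\<^sub>R u = r *\<^sub>R u + s *\<^sub>R u" by (rule fn_eqI) (simp add: fn_add fn_scaleR algebra_simps)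
  show "r *\<^sub>R s *\<^sub>R u = (r * s) *\<^sub>R u" by (rule fn_eqI) (simp add: fn_scaleR)
  show "1 *\<^sub>R u = u" by (rule fn_eqI) (simp add: fn_scaleR)
  show "dist u v = norm (u - v)" by (rule dist_h1_def)
  show "sgn u = inverse (norm u) *\<^sub>R u" by (simp add: sgn_h1_def scaleR_h1_def)
  show "(uniformity :: (h1 \<times> h1) filter) = (INF e\<in>{0<..}. principal {(x, y). dist x y < e})"
    by (rule uniformity_h1_def)
  show "open U \<longleftrightarrow> (\<forall>x\<in>U. \<forall>\<^sub>F (x', y) in uniformity. x' = x \<longrightarrow> y \<in> U)" for U :: "h1 set"
    by (rule open_h1_def)
  show "norm u = sqrt (inner u u)" by (rule norm_h1_def)
  show "inner u v = inner v u"
    unfolding inner_h1_def by (rule set_integral_pw_cong) (auto simp: algebra_simps)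
  show "inner (u + v) w = inner u w + inner v w"
  proof -
    have "inner (u + v) w = iper (\<lambda>z. Re (cnj (fn u z) * fn w z) + Re (cnj (fn v z) * fn w z))
       + iper (\<lambda>z. Re (cnj (dv u z) * dv w z) + Re (cnj (dv v z) * dv w z))"
      using inner_h1_AC[OF AC_fn_add AC_fn, of u v w] by (simp add: fn_add distrib_right)
    also have "\<dots> = (iper (\<lambda>z. Re (cnj (fn u z) * fn w z)) + iper (\<lambda>z. Re (cnj (fn v z) * fn w z)))
       + (iper (\<lambda>z. Re (cnj (dv u z) * dv w z)) + iper (\<lambda>z. Re (cnj (dv v z) * dv w z)))"
      by (intro arg_cong2[where f = "(+)"] set_integral_add(2) inner_integrable L2_fn L2_dv)
    also have "\<dots> = inner u w + inner v w"
      using inner_h1_AC[OF AC_fn AC_fn, of u w] inner_h1_AC[OF AC_fn AC_fn, of v w] by simp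
    finally show ?thesis .
  qed
  show "inner (r *\<^sub>R u) v = r * inner u v"
  proof -
    have "inner (r *\<^sub>R u) v = iper (\<lambda>z. r * Re (cnj (fn u z) * fn v z)) + iper (\<lambda>z. r * Re (cnj (dv u z) * dv v z))"
      using inner_h1_AC[OF AC_fn_scaleR AC_fn, of r u v] by (simp add: fn_scaleR algebra_simps)
    also have "\<dots> = r * inner u v"
      unfolding inner_h1_AC[OF AC_fn AC_fn, of u v] distrib_left
      by (intro arg_cong2[where f = "(+)"] set_integral_mult_right)
    finally show ?thesis .
  qed
  have nn: "Re (cnj (fn u z) * fn u z + cnj (dv u z) * dv u z) = cmod2 (fn u z) + cmod2 (dv u z)" for z
    by (simp only: plus_complex.sel Re_cnj_mult_self)
  show pos: "0 \<le> inner u u"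
    unfolding inner_h1_def nn by (rule set_integral_nonneg) simp
  show "inner u u = 0 \<longleftrightarrow> u = 0"
  proof
    assume "u = 0"
    have "AC (fn (0::h1)) (\<lambda>_. 0)" by (rule AC_C1) (auto simp: fn_zero[abs_def])
    from inner_h1_AC[OF this this] show "inner u u = 0" using \<open>u = 0\<close> by (simp add: fn_zero)
  next
    assume z: "inner u u = 0"
      have "inner u u = iper (\<lambda>z. cmod2 (fn u z)) + iper (\<lambda>z. cmod2 (dv u z))"
      using inner_h1_AC[OF AC_fn AC_fn, of u u] unfolding Re_cnj_mult_self .
    moreover have "0 \<le> iper (\<lambda>z. cmod2 (fn u z))" "0 \<le> iper (\<lambda>z. cmod2 (dv u z))"
      by (rule set_integral_nonneg, simp)+
    ultimately have "iper (\<lambda>z. cmod2 (fn u z)) = 0" using z by linarith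
    \<comment> \<open>Definiteness holds pointwise because elements are continuous
      representatives.\<close>
    hence "integral {0..2*pi} (\<lambda>z. cmod2 (fn u z)) = 0"
      using set_borel_integral_eq_integral(2)[OF L2_loc_sq_integrable[OF L2_fn[of u]], of 0 "2*pi"] by simp
    hence "\<forall>z\<in>{0..2*pi}. cmod2 (fn u z) = 0"
      by (subst (asm) integral_eq_0_iff) (auto intro!: continuous_intros fn_continuous)
    hence "fn u z = 0" for z
      using periodic_reduce[of "fn u" z, OF fn_periodic] by auto
    thus "u = 0" by (intro fn_eqI) (simp add: fn_zero)
  qed
qed

end

lemma norm_h1_sq: "(norm u)\<^sup>2 = iper (\<lambda>z. cmod2 (fn u z)) + iper (\<lambda>z. cmod2 (dv u z))"
proof -
  show ?thesis
    using inner_h1_AC[OF AC_fn AC_fn, of u u] unfolding Re_cnj_mult_self by (simp add: power2_norm_eq_inner)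
qed

lemma X_norm_fn: "X_norm (fn u) = norm u"
proof -
  have "X_norm (fn u) = sqrt (iper (\<lambda>z. cmod2 (fn u z) + cmod2 (dv u z)))"
    by (simp add: X_norm_def dv_def)
  also have "iper (\<lambda>z. cmod2 (fn u z) + cmod2 (dv u z)) = (norm u)\<^sup>2"
    unfolding norm_h1_sq by (intro set_integral_add(2) L2_loc_sq_integrable L2_fn L2_dv)
  finally show ?thesis by simp
qed

lemma X_dist_fn: "X_dist (fn u) (fn v) = norm (u - v)"
  unfolding X_dist_def X_norm_fn[symmetric] by (simp add: fn_minus[abs_def])

section \<open>L2 norms and the embedding into bounded functions\<close>

definition L2n :: "(real \<Rightarrow> complex) \<Rightarrow> real" where
  "L2n f = sqrt (iper (\<lambda>z. cmod2 (f z)))"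

lemma iper_sq_nonneg: "0 \<le> iper (\<lambda>z. cmod2 (f z))"
  by (rule set_integral_nonneg) simp

lemma L2n_sq: "(L2n f)\<^sup>2 = iper (\<lambda>z. cmod2 (f z))"
  by (simp add: L2n_def iper_sq_nonneg)

lemma L2n_nonneg: "0 \<le> L2n f"
  by (simp add: L2n_def iper_sq_nonneg)

lemma L2n_fn_le: "L2n (fn u) \<le> norm u" and L2n_dv_le: "L2n (dv u) \<le> norm u"
  unfolding L2n_def
  by (rule real_le_lsqrt; use norm_h1_sq[of u] iper_sq_nonneg[of "fn u"] iper_sq_nonneg[of "dv u"] in simp)+

lemma iper_norm_CS:
  assumes "L2_loc f" "L2_loc g"
  shows "iper (\<lambda>z. cmod (f z) * cmod (g z)) \<le> L2n f * L2n g"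
proof -
  have i: "intg 0 (2*pi) (\<lambda>z. cmod (f z) * cmod (g z))"
    using set_integrable_norm[OF L2_loc_mult_integrable[OF assms]] by (simp add: norm_mult)
  have "(iper (\<lambda>z. cmod (f z) * cmod (g z)))\<^sup>2 \<le> (L2n f * L2n g)\<^sup>2"
    unfolding power_mult_distrib L2n_sq
    by (intro set_integral_Cauchy_Schwarz L2_loc_sq_integrable assms i)
  thus ?thesis by (rule power2_le_imp_le) (simp add: L2n_nonneg)
qed

lemma iper_CS:
  assumes "L2_loc f" "L2_loc g"
  shows "cmod (iper (\<lambda>z. f z * g z)) \<le> L2n f * L2n g"
proof -
  have "cmod (iper (\<lambda>z. f z * g z)) \<le> iper (\<lambda>z. cmod (f z) * cmod (g z))"
    using set_integral_norm_bound[OF L2_loc_mult_integrable[OF assms]] by (simp add: norm_mult)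
  also have "\<dots> \<le> L2n f * L2n g" by (rule iper_norm_CS[OF assms])
  finally show ?thesis .
qed

lemma L2n_bounded_mult:
  assumes f: "L2_loc f" and g: "continuous_on UNIV g" and C: "\<And>z. cmod (g z) \<le> C"
  shows "L2n (\<lambda>z. g z * f z) \<le> C * L2n f"
proof -
  have C0: "0 \<le> C" using C[of 0] norm_ge_zero order_trans by blast
  have "iper (\<lambda>z. cmod2 (g z * f z)) \<le> iper (\<lambda>z. C\<^sup>2 * cmod2 (f z))"
  proof (rule set_integral_mono)
    show "cmod2 (g z * f z) \<le> C\<^sup>2 * cmod2 (f z)" for z
      unfolding norm_mult power_mult_distrib by (intro mult_right_mono power_mono C) auto
  qed (auto intro!: L2_loc_sq_integrable f L2_loc_mult_bounded g)
  also have "\<dots> = (C * L2n f)\<^sup>2" by (simp add: power_mult_distrib L2n_sq)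
  finally show ?thesis
    unfolding L2n_def[of "\<lambda>z. g z * f z"] using C0 L2n_nonneg[of f] by (intro real_le_lsqrt) auto
qed

lemma L2n_add:
  assumes f: "L2_loc f" and g: "L2_loc g"
  shows "L2n (\<lambda>z. f z + g z) \<le> L2n f + L2n g"
proof -
  have i: "intg 0 (2*pi) (\<lambda>z. cmod (f z) * cmod (g z))"
    using set_integrable_norm[OF L2_loc_mult_integrable[OF assms]] by (simp add: norm_mult)
  have "iper (\<lambda>z. cmod2 (f z + g z)) \<le> iper (\<lambda>z. cmod2 (f z) + (2 * (cmod (f z) * cmod (g z)) + cmod2 (g z)))"
  proof (rule set_integral_mono)
    fix z
    have "cmod2 (f z + g z) \<le> (cmod (f z) + cmod (g z))\<^sup>2" by (intro power_mono norm_triangle_ineq) auto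
    thus "cmod2 (f z + g z) \<le> cmod2 (f z) + (2 * (cmod (f z) * cmod (g z)) + cmod2 (g z))"
      by (simp add: power2_sum)
  qed (intro L2_loc_sq_integrable L2_loc_add set_integral_add(1) set_integrable_mult_right i f g)+
  also have "\<dots> = (L2n f)\<^sup>2 + (2 * iper (\<lambda>z. cmod (f z) * cmod (g z)) + (L2n g)\<^sup>2)"
    unfolding L2n_sq
    by (subst set_integral_add(2), (intro L2_loc_sq_integrable set_integral_add(1) set_integrable_mult_right i f g)+)
       (subst set_integral_add(2), (intro L2_loc_sq_integrable set_integrable_mult_right i f g)+, simp)
  also have "\<dots> \<le> (L2n f + L2n g)\<^sup>2"
    using iper_norm_CS[OF assms] by (simp add: power2_sum)
  finally show ?thesis
    unfolding L2n_def[of "\<lambda>z. f z + g z"] using L2n_nonneg by (intro real_le_lsqrt) (auto intro: add_nonneg_nonneg)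
qed

lemma L2n_uminus: "L2n (\<lambda>z. - f z) = L2n f"
  by (simp add: L2n_def)

text \<open>Sobolev embedding on the circle: compare the value at \<open>x\<close> with that at
  \<open>y\<close> by the Holder bound and average over \<open>y\<close>. The constant is rounded up
  from \<open>4 * pi <= 16\<close>.\<close>

lemma fn_bound: "cmod (fn u z) \<le> 4 * norm u"
proof -
  obtain x where x: "x \<in> {0..2*pi}" "fn u z = fn u x"
    using periodic_reduce[of "fn u" z, OF fn_periodic] by blast
  define D where "D = iper (\<lambda>z. cmod2 (dv u z))"
  have D0: "0 \<le> D" unfolding D_def by (rule iper_sq_nonneg)
  have ord: "cmod2 (fn u b - fn u a) \<le> 2 * pi * D" if "a \<in> {0..2*pi}" "b \<in> {0..2*pi}" "a \<le> b" for a b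
  proof -
    have "(LINT x:{a..b}|lborel. cmod2 (dv u x)) \<le> D"
      unfolding D_def by (rule set_integral_mono_set) (use that in \<open>auto intro: L2_loc_sq_integrable L2_dv\<close>)
    hence "(b - a) * (LINT x:{a..b}|lborel. cmod2 (dv u x)) \<le> 2 * pi * D"
      using that by (intro mult_mono) (auto intro: set_integral_nonneg)
    thus ?thesis using AC_Holder[OF AC_fn that(3), of u] by linarith
  qed
  have pt: "cmod2 (fn u x) \<le> 2 * cmod2 (fn u y) + 4 * pi * D" if "y \<in> {0..2*pi}" for y
  proof -
    have "cmod2 (fn u x - fn u y) \<le> 2 * pi * D"
      using ord[OF that x(1)] ord[OF x(1) that] by (cases "y \<le> x") (auto simp: norm_minus_commute)
    moreover have "cmod2 (fn u x) \<le> (cmod (fn u y) + cmod (fn u x - fn u y))\<^sup>2"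
      by (intro power_mono norm_triangle_sub norm_ge_zero)
    moreover have "(cmod (fn u y) + cmod (fn u x - fn u y))\<^sup>2 \<le> 2 * cmod2 (fn u y) + 2 * cmod2 (fn u x - fn u y)"
      using sum_squares_bound[of "cmod (fn u y)" "cmod (fn u x - fn u y)"] by (simp add: power2_sum)
    ultimately show ?thesis by linarith
  qed
  have c: "intg 0 (2*pi) (\<lambda>_. c)" for c :: real by (intro set_integrable_continuous continuous_intros)
  have ci: "iper (\<lambda>_. c) = 2 * pi * c" for c :: real by (simp add: set_lebesgue_integral_def)
  have "iper (\<lambda>y. cmod2 (fn u x)) \<le> iper (\<lambda>y. 2 * cmod2 (fn u y) + 4 * pi * D)"
    by (rule set_integral_mono) (use pt in \<open>auto intro!: c set_integral_add(1) set_integrable_mult_right L2_loc_sq_integrable L2_fn\<close>)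
  also have "\<dots> = 2 * iper (\<lambda>y. cmod2 (fn u y)) + 2 * pi * (4 * pi * D)"
    by (subst set_integral_add(2)) (auto intro!: c set_integrable_mult_right L2_loc_sq_integrable L2_fn simp: ci)
  finally have "2 * pi * cmod2 (fn u x) \<le> 2 * iper (\<lambda>y. cmod2 (fn u y)) + 2 * pi * (4 * pi * D)"
    unfolding ci .
  moreover have "2 * iper (\<lambda>y. cmod2 (fn u y)) \<le> 2 * pi * iper (\<lambda>y. cmod2 (fn u y))"
    using pi_gt3 by (intro mult_right_mono iper_sq_nonneg) auto
  ultimately have "2 * pi * cmod2 (fn u x) \<le> 2 * pi * (iper (\<lambda>y. cmod2 (fn u y)) + 4 * pi * D)"
    by (simp add: algebra_simps)
  hence "cmod2 (fn u x) \<le> iper (\<lambda>y. cmod2 (fn u y)) + 4 * pi * D"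
    using pi_gt_zero by (simp add: mult_le_cancel_left)
  also have "\<dots> \<le> 16 * iper (\<lambda>y. cmod2 (fn u y)) + 16 * D"
    using D0 pi_less_4 iper_sq_nonneg[of "fn u"] by (intro add_mono mult_right_mono) auto
  also have "\<dots> = (4 * norm u)\<^sup>2"
    using norm_h1_sq[of u] by (simp add: D_def power_mult_distrib)
  finally show ?thesis unfolding x(2) by (rule power2_le_imp_le) simp
qed

section \<open>Translation, multiplication and conjugation\<close>

definition shift :: "real \<Rightarrow> h1 \<Rightarrow> h1" where "shift t u = H1 (\<lambda>z. fn u (z + t))"
definition cmul :: "complex \<Rightarrow> h1 \<Rightarrow> h1" where "cmul c u = H1 (\<lambda>z. c * fn u z)"
definition hmul :: "h1 \<Rightarrow> h1 \<Rightarrow> h1" where "hmul u v = H1 (\<lambda>z. fn u z * fn v z)"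
definition hcnj :: "h1 \<Rightarrow> h1" where "hcnj u = H1 (\<lambda>z. cnj (fn u z))"

lemma fn_shift: "fn (shift t u) z = fn u (z + t)"
  unfolding shift_def by (subst fn_H1) (auto intro: X_space_shift fn)
lemma fn_cmul: "fn (cmul c u) z = c * fn u z"
  unfolding cmul_def by (subst fn_H1) (auto intro: X_space_cmult fn)
lemma fn_hmul: "fn (hmul u v) z = fn u z * fn v z"
  unfolding hmul_def by (subst fn_H1) (auto intro: X_space_mult fn)
lemma fn_hcnj: "fn (hcnj u) z = cnj (fn u z)"
  unfolding hcnj_def by (subst fn_H1) (auto intro: X_space_cnj fn)

lemmas fn_simps = fn_zero fn_add fn_minus fn_uminus fn_scaleR fn_shift fn_cmul fn_hmul fn_hcnj

lemma AC_fn_shift: "AC (fn (shift t u)) (\<lambda>z. dv u (z + t))"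
  using AC_affine[OF AC_fn, of 1 u t] by (simp add: fn_shift[abs_def] add.commute)
lemma AC_fn_cmul: "AC (fn (cmul c u)) (\<lambda>z. c * dv u z)"
  using AC_cmult[OF AC_fn, of c u] by (simp add: fn_cmul[abs_def])
lemma AC_fn_hmul: "AC (fn (hmul u v)) (\<lambda>z. dv u z * fn v z + fn u z * dv v z)"
  using AC_mult[OF AC_fn AC_fn, of u v] by (simp add: fn_hmul[abs_def])
lemma AC_fn_hcnj: "AC (fn (hcnj u)) (\<lambda>z. cnj (dv u z))"
  using AC_cnj[OF AC_fn, of u] by (simp add: fn_hcnj[abs_def])

lemma norm_h1_AC:
  assumes "AC (fn u) v" shows "(norm u)\<^sup>2 = (L2n (fn u))\<^sup>2 + (L2n v)\<^sup>2"
proof -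
  show ?thesis
    using inner_h1_AC[OF assms assms] unfolding Re_cnj_mult_self L2n_sq by (simp add: power2_norm_eq_inner)
qed

lemma norm_h1_le:
  assumes "AC (fn u) v" shows "norm u \<le> L2n (fn u) + L2n v"
proof -
  have "(norm u)\<^sup>2 \<le> (L2n (fn u) + L2n v)\<^sup>2"
    unfolding norm_h1_AC[OF assms] by (simp add: power2_sum L2n_nonneg)
  thus ?thesis by (rule power2_le_imp_le) (simp add: L2n_nonneg add_nonneg_nonneg)
qed

lemma inner_shift: "inner (shift t u) (shift t v) = inner u v"
proof -
  have "inner (shift t u) (shift t v) = iper (\<lambda>z. Re (cnj (fn u (z + t)) * fn v (z + t))) + iper (\<lambda>z. Re (cnj (dv u (z + t)) * dv v (z + t)))"
    using inner_h1_AC[OF AC_fn_shift AC_fn_shift, of t u t v] by (simp only: fn_shift)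
  also have "\<dots> = iper (\<lambda>z. Re (cnj (fn u z) * fn v z)) + iper (\<lambda>z. Re (cnj (dv u z) * dv v z))"
  proof (intro arg_cong2[where f = "(+)"])
    show "iper (\<lambda>z. Re (cnj (fn u (z + t)) * fn v (z + t))) = iper (\<lambda>z. Re (cnj (fn u z) * fn v z))"
      by (rule iper_shift[where f = "\<lambda>z. Re (cnj (fn u z) * fn v z)"])
         (intro inner_integrable L2_fn, simp add: fn_periodic)
    show "iper (\<lambda>z. Re (cnj (dv u (z + t)) * dv v (z + t))) = iper (\<lambda>z. Re (cnj (dv u z) * dv v z))"
    proof (rule iper_shift[where f = "\<lambda>z. Re (cnj (dv u z) * dv v z)"])
      show "AE z in lborel. Re (cnj (dv u (z + 2 * pi)) * dv v (z + 2 * pi)) = Re (cnj (dv u z) * dv v z)"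
        using dv_periodic[of u] dv_periodic[of v] by eventually_elim simp
    qed (intro inner_integrable L2_dv)
  qed
  also have "\<dots> = inner u v" using inner_h1_AC[OF AC_fn AC_fn, of u v] by simp
  finally show ?thesis .
qed

lemma norm_shift: "norm (shift t u) = norm u"
  by (simp add: norm_eq_sqrt_inner inner_shift)

lemma norm_cmul: "norm (cmul c u) = cmod c * norm u"
proof -
  have "(norm (cmul c u))\<^sup>2 = (L2n (fn (cmul c u)))\<^sup>2 + (L2n (\<lambda>z. c * dv u z))\<^sup>2"
    by (rule norm_h1_AC[OF AC_fn_cmul])
  also have "\<dots> = (cmod c * norm u)\<^sup>2"
    unfolding power_mult_distrib norm_h1_sq[of u] L2n_sq fn_cmul norm_mult by (simp add: distrib_left)
  finally show ?thesis by simp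
qed

lemma norm_hcnj: "norm (hcnj u) = norm u"
proof -
  have "(norm (hcnj u))\<^sup>2 = (norm u)\<^sup>2"
    unfolding norm_h1_AC[OF AC_fn_hcnj] unfolding L2n_sq norm_h1_sq[of u] fn_hcnj by simp
  thus ?thesis by simp
qed

text \<open>The constant collects a factor 4 from \<open>fn_bound\<close> for the product itself and
  for each of the two terms of the Leibniz rule.\<close>

lemma norm_hmul: "norm (hmul u v) \<le> 12 * norm u * norm v"
proof -
  have c: "continuous_on UNIV (fn w)" for w by (rule fn_continuous)
  have 1: "L2n (fn (hmul u v)) \<le> (4 * norm u) * L2n (fn v)"
    unfolding fn_hmul[abs_def] by (rule L2n_bounded_mult[OF L2_fn c fn_bound])
  have 2: "L2n (\<lambda>z. fn u z * dv v z) \<le> (4 * norm u) * L2n (dv v)"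
    by (rule L2n_bounded_mult[OF L2_dv c fn_bound])
  have 3: "L2n (\<lambda>z. dv u z * fn v z) \<le> (4 * norm v) * L2n (dv u)"
    using L2n_bounded_mult[OF L2_dv c fn_bound, of v u] by (simp add: mult.commute)
  have "L2n (\<lambda>z. dv u z * fn v z + fn u z * dv v z) \<le> (4 * norm v) * L2n (dv u) + (4 * norm u) * L2n (dv v)"
    by (rule order_trans[OF L2n_add add_mono[OF 3 2]])
       (intro L2_loc_mult_bounded[OF L2_dv c] | subst mult.commute)+
  moreover have "(4 * norm v) * L2n (dv u) \<le> (4 * norm v) * norm u" "(4 * norm u) * L2n (dv v) \<le> (4 * norm u) * norm v"
     "(4 * norm u) * L2n (fn v) \<le> (4 * norm u) * norm v"
    by (intro mult_left_mono L2n_dv_le L2n_fn_le; simp)+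
  ultimately show ?thesis
    using norm_h1_le[OF AC_fn_hmul, of u v] 1 by (simp add: algebra_simps)
qed

section \<open>Difference quotients\<close>

text \<open>Truncation in height is followed by approximation almost everywhere by continuous
  functions; both steps converge in the mean by domination.\<close>

lemma L2_loc_density:
  assumes w: "L2_loc w" and e: "e > 0"
  shows "\<exists>g. continuous_on UNIV g \<and> (LINT x:{a..b}|lborel. cmod2 (w x - g x)) < e"
proof -
  have wm [measurable]: "w \<in> borel_measurable borel" by (rule L2_loc_measurable[OF w])
  define wt where "wt = (\<lambda>M x. if cmod (w x) \<le> real M then w x else 0)"
  have wtm [measurable]: "wt M \<in> borel_measurable borel" for M unfolding wt_def by measurable
  let ?d = "\<lambda>M x. indicator {a..b} x *\<^sub>R cmod2 (w x - wt M x)"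
  have "(\<lambda>M. LINT x|lborel. ?d M x) \<longlonglongrightarrow> (LINT x::real|lborel. 0)"
  proof (rule integral_dominated_convergence)
    show "integrable lborel (\<lambda>x. indicator {a..b} x *\<^sub>R cmod2 (w x))"
      using L2_loc_sq_integrable[OF w, of a b] by (simp add: set_integrable_def)
    show "AE x in lborel. (\<lambda>M. ?d M x) \<longlonglongrightarrow> 0"
    proof (rule AE_I2)
      fix x
      obtain N where N: "cmod (w x) \<le> real N" using real_arch_simple by blast
      have "eventually (\<lambda>M. ?d M x = 0) sequentially"
        using eventually_ge_at_top[of N] by eventually_elim (use N in \<open>auto simp: wt_def\<close>)
      thus "(\<lambda>M. ?d M x) \<longlonglongrightarrow> 0" by (rule tendsto_eventually)
    qed
    show "AE x in lborel. norm (?d M x) \<le> indicator {a..b} x *\<^sub>R cmod2 (w x)" for M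
      by (rule AE_I2) (auto simp: wt_def indicator_def)
  qed measurable
  hence "eventually (\<lambda>M. (LINT x|lborel. ?d M x) < e / 4) sequentially"
    using e by (intro order_tendstoD(2)) auto
  then obtain M where M: "(LINT x:{a..b}|lborel. cmod2 (w x - wt M x)) < e / 4"
    unfolding set_lebesgue_integral_def eventually_sequentially by blast
  have wt_b: "cmod (wt M x) \<le> real M" for x by (simp add: wt_def)
  have wt2: "L2_loc (wt M)"
  proof (rule L2_loc_I)
    show "intg c d (\<lambda>x. cmod2 (wt M x))" for c d
      by (rule set_integrable_dominated[OF L2_loc_sq_integrable[OF w]]) (auto simp: wt_def)
  qed measurable
  have "wt M measurable_on UNIV"
    by (rule lebesgue_measurable_imp_measurable_on) (auto intro: measurable_completion)
  then obtain N g where N: "negligible N" and gc: "\<And>n. continuous_on UNIV (g n)"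
    and gl: "\<And>x. x \<notin> N \<Longrightarrow> (\<lambda>n. g n x) \<longlonglongrightarrow> wt M x"
    unfolding measurable_on_def by auto
  \<comment> \<open>Projecting onto the ball of radius \<open>M\<close> keeps continuity and bounds
    the approximants uniformly, which provides the dominating function.\<close>
  define G where "G = (\<lambda>n x. closest_point (cball 0 (real M)) (g n x))"
  have cp: "continuous_on UNIV (closest_point (cball (0::complex) (real M)))"
    by (rule continuous_on_closest_point) auto
  have Gc: "continuous_on UNIV (G n)" for n
    unfolding G_def by (rule continuous_on_compose2[OF cp gc]) simp
  have Gm [measurable]: "G n \<in> borel_measurable borel" for n by (rule borel_measurable_continuous_onI[OF Gc])
  have Gb: "cmod (G n x) \<le> real M" for n x
    using closest_point_in_set[of "cball 0 (real M)" "g n x"] by (simp add: G_def)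
  have Gl: "(\<lambda>n. G n x) \<longlonglongrightarrow> wt M x" if "x \<notin> N" for x
  proof -
    have "(\<lambda>n. G n x) \<longlonglongrightarrow> closest_point (cball 0 (real M)) (wt M x)"
      unfolding G_def using cp by (intro isCont_tendsto_compose[OF _ gl[OF that]]) (simp add: continuous_on_eq_continuous_at)
    thus ?thesis using wt_b[of x] by (simp add: closest_point_self)
  qed
  let ?g = "\<lambda>n x. indicator {a..b} x *\<^sub>R cmod2 (wt M x - G n x)"
  have "(\<lambda>n. LINT x|lborel. ?g n x) \<longlonglongrightarrow> (LINT x::real|lborel. 0)"
  proof (rule integral_dominated_convergence)
    have "intg a b (\<lambda>_. (2 * real M)\<^sup>2)" by (intro set_integrable_continuous continuous_intros)
    thus "integrable lborel (\<lambda>x. indicator {a..b} x *\<^sub>R (2 * real M)\<^sup>2)"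
      by (simp add: set_integrable_def)
    have "AE x in lebesgue. x \<notin> N" using N by (simp add: negligible_iff_null_sets AE_not_in)
    hence "AE x in lborel. x \<notin> N" by (simp add: AE_completion_iff)
    thus "AE x in lborel. (\<lambda>n. ?g n x) \<longlonglongrightarrow> 0"
    proof eventually_elim
      case (elim x)
      have "(\<lambda>n. ?g n x) \<longlonglongrightarrow> indicator {a..b} x *\<^sub>R cmod2 (wt M x - wt M x)"
        by (intro tendsto_intros Gl elim)
      thus ?case by simp
    qed
    show "AE x in lborel. norm (?g n x) \<le> indicator {a..b} x *\<^sub>R (2 * real M)\<^sup>2" for n
    proof (rule AE_I2)
      fix x
      have "cmod (wt M x - G n x) \<le> 2 * real M"
        using norm_triangle_ineq4[of "wt M x" "G n x"] wt_b[of x] Gb[of n x] by linarith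
      hence "cmod2 (wt M x - G n x) \<le> (2 * real M)\<^sup>2" by (rule power_mono) simp
      thus "norm (?g n x) \<le> indicator {a..b} x *\<^sub>R (2 * real M)\<^sup>2"
        by (simp add: indicator_def)
    qed
  qed measurable
  hence "eventually (\<lambda>n. (LINT x|lborel. ?g n x) < e / 4) sequentially"
    using e by (intro order_tendstoD(2)) auto
  then obtain n where n: "(LINT x:{a..b}|lborel. cmod2 (wt M x - G n x)) < e / 4"
    unfolding set_lebesgue_integral_def eventually_sequentially by blast
  have L: "L2_loc (G n)" by (rule L2_loc_continuous[OF Gc])
  have "(LINT x:{a..b}|lborel. cmod2 (w x - G n x))
    \<le> (LINT x:{a..b}|lborel. 2 * cmod2 (w x - wt M x) + 2 * cmod2 (wt M x - G n x))"
  proof (rule set_integral_mono)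
    fix x
    have "cmod2 (w x - G n x) \<le> (cmod (w x - wt M x) + cmod (wt M x - G n x))\<^sup>2"
      using norm_triangle_ineq[of "w x - wt M x" "wt M x - G n x"] by (intro power_mono) auto
    also have "\<dots> \<le> 2 * cmod2 (w x - wt M x) + 2 * cmod2 (wt M x - G n x)"
      using sum_squares_bound[of "cmod (w x - wt M x)" "cmod (wt M x - G n x)"] by (simp add: power2_sum)
    finally show "cmod2 (w x - G n x) \<le> 2 * cmod2 (w x - wt M x) + 2 * cmod2 (wt M x - G n x)" .
  qed (intro L2_loc_sq_integrable L2_loc_diff set_integral_add(1) set_integrable_mult_right L w wt2)+
  also have "\<dots> = 2 * (LINT x:{a..b}|lborel. cmod2 (w x - wt M x)) + 2 * (LINT x:{a..b}|lborel. cmod2 (wt M x - G n x))"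
    by (subst set_integral_add(2)) (auto intro!: L2_loc_sq_integrable L2_loc_diff set_integrable_mult_right L w wt2)
  also have "\<dots> < e" using M n by linarith
  finally show ?thesis using Gc by blast
qed

text \<open>\<open>AC_Holder\<close> on \<open>[z, z + h]\<close> bounds the squared increment by
  \<open>h\<close> times an increment of the primitive \<open>S\<close> of \<open>cmod2 v\<close>;
  integrating over \<open>z\<close> telescopes and yields a second factor \<open>h\<close>.\<close>

lemma diff_quotient_bound:
  assumes u: "AC u v" and h: "h > 0"
  shows "iper (\<lambda>z. cmod2 ((u (z + h) - u z) / of_real h)) \<le> (LINT x:{0..2*pi+h}|lborel. cmod2 (v x))"
proof -
  define S where "S = (\<lambda>z. LINT x:{0..z}|lborel. cmod2 (v x))"
  note sqi = L2_loc_sq_integrable[OF AC_L2[OF u]]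
  have Sm: "S x \<le> S y" if "x \<le> y" for x y
    unfolding S_def by (rule set_integral_mono_set[OF sqi]) (use that in auto)
  have S0: "0 \<le> S x" for x unfolding S_def by (rule set_integral_nonneg) simp
  have S_meas [measurable]: "S \<in> borel_measurable borel" by (rule borel_measurable_mono) (simp add: mono_def Sm)
  have Si: "intg a b S" for a b
  proof (rule set_integrable_dominated)
    show "intg a b (\<lambda>_. S b)" by (intro set_integrable_continuous continuous_intros)
    show "norm (S x) \<le> S b" if "x \<in> {a..b}" for x using S0[of x] Sm[of x b] that by simp
  qed (rule S_meas)
  have Sd: "S b - S a = (LINT x:{a..b}|lborel. cmod2 (v x))" if "0 \<le> a" "a \<le> b" for a b
    using set_integral_split[OF that sqi] by (simp add: S_def)
  have uc: "L2_loc (\<lambda>z. u (z + h) - u z)"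
    by (intro L2_loc_continuous continuous_on_diff AC_continuous[OF u]
          continuous_on_compose2[OF AC_continuous[OF u]] continuous_intros subset_UNIV)
  have Sh: "intg a b (\<lambda>z. S (z + h))" for a b
    using set_integrable_affine[of 1 h a b S] Si by (simp add: add.commute)
  have "iper (\<lambda>z. cmod2 (u (z + h) - u z)) \<le> iper (\<lambda>z. h * (S (z + h) - S z))"
  proof (rule set_integral_mono)
    fix z :: real assume "z \<in> {0..2*pi}"
    thus "cmod2 (u (z + h) - u z) \<le> h * (S (z + h) - S z)"
      using AC_Holder[OF u, of z "z + h"] Sd[of z "z + h"] h by simp
  qed (intro L2_loc_sq_integrable uc set_integrable_mult_right set_integral_diff(1) Si Sh)+
  also have "\<dots> = h * (iper (\<lambda>z. S (z + h)) - iper S)"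
    by (simp add: set_integral_diff(2)[OF Sh Si])
  also have "iper (\<lambda>z. S (z + h)) = (LINT x:{h..2*pi+h}|lborel. S x)"
    using set_integral_affine[of 1 0 "2*pi" S h] by (simp add: add.commute)
  \<comment> \<open>After cancellation only strips of length \<open>h\<close> at the two ends
    remain, and \<open>S\<close> is nonnegative and monotone.\<close>
  also have "(LINT x:{h..2*pi+h}|lborel. S x) - iper S \<le> h * S (2 * pi + h)"
  proof -
    have "(LINT x:{0..2*pi+h}|lborel. S x) = (LINT x:{0..h}|lborel. S x) + (LINT x:{h..2*pi+h}|lborel. S x)"
      by (rule set_integral_split[OF _ _ Si]) (use h in auto)
    moreover have "(LINT x:{0..2*pi+h}|lborel. S x) = iper S + (LINT x:{2*pi..2*pi+h}|lborel. S x)"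
      by (rule set_integral_split[OF _ _ Si]) (use h in auto)
    moreover have "0 \<le> (LINT x:{0..h}|lborel. S x)" by (rule set_integral_nonneg) (rule S0)
    moreover have "(LINT x:{2*pi..2*pi+h}|lborel. S x) \<le> (LINT x:{2*pi..2*pi+h}|lborel. S (2 * pi + h))"
    proof (rule set_integral_mono)
      show "set_integrable lborel {2*pi..2*pi+h} (\<lambda>_. S (2 * pi + h))"
        by (intro set_integrable_continuous continuous_intros)
    qed (use Sm in \<open>auto intro: Si\<close>)
    moreover have "(LINT x:{2*pi..2*pi+h}|lborel. S (2 * pi + h)) = h * S (2 * pi + h)"
      using h by (simp add: set_lebesgue_integral_def)
    ultimately show ?thesis by linarith
  qed
  finally have "iper (\<lambda>z. cmod2 (u (z + h) - u z)) \<le> h * (h * S (2 * pi + h))"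
    using h by (simp add: mult_left_mono)
  hence "iper (\<lambda>z. cmod2 (u (z + h) - u z)) / h\<^sup>2 \<le> S (2 * pi + h)"
    using h by (simp add: field_simps power2_eq_square)
  moreover have "cmod2 ((u (z + h) - u z) / of_real h) = cmod2 (u (z + h) - u z) / h\<^sup>2" for z
    using h by (simp add: norm_divide power_divide)
  ultimately show ?thesis by (simp add: S_def)
qed

text \<open>Density argument: for a continuous derivative \<open>g\<close> the quotients converge
  uniformly, and \<open>diff_quotient_bound\<close> controls the quotients of the remainder by the
  mean square distance from \<open>w\<close> to \<open>g\<close>.\<close>

lemma diff_quotient_tendsto:
  assumes u: "AC u w"
  shows "(\<lambda>n. L2n (\<lambda>z. (u (z + 1 / Suc n) - u z) / of_real (1 / Suc n) - w z)) \<longlonglongrightarrow> 0"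
proof (rule LIMSEQ_I)
  fix r :: real assume r: "0 < r"
  \<comment> \<open>Three errors of size \<open>e\<close> will be added.\<close>
  define e where "e = r / 4"
  have e: "e > 0" using r by (simp add: e_def)
  obtain g where gc: "continuous_on UNIV g" and g: "(LINT x:{0..2*pi+1}|lborel. cmod2 (w x - g x)) < e\<^sup>2"
    using L2_loc_density[OF AC_L2[OF u], of "e\<^sup>2" 0 "2*pi+1"] e by auto
  have Lg: "L2_loc g" by (rule L2_loc_continuous[OF gc])
  define G where "G = (\<lambda>x. if 0 \<le> x then (LINT y:{0..x}|lborel. g y) else - (LINT y:{x..0}|lborel. g y))"
  have G: "AC G g"
    unfolding AC_def
  proof (intro conjI allI impI)
    fix a b :: real assume ab: "a \<le> b"
    note sp = set_integral_split[where f = g, OF _ _ L2_loc_integrable[OF Lg]]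
    have z: "(LINT y:{0..0}|lborel. g y) = 0" using sp[of 0 0 0] by simp
    consider "0 \<le> a" | "b \<le> 0" "a < 0" | "a < 0" "0 < b" by linarith
    thus "G b - G a = (LINT x:{a..b}|lborel. g x)"
    proof cases
      case 1 thus ?thesis using sp[OF 1 ab] ab by (simp add: G_def)
    next
      case 2
      thus ?thesis using sp[OF ab 2(1)] z by (cases "b = 0") (simp_all add: G_def)
    next
      case 3
      thus ?thesis using sp[of a 0 b] by (simp add: G_def)
    qed
  qed (rule Lg)
  have ugc: "AC (\<lambda>x. u x - G x) (\<lambda>x. w x - g x)" by (rule AC_diff[OF u G])
  have "uniformly_continuous_on {0..2*pi+1} g"
    by (rule compact_uniformly_continuous) (auto intro: continuous_on_subset[OF gc])
  \<comment> \<open>The tolerance \<open>e / 3\<close> is squared and integrated over a period, and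
    \<open>2 * pi <= 9\<close>.\<close>
  then obtain d where d: "d > 0" "\<And>x y. x \<in> {0..2*pi+1} \<Longrightarrow> y \<in> {0..2*pi+1} \<Longrightarrow> dist y x < d \<Longrightarrow> dist (g y) (g x) < e / 3"
    using e unfolding uniformly_continuous_on_def by (metis divide_pos_pos zero_less_numeral)
  obtain N where N: "1 / real (Suc N) < d" using d(1) nat_approx_posE by blast
  show "\<exists>no. \<forall>n\<ge>no. norm (L2n (\<lambda>z. (u (z + 1 / Suc n) - u z) / of_real (1 / Suc n) - w z) - 0) < r"
  proof (intro exI allI impI)
    fix n assume n: "n \<ge> N"
    define h :: real where "h = 1 / Suc n"
    have h: "0 < h" "h \<le> 1" "h < d"
    proof -
      have "1 / real (Suc n) \<le> 1 / real (Suc N)" using n by (simp add: frac_le)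
      thus "h < d" using N by (simp add: h_def)
    qed (auto simp: h_def)
    let ?D = "\<lambda>f z. (f (z + h) - f z) / of_real h :: complex"
    have Dc: "L2_loc (?D f)" if "AC f f'" for f f'
      by (intro L2_loc_continuous continuous_on_divide continuous_on_diff AC_continuous[OF that]
          continuous_on_compose2[OF AC_continuous[OF that]] continuous_intros subset_UNIV) (use h in auto)
    have 1: "L2n (?D (\<lambda>x. u x - G x)) \<le> e"
    proof -
      have "iper (\<lambda>z. cmod2 (?D (\<lambda>x. u x - G x) z)) \<le> (LINT x:{0..2*pi+h}|lborel. cmod2 (w x - g x))"
        by (rule diff_quotient_bound[OF ugc h(1)])
      also have "\<dots> \<le> (LINT x:{0..2*pi+1}|lborel. cmod2 (w x - g x))"
        by (rule set_integral_mono_set[OF L2_loc_sq_integrable[OF AC_L2[OF ugc]]]) (use h in auto)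
      finally show ?thesis unfolding L2n_def using g e by (intro real_le_lsqrt) auto
    qed
    have 2: "L2n (\<lambda>z. ?D G z - g z) \<le> e"
    proof -
      have pt: "cmod (?D G z - g z) \<le> e / 3" if z: "z \<in> {0..2*pi}" for z
      proof -
        have "G (z + h) - G z - of_real h * g z = (LINT x:{z..z+h}|lborel. g x) - (LINT x:{z..z+h}|lborel. g z)"
          using AC_diff_eq[OF G, of z "z+h"] h by (simp add: set_lebesgue_integral_def scaleR_conv_of_real)
        also have "\<dots> = (LINT x:{z..z+h}|lborel. g x - g z)"
          by (rule set_integral_diff(2)[symmetric]) (auto intro!: set_integrable_continuous gc continuous_intros)
        also have "cmod \<dots> \<le> (LINT x:{z..z+h}|lborel. cmod (g x - g z))"
          by (intro set_integral_norm_bound set_integrable_continuous gc continuous_intros)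
        also have "\<dots> \<le> (LINT x:{z..z+h}|lborel. e / 3)"
        proof (rule set_integral_mono)
          fix x assume "x \<in> {z..z+h}"
          thus "cmod (g x - g z) \<le> e / 3" using d(2)[of z x] z h by (auto simp: dist_norm less_imp_le)
        qed (intro set_integrable_continuous gc continuous_intros)+
        also have "\<dots> = h * (e / 3)" using h by (simp add: set_lebesgue_integral_def)
        finally have "cmod (G (z + h) - G z - of_real h * g z) \<le> h * (e / 3)" .
        moreover have "?D G z - g z = (G (z + h) - G z - of_real h * g z) / of_real h"
          using h by (simp add: field_simps)
        ultimately show ?thesis using h by (simp add: norm_divide field_simps)
      qed
      have "iper (\<lambda>z. cmod2 (?D G z - g z)) \<le> iper (\<lambda>z. (e / 3)\<^sup>2)"
      proof (rule set_integral_mono)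
        show "intg 0 (2*pi) (\<lambda>z. cmod2 (?D G z - g z))"
          by (intro L2_loc_sq_integrable L2_loc_diff Dc[OF G] Lg)
        show "intg 0 (2*pi) (\<lambda>z. (e / 3)\<^sup>2)"
          by (intro set_integrable_continuous continuous_intros)
      qed (use pt in \<open>auto intro!: power_mono\<close>)
      also have "\<dots> = 2 * pi * (e / 3)\<^sup>2" by (simp add: set_lebesgue_integral_def)
      also have "\<dots> \<le> 9 * (e / 3)\<^sup>2" using pi_less_4 by (intro mult_right_mono) auto
      also have "\<dots> = e\<^sup>2" by (simp add: power2_eq_square)
      finally show ?thesis unfolding L2n_def using e by (intro real_le_lsqrt) auto
    qed
    have 3: "L2n (\<lambda>z. - (w z - g z)) \<le> e"
    proof -
      have "iper (\<lambda>z. cmod2 (w z - g z)) \<le> (LINT x:{0..2*pi+1}|lborel. cmod2 (w x - g x))"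
        by (rule set_integral_mono_set[OF L2_loc_sq_integrable[OF AC_L2[OF ugc]]]) auto
      thus ?thesis unfolding L2n_uminus L2n_def using g e by (intro real_le_lsqrt) auto
    qed
    have eq: "(\<lambda>z. ?D u z - w z) = (\<lambda>z. (?D (\<lambda>x. u x - G x) z + (?D G z - g z)) + - (w z - g z))"
      by (auto simp: fun_eq_iff diff_divide_distrib)
    have "L2n (\<lambda>z. ?D u z - w z) \<le> (e + e) + e"
      unfolding eq
      by (rule order_trans[OF L2n_add add_mono[OF order_trans[OF L2n_add add_mono[OF 1 2]] 3]])
         (intro L2_loc_add L2_loc_minus L2_loc_diff Dc[OF ugc] Dc[OF G] Lg AC_L2[OF u])+
    also have "\<dots> < r" using r by (simp add: e_def)
    finally show "norm (L2n (\<lambda>z. (u (z + 1 / Suc n) - u z) / of_real (1 / Suc n) - w z) - 0) < r"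
      using L2n_nonneg by (simp add: h_def abs_of_nonneg)
  qed
qed

section \<open>Conservation laws for weak solutions\<close>

abbreviation fn2 :: "h1 \<Rightarrow> real \<Rightarrow> complex" where "fn2 u z \<equiv> of_real (cmod2 (fn u z))"
abbreviation cd :: "h1 \<Rightarrow> real \<Rightarrow> complex" where "cd u z \<equiv> cnj (fn u z) * dv u z"

lemma Re_of_real_mult: "Re (of_real r * z) = r * Re z"
  and Im_of_real_mult: "Im (of_real r * z) = r * Im z"
  by simp_all

lemma set_integral_add3:
  fixes f g h :: "real \<Rightarrow> 'a::euclidean_space"
  assumes "set_integrable lborel A f" "set_integrable lborel A g" "set_integrable lborel A h"
  shows "(LINT x:A|lborel. f x + g x + h x) = (LINT x:A|lborel. f x) + (LINT x:A|lborel. g x) + (LINT x:A|lborel. h x)"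
  using assms by (simp add: set_integral_add)

lemma norm_triangle3:
  fixes x y z :: "'a::real_normed_vector"
  shows "norm x \<le> a \<Longrightarrow> norm y \<le> b \<Longrightarrow> norm z \<le> c \<Longrightarrow> norm (x + y + z) \<le> a + b + c"
  using norm_triangle_ineq[of "x + y" z] norm_triangle_ineq[of x y] by linarith

lemma iper_deriv_zero:
  assumes "AC f f'" "f (2 * pi) = f 0" shows "iper f' = 0"
  using AC_diff_eq[OF assms(1), of 0 "2*pi"] assms(2) by simp

lemma bounded_linear_shift: "bounded_linear (shift t)"
proof (rule bounded_linear_intro[where K = 1])
  show "shift t (u + v) = shift t u + shift t v" for u v by (rule fn_eqI) (simp add: fn_simps)
  show "shift t (r *\<^sub>R u) = r *\<^sub>R shift t u" for r u by (rule fn_eqI) (simp add: fn_simps)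
qed (simp add: norm_shift)

lemma bounded_linear_hcnj: "bounded_linear hcnj"
proof (rule bounded_linear_intro[where K = 1])
  show "hcnj (u + v) = hcnj u + hcnj v" for u v by (rule fn_eqI) (simp add: fn_simps)
  show "hcnj (r *\<^sub>R u) = r *\<^sub>R hcnj u" for r u by (rule fn_eqI) (simp add: fn_simps)
qed (simp add: norm_hcnj)

lemma bounded_bilinear_hmul: "bounded_bilinear hmul"
proof
  show "hmul (u + v) w = hmul u w + hmul v w" for u v w by (rule fn_eqI) (simp add: fn_simps algebra_simps)
  show "hmul u (v + w) = hmul u v + hmul u w" for u v w by (rule fn_eqI) (simp add: fn_simps algebra_simps)
  show "hmul (r *\<^sub>R u) v = r *\<^sub>R hmul u v" for r u v by (rule fn_eqI) (simp add: fn_simps)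
  show "hmul u (r *\<^sub>R v) = r *\<^sub>R hmul u v" for r u v by (rule fn_eqI) (simp add: fn_simps)
  show "\<exists>K. \<forall>u v. norm (hmul u v) \<le> norm u * norm v * K"
    using norm_hmul by (intro exI[of _ 12]) (simp add: algebra_simps)
qed

section \<open>The right-hand side of the weak equation\<close>

definition pair_form :: "real \<Rightarrow> real \<Rightarrow> h1 \<Rightarrow> h1 \<Rightarrow> complex" where
  "pair_form k p u \<phi> = \<i> * iper (\<lambda>z. 4 * \<i> * of_real (p * k) * dv u z * fn \<phi> z
      - 4 * of_real (k\<^sup>2) * dv u z * dv \<phi> z + of_real (1 - p\<^sup>2) * fn u z * fn \<phi> z
      + fn2 u z * fn u z * fn \<phi> z)"

lemma L2_cubic: "L2_loc (\<lambda>z. fn2 u z * fn u z)"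
  by (intro L2_loc_continuous continuous_intros fn_continuous)

lemma pair_form_AC:
  assumes "AC (fn \<phi>) \<phi>'"
  shows "pair_form k p u \<phi> = \<i> * (4 * \<i> * of_real (p * k) * iper (\<lambda>z. dv u z * fn \<phi> z)
      - 4 * of_real (k\<^sup>2) * iper (\<lambda>z. dv u z * \<phi>' z) + of_real (1 - p\<^sup>2) * iper (\<lambda>z. fn u z * fn \<phi> z)
      + iper (\<lambda>z. fn2 u z * fn u z * fn \<phi> z))"
proof -
  have e: "iper (\<lambda>z. dv u z * dv \<phi> z) = iper (\<lambda>z. dv u z * \<phi>' z)"
  proof (rule set_integral_AE_cong')
    show "AE z in lborel. dv u z * dv \<phi> z = dv u z * \<phi>' z"
      using dv_AE[OF assms] by eventually_elim simp
  qed (intro L2_loc_mult_integrable L2_dv AC_L2[OF assms])+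
  have i1: "intg 0 (2*pi) (\<lambda>z. dv u z * fn \<phi> z)"
   and i2: "intg 0 (2*pi) (\<lambda>z. dv u z * dv \<phi> z)"
   and i3: "intg 0 (2*pi) (\<lambda>z. fn u z * fn \<phi> z)"
   and i4: "intg 0 (2*pi) (\<lambda>z. fn2 u z * fn u z * fn \<phi> z)"
    by (intro L2_loc_mult_integrable L2_dv L2_fn L2_cubic)+
  have "iper (\<lambda>z. 4 * \<i> * of_real (p * k) * (dv u z * fn \<phi> z)
      - 4 * of_real (k\<^sup>2) * (dv u z * dv \<phi> z) + of_real (1 - p\<^sup>2) * (fn u z * fn \<phi> z)
      + fn2 u z * fn u z * fn \<phi> z)
    = 4 * \<i> * of_real (p * k) * iper (\<lambda>z. dv u z * fn \<phi> z)
      - 4 * of_real (k\<^sup>2) * iper (\<lambda>z. dv u z * dv \<phi> z) + of_real (1 - p\<^sup>2) * iper (\<lambda>z. fn u z * fn \<phi> z)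
      + iper (\<lambda>z. fn2 u z * fn u z * fn \<phi> z)"
    using i1 i2 i3 i4
    by (simp only: set_integral_add(2) set_integral_diff(2) set_integral_add(1) set_integral_diff(1)
        set_integrable_mult_right set_integral_mult_right simp_thms)
  thus ?thesis unfolding e by (simp only: pair_form_def mult.assoc)
qed

definition pair_const :: "real \<Rightarrow> real \<Rightarrow> real \<Rightarrow> real" where
  "pair_const k p r = (4 * \<bar>p * k\<bar> + 4 * k\<^sup>2 + \<bar>1 - p\<^sup>2\<bar> + 16 * r\<^sup>2) * r"

lemma pair_const_mono: "0 \<le> r \<Longrightarrow> r \<le> s \<Longrightarrow> pair_const k p r \<le> pair_const k p s"
  unfolding pair_const_def by (intro mult_mono add_mono) (auto intro: power_mono)

lemma pair_form_bound: "cmod (pair_form k p u \<phi>) \<le> pair_const k p (norm u) * norm \<phi>"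
proof -
  let ?a = "iper (\<lambda>z. dv u z * fn \<phi> z)" and ?b = "iper (\<lambda>z. dv u z * dv \<phi> z)"
    and ?c = "iper (\<lambda>z. fn u z * fn \<phi> z)" and ?d = "iper (\<lambda>z. fn2 u z * fn u z * fn \<phi> z)"
  have a: "cmod ?a \<le> norm u * norm \<phi>"
    by (rule order_trans[OF iper_CS]) (intro L2_dv L2_fn mult_mono L2n_dv_le L2n_fn_le L2n_nonneg norm_ge_zero)+
  have b: "cmod ?b \<le> norm u * norm \<phi>"
    by (rule order_trans[OF iper_CS]) (intro L2_dv L2_fn mult_mono L2n_dv_le L2n_fn_le L2n_nonneg norm_ge_zero)+
  have c: "cmod ?c \<le> norm u * norm \<phi>"
    by (rule order_trans[OF iper_CS]) (intro L2_dv L2_fn mult_mono L2n_dv_le L2n_fn_le L2n_nonneg norm_ge_zero)+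
  have cub: "L2n (\<lambda>z. fn2 u z * fn u z) \<le> (16 * (norm u)\<^sup>2) * norm u"
  proof (rule order_trans[OF L2n_bounded_mult])
    show "cmod (fn2 u z) \<le> 16 * (norm u)\<^sup>2" for z
      using power_mono[OF fn_bound norm_ge_zero, of u z 2] by (simp add: power_mult_distrib norm_power)
    show "16 * (norm u)\<^sup>2 * L2n (fn u) \<le> 16 * (norm u)\<^sup>2 * norm u" by (intro mult_left_mono L2n_fn_le) simp
  qed (intro L2_fn continuous_intros fn_continuous)+
  have d: "cmod ?d \<le> (16 * (norm u)\<^sup>2) * norm u * norm \<phi>"
    by (rule order_trans[OF iper_CS[OF L2_cubic L2_fn]]) (intro mult_mono cub L2n_fn_le L2n_nonneg; simp)
  have "cmod (pair_form k p u \<phi>) = cmod (4 * \<i> * of_real (p * k) * ?a - 4 * of_real (k\<^sup>2) * ?b + of_real (1 - p\<^sup>2) * ?c + ?d)"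
    unfolding pair_form_AC[OF AC_fn] by (simp add: norm_mult)
  also have "\<dots> \<le> cmod (4 * \<i> * of_real (p * k) * ?a) + cmod (4 * of_real (k\<^sup>2) * ?b) + cmod (of_real (1 - p\<^sup>2) * ?c) + cmod ?d"
    by (intro order_trans[OF norm_triangle_ineq] add_mono order_trans[OF norm_triangle_ineq4] order_refl)
  also have "\<dots> = 4 * \<bar>p * k\<bar> * cmod ?a + 4 * k\<^sup>2 * cmod ?b + \<bar>1 - p\<^sup>2\<bar> * cmod ?c + cmod ?d"
    unfolding norm_mult norm_of_real by simp
  also have "\<dots> \<le> 4 * \<bar>p * k\<bar> * (norm u * norm \<phi>) + 4 * k\<^sup>2 * (norm u * norm \<phi>) + \<bar>1 - p\<^sup>2\<bar> * (norm u * norm \<phi>) + (16 * (norm u)\<^sup>2) * norm u * norm \<phi>"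
    by (intro add_mono mult_left_mono a b c d) auto
  also have "\<dots> = pair_const k p (norm u) * norm \<phi>" by (simp add: pair_const_def algebra_simps)
  finally show ?thesis .
qed

text \<open>Expanded in \<open>h\<close>, this correlation carries the mass, the momentum and the
  Dirichlet integral at orders 0, 1 and 2. Its time derivative makes sense for weak solutions, since
  the shifted function is an admissible test function.\<close>

definition corr :: "real \<Rightarrow> h1 \<Rightarrow> complex" where
  "corr h u = iper (\<lambda>z. cnj (fn u z) * fn u (z + h))"

definition flux :: "real \<Rightarrow> h1 \<Rightarrow> complex" where
  "flux h u = iper (\<lambda>z. of_real (cmod2 (fn u (z + h)) - cmod2 (fn u z)) * (cnj (fn u z) * fn u (z + h)))"

lemma iper_shift_mult:
  assumes f: "L2_loc f" "AE z in lborel. f (z + 2 * pi) = f z"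
    and g: "L2_loc g" "AE z in lborel. g (z + 2 * pi) = g z"
  shows "iper (\<lambda>z. f (z + t) * g (z + t)) = iper (\<lambda>z. f z * g z)"
proof (rule iper_shift[where f = "\<lambda>z. f z * g z"])
  show "AE x in lborel. f (x + 2 * pi) * g (x + 2 * pi) = f x * g x"
    using f(2) g(2) by eventually_elim simp
qed (intro L2_loc_mult_integrable f g)

text \<open>The left side is the formal time derivative of \<open>corr h\<close>. The linear terms
  of the equation commute with translations and cancel, the transport term after integration by
  parts; the cubic term leaves the difference of the densities at \<open>z + h\<close> and
  \<open>z\<close>.\<close>

lemma corr_flux:
  "cnj (pair_form k p u (hcnj (shift h u))) + pair_form k p u (hcnj (shift (- h) u)) = \<i> * flux h u"
proof -
  have c: "continuous_on UNIV (\<lambda>z. fn u (z + t))" for t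
    by (intro continuous_on_compose2[OF fn_continuous] continuous_intros) auto
  have L1: "L2_loc (\<lambda>z. fn u (z + t))" for t using L2_loc_affine[OF L2_fn, of 1 u t] by (simp add: add.commute)
  have L2: "L2_loc (\<lambda>z. dv u (z + t))" for t using L2_loc_affine[OF L2_dv, of 1 u t] by (simp add: add.commute)
  have AC1: "AC (fn (hcnj (shift t u))) (\<lambda>z. cnj (dv u (z + t)))" for t
    using AC_cnj[OF AC_fn_shift, of t u] by (simp add: fn_hcnj[abs_def] fn_shift)
  define A where "A = iper (\<lambda>z. cnj (dv u z) * fn u (z + h))"
  define B where "B = iper (\<lambda>z. cnj (dv u z) * dv u (z + h))"
  define C where "C = iper (\<lambda>z. cnj (fn u z) * fn u (z + h))"
  define D where "D = iper (\<lambda>z. fn2 u z * (cnj (fn u z) * fn u (z + h)))"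
  define A' where "A' = iper (\<lambda>z. cnj (fn u z) * dv u (z + h))"
  define D' where "D' = iper (\<lambda>z. of_real (cmod2 (fn u (z + h))) * (cnj (fn u z) * fn u (z + h)))"
  have 1: "cnj (pair_form k p u (hcnj (shift h u))) = - \<i> * (- 4 * \<i> * of_real (p * k) * A - 4 * of_real (k\<^sup>2) * B + of_real (1 - p\<^sup>2) * C + D)"
    unfolding pair_form_AC[OF AC1] A_def B_def C_def D_def fn_hcnj fn_shift
    by (simp flip: set_integral_cnj) (simp add: mult.assoc)
  have pu: "AE z in lborel. fn u (z + 2 * pi) = fn u z" by (simp add: fn_periodic)
  have sh: "\<And>f. (f :: real \<Rightarrow> complex) (z + h + (- h)) = f z" for z by simp
  have pm: "fn u (z + 2 * pi - h) = fn u (z - h)" for z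
    using fn_periodic[of u "z - h"] by (simp add: algebra_simps)
  have a: "iper (\<lambda>z. dv u z * cnj (fn u (z - h))) = A'"
    using iper_shift_mult[where f = "dv u" and g = "\<lambda>z. cnj (fn u (z - h))" and t = h] dv_periodic[of u]
      L2_loc_cnj[OF L1, of "- h"] L2_dv[of u] pm
    by (simp add: A'_def mult.commute)
  have b: "iper (\<lambda>z. dv u z * cnj (dv u (z - h))) = B"
  proof -
    have "AE z in lborel. dv u (z - h + 2 * pi) = dv u (z - h)"
    proof -
      have [measurable]: "dv u \<in> borel_measurable borel" by (rule L2_loc_measurable[OF L2_dv])
      have "Measurable.pred borel (\<lambda>z. dv u (z + 2 * pi) = dv u z)" by measurable
      from AE_borel_affine[of 1, OF _ this, of "- h"] show ?thesis using dv_periodic[of u] by simp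
    qed
    hence "AE z in lborel. cnj (dv u (z + 2 * pi - h)) = cnj (dv u (z - h))"
      by eventually_elim (simp add: algebra_simps)
    thus ?thesis
      using iper_shift_mult[where f = "dv u" and g = "\<lambda>z. cnj (dv u (z - h))" and t = h] dv_periodic[of u]
      L2_loc_cnj[OF L2, of "- h"] L2_dv[of u]
      by (simp add: B_def mult.commute)
  qed
  have c: "iper (\<lambda>z. fn u z * cnj (fn u (z - h))) = C"
    using iper_shift_mult[where f = "fn u" and g = "\<lambda>z. cnj (fn u (z - h))" and t = h]
      L2_loc_cnj[OF L1, of "- h"] L2_fn[of u] fn_periodic[of u] pm
    by (simp add: C_def mult.commute)
  have d: "iper (\<lambda>z. fn2 u z * fn u z * cnj (fn u (z - h))) = D'"
    using iper_shift_mult[where f = "\<lambda>z. fn2 u z * fn u z" and g = "\<lambda>z. cnj (fn u (z - h))" and t = h]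
      L2_loc_cnj[OF L1, of "- h"] L2_cubic[of u] fn_periodic[of u] pm
    by (simp add: D'_def mult_ac)
  have 2: "pair_form k p u (hcnj (shift (- h) u)) = \<i> * (4 * \<i> * of_real (p * k) * A' - 4 * of_real (k\<^sup>2) * B + of_real (1 - p\<^sup>2) * C + D')"
    unfolding pair_form_AC[OF AC1] fn_hcnj fn_shift using a b c d by simp
  have "A + A' = iper (\<lambda>z. cnj (dv u z) * fn u (z + h) + cnj (fn u z) * dv u (z + h))"
    unfolding A_def A'_def
    by (rule set_integral_add(2)[symmetric]) (intro L2_loc_mult_integrable L2_loc_cnj L2_dv L2_fn L1 L2)+
  also have "\<dots> = 0"
  proof (rule iper_deriv_zero)
    show "AC (\<lambda>z. cnj (fn u z) * fn u (z + h)) (\<lambda>z. cnj (dv u z) * fn u (z + h) + cnj (fn u z) * dv u (z + h))"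
      using AC_mult[OF AC_cnj[OF AC_fn[of u]] AC_fn_shift[of h u]] by (simp add: fn_shift)
    show "cnj (fn u (2 * pi)) * fn u (2 * pi + h) = cnj (fn u 0) * fn u (0 + h)"
      using fn_periodic[of u 0] fn_periodic[of u h] by (simp add: add.commute)
  qed
  finally have AA: "A' = - A" by (simp add: eq_neg_iff_add_eq_0 add.commute)
  have "D' - D = flux h u"
    unfolding D_def D'_def flux_def of_real_diff left_diff_distrib
    by (rule set_integral_diff(2)[symmetric])
       (intro set_integrable_continuous continuous_intros fn_continuous continuous_on_compose2[OF fn_continuous[of UNIV]] subset_UNIV)+
  thus ?thesis unfolding 1 2 AA by (simp add: algebra_simps)
qed

lemma has_vector_derivative_iff_tendsto:
  "(f has_vector_derivative D) (at t) \<longleftrightarrow> ((\<lambda>\<tau>. (f \<tau> - f t) /\<^sub>R (\<tau> - t)) \<longlongrightarrow> D) (at t)"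
proof -
  have eq: "norm ((f \<tau> - f t) /\<^sub>R (\<tau> - t) - D) = norm (f \<tau> - f t - (\<tau> - t) *\<^sub>R D) / norm (\<tau> - t)" if "\<tau> \<noteq> t" for \<tau>
  proof -
    have "(f \<tau> - f t) /\<^sub>R (\<tau> - t) - D = (f \<tau> - f t - (\<tau> - t) *\<^sub>R D) /\<^sub>R (\<tau> - t)"
      using that by (simp add: scaleR_diff_right)
    thus ?thesis by (simp add: divide_inverse mult.commute)
  qed
  have "((\<lambda>\<tau>. (f \<tau> - f t) /\<^sub>R (\<tau> - t)) \<longlongrightarrow> D) (at t)
    \<longleftrightarrow> ((\<lambda>\<tau>. norm ((f \<tau> - f t) /\<^sub>R (\<tau> - t) - D)) \<longlongrightarrow> 0) (at t)"
    by (subst tendsto_norm_zero_iff) (rule LIM_zero_iff[symmetric])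
  also have "\<dots> \<longleftrightarrow> ((\<lambda>\<tau>. norm (f \<tau> - f t - (\<tau> - t) *\<^sub>R D) / norm (\<tau> - t)) \<longlongrightarrow> 0) (at t)"
    by (rule filterlim_cong) (auto simp: eventually_at_filter eq)
  also have "\<dots> \<longleftrightarrow> (f has_vector_derivative D) (at t)"
    unfolding has_vector_derivative_def has_derivative_iff_norm by (simp add: bounded_linear_scaleR_left)
  finally show ?thesis ..
qed

text \<open>Meant for laws that hold approximately at step size \<open>1 / (n + 1)\<close>:
  dominated convergence in time passes to the limit in the fundamental theorem of calculus.\<close>

lemma limit_conserved:
  fixes e :: "nat \<Rightarrow> real \<Rightarrow> real"
  assumes d: "\<And>n t. (e n has_vector_derivative e' n t) (at t)"
    and b: "\<And>a b. \<exists>C. \<forall>n. \<forall>t\<in>{a..b}. \<bar>e' n t\<bar> \<le> C"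
    and z: "\<And>t. (\<lambda>n. e' n t) \<longlonglongrightarrow> 0"
    and l: "\<And>t. (\<lambda>n. e n t) \<longlonglongrightarrow> L t"
  shows "L s = L t"
proof -
  have main: "L b = L a" if "a \<le> b" for a b
  proof -
    obtain C where C: "\<And>n t. t \<in> {a..b} \<Longrightarrow> \<bar>e' n t\<bar> \<le> C" using b[of a b] by blast
    have I: "(e' n has_integral e n b - e n a) {a..b}" for n
      using that d by (intro fundamental_theorem_of_calculus) (auto intro: has_vector_derivative_at_within)
    have "(\<lambda>n. integral {a..b} (e' n)) \<longlonglongrightarrow> integral {a..b} (\<lambda>_. 0)"
      by (rule dominated_convergence(2)[where h = "\<lambda>_. C"]) (use I C z in auto)
    moreover have "integral {a..b} (e' n) = e n b - e n a" for n using I by blast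
    ultimately have "(\<lambda>n. e n b - e n a) \<longlonglongrightarrow> 0" by simp
    moreover have "(\<lambda>n. e n b - e n a) \<longlonglongrightarrow> L b - L a" by (intro tendsto_diff l)
    ultimately have "L b - L a = 0" using LIMSEQ_unique by blast
    thus ?thesis by simp
  qed
  thus ?thesis by (cases "s \<le> t") (use main[of s t] main[of t s] in auto)
qed

definition dq :: "nat \<Rightarrow> h1 \<Rightarrow> real \<Rightarrow> complex" where
  "dq n u z = (fn u (z + 1 / Suc n) - fn u z) / of_real (1 / Suc n)"

lemma L2_dq: "L2_loc (dq n u)"
  unfolding dq_def
  by (intro L2_loc_continuous continuous_on_divide continuous_on_diff fn_continuous
      continuous_on_compose2[OF fn_continuous] continuous_intros subset_UNIV) (auto simp del: of_nat_Suc)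

lemma dq_tendsto: "(\<lambda>n. L2n (\<lambda>z. dq n u z - dv u z)) \<longlonglongrightarrow> 0"
  using diff_quotient_tendsto[OF AC_fn[of u]] by (simp add: dq_def)

lemma dq_shift: "fn u (z + 1 / Suc n) = fn u z + of_real (1 / Suc n) * dq n u z"
  by (simp add: dq_def del: of_nat_Suc)

lemma L2n_dq_le: "L2n (dq n u) \<le> 2 * norm u"
proof -
  note sqi = L2_loc_sq_integrable[OF L2_dv[of u]]
  have "iper (\<lambda>z. cmod2 (dq n u z)) \<le> (LINT x:{0..2*pi + 1 / Suc n}|lborel. cmod2 (dv u x))"
    unfolding dq_def by (rule diff_quotient_bound[OF AC_fn]) simp
  \<comment> \<open>Enlarging the interval to two full periods gives a bound in terms of the
    norm.\<close>
  also have "\<dots> \<le> (LINT x:{0..2*pi + 2*pi}|lborel. cmod2 (dv u x))"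
  proof (rule set_integral_mono_set[OF sqi])
    have "1 / real (Suc n) \<le> 1" by simp
    hence "2 * pi + 1 / Suc n \<le> 2 * pi + 2 * pi" using pi_gt3 by linarith
    thus "{0..2*pi + 1 / Suc n} \<subseteq> {0..2*pi + 2*pi}" by (simp only: atLeastatMost_subset_iff) simp
  qed auto
  also have "\<dots> = iper (\<lambda>z. cmod2 (dv u z)) + (LINT x:{2*pi..2*pi + 2*pi}|lborel. cmod2 (dv u x))"
    by (rule set_integral_split[OF _ _ sqi]) auto
  also have "(LINT x:{2*pi..2*pi + 2*pi}|lborel. cmod2 (dv u x)) = iper (\<lambda>z. cmod2 (dv u (z + 2 * pi)))"
    using set_integral_affine[of 1 0 "2*pi" "\<lambda>x. cmod2 (dv u x)" "2*pi"] by (simp add: add.commute)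
  also have "\<dots> = iper (\<lambda>z. cmod2 (dv u z))"
  proof (rule iper_shift[OF sqi])
    show "AE x in lborel. cmod2 (dv u (x + 2 * pi)) = cmod2 (dv u x)"
      using dv_periodic[of u] by eventually_elim simp
  qed
  finally have "iper (\<lambda>z. cmod2 (dq n u z)) \<le> 2 * iper (\<lambda>z. cmod2 (dv u z))" by simp
  also have "\<dots> \<le> (2 * norm u)\<^sup>2"
    using norm_h1_sq[of u] iper_sq_nonneg[of "fn u"] iper_sq_nonneg[of "dv u"] by (simp add: power_mult_distrib)
  finally show ?thesis unfolding L2n_def by (intro real_le_lsqrt) auto
qed

lemma shift_sup_tendsto: "(\<lambda>n. SUP z. cmod (fn u (z + 1 / Suc n) - fn u z)) \<longlonglongrightarrow> 0"
  and shift_bdd: "bdd_above (range (\<lambda>z. cmod (fn u (z + 1 / Suc n) - fn u z)))"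
proof -
  define K where "K = (LINT x:{0..2*pi+1}|lborel. cmod2 (dv u x))"
  have K0: "0 \<le> K" unfolding K_def by (rule set_integral_nonneg) simp
  have b: "cmod (fn u (z + h) - fn u z) \<le> sqrt (h * K)" if h: "0 < h" "h \<le> 1" for z h
  proof -
    have per: "fn u (z + 2 * pi + h) - fn u (z + 2 * pi) = fn u (z + h) - fn u z" for z
      using fn_periodic[of u z] fn_periodic[of u "z + h"] by (simp add: add_ac)
    obtain y where y: "y \<in> {0..2*pi}" "fn u (z + h) - fn u z = fn u (y + h) - fn u y"
      using periodic_reduce[of "\<lambda>z. fn u (z + h) - fn u z" z] per by blast
    have "(LINT x:{y..y+h}|lborel. cmod2 (dv u x)) \<le> K"
      unfolding K_def by (rule set_integral_mono_set[OF L2_loc_sq_integrable[OF L2_dv]]) (use y h in auto)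
    hence "cmod2 (fn u (y + h) - fn u y) \<le> h * K"
    proof -
      have "cmod2 (fn u (y + h) - fn u y) \<le> (y + h - y) * (LINT x:{y..y+h}|lborel. cmod2 (dv u x))"
        by (rule AC_Holder[OF AC_fn]) (use h in simp)
      also have "\<dots> \<le> h * K"
        using h \<open>(LINT x:{y..y+h}|lborel. cmod2 (dv u x)) \<le> K\<close> by (simp add: mult_left_mono)
      finally show ?thesis .
    qed
    thus ?thesis unfolding y(2) by (rule real_le_rsqrt)
  qed
  have b': "cmod (fn u (z + 1 / Suc n) - fn u z) \<le> sqrt (1 / Suc n * K)" for z n
    by (rule b) auto
  show "bdd_above (range (\<lambda>z. cmod (fn u (z + 1 / Suc n) - fn u z)))"
    by (rule bdd_aboveI2) (rule b')
  hence bdd: "bdd_above (range (\<lambda>z. cmod (fn u (z + 1 / Suc n) - fn u z)))" for n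
    using b' by (intro bdd_aboveI2) auto
  show "(\<lambda>n. SUP z. cmod (fn u (z + 1 / Suc n) - fn u z)) \<longlonglongrightarrow> 0"
  proof (rule tendsto_sandwich[OF _ _ tendsto_const])
    show "\<forall>\<^sub>F n in sequentially. 0 \<le> (SUP z. cmod (fn u (z + 1 / Suc n) - fn u z))"
      by (intro always_eventually allI cSUP_upper2[OF bdd, of 0]) auto
    show "\<forall>\<^sub>F n in sequentially. (SUP z. cmod (fn u (z + 1 / Suc n) - fn u z)) \<le> sqrt (1 / Suc n * K)"
      by (intro always_eventually allI cSUP_least b') auto
    have "(\<lambda>n. sqrt (1 / Suc n * K)) \<longlonglongrightarrow> sqrt (0 * K)"
      by (intro tendsto_intros LIMSEQ_Suc[OF lim_1_over_n])
    thus "(\<lambda>n. sqrt (1 / Suc n * K)) \<longlonglongrightarrow> 0" by simp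
  qed
qed

lemma L2n_mult_tendsto:
  assumes a: "\<And>n. L2_loc (a n)" "L2_loc a0" "(\<lambda>n. L2n (\<lambda>z. a n z - a0 z)) \<longlonglongrightarrow> 0"
    and b: "\<And>n. L2_loc (b n)" "L2_loc b0" "(\<lambda>n. L2n (\<lambda>z. b n z - b0 z)) \<longlonglongrightarrow> 0"
  shows "(\<lambda>n. iper (\<lambda>z. a n z * b n z)) \<longlonglongrightarrow> iper (\<lambda>z. a0 z * b0 z)"
proof -
  let ?B = "\<lambda>n. L2n (\<lambda>z. a n z - a0 z) * L2n (\<lambda>z. b n z - b0 z) + L2n a0 * L2n (\<lambda>z. b n z - b0 z) + L2n (\<lambda>z. a n z - a0 z) * L2n b0"
  have "(\<lambda>n. iper (\<lambda>z. a n z * b n z) - iper (\<lambda>z. a0 z * b0 z)) \<longlonglongrightarrow> 0"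
  proof (rule Lim_null_comparison)
    have "cmod (iper (\<lambda>z. a n z * b n z) - iper (\<lambda>z. a0 z * b0 z)) \<le> ?B n" for n
    proof -
      have La: "L2_loc (\<lambda>z. a n z - a0 z)" and Lb: "L2_loc (\<lambda>z. b n z - b0 z)"
        by (intro L2_loc_diff a(1,2) b(1,2))+
      have "iper (\<lambda>z. a n z * b n z) - iper (\<lambda>z. a0 z * b0 z) = iper (\<lambda>z. a n z * b n z - a0 z * b0 z)"
        by (rule set_integral_diff(2)[symmetric]) (intro L2_loc_mult_integrable a(1,2) b(1,2))+
      also have "\<dots> = iper (\<lambda>z. ((a n z - a0 z) * (b n z - b0 z) + a0 z * (b n z - b0 z)) + (a n z - a0 z) * b0 z)"
        by (rule set_integral_pw_cong) (auto simp: algebra_simps)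
      also have "\<dots> = iper (\<lambda>z. (a n z - a0 z) * (b n z - b0 z)) + iper (\<lambda>z. a0 z * (b n z - b0 z)) + iper (\<lambda>z. (a n z - a0 z) * b0 z)"
        by (rule set_integral_add3[OF L2_loc_mult_integrable[OF La Lb] L2_loc_mult_integrable[OF a(2) Lb] L2_loc_mult_integrable[OF La b(2)]])
      finally have E: "iper (\<lambda>z. a n z * b n z) - iper (\<lambda>z. a0 z * b0 z) = \<dots>" .
      show ?thesis
        unfolding E
        by (rule norm_triangle3[OF iper_CS[OF La Lb] iper_CS[OF a(2) Lb] iper_CS[OF La b(2)]])
    qed
    thus "\<forall>\<^sub>F n in sequentially. cmod (iper (\<lambda>z. a n z * b n z) - iper (\<lambda>z. a0 z * b0 z)) \<le> ?B n"
      by (intro always_eventually allI)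
    have "?B \<longlonglongrightarrow> 0 * 0 + L2n a0 * 0 + 0 * L2n b0"
      by (intro tendsto_add tendsto_mult tendsto_const a(3) b(3))
    thus "?B \<longlonglongrightarrow> 0" by simp
  qed
  thus ?thesis by (simp add: LIM_zero_iff)
qed

section \<open>Conserved quantities of weak solutions\<close>

locale weak_flow =
  fixes k p :: real and Q :: "real \<Rightarrow> h1"
  assumes cont: "isCont Q t"
    and weak: "((\<lambda>\<tau>. iper (\<lambda>z. fn (Q \<tau>) z * fn \<phi> z)) has_vector_derivative pair_form k p (Q t) \<phi>) (at t)"
begin

text \<open>The weak equation makes \<open>Q\<close> locally Lipschitz into the dual of X. The point
  is that one constant serves all test functions, so they may vary with time.\<close>

lemma pairing_lipschitz:
  "\<exists>d>0. \<exists>C\<ge>0. \<forall>\<tau>. \<bar>\<tau> - t\<bar> < d \<longrightarrow> (\<forall>\<phi>. cmod (iper (\<lambda>z. (fn (Q \<tau>) z - fn (Q t) z) * fn \<phi> z)) \<le> C * \<bar>\<tau> - t\<bar> * norm \<phi>)"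
proof -
  define R where "R = norm (Q t) + 1"
  have "eventually (\<lambda>\<tau>. norm (Q \<tau>) < R) (nhds t)"
    using cont[of t] unfolding isCont_def tendsto_at_iff_tendsto_nhds
    by (intro order_tendstoD(2)[OF tendsto_norm]) (auto simp: R_def)
  then obtain d where d: "d > 0" "\<And>\<tau>. dist \<tau> t < d \<Longrightarrow> norm (Q \<tau>) < R"
    unfolding eventually_nhds_metric by blast
  have R0: "0 \<le> R" by (simp add: R_def)
  have C0: "0 \<le> pair_const k p R" using R0 unfolding pair_const_def by simp
  have main: "cmod (iper (\<lambda>z. (fn (Q \<tau>) z - fn (Q t) z) * fn \<phi> z)) \<le> pair_const k p R * \<bar>\<tau> - t\<bar> * norm \<phi>"
    if "\<bar>\<tau> - t\<bar> < d" for \<tau> \<phi>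
  proof -
    let ?f = "\<lambda>\<tau>. iper (\<lambda>z. fn (Q \<tau>) z * fn \<phi> z)"
    have "norm (?f \<tau> - ?f t) \<le> (pair_const k p R * norm \<phi>) * norm (\<tau> - t)"
    proof (rule differentiable_bound[where S = "ball t d" and f' = "\<lambda>x h. h *\<^sub>R pair_form k p (Q x) \<phi>"])
      fix x assume x: "x \<in> ball t d"
      show "(?f has_derivative (\<lambda>h. h *\<^sub>R pair_form k p (Q x) \<phi>)) (at x within ball t d)"
        using weak[of \<phi> x] by (simp add: has_vector_derivative_def has_derivative_at_withinI)
      show "onorm (\<lambda>h. h *\<^sub>R pair_form k p (Q x) \<phi>) \<le> pair_const k p R * norm \<phi>"
      proof (rule onorm_le)
        fix h :: real
        have "norm (pair_form k p (Q x) \<phi>) \<le> pair_const k p (norm (Q x)) * norm \<phi>" by (rule pair_form_bound)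
        also have "\<dots> \<le> pair_const k p R * norm \<phi>"
          using d(2)[of x] x by (intro mult_right_mono pair_const_mono) (auto simp: dist_commute)
        finally show "norm (h *\<^sub>R pair_form k p (Q x) \<phi>) \<le> pair_const k p R * norm \<phi> * norm h"
          by (simp add: mult.commute mult_left_mono)
      qed
    qed (use that d in \<open>auto simp: dist_norm\<close>)
    moreover have "?f \<tau> - ?f t = iper (\<lambda>z. (fn (Q \<tau>) z - fn (Q t) z) * fn \<phi> z)"
      unfolding left_diff_distrib by (rule set_integral_diff(2)[symmetric]) (intro L2_loc_mult_integrable L2_fn)+
    ultimately show ?thesis by (simp add: mult_ac)
  qed
  show ?thesis using d(1) C0 main by blast
qed

text \<open>The test function may move with time: its increment tends to zero and is paired with a
  quotient that stays bounded in the dual space.\<close>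

lemma pairing_deriv:
  assumes W: "isCont W t"
  shows "((\<lambda>\<tau>. iper (\<lambda>z. (fn (Q \<tau>) z - fn (Q t) z) * fn (W \<tau>) z) /\<^sub>R (\<tau> - t)) \<longlongrightarrow> pair_form k p (Q t) (W t)) (at t)"
proof -
  let ?I = "\<lambda>\<tau> \<phi>. iper (\<lambda>z. (fn (Q \<tau>) z - fn (Q t) z) * fn \<phi> z)"
  obtain d C where d: "d > 0" "C \<ge> 0" "\<And>\<tau> \<phi>. \<bar>\<tau> - t\<bar> < d \<Longrightarrow> cmod (?I \<tau> \<phi>) \<le> C * \<bar>\<tau> - t\<bar> * norm \<phi>"
    using pairing_lipschitz[of t] by blast
  have Idiff: "?I \<tau> \<phi> = iper (\<lambda>z. fn (Q \<tau>) z * fn \<phi> z) - iper (\<lambda>z. fn (Q t) z * fn \<phi> z)" for \<tau> \<phi>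
    unfolding left_diff_distrib by (rule set_integral_diff(2)) (intro L2_loc_mult_integrable L2_fn)+
  have 1: "((\<lambda>\<tau>. ?I \<tau> (W t) /\<^sub>R (\<tau> - t)) \<longlongrightarrow> pair_form k p (Q t) (W t)) (at t)"
    using weak[of "W t" t] unfolding has_vector_derivative_iff_tendsto Idiff .
  have 2: "((\<lambda>\<tau>. ?I \<tau> (W \<tau> - W t) /\<^sub>R (\<tau> - t)) \<longlongrightarrow> 0) (at t)"
  proof (rule Lim_null_comparison)
    have "eventually (\<lambda>\<tau>. \<tau> \<in> ball t d) (at t)" using d(1) by (intro eventually_at_in_open') auto
    moreover have "eventually (\<lambda>\<tau>. \<tau> \<noteq> t) (at t)" by (simp add: eventually_at_filter)
    ultimately show "eventually (\<lambda>\<tau>. norm (?I \<tau> (W \<tau> - W t) /\<^sub>R (\<tau> - t)) \<le> C * norm (W \<tau> - W t)) (at t)"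
    proof eventually_elim
      case (elim \<tau>)
      hence "cmod (?I \<tau> (W \<tau> - W t)) \<le> C * \<bar>\<tau> - t\<bar> * norm (W \<tau> - W t)"
        by (intro d(3)) (auto simp: dist_norm abs_minus_commute)
      thus ?case using elim by (simp add: field_simps)
    qed
    have "((\<lambda>\<tau>. C * norm (W \<tau> - W t)) \<longlongrightarrow> C * norm (W t - W t)) (at t)"
      using W unfolding isCont_def by (intro tendsto_intros)
    thus "((\<lambda>\<tau>. C * norm (W \<tau> - W t)) \<longlongrightarrow> 0) (at t)" by simp
  qed
  have "?I \<tau> (W \<tau>) /\<^sub>R (\<tau> - t) = ?I \<tau> (W t) /\<^sub>R (\<tau> - t) + ?I \<tau> (W \<tau> - W t) /\<^sub>R (\<tau> - t)" for \<tau>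
  proof -
    have L: "L2_loc (\<lambda>z. fn (Q \<tau>) z - fn (Q t) z)" by (intro L2_loc_diff L2_fn)
    have "?I \<tau> (W \<tau>) = ?I \<tau> (W t) + ?I \<tau> (W \<tau> - W t)"
      by (subst set_integral_add(2)[symmetric]) (auto intro!: L2_loc_mult_integrable L L2_fn simp: fn_simps algebra_simps)
    thus ?thesis by (simp add: scaleR_add_right)
  qed
  thus ?thesis using tendsto_add[OF 1 2] by simp
qed

lemma corr_deriv: "((\<lambda>\<tau>. corr h (Q \<tau>)) has_vector_derivative \<i> * flux h (Q t)) (at t)"
proof -
  let ?u = "Q t"
  have c: "isCont (\<lambda>\<tau>. hcnj (shift h (Q \<tau>))) t"
    by (intro bounded_linear.isCont[OF bounded_linear_hcnj] bounded_linear.isCont[OF bounded_linear_shift] cont)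
  have 1: "((\<lambda>\<tau>. cnj (iper (\<lambda>z. (fn (Q \<tau>) z - fn ?u z) * fn (hcnj (shift h (Q \<tau>))) z) /\<^sub>R (\<tau> - t))) \<longlongrightarrow> cnj (pair_form k p ?u (hcnj (shift h ?u)))) (at t)"
    by (intro tendsto_cnj pairing_deriv c)
  have 2: "((\<lambda>\<tau>. iper (\<lambda>z. (fn (Q \<tau>) z - fn ?u z) * fn (hcnj (shift (- h) ?u)) z) /\<^sub>R (\<tau> - t)) \<longlongrightarrow> pair_form k p ?u (hcnj (shift (- h) ?u))) (at t)"
    by (rule pairing_deriv) simp
  have cs: "continuous_on UNIV (\<lambda>z. fn w (z + s))" for w s
    by (intro continuous_on_compose2[OF fn_continuous[of UNIV]] continuous_intros subset_UNIV)
  \<comment> \<open>The increment of a product changes one factor at a time: first the conjugated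
    one, with the other already at time \<open>\<tau>\<close>, then the other one, with the
    conjugated factor at time \<open>t\<close> turned into a test function by a shift.\<close>
  have eq: "(corr h (Q \<tau>) - corr h ?u) /\<^sub>R (\<tau> - t) = cnj (iper (\<lambda>z. (fn (Q \<tau>) z - fn ?u z) * fn (hcnj (shift h (Q \<tau>))) z) /\<^sub>R (\<tau> - t))
      + iper (\<lambda>z. (fn (Q \<tau>) z - fn ?u z) * fn (hcnj (shift (- h) ?u)) z) /\<^sub>R (\<tau> - t)" for \<tau>
  proof -
    let ?v = "Q \<tau>"
    have pu: "fn w (z + 2 * pi + s) = fn w (z + s)" for w s z
      using fn_periodic[of w "z + s"] by (simp add: add_ac)
    have "iper (\<lambda>z. (fn ?v z - fn ?u z) * cnj (fn ?u (z + - h))) = iper (\<lambda>z. (fn ?v (z + h) - fn ?u (z + h)) * cnj (fn ?u (z + h + - h)))"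
      by (rule iper_shift_mult[where f = "\<lambda>z. fn ?v z - fn ?u z" and g = "\<lambda>z. cnj (fn ?u (z + - h))", symmetric])
         (auto intro!: L2_loc_continuous continuous_intros fn_continuous cs simp del: add_uminus_conv_diff simp: pu fn_periodic)
    hence s2: "iper (\<lambda>z. (fn ?v z - fn ?u z) * fn (hcnj (shift (- h) ?u)) z) = iper (\<lambda>z. cnj (fn ?u z) * (fn ?v (z + h) - fn ?u (z + h)))"
      by (simp add: fn_simps mult.commute)
    have s1: "cnj (iper (\<lambda>z. (fn ?v z - fn ?u z) * fn (hcnj (shift h ?v)) z)) = iper (\<lambda>z. cnj (fn ?v z - fn ?u z) * fn ?v (z + h))"
      by (simp flip: set_integral_cnj add: fn_simps)
    have "corr h ?v - corr h ?u = iper (\<lambda>z. cnj (fn ?v z) * fn ?v (z + h) - cnj (fn ?u z) * fn ?u (z + h))"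
      unfolding corr_def by (rule set_integral_diff(2)[symmetric]) (intro set_integrable_continuous continuous_intros cs fn_continuous)+
    also have "\<dots> = iper (\<lambda>z. cnj (fn ?v z - fn ?u z) * fn ?v (z + h) + cnj (fn ?u z) * (fn ?v (z + h) - fn ?u (z + h)))"
      by (rule set_integral_pw_cong) (auto simp: algebra_simps)
    also have "\<dots> = iper (\<lambda>z. cnj (fn ?v z - fn ?u z) * fn ?v (z + h)) + iper (\<lambda>z. cnj (fn ?u z) * (fn ?v (z + h) - fn ?u (z + h)))"
      by (rule set_integral_add(2)) (intro set_integrable_continuous continuous_intros cs fn_continuous)+
    finally show ?thesis unfolding s1[symmetric] s2[symmetric] by (simp add: scaleR_conv_of_real distrib_left)
  qed
  show ?thesis
    unfolding has_vector_derivative_iff_tendsto eq corr_flux[of k p, symmetric] by (intro tendsto_add 1 2)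
qed

lemma mass_conserved: "iper (\<lambda>z. cmod2 (fn (Q t) z)) = iper (\<lambda>z. cmod2 (fn (Q s) z))"
proof -
  have "flux 0 u = 0" for u by (simp add: flux_def set_lebesgue_integral_def)
  hence "((\<lambda>\<tau>. corr 0 (Q \<tau>)) has_vector_derivative 0) (at t within UNIV)" for t
    using corr_deriv[of 0 t] by simp
  then obtain c where c: "\<And>t. corr 0 (Q t) = c"
    using has_vector_derivative_zero_constant[of UNIV "\<lambda>\<tau>. corr 0 (Q \<tau>)"] by auto
  have "corr 0 u = of_real (iper (\<lambda>z. cmod2 (fn u z)))" for u
    unfolding corr_def by (subst set_integral_complex_of_real[symmetric]) (unfold complex_norm_square, simp add: mult.commute)
  thus ?thesis using c by (metis of_real_eq_iff)
qed

definition quart :: "h1 \<Rightarrow> real" where "quart u = iper (\<lambda>z. (cmod (fn u z))^4)"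
definition qflux :: "h1 \<Rightarrow> complex" where "qflux u = iper (\<lambda>z. cd u z * cd u z)"

text \<open>Only the dispersive term contributes. Tested against a real multiple of |u|^2 conj u,
  the transport term gives a total derivative and the remaining terms give real integrands, which
  drop out in the real part after multiplication by i.\<close>

lemma quart_deriv: "((\<lambda>\<tau>. quart (Q \<tau>)) has_vector_derivative 16 * k\<^sup>2 * Im (qflux (Q t))) (at t)"
proof -
  let ?u = "Q t"
  \<comment> \<open>This factors |v|^4 - |u|^4 as the real part of \<open>(v - u) * W v\<close>, so
    the difference quotient is a pairing with a moving test function.\<close>
  define W where "W = (\<lambda>v. hmul (hmul v (hcnj v) + hmul ?u (hcnj ?u)) (hcnj v + hcnj ?u))"
  have cc: "isCont (\<lambda>\<tau>. hcnj (Q \<tau>)) t"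
    by (intro bounded_linear.isCont[OF bounded_linear_hcnj] cont)
  have c: "isCont (\<lambda>\<tau>. W (Q \<tau>)) t"
    unfolding W_def by (intro bounded_bilinear.isCont[OF bounded_bilinear_hmul] continuous_add continuous_const cc cont)
  have eq: "(quart (Q \<tau>) - quart ?u) /\<^sub>R (\<tau> - t) = Re (iper (\<lambda>z. (fn (Q \<tau>) z - fn ?u z) * fn (W (Q \<tau>)) z) /\<^sub>R (\<tau> - t))" for \<tau>
  proof -
    let ?v = "Q \<tau>"
    have pt: "(cmod a)^4 - (cmod b)^4 = Re ((a - b) * ((a * cnj a + b * cnj b) * (cnj a + cnj b)))" for a b
    proof -
      have "(a - b) * ((a * cnj a + b * cnj b) * (cnj a + cnj b)) = of_real (cmod2 a + cmod2 b) * ((a - b) * (cnj a + cnj b))"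
        unfolding of_real_add complex_norm_square by (simp add: mult_ac)
      also have "Re \<dots> = (cmod2 a + cmod2 b) * (cmod2 a - cmod2 b)"
        unfolding Re_of_real_mult cmod_power2 by (simp add: algebra_simps power2_eq_square)
      also have "\<dots> = (cmod a)^4 - (cmod b)^4" by (simp add: power4_eq_xxxx power2_eq_square algebra_simps)
      finally show ?thesis ..
    qed
    have "quart ?v - quart ?u = iper (\<lambda>z. (cmod (fn ?v z))^4 - (cmod (fn ?u z))^4)"
      unfolding quart_def by (rule set_integral_diff(2)[symmetric]) (intro set_integrable_continuous continuous_intros fn_continuous)+
    also have "\<dots> = iper (\<lambda>z. Re ((fn ?v z - fn ?u z) * fn (W ?v) z))"
      unfolding pt W_def fn_simps ..
    also have "\<dots> = Re (iper (\<lambda>z. (fn ?v z - fn ?u z) * fn (W ?v) z))"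
      by (rule set_integral_Re) (intro set_integrable_continuous continuous_intros fn_continuous)
    finally show ?thesis by simp
  qed
  have "((\<lambda>\<tau>. (quart (Q \<tau>) - quart ?u) /\<^sub>R (\<tau> - t)) \<longlongrightarrow> Re (pair_form k p ?u (W ?u))) (at t)"
    unfolding eq by (intro tendsto_Re pairing_deriv c)
  moreover have "Re (pair_form k p ?u (W ?u)) = 16 * k\<^sup>2 * Im (qflux ?u)"
  proof -
    define u where "u = fn ?u"
    define v where "v = dv ?u"
    have uc: "continuous_on UNIV u" unfolding u_def by (rule fn_continuous)
    have L: "L2_loc u" "L2_loc v" unfolding u_def v_def by (rule L2_fn L2_dv)+
    let ?W1 = "\<lambda>z. 4 * ((v z * cnj (u z) + u z * cnj (v z)) * cnj (u z) + (u z * cnj (u z)) * cnj (v z))"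
    have Wu: "fn (W ?u) = (\<lambda>z. 4 * ((u z * cnj (u z)) * cnj (u z)))"
      by (auto simp: W_def fn_simps fun_eq_iff u_def algebra_simps)
    have AC1: "AC u v" unfolding u_def v_def by (rule AC_fn)
    have AC2: "AC (\<lambda>z. u z * cnj (u z)) (\<lambda>z. v z * cnj (u z) + u z * cnj (v z))" by (intro AC_mult AC_cnj AC1)
    have AC3: "AC (fn (W ?u)) ?W1"
      unfolding Wu by (intro AC_cmult AC_mult AC_cnj AC2 AC1)
    have per: "u (2 * pi) = u 0" using fn_periodic[of ?u 0] by (simp add: u_def)
    have I1: "Re (iper (\<lambda>z. v z * fn (W ?u) z)) = 0"
    proof -
      have "(\<lambda>z. Re (v z * fn (W ?u) z)) = (\<lambda>z. Re ((v z * cnj (u z) + u z * cnj (v z)) * (u z * cnj (u z)) + (u z * cnj (u z)) * (v z * cnj (u z) + u z * cnj (v z))))"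
        unfolding Wu by (auto simp: fun_eq_iff algebra_simps)
      moreover have "iper (\<lambda>z. (v z * cnj (u z) + u z * cnj (v z)) * (u z * cnj (u z)) + (u z * cnj (u z)) * (v z * cnj (u z) + u z * cnj (v z))) = 0"
        by (rule iper_deriv_zero[OF AC_mult[OF AC2 AC2]]) (simp add: per)
      ultimately have "iper (\<lambda>z. Re (v z * fn (W ?u) z)) = 0"
        using set_integral_Re[OF L2_loc_integrable[OF AC_L2[OF AC_mult[OF AC2 AC2]]], of 0 "2*pi"] by simp
      thus ?thesis
        by (subst set_integral_Re[symmetric]) (intro L2_loc_mult_integrable L L2_fn)
    qed
    have i2: "intg 0 (2*pi) (\<lambda>z. v z * ?W1 z)"
      by (intro L2_loc_mult_integrable L AC_L2[OF AC3])
    have I2: "Im (iper (\<lambda>z. v z * ?W1 z)) = 4 * Im (qflux ?u)"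
    proof -
      have "Im (a * (4 * ((a * cnj b + b * cnj a) * cnj b + (b * cnj b) * cnj a))) = 4 * Im ((cnj b * a) * (cnj b * a))" for a b
        by (simp add: algebra_simps)
      hence "iper (\<lambda>z. Im (v z * ?W1 z))
         = 4 * iper (\<lambda>z. Im ((cnj (u z) * v z) * (cnj (u z) * v z)))" by (simp only: set_integral_mult_right)
      moreover have "iper (\<lambda>z. Im ((cnj (u z) * v z) * (cnj (u z) * v z))) = Im (qflux ?u)"
        unfolding qflux_def u_def v_def
        by (rule set_integral_Im) (intro L2_loc_mult_integrable L2_loc_mult_bounded L2_dv continuous_intros fn_continuous)
      ultimately show ?thesis using set_integral_Im[OF i2] by simp
    qed
    have I3: "Im (iper (\<lambda>z. u z * fn (W ?u) z)) = 0"
    proof -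
      have "Im (u z * fn (W ?u) z) = 0" for z unfolding Wu by (simp add: algebra_simps)
      thus ?thesis
        by (subst set_integral_Im[symmetric]) (auto intro!: L2_loc_mult_integrable L L2_fn simp: set_lebesgue_integral_def)
    qed
    have I4: "Im (iper (\<lambda>z. of_real (cmod2 (u z)) * u z * fn (W ?u) z)) = 0"
    proof -
      have "Im (of_real (cmod2 (u z)) * u z * fn (W ?u) z) = 0" for z
        unfolding Wu mult.assoc Im_of_real_mult by (simp add: algebra_simps)
      thus ?thesis
        using set_integral_Im[OF L2_loc_mult_integrable[OF L2_cubic L2_fn], of 0 "2*pi" ?u "W ?u"]
        by (simp add: set_lebesgue_integral_def u_def)
    qed
    have "pair_form k p ?u (W ?u) = \<i> * (4 * \<i> * of_real (p * k) * iper (\<lambda>z. v z * fn (W ?u) z)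
      - 4 * of_real (k\<^sup>2) * iper (\<lambda>z. v z * ?W1 z) + of_real (1 - p\<^sup>2) * iper (\<lambda>z. u z * fn (W ?u) z)
      + iper (\<lambda>z. of_real (cmod2 (u z)) * u z * fn (W ?u) z))"
      using pair_form_AC[OF AC3, of k p ?u] by (simp only: u_def v_def)
    thus ?thesis using I1 I2 I3 I4 by simp
  qed
  ultimately show ?thesis unfolding has_vector_derivative_iff_tendsto by simp
qed

lemma norm_bounded_on: "\<exists>R\<ge>0. \<forall>t\<in>{a..b}. norm (Q t) \<le> R"
proof -
  have "continuous_on {a..b} Q" using cont by (simp add: continuous_at_imp_continuous_on)
  hence "compact (Q ` {a..b})" by (rule compact_continuous_image) simp
  then obtain R where "\<forall>x\<in>Q ` {a..b}. norm x \<le> R" by (meson bounded_iff compact_imp_bounded)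
  thus ?thesis by (intro exI[of _ "\<bar>R\<bar>"]) force
qed

text \<open>Over a step \<open>h = 1 / (n + 1)\<close> the density |u|^2 grows by
  \<open>h * Re (dA n u z)\<close>, and conj u(z) u(z + h) exceeds the density by
  \<open>h * dB n u z\<close>.\<close>

definition dA :: "nat \<Rightarrow> h1 \<Rightarrow> real \<Rightarrow> complex" where
  "dA n u z = cnj (fn u (z + 1 / Suc n) + fn u z) * dq n u z"
definition dB :: "nat \<Rightarrow> h1 \<Rightarrow> real \<Rightarrow> complex" where
  "dB n u z = cnj (fn u z) * dq n u z"

abbreviation rA :: "nat \<Rightarrow> h1 \<Rightarrow> real \<Rightarrow> complex" where "rA n u z \<equiv> of_real (Re (dA n u z))"

lemma L2_fn2: "L2_loc (fn2 u)"
  by (intro L2_loc_continuous continuous_intros fn_continuous)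

lemma L2_cd: "L2_loc (cd u)"
  by (intro L2_loc_mult_bounded L2_dv continuous_intros fn_continuous)

lemma L2n_fn2_le: "L2n (fn2 u) \<le> 4 * (norm u)\<^sup>2"
proof -
  have "L2n (\<lambda>z. of_real (cmod (fn u z)) * of_real (cmod (fn u z))) \<le> (4 * norm u) * L2n (\<lambda>z. of_real (cmod (fn u z)))"
    by (intro L2n_bounded_mult L2_loc_continuous continuous_intros fn_continuous) (simp add: fn_bound)
  also have "L2n (\<lambda>z. of_real (cmod (fn u z))) = L2n (fn u)" by (simp add: L2n_def)
  also have "(4 * norm u) * L2n (fn u) \<le> (4 * norm u) * norm u" by (intro mult_left_mono L2n_fn_le) simp
  finally show ?thesis by (simp add: power2_eq_square)
qed

lemma sum_shift_bound: "cmod (cnj (fn u (z + s) + fn u z)) \<le> 8 * norm u"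
  using norm_triangle_ineq[of "fn u (z + s)" "fn u z"] fn_bound[of u z] fn_bound[of u "z + s"]
  unfolding complex_mod_cnj by linarith

lemma dA_continuous: "continuous_on UNIV (\<lambda>z. cnj (fn u (z + s) + fn u z))"
  by (intro continuous_intros fn_continuous continuous_on_compose2[OF fn_continuous[of UNIV]] subset_UNIV)

lemma L2_dA: "L2_loc (dA n u)" and L2_dB: "L2_loc (dB n u)"
  unfolding dA_def dB_def by (intro L2_loc_mult_bounded L2_dq dA_continuous continuous_intros fn_continuous)+

lemma L2_Re: "L2_loc f \<Longrightarrow> L2_loc (\<lambda>z. of_real (Re (f z)))"
  using L2_loc_cmult[OF L2_loc_add[OF _ L2_loc_cnj], of f f "1 / 2"] by (simp add: complex_add_cnj)

lemma L2n_mono: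
  assumes "L2_loc f" "L2_loc g" "\<And>z. cmod (f z) \<le> cmod (g z)" shows "L2n f \<le> L2n g"
  unfolding L2n_def
  by (intro real_sqrt_le_mono set_integral_mono L2_loc_sq_integrable assms power_mono norm_ge_zero)

lemma L2n_null:
  assumes "\<And>n. L2n (f n) \<le> g n" "g \<longlonglongrightarrow> 0"
  shows "(\<lambda>n. L2n (f n)) \<longlonglongrightarrow> 0"
  by (rule tendsto_sandwich[OF _ _ tendsto_const assms(2)]) (simp_all add: L2n_nonneg assms(1))

text \<open>The error splits into a bounded factor times the error of the difference quotient, and a
  uniformly small translation error times the derivative.\<close>

lemma dA_tendsto: "(\<lambda>n. L2n (\<lambda>z. rA n u z - of_real (Re (2 * cd u z)))) \<longlonglongrightarrow> 0"
proof (rule L2n_null)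
  let ?S = "\<lambda>n. SUP z. cmod (fn u (z + 1 / Suc n) - fn u z)"
  show "L2n (\<lambda>z. rA n u z - of_real (Re (2 * cd u z)))
    \<le> (8 * norm u) * L2n (\<lambda>z. dq n u z - dv u z) + ?S n * L2n (dv u)" for n
  proof -
    have eq: "dA n u z - 2 * cd u z = cnj (fn u (z + 1 / Suc n) + fn u z) * (dq n u z - dv u z)
       + cnj (fn u (z + 1 / Suc n) - fn u z) * dv u z" for z
      by (simp add: dA_def algebra_simps)
    have c: "continuous_on UNIV (\<lambda>z. cnj (fn u (z + 1 / Suc n) - fn u z))"
      by (intro continuous_intros fn_continuous continuous_on_compose2[OF fn_continuous[of UNIV]] subset_UNIV)
    have "L2n (\<lambda>z. rA n u z - of_real (Re (2 * cd u z))) \<le> L2n (\<lambda>z. dA n u z - 2 * cd u z)"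
    proof (rule L2n_mono)
      show "cmod (rA n u z - of_real (Re (2 * cd u z))) \<le> cmod (dA n u z - 2 * cd u z)" for z
        unfolding of_real_diff[symmetric] minus_complex.sel(1)[symmetric] norm_of_real by (rule abs_Re_le_cmod)
    qed (intro L2_loc_diff L2_Re L2_dA L2_loc_cmult L2_cd)+
    also have "\<dots> \<le> L2n (\<lambda>z. cnj (fn u (z + 1 / Suc n) + fn u z) * (dq n u z - dv u z)) + L2n (\<lambda>z. cnj (fn u (z + 1 / Suc n) - fn u z) * dv u z)"
      unfolding eq by (intro L2n_add L2_loc_mult_bounded L2_loc_diff L2_dq L2_dv dA_continuous c)
    also have "\<dots> \<le> (8 * norm u) * L2n (\<lambda>z. dq n u z - dv u z) + ?S n * L2n (dv u)"
    proof (intro add_mono L2n_bounded_mult L2_loc_diff L2_dq L2_dv dA_continuous c)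
      show "cmod (cnj (fn u (z + 1 / Suc n) + fn u z)) \<le> 8 * norm u" for z by (rule sum_shift_bound)
      show "cmod (cnj (fn u (z + 1 / Suc n) - fn u z)) \<le> ?S n" for z
        unfolding complex_mod_cnj by (rule cSUP_upper[OF _ shift_bdd]) simp
    qed
    finally show ?thesis .
  qed
  have "(\<lambda>n. (8 * norm u) * L2n (\<lambda>z. dq n u z - dv u z) + ?S n * L2n (dv u)) \<longlonglongrightarrow> (8 * norm u) * 0 + 0 * L2n (dv u)"
    by (intro tendsto_add tendsto_mult tendsto_const dq_tendsto shift_sup_tendsto)
  thus "(\<lambda>n. (8 * norm u) * L2n (\<lambda>z. dq n u z - dv u z) + ?S n * L2n (dv u)) \<longlonglongrightarrow> 0" by simp
qed

lemma dB_tendsto: "(\<lambda>n. L2n (\<lambda>z. dB n u z - cd u z)) \<longlonglongrightarrow> 0"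
proof (rule L2n_null)
  show "L2n (\<lambda>z. dB n u z - cd u z) \<le> (4 * norm u) * L2n (\<lambda>z. dq n u z - dv u z)" for n
    unfolding dB_def right_diff_distrib[symmetric]
    by (intro L2n_bounded_mult L2_loc_diff L2_dq L2_dv continuous_intros fn_continuous) (simp add: fn_bound)
  have "(\<lambda>n. (4 * norm u) * L2n (\<lambda>z. dq n u z - dv u z)) \<longlonglongrightarrow> (4 * norm u) * 0"
    by (intro tendsto_mult tendsto_const dq_tendsto)
  thus "(\<lambda>n. (4 * norm u) * L2n (\<lambda>z. dq n u z - dv u z)) \<longlonglongrightarrow> 0" by simp
qed

lemma L2n_dA_le: "L2n (\<lambda>z. rA n u z) \<le> 16 * (norm u)\<^sup>2" and L2n_dB_le: "L2n (dB n u) \<le> 8 * (norm u)\<^sup>2"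
proof -
  have "L2n (\<lambda>z. rA n u z) \<le> L2n (dA n u)"
    by (intro L2n_mono L2_Re L2_dA) (simp add: abs_Re_le_cmod)
  also have "\<dots> \<le> (8 * norm u) * L2n (dq n u)"
    unfolding dA_def by (intro L2n_bounded_mult L2_dq dA_continuous sum_shift_bound)
  also have "\<dots> \<le> (8 * norm u) * (2 * norm u)" by (intro mult_left_mono L2n_dq_le) simp
  finally show "L2n (\<lambda>z. rA n u z) \<le> 16 * (norm u)\<^sup>2" by (simp add: power2_eq_square)
  have "L2n (dB n u) \<le> (4 * norm u) * L2n (dq n u)"
    unfolding dB_def by (intro L2n_bounded_mult L2_dq continuous_intros fn_continuous) (simp add: fn_bound)
  also have "\<dots> \<le> (4 * norm u) * (2 * norm u)" by (intro mult_left_mono L2n_dq_le) simp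
  finally show "L2n (dB n u) \<le> 8 * (norm u)\<^sup>2" by (simp add: power2_eq_square)
qed

lemma flux_dA:
  "flux (1 / Suc n) u = of_real (1 / Suc n) * iper (\<lambda>z. rA n u z * (fn2 u z + of_real (1 / Suc n) * dB n u z))"
proof -
  define h where "h = 1 / real (Suc n)"
  have h: "h \<noteq> 0" by (simp add: h_def)
  have "of_real (cmod2 (fn u (z + h)) - cmod2 (fn u z)) * (cnj (fn u z) * fn u (z + h))
     = of_real h * (rA n u z * (fn2 u z + of_real h * dB n u z))" for z
  proof -
    let ?a = "fn u (z + h)" and ?b = "fn u z"
    have D: "?a - ?b = of_real h * dq n u z" using dq_shift[of u z n] unfolding h_def[symmetric] by simp
    have "cmod2 ?a - cmod2 ?b = Re (cnj (?a + ?b) * (?a - ?b))"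
      unfolding cmod_power2 by (simp add: algebra_simps power2_eq_square)
    also have "\<dots> = h * Re (dA n u z)"
      unfolding D dA_def h_def[symmetric] by (simp add: algebra_simps)
    finally have 1: "cmod2 ?a - cmod2 ?b = h * Re (dA n u z)" .
    have "cnj ?b * ?a = cnj ?b * ?b + cnj ?b * (?a - ?b)" by (simp add: algebra_simps)
    also have "\<dots> = of_real (cmod2 ?b) + of_real h * dB n u z"
      unfolding D dB_def complex_norm_square by (simp add: mult_ac)
    finally show ?thesis unfolding 1 by (simp add: mult_ac)
  qed
  thus ?thesis unfolding flux_def h_def[symmetric] by (simp only: set_integral_mult_right)
qed

text \<open>The momentum is the limit of the imaginary part of \<open>corr h\<close> over
  \<open>h\<close>. The rate of change of this quotient tends to the integral of the derivative of
  |u|^4 / 2 over a period.\<close>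

lemma momentum_conserved:
  "Im (iper (\<lambda>z. cd (Q t) z)) = Im (iper (\<lambda>z. cd (Q s) z))"
proof (rule limit_conserved[where L = "\<lambda>t. Im (iper (\<lambda>z. cd (Q t) z))"])
  let ?h = "\<lambda>n. 1 / real (Suc n)"
  let ?e' = "\<lambda>n t. Re (iper (\<lambda>z. rA n (Q t) z * (fn2 (Q t) z + of_real (?h n) * dB n (Q t) z)))"
  show "((\<lambda>t. Im (corr (?h n) (Q t)) / ?h n) has_vector_derivative ?e' n t) (at t)" for n t
  proof -
    have "((\<lambda>t. Im (corr (?h n) (Q t)) / ?h n) has_vector_derivative Im (\<i> * flux (?h n) (Q t)) / ?h n) (at t)"
      by (intro has_vector_derivative_divide bounded_linear.has_vector_derivative[OF bounded_linear_Im] corr_deriv)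
    moreover have "Im (\<i> * flux (?h n) (Q t)) / ?h n = ?e' n t"
      unfolding flux_dA by (simp add: Re_of_real_mult del: of_nat_Suc)
    ultimately show ?thesis by simp
  qed
  show "\<exists>C. \<forall>n. \<forall>t\<in>{a..b}. \<bar>?e' n t\<bar> \<le> C" for a b
  proof -
    obtain R where R: "R \<ge> 0" "\<And>t. t \<in> {a..b} \<Longrightarrow> norm (Q t) \<le> R" using norm_bounded_on[of a b] by blast
    have "\<bar>?e' n t\<bar> \<le> (16 * R\<^sup>2) * (12 * R\<^sup>2)" if "t \<in> {a..b}" for n t
    proof -
      have sq: "(norm (Q t))\<^sup>2 \<le> R\<^sup>2" using R that by (intro power_mono) auto
      have "\<bar>?e' n t\<bar> \<le> L2n (\<lambda>z. rA n (Q t) z) * L2n (\<lambda>z. fn2 (Q t) z + of_real (?h n) * dB n (Q t) z)"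
        by (rule order_trans[OF abs_Re_le_cmod iper_CS]) (intro L2_Re L2_dA L2_loc_add L2_fn2 L2_loc_cmult L2_dB)+
      also have "\<dots> \<le> (16 * R\<^sup>2) * (12 * R\<^sup>2)"
      proof (intro mult_mono L2n_nonneg)
        show "L2n (\<lambda>z. rA n (Q t) z) \<le> 16 * R\<^sup>2" using L2n_dA_le[of n "Q t"] sq by simp
        have "L2n (\<lambda>z. of_real (?h n) * dB n (Q t) z) \<le> 1 * L2n (dB n (Q t))"
          by (intro L2n_bounded_mult L2_dB continuous_intros) (simp only: norm_of_real, simp)
        hence "L2n (\<lambda>z. fn2 (Q t) z + of_real (?h n) * dB n (Q t) z) \<le> 4 * (norm (Q t))\<^sup>2 + 8 * (norm (Q t))\<^sup>2"
          using L2n_add[OF L2_fn2 L2_loc_cmult[OF L2_dB], of "Q t" "of_real (?h n)" n "Q t"] L2n_fn2_le[of "Q t"] L2n_dB_le[of n "Q t"] by simp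
        thus "L2n (\<lambda>z. fn2 (Q t) z + of_real (?h n) * dB n (Q t) z) \<le> 12 * R\<^sup>2" using sq by simp
      qed simp
      finally show ?thesis .
    qed
    thus ?thesis by blast
  qed
  show "(\<lambda>n. ?e' n t) \<longlonglongrightarrow> 0" for t
  proof -
    define u where "u = Q t"
    have B0: "(\<lambda>n. L2n (\<lambda>z. (fn2 u z + of_real (?h n) * dB n u z) - fn2 u z)) \<longlonglongrightarrow> 0"
    proof (rule L2n_null)
      have "L2n (\<lambda>z. of_real (?h n) * dB n u z) \<le> ?h n * L2n (dB n u)" for n
        by (intro L2n_bounded_mult L2_dB continuous_intros) (simp only: norm_of_real, simp)
      moreover have "?h n * L2n (dB n u) \<le> ?h n * (8 * (norm u)\<^sup>2)" for n by (intro mult_left_mono L2n_dB_le) simp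
      ultimately show "L2n (\<lambda>z. (fn2 u z + of_real (?h n) * dB n u z) - fn2 u z) \<le> ?h n * (8 * (norm u)\<^sup>2)" for n
        by (simp del: of_nat_Suc, meson order_trans)
      have "(\<lambda>n. ?h n * (8 * (norm u)\<^sup>2)) \<longlonglongrightarrow> 0 * (8 * (norm u)\<^sup>2)"
        by (intro tendsto_mult tendsto_const LIMSEQ_Suc[OF lim_1_over_n])
      thus "(\<lambda>n. ?h n * (8 * (norm u)\<^sup>2)) \<longlonglongrightarrow> 0" by simp
    qed
    have "(\<lambda>n. iper (\<lambda>z. rA n u z * (fn2 u z + of_real (?h n) * dB n u z)))
       \<longlonglongrightarrow> iper (\<lambda>z. of_real (Re (2 * cd u z)) * fn2 u z)"
      by (rule L2n_mult_tendsto[OF _ _ dA_tendsto _ _ B0]) (intro L2_Re L2_dA L2_loc_cmult L2_cd L2_fn2 L2_loc_add L2_loc_cmult L2_dB)+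
    moreover have "iper (\<lambda>z. complex_of_real (Re (2 * cd u z)) * fn2 u z) = 0"
    proof -
      have AC2: "AC (\<lambda>z. fn u z * cnj (fn u z)) (\<lambda>z. dv u z * cnj (fn u z) + fn u z * cnj (dv u z))" by (intro AC_mult AC_cnj AC_fn)
      have "of_real (Re (2 * (cnj a * b))) * of_real (cmod2 a) = (1 / 2) * ((b * cnj a + a * cnj b) * (a * cnj a) + (a * cnj a) * (b * cnj a + a * cnj b))" for a b
        unfolding complex_norm_square complex_add_cnj[symmetric]
        by (simp add: complex_eq_iff algebra_simps)
      moreover have "iper (\<lambda>z. (1 / 2) * ((dv u z * cnj (fn u z) + fn u z * cnj (dv u z)) * (fn u z * cnj (fn u z)) + (fn u z * cnj (fn u z)) * (dv u z * cnj (fn u z) + fn u z * cnj (dv u z)))) = 0"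
        by (rule iper_deriv_zero[OF AC_cmult[OF AC_mult[OF AC2 AC2]]]) (use fn_periodic[of u 0] in simp)
      ultimately show ?thesis by (simp only:)
    qed
    ultimately have "(\<lambda>n. iper (\<lambda>z. rA n u z * (fn2 u z + of_real (?h n) * dB n u z))) \<longlonglongrightarrow> 0"
      by (simp only:)
    from tendsto_Re[OF this] show ?thesis by (simp only: u_def zero_complex.sel)
  qed
  show "(\<lambda>n. Im (corr (?h n) (Q t)) / ?h n) \<longlonglongrightarrow> Im (iper (\<lambda>z. cd (Q t) z))" for t
  proof -
    define u where "u = Q t"
    have "Im (corr (?h n) u) / ?h n = Im (iper (dB n u))" for n
    proof -
      have "corr (?h n) u = iper (\<lambda>z. fn2 u z + of_real (?h n) * dB n u z)"
        unfolding corr_def dB_def complex_norm_square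
        by (rule set_integral_pw_cong) (auto simp: dq_def algebra_simps simp del: of_nat_Suc)
      also have "\<dots> = iper (\<lambda>z. fn2 u z) + of_real (?h n) * iper (dB n u)"
        by (subst set_integral_add(2), (intro L2_loc_integrable L2_fn2 L2_loc_cmult L2_dB)+, simp only: set_integral_mult_right)
      also have "iper (\<lambda>z. fn2 u z) = of_real (iper (\<lambda>z. cmod2 (fn u z)))"
        by (rule set_integral_complex_of_real)
      finally show ?thesis by (simp add: Im_of_real_mult del: of_nat_Suc of_real_power)
    qed
    moreover have "(\<lambda>n. iper (\<lambda>z. dB n u z * 1)) \<longlonglongrightarrow> iper (\<lambda>z. cd u z * 1)"
    proof (rule L2n_mult_tendsto[OF _ _ dB_tendsto])
      show "(\<lambda>n. L2n (\<lambda>z. 1 - 1)) \<longlonglongrightarrow> 0" by (simp add: L2n_def set_lebesgue_integral_def)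
    qed (intro L2_dB L2_loc_mult_bounded L2_dv L2_loc_continuous continuous_intros fn_continuous)+
    ultimately show ?thesis unfolding u_def[symmetric] by (simp add: tendsto_Im)
  qed
qed

text \<open>With the conserved mass \<open>m\<close>, the real part of \<open>corr\<close> gives the
  squared L2 norm of the difference quotient. The rates of change of this norm and of the quartic
  term are both governed in the limit by the integral of the square of \<open>cd\<close>, and they
  cancel.\<close>

lemma energy_conserved:
  "2 * k\<^sup>2 * iper (\<lambda>z. cmod2 (dv (Q t) z)) - quart (Q t) / 4 = 2 * k\<^sup>2 * iper (\<lambda>z. cmod2 (dv (Q s) z)) - quart (Q s) / 4"
proof (rule limit_conserved[where L = "\<lambda>t. 2 * k\<^sup>2 * iper (\<lambda>z. cmod2 (dv (Q t) z)) - quart (Q t) / 4"])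
  let ?h = "\<lambda>n. 1 / real (Suc n)"
  define m where "m = iper (\<lambda>z. cmod2 (fn (Q 0) z))"
  have m: "iper (\<lambda>z. cmod2 (fn (Q t) z)) = m" for t unfolding m_def by (rule mass_conserved)
  let ?F = "\<lambda>n u. Im (iper (\<lambda>z. rA n u z * dB n u z))"
  let ?e = "\<lambda>n t. 2 * k\<^sup>2 * ((2 * m - 2 * Re (corr (?h n) (Q t))) / (?h n)\<^sup>2) - quart (Q t) / 4"
  let ?e' = "\<lambda>n t. 4 * k\<^sup>2 * (?F n (Q t) - Im (qflux (Q t)))"
  have F: "Im (flux (?h n) u) = (?h n)\<^sup>2 * ?F n u" for n u
  proof -
    have "iper (\<lambda>z. rA n u z * (fn2 u z + of_real (?h n) * dB n u z))
      = iper (\<lambda>z. rA n u z * fn2 u z) + of_real (?h n) * iper (\<lambda>z. rA n u z * dB n u z)"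
    proof -
      have "iper (\<lambda>z. rA n u z * (fn2 u z + of_real (?h n) * dB n u z))
        = iper (\<lambda>z. rA n u z * fn2 u z + of_real (?h n) * (rA n u z * dB n u z))"
        by (simp only: distrib_left mult.left_commute)
      also have "\<dots> = iper (\<lambda>z. rA n u z * fn2 u z) + iper (\<lambda>z. of_real (?h n) * (rA n u z * dB n u z))"
        by (rule set_integral_add(2)) (intro set_integrable_mult_right L2_loc_mult_integrable L2_Re L2_dA L2_dB L2_fn2)+
      finally show ?thesis by (simp only: set_integral_mult_right)
    qed
    moreover have "iper (\<lambda>z. rA n u z * fn2 u z) = of_real (iper (\<lambda>z. Re (dA n u z) * cmod2 (fn u z)))"
      by (subst set_integral_complex_of_real[symmetric]) simp
    ultimately show ?thesis
      unfolding flux_dA by (simp add: Im_of_real_mult power2_eq_square del: of_nat_Suc)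
  qed
  show "(?e n has_vector_derivative ?e' n t) (at t)" for n t
  proof -
    have "((\<lambda>t. Re (corr (?h n) (Q t))) has_vector_derivative Re (\<i> * flux (?h n) (Q t))) (at t)"
      by (intro bounded_linear.has_vector_derivative[OF bounded_linear_Re] corr_deriv)
    hence d1: "((\<lambda>t. Re (corr (?h n) (Q t))) has_vector_derivative - ((?h n)\<^sup>2 * ?F n (Q t))) (at t)"
      by (simp add: F del: of_nat_Suc)
    have "(?e n has_vector_derivative 2 * k\<^sup>2 * ((0 - 2 * - ((?h n)\<^sup>2 * ?F n (Q t))) / (?h n)\<^sup>2) - (16 * k\<^sup>2 * Im (qflux (Q t))) / 4) (at t)"
      by (intro has_vector_derivative_diff has_vector_derivative_mult_right has_vector_derivative_divide has_vector_derivative_const d1 quart_deriv)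
    moreover have "2 * k\<^sup>2 * ((0 - 2 * - ((?h n)\<^sup>2 * ?F n (Q t))) / (?h n)\<^sup>2) - (16 * k\<^sup>2 * Im (qflux (Q t))) / 4 = ?e' n t"
      by (simp add: right_diff_distrib del: of_nat_Suc)
    ultimately show ?thesis by simp
  qed
  show "\<exists>C. \<forall>n. \<forall>t\<in>{a..b}. \<bar>?e' n t\<bar> \<le> C" for a b
  proof -
    obtain R where R: "R \<ge> 0" "\<And>t. t \<in> {a..b} \<Longrightarrow> norm (Q t) \<le> R" using norm_bounded_on[of a b] by blast
    have "\<bar>?e' n t\<bar> \<le> 4 * k\<^sup>2 * ((16 * R\<^sup>2) * (8 * R\<^sup>2) + (4 * R\<^sup>2) * (4 * R\<^sup>2))" if "t \<in> {a..b}" for n t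
    proof -
      have nr: "norm (Q t) \<le> R" using R that by auto
      have sq: "(norm (Q t))\<^sup>2 \<le> R\<^sup>2" using R that by (intro power_mono) auto
      have "\<bar>?F n (Q t)\<bar> \<le> L2n (\<lambda>z. rA n (Q t) z) * L2n (dB n (Q t))"
        by (rule order_trans[OF abs_Im_le_cmod iper_CS]) (intro L2_Re L2_dA L2_dB)+
      also have "\<dots> \<le> (16 * R\<^sup>2) * (8 * R\<^sup>2)"
        using L2n_dA_le[of n "Q t"] L2n_dB_le[of n "Q t"] sq by (intro mult_mono L2n_nonneg) auto
      finally have 1: "\<bar>?F n (Q t)\<bar> \<le> (16 * R\<^sup>2) * (8 * R\<^sup>2)" .
      have b: "L2n (\<lambda>z. cd (Q t) z) \<le> 4 * R\<^sup>2"
      proof -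
        have "L2n (\<lambda>z. cd (Q t) z) \<le> (4 * norm (Q t)) * L2n (dv (Q t))"
          by (intro L2n_bounded_mult L2_dv continuous_intros fn_continuous) (simp add: fn_bound)
        also have "\<dots> \<le> (4 * norm (Q t)) * norm (Q t)" by (intro mult_left_mono L2n_dv_le) simp
        finally show ?thesis using sq by (simp add: power2_eq_square)
      qed
      have "\<bar>Im (qflux (Q t))\<bar> \<le> L2n (\<lambda>z. cd (Q t) z) * L2n (\<lambda>z. cd (Q t) z)"
        unfolding qflux_def by (rule order_trans[OF abs_Im_le_cmod iper_CS]) (intro L2_cd)+
      also have "\<dots> \<le> (4 * R\<^sup>2) * (4 * R\<^sup>2)" by (intro mult_mono b L2n_nonneg) simp
      finally have "\<bar>?F n (Q t) - Im (qflux (Q t))\<bar> \<le> (16 * R\<^sup>2) * (8 * R\<^sup>2) + (4 * R\<^sup>2) * (4 * R\<^sup>2)" using 1 by linarith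
      from mult_left_mono[OF this, of "4 * k\<^sup>2"] show ?thesis by (simp add: abs_mult)
    qed
    thus ?thesis by blast
  qed
  show "(\<lambda>n. ?e' n t) \<longlonglongrightarrow> 0" for t
  proof -
    define u where "u = Q t"
    have "(\<lambda>n. iper (\<lambda>z. rA n u z * dB n u z))
       \<longlonglongrightarrow> iper (\<lambda>z. of_real (Re (2 * cd u z)) * cd u z)"
      by (rule L2n_mult_tendsto[OF _ _ dA_tendsto _ _ dB_tendsto]) (intro L2_Re L2_dA L2_cd L2_loc_cmult L2_dB)+
    hence "(\<lambda>n. ?F n u) \<longlonglongrightarrow> Im (iper (\<lambda>z. of_real (Re (2 * cd u z)) * cd u z))"
      by (rule tendsto_Im)
    also have "Im (iper (\<lambda>z. of_real (Re (2 * cd u z)) * cd u z)) = Im (qflux u)"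
    proof -
      have "Im (of_real (Re (2 * w)) * w) = Im (w * w)" for w by simp
      hence "iper (\<lambda>z. Im (of_real (Re (2 * cd u z)) * cd u z)) = iper (\<lambda>z. Im (cd u z * cd u z))"
        by (simp only:)
      moreover have "iper (\<lambda>z. Im (of_real (Re (2 * cd u z)) * cd u z)) = Im (iper (\<lambda>z. of_real (Re (2 * cd u z)) * cd u z))"
        by (rule set_integral_Im) (intro L2_loc_mult_integrable L2_Re L2_loc_cmult L2_cd)
      moreover have "iper (\<lambda>z. Im (cd u z * cd u z)) = Im (qflux u)"
        unfolding qflux_def by (rule set_integral_Im) (intro L2_loc_mult_integrable L2_cd)
      ultimately show ?thesis by simp
    qed
    finally have "(\<lambda>n. 4 * k\<^sup>2 * (?F n u - Im (qflux u))) \<longlonglongrightarrow> 4 * k\<^sup>2 * (Im (qflux u) - Im (qflux u))"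
      by (intro tendsto_mult tendsto_diff tendsto_const)
    thus ?thesis by (simp add: u_def)
  qed
  show "(\<lambda>n. ?e n t) \<longlonglongrightarrow> 2 * k\<^sup>2 * iper (\<lambda>z. cmod2 (dv (Q t) z)) - quart (Q t) / 4" for t
  proof -
    define u where "u = Q t"
    have eq: "(2 * m - 2 * Re (corr (?h n) u)) / (?h n)\<^sup>2 = iper (\<lambda>z. cmod2 (dq n u z))" for n
    proof -
      have cs: "continuous_on UNIV (\<lambda>z. fn u (z + ?h n))"
        by (intro continuous_on_compose2[OF fn_continuous[of UNIV]] continuous_intros subset_UNIV)
      have s: "iper (\<lambda>z. cmod2 (fn u (z + ?h n))) = m"
      proof -
        have "iper (\<lambda>z. cmod2 (fn u (z + ?h n))) = iper (\<lambda>z. cmod2 (fn u z))"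
          by (rule iper_shift[where f = "\<lambda>z. cmod2 (fn u z)"]) (auto intro: L2_loc_sq_integrable L2_fn simp: fn_periodic)
        thus ?thesis using m[of t] by (simp add: u_def)
      qed
      have i: "intg 0 (2*pi) (\<lambda>z. Re (cnj (fn u z) * fn u (z + ?h n)))"
        by (intro set_integrable_continuous continuous_intros cs fn_continuous)
      have pt: "(?h n)\<^sup>2 * cmod2 (dq n u z) = cmod2 (fn u (z + ?h n)) + cmod2 (fn u z) + (- 2) * Re (cnj (fn u z) * fn u (z + ?h n))" for z
      proof -
        have "(?h n)\<^sup>2 * cmod2 (dq n u z) = cmod2 (of_real (?h n) * dq n u z)"
          by (simp add: norm_mult power_mult_distrib norm_divide power_divide del: of_nat_Suc)
        also have "of_real (?h n) * dq n u z = fn u (z + ?h n) - fn u z" using dq_shift[of u z n] by simp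
        also have "cmod2 (fn u (z + ?h n) - fn u z) = cmod2 (fn u (z + ?h n)) + cmod2 (fn u z) + (- 2) * Re (cnj (fn u z) * fn u (z + ?h n))"
          unfolding cmod_power2 by (simp add: power2_eq_square algebra_simps del: of_nat_Suc)
        finally show ?thesis .
      qed
      have "(?h n)\<^sup>2 * iper (\<lambda>z. cmod2 (dq n u z)) = iper (\<lambda>z. (?h n)\<^sup>2 * cmod2 (dq n u z))"
        by (simp only: set_integral_mult_right)
      also have "\<dots> = iper (\<lambda>z. cmod2 (fn u (z + ?h n))) + iper (\<lambda>z. cmod2 (fn u z)) + iper (\<lambda>z. (- 2) * Re (cnj (fn u z) * fn u (z + ?h n)))"
        unfolding pt by (intro set_integral_add3 set_integrable_mult_right i L2_loc_sq_integrable L2_fn L2_loc_continuous cs)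
      also have "\<dots> = 2 * m - 2 * Re (corr (?h n) u)"
      proof -
        have "iper (\<lambda>z. Re (cnj (fn u z) * fn u (z + ?h n))) = Re (corr (?h n) u)"
          unfolding corr_def by (rule set_integral_Re) (intro set_integrable_continuous continuous_intros cs fn_continuous)
        moreover have "iper (\<lambda>z. (- 2) * Re (cnj (fn u z) * fn u (z + ?h n))) = (- 2) * iper (\<lambda>z. Re (cnj (fn u z) * fn u (z + ?h n)))"
          by (rule set_integral_mult_right)
        moreover have "iper (\<lambda>z. cmod2 (fn u z)) = m" using m[of t] by (simp add: u_def)
        ultimately show ?thesis using s by linarith
      qed
      finally have fin: "(?h n)\<^sup>2 * iper (\<lambda>z. cmod2 (dq n u z)) = 2 * m - 2 * Re (corr (?h n) u)" .
      have "(?h n)\<^sup>2 \<noteq> 0" by simp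
      thus ?thesis unfolding fin[symmetric] by (metis nonzero_mult_div_cancel_left)
    qed
    have "(\<lambda>n. iper (\<lambda>z. dq n u z * cnj (dq n u z))) \<longlonglongrightarrow> iper (\<lambda>z. dv u z * cnj (dv u z))"
    proof (rule L2n_mult_tendsto[OF _ _ dq_tendsto])
      have "L2n (\<lambda>z. cnj (dq n u z) - cnj (dv u z)) = L2n (\<lambda>z. dq n u z - dv u z)" for n
        unfolding L2n_def complex_cnj_diff[symmetric] complex_mod_cnj ..
      thus "(\<lambda>n. L2n (\<lambda>z. cnj (dq n u z) - cnj (dv u z))) \<longlonglongrightarrow> 0" using dq_tendsto by simp
    qed (intro L2_loc_cnj L2_dq L2_dv)+
    hence "(\<lambda>n. Re (iper (\<lambda>z. dq n u z * cnj (dq n u z)))) \<longlonglongrightarrow> Re (iper (\<lambda>z. dv u z * cnj (dv u z)))"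
      by (rule tendsto_Re)
    moreover have "Re (iper (\<lambda>z. f z * cnj (f z))) = iper (\<lambda>z. cmod2 (f z))" if "L2_loc f" for f
      using set_integral_Re[OF L2_loc_mult_integrable[OF that L2_loc_cnj[OF that]], of 0 "2*pi"] Re_cnj_mult_self
      by (simp add: mult.commute)
    ultimately have "(\<lambda>n. iper (\<lambda>z. cmod2 (dq n u z))) \<longlonglongrightarrow> iper (\<lambda>z. cmod2 (dv u z))"
      using L2_dq L2_dv by simp
    hence "(\<lambda>n. 2 * k\<^sup>2 * ((2 * m - 2 * Re (corr (?h n) u)) / (?h n)\<^sup>2) - quart u / 4) \<longlonglongrightarrow> 2 * k\<^sup>2 * iper (\<lambda>z. cmod2 (dv u z)) - quart u / 4"
      unfolding eq by (intro tendsto_intros)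
    thus ?thesis by (simp only: u_def)
  qed
qed

end

section \<open>The periodic waves\<close>

lemma real_antiderivative:
  fixes f :: "real \<Rightarrow> real"
  assumes "continuous_on UNIV f"
  shows "\<exists>F. F 0 = 0 \<and> (\<forall>x. (F has_real_derivative f x) (at x))"
proof -
  define F where "F = (\<lambda>x. if 0 \<le> x then integral {0..x} f else - integral {x..0} f)"
  have int: "f integrable_on {c..d}" for c d
    by (intro integrable_continuous_interval continuous_on_subset[OF assms]) auto
  have "(F has_real_derivative f x) (at x)" for x
  proof -
    define M where "M = \<bar>x\<bar> + 1"
    have M: "M \<ge> 1" "x \<in> {-M<..<M}" by (auto simp: M_def abs_if)
    have "((\<lambda>y. integral {-M..y} f) has_real_derivative f x) (at x within {-M..M})"
      using integral_has_real_derivative[of "-M" M f x] M continuous_on_subset[OF assms] by auto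
    hence "((\<lambda>y. integral {-M..y} f) has_real_derivative f x) (at x)"
      using M at_within_interior[of x "{-M..M}"] by (simp add: interior_atLeastAtMost_real)
    hence "((\<lambda>y. integral {-M..y} f - integral {-M..0} f) has_real_derivative f x - 0) (at x)"
      by (rule DERIV_diff) simp
    moreover have "integral {-M..y} f - integral {-M..0} f = F y" if "y \<in> {-M<..<M}" for y
    proof (cases "0 \<le> y")
      case True
      thus ?thesis
        using Henstock_Kurzweil_Integration.integral_combine[of "-M" 0 y f] M int by (simp add: F_def)
    next
      case False
      thus ?thesis
        using Henstock_Kurzweil_Integration.integral_combine[of "-M" y 0 f] that int by (simp add: F_def)
    qed
    ultimately show ?thesis
      by (subst DERIV_cong_ev[symmetric, OF refl _ refl])
         (use M eventually_nhds_in_open[of "{-M<..<M}" x] in \<open>auto elim!: eventually_mono\<close>)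
  qed
  thus ?thesis by (intro exI[of _ F]) (simp add: F_def)
qed

lemma DERIV_zero_eq:
  fixes f :: "real \<Rightarrow> real"
  assumes "\<And>x. (f has_real_derivative 0) (at x)" shows "f x = f y"
  using DERIV_isconst_all[of f x y] assms by blast

lemma has_vector_derivative_cis:
  assumes "(f has_real_derivative f') (at x)"
  shows "((\<lambda>x. cis (f x)) has_vector_derivative \<i> * of_real f' * cis (f x)) (at x)"
proof -
  have "((\<lambda>x. Complex (cos (f x)) (sin (f x))) has_vector_derivative Complex (- sin (f x) * f') (cos (f x) * f')) (at x)"
    using assms unfolding has_vector_derivative_complex_iff has_real_derivative_iff_has_vector_derivative[symmetric]
    by (auto intro!: derivative_eq_intros)
  moreover have "(\<lambda>x. Complex (cos (f x)) (sin (f x))) = (\<lambda>x. cis (f x))"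
    by (simp add: fun_eq_iff complex_eq_iff)
  moreover have "Complex (- sin (f x) * f') (cos (f x) * f') = \<i> * of_real f' * cis (f x)"
    by (simp add: complex_eq_iff)
  ultimately show ?thesis by simp
qed

text \<open>The numbers |j| and R are the extreme values of |W|. The parameter \<open>j\<close> is
  signed so that it can carry the sign of the angular momentum \<open>J\<close>.\<close>

locale cn_wave =
  fixes j R :: real
  assumes jR: "\<bar>j\<bar> < R"
begin

text \<open>The squares of \<open>j\<close> and \<open>R\<close> and \<open>- eta\<close> turn out
  to be the roots \<open>y1\<close>, \<open>y2\<close>, \<open>y3\<close>. The wave starts at the
  minimum of |W| with value \<open>j\<close> and derivative \<open>i g\<close>, which determines
  \<open>J\<close> and \<open>E\<close>.\<close>

definition eta where "eta = 2 + j\<^sup>2 + R\<^sup>2"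
definition h where "h = sqrt eta"
definition g where "g = R * h / sqrt 2"
definition J where "J = j * g"
definition E where "E = g\<^sup>2 / 2 + j\<^sup>2 / 2 + j^4 / 4"
definition sph where "sph \<phi> = j\<^sup>2 * (cos \<phi>)\<^sup>2 + R\<^sup>2 * (sin \<phi>)\<^sup>2"
definition Dl where "Dl \<phi> = sqrt (eta + sph \<phi>)"

lemma R_pos: "R > 0" using jR by simp
lemma j2_less: "j\<^sup>2 < R\<^sup>2"
  using power_strict_mono[OF jR, of 2] by simp
lemma eta_ge: "eta \<ge> 2" by (simp add: eta_def)
lemma h_sq: "h\<^sup>2 = eta" using eta_ge by (simp add: h_def)
lemma h_pos: "h > 0" using eta_ge by (simp add: h_def)
lemma g_pos: "g > 0" using R_pos h_pos by (simp add: g_def)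
lemma g_sq: "g\<^sup>2 = R\<^sup>2 * eta / 2" using h_sq by (simp add: g_def power_mult_distrib power_divide)
lemma sph_nonneg: "0 \<le> sph \<phi>" by (simp add: sph_def)
lemma sph_eq: "sph \<phi> = j\<^sup>2 + (R\<^sup>2 - j\<^sup>2) * (sin \<phi>)\<^sup>2" "sph \<phi> = R\<^sup>2 - (R\<^sup>2 - j\<^sup>2) * (cos \<phi>)\<^sup>2"
  unfolding sph_def by (simp add: cos_squared_eq algebra_simps, simp add: sin_squared_eq algebra_simps)
lemma sph_le: "sph \<phi> \<le> R\<^sup>2" using j2_less by (simp add: sph_eq(2))
lemma Dl_sq: "(Dl \<phi>)\<^sup>2 = eta + sph \<phi>" using eta_ge sph_nonneg[of \<phi>] by (simp add: Dl_def)
lemma Dl_pos: "Dl \<phi> > 0" using eta_ge sph_nonneg[of \<phi>] by (simp add: Dl_def)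
lemma Dl_le: "Dl \<phi> \<le> sqrt (eta + R\<^sup>2)" using sph_le[of \<phi>] by (simp add: Dl_def)
lemma Dl_periodic: "Dl (\<phi> + pi) = Dl \<phi>" "Dl (pi - \<phi>) = Dl \<phi>" by (simp_all add: Dl_def sph_def)

lemma sph_deriv: "(sph has_real_derivative 2 * (R\<^sup>2 - j\<^sup>2) * sin \<phi> * cos \<phi>) (at \<phi>)"
  unfolding sph_def[abs_def] by (auto intro!: derivative_eq_intros simp: algebra_simps)

lemma Dl_deriv: "(Dl has_real_derivative (R\<^sup>2 - j\<^sup>2) * sin \<phi> * cos \<phi> / Dl \<phi>) (at \<phi>)"
proof -
  have "eta + sph \<phi> > 0" using eta_ge sph_nonneg[of \<phi>] by simp
  thus ?thesis
    unfolding Dl_def[abs_def] by (auto intro!: derivative_eq_intros sph_deriv simp: field_simps)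
qed

lemma Dl_continuous: "continuous_on S Dl"
  using Dl_deriv by (meson DERIV_isCont continuous_at_imp_continuous_on)

text \<open>Position and extra rotation of the wave as functions of the angle. \<open>X\<close> is
  an elliptic integral of the first kind, and the derivative of \<open>al\<close> is half the
  integrand of \<open>Psi\<close>, prefactor included.\<close>

definition X where "X = (SOME F. F 0 = 0 \<and> (\<forall>\<phi>. (F has_real_derivative sqrt 2 / Dl \<phi>) (at \<phi>)))"
definition al where "al = (SOME F. F 0 = 0 \<and> (\<forall>\<phi>. (F has_real_derivative - (j * R) / (Dl \<phi> * (h + Dl \<phi>))) (at \<phi>)))"

lemma X_0: "X 0 = 0" and X_deriv: "(X has_real_derivative sqrt 2 / Dl \<phi>) (at \<phi>)"
proof -
  have "continuous_on UNIV (\<lambda>\<phi>. sqrt 2 / Dl \<phi>)"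
    using Dl_pos by (intro continuous_intros Dl_continuous) (metis less_irrefl)
  hence "X 0 = 0 \<and> (\<forall>\<phi>. (X has_real_derivative sqrt 2 / Dl \<phi>) (at \<phi>))"
    unfolding X_def by (intro someI_ex[of "\<lambda>F. F 0 = 0 \<and> (\<forall>\<phi>. (F has_real_derivative sqrt 2 / Dl \<phi>) (at \<phi>))"] real_antiderivative)
  thus "X 0 = 0" "(X has_real_derivative sqrt 2 / Dl \<phi>) (at \<phi>)" by auto
qed

lemma al_0: "al 0 = 0" and al_deriv: "(al has_real_derivative - (j * R) / (Dl \<phi> * (h + Dl \<phi>))) (at \<phi>)"
proof -
  have nz: "Dl \<phi> * (h + Dl \<phi>) \<noteq> 0" for \<phi> using Dl_pos[of \<phi>] h_pos by simp
  have "continuous_on UNIV (\<lambda>\<phi>. - (j * R) / (Dl \<phi> * (h + Dl \<phi>)))"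
    using nz by (intro continuous_intros Dl_continuous) simp
  hence "al 0 = 0 \<and> (\<forall>\<phi>. (al has_real_derivative - (j * R) / (Dl \<phi> * (h + Dl \<phi>))) (at \<phi>))"
    unfolding al_def by (intro someI_ex[of "\<lambda>F. F 0 = 0 \<and> (\<forall>\<phi>. (F has_real_derivative - (j * R) / (Dl \<phi> * (h + Dl \<phi>))) (at \<phi>))"] real_antiderivative)
  thus "al 0 = 0" "(al has_real_derivative - (j * R) / (Dl \<phi> * (h + Dl \<phi>))) (at \<phi>)" by auto
qed

text \<open>When the angle advances by pi, cosine and sine change sign; this is the summand
  \<open>pi\<close> of the phase increment \<open>Th\<close>.\<close>

definition T where "T = X pi"
definition Th where "Th = pi + al pi"

lemma X_shift: "X (\<phi> + pi) = X \<phi> + T"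
proof -
  have "((\<lambda>\<phi>. X (\<phi> + pi) - X \<phi>) has_real_derivative 0) (at \<phi>)" for \<phi>
    by (rule DERIV_cong[OF DERIV_diff[OF DERIV_chain2[OF X_deriv] X_deriv]])
       (auto intro!: derivative_eq_intros simp: Dl_periodic)
  from DERIV_zero_eq[OF this, of \<phi> 0] show ?thesis by (simp add: X_0 T_def)
qed

lemma al_shift: "al (\<phi> + pi) = al \<phi> + al pi"
proof -
  have "((\<lambda>\<phi>. al (\<phi> + pi) - al \<phi>) has_real_derivative 0) (at \<phi>)" for \<phi>
    by (rule DERIV_cong[OF DERIV_diff[OF DERIV_chain2[OF al_deriv] al_deriv]])
       (auto intro!: derivative_eq_intros simp: Dl_periodic)
  from DERIV_zero_eq[OF this, of \<phi> 0] show ?thesis by (simp add: al_0)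
qed

text \<open>The integrand is symmetric about \<open>pi / 2\<close>.\<close>

lemma X_half: "X (pi / 2) = T / 2"
proof -
  have "((\<lambda>\<phi>. X (pi - \<phi>) + X \<phi>) has_real_derivative 0) (at \<phi>)" for \<phi>
    by (rule DERIV_cong[OF DERIV_add[OF DERIV_chain2[OF X_deriv] X_deriv]])
       (auto intro!: derivative_eq_intros simp: Dl_periodic)
  from DERIV_zero_eq[OF this, of "pi / 2" 0] show ?thesis by (simp add: X_0 T_def)
qed

lemma al_half: "al (pi / 2) = al pi / 2"
proof -
  have "((\<lambda>\<phi>. al (pi - \<phi>) + al \<phi>) has_real_derivative 0) (at \<phi>)" for \<phi>
    by (rule DERIV_cong[OF DERIV_add[OF DERIV_chain2[OF al_deriv] al_deriv]])
       (auto intro!: derivative_eq_intros simp: Dl_periodic)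
  from DERIV_zero_eq[OF this, of "pi / 2" 0] show ?thesis by (simp add: al_0)
qed

text \<open>A lower bound for the derivative of \<open>X\<close>; it makes \<open>X\<close> a
  bijection with Lipschitz inverse.\<close>

definition cX where "cX = sqrt 2 / sqrt (eta + R\<^sup>2)"

lemma cX_pos: "cX > 0" using eta_ge by (simp add: cX_def add_pos_nonneg)

lemma X_expand: "a \<le> b \<Longrightarrow> cX * (b - a) \<le> X b - X a"
proof -
  assume ab: "a \<le> b"
  have "X a - cX * a \<le> X b - cX * b"
  proof (rule DERIV_nonneg_imp_nondecreasing[OF ab])
    fix x
    have "cX \<le> sqrt 2 / Dl x" unfolding cX_def using Dl_le Dl_pos eta_ge by (intro divide_left_mono) (auto intro!: mult_pos_pos add_pos_nonneg)
    thus "\<exists>y. ((\<lambda>\<phi>. X \<phi> - cX * \<phi>) has_real_derivative y) (at x) \<and> 0 \<le> y"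
      by (intro exI[of _ "sqrt 2 / Dl x - cX"]) (auto intro!: derivative_eq_intros X_deriv)
  qed
  thus ?thesis by (simp add: algebra_simps)
qed

lemma X_expand': "cX * \<bar>b - a\<bar> \<le> \<bar>X b - X a\<bar>"
  using X_expand[of a b] X_expand[of b a] cX_pos
  by (cases "a \<le> b") (auto simp: abs_if algebra_simps mult_left_mono)

text \<open>The Jacobi amplitude belonging to \<open>X\<close>.\<close>

definition ph where "ph x = (THE \<phi>. X \<phi> = x)"

lemma X_ph: "X (ph x) = x" and ph_X: "ph (X \<phi>) = \<phi>"
proof -
  have inj: "a = b" if "X a = X b" for a b using X_expand'[of b a] that cX_pos by (simp add: mult_le_0_iff)
  define M where "M = \<bar>x\<bar> / cX"
  have M0: "M \<ge> 0" using cX_pos by (simp add: M_def)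
  have "cX * M = \<bar>x\<bar>" using cX_pos by (simp add: M_def)
  hence "X (- M) \<le> x" "x \<le> X M" using X_expand[of 0 M] X_expand[of "-M" 0] M0 X_0 by auto
  moreover have "continuous_on {-M..M} X" using X_deriv by (meson DERIV_isCont continuous_at_imp_continuous_on)
  ultimately have "\<exists>\<phi>. X \<phi> = x" using IVT'[of X "-M" x M] M0 by auto
  hence "\<exists>!\<phi>. X \<phi> = x" using inj by blast
  thus "X (ph x) = x" unfolding ph_def by (rule theI')
  show "ph (X \<phi>) = \<phi>" unfolding ph_def using inj by blast
qed

lemma ph_0: "ph 0 = 0" using ph_X[of 0] by (simp add: X_0)
lemma ph_shift: "ph (x + T) = ph x + pi"
  using ph_X[of "ph x + pi"] by (simp add: X_shift X_ph)
lemma ph_T: "ph T = pi" unfolding T_def by (rule ph_X)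
lemma ph_half: "ph (T / 2) = pi / 2" using ph_X[of "pi / 2"] by (simp add: X_half)
lemma T_pos: "T > 0"
proof -
  have "0 < cX * pi" using cX_pos by simp
  thus ?thesis using X_expand[of 0 pi] by (simp add: X_0 T_def)
qed

lemma ph_mono:
  assumes "x < y" shows "ph x < ph y"
proof (rule ccontr)
  assume "\<not> ?thesis"
  hence "cX * (ph x - ph y) \<le> X (ph x) - X (ph y)" "0 \<le> cX * (ph x - ph y)"
    using X_expand[of "ph y" "ph x"] cX_pos by auto
  thus False using assms by (simp add: X_ph)
qed

lemma ph_continuous: "isCont ph x"
  unfolding isCont_def
proof (rule LIM_zero_cancel, rule Lim_null_comparison)
  show "\<forall>\<^sub>F y in at x. norm (ph y - ph x) \<le> \<bar>y - x\<bar> / cX"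
  proof (intro always_eventually allI)
    fix y show "norm (ph y - ph x) \<le> \<bar>y - x\<bar> / cX"
      using X_expand'[of "ph y" "ph x"] cX_pos by (simp add: X_ph field_simps)
  qed
  have "((\<lambda>y. \<bar>y - x\<bar> / cX) \<longlongrightarrow> \<bar>x - x\<bar> / cX) (at x)"
    using cX_pos by (intro tendsto_intros) auto
  thus "((\<lambda>y. \<bar>y - x\<bar> / cX) \<longlongrightarrow> 0) (at x)" by simp
qed

lemma ph_deriv: "(ph has_real_derivative Dl (ph x) / sqrt 2) (at x)"
proof -
  have "(ph has_real_derivative inverse (sqrt 2 / Dl (ph x))) (at x)"
    by (rule DERIV_inverse_function[where f = X and a = "x - 1" and b = "x + 1", OF X_deriv])
       (use Dl_pos[of "ph x"] X_ph ph_continuous in auto)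
  thus ?thesis by simp
qed

section \<open>The profile and its derivative in closed form\<close>

definition Cx where "Cx x = cos (ph x)"
definition Sx where "Sx x = sin (ph x)"
definition Dx where "Dx x = Dl (ph x)"
definition ax where "ax x = al (ph x)"

lemma Cx_deriv: "(Cx has_real_derivative - (Sx x * Dx x / sqrt 2)) (at x)"
  unfolding Cx_def[abs_def] Sx_def Dx_def by (auto intro!: derivative_eq_intros ph_deriv)
lemma Sx_deriv: "(Sx has_real_derivative Cx x * Dx x / sqrt 2) (at x)"
  unfolding Sx_def[abs_def] Cx_def Dx_def by (auto intro!: derivative_eq_intros ph_deriv)
lemma Dx_deriv: "(Dx has_real_derivative (R\<^sup>2 - j\<^sup>2) * Sx x * Cx x / sqrt 2) (at x)"
  unfolding Dx_def[abs_def] Cx_def Sx_def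
  by (rule DERIV_cong[OF DERIV_chain2[OF Dl_deriv ph_deriv]]) (use Dl_pos[of "ph x"] in simp)
lemma ax_deriv: "(ax has_real_derivative - (j * R) / (sqrt 2 * (h + Dx x))) (at x)"
  unfolding ax_def[abs_def] Dx_def
  by (rule DERIV_cong[OF DERIV_chain2[OF al_deriv ph_deriv]]) (use Dl_pos[of "ph x"] in simp)

lemma SC: "(Sx x)\<^sup>2 + (Cx x)\<^sup>2 = 1" by (simp add: Sx_def Cx_def)
lemma Dx_pos: "Dx x > 0" by (simp add: Dx_def Dl_pos)

definition sx where "sx x = sph (ph x)"

lemma sx_eq: "sx x = j\<^sup>2 * (Cx x)\<^sup>2 + R\<^sup>2 * (Sx x)\<^sup>2" by (simp add: sx_def sph_def Cx_def Sx_def)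
lemma sx_eq': "(R\<^sup>2 - j\<^sup>2) * (Sx x)\<^sup>2 = sx x - j\<^sup>2" "(R\<^sup>2 - j\<^sup>2) * (Cx x)\<^sup>2 = R\<^sup>2 - sx x"
  using sph_eq[of "ph x"] by (auto simp: sx_def Cx_def Sx_def)
lemma Dx_sq: "(Dx x)\<^sup>2 = h\<^sup>2 + sx x" by (simp add: Dx_def Dl_sq h_sq sx_def)
lemma sx_factor: "sx x = (Dx x - h) * (h + Dx x)" using Dx_sq[of x] by (simp add: algebra_simps power2_eq_square)

text \<open>With \<open>N = h + D\<close> the real and imaginary parts of \<open>W'\<close> in the frame rotating with \<open>e\<^sup>i\<^sup>a\<close>.\<close>

definition px where "px x = j * Sx x * (R\<^sup>2 / (h + Dx x) - Dx x) / sqrt 2"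
definition qx where "qx x = R * Cx x * (Dx x - j\<^sup>2 / (h + Dx x)) / sqrt 2"

text \<open>An ellipse with semi-axes |j| and R, seen in a frame that rotates by
  \<open>ax\<close>.\<close>

definition W where "W x = cis (ax x) * Complex (j * Cx x) (R * Sx x)"
definition W1 where "W1 x = cis (ax x) * Complex (px x) (qx x)"

lemma N_pos: "h + Dx x > 0" using h_pos Dx_pos[of x] by simp

lemma sqrt2_nz: "sqrt 2 \<noteq> (0::real)" by simp

lemma W_deriv: "(W has_vector_derivative W1 x) (at x)"
proof -
  let ?N = "h + Dx x"
  have 1: "((\<lambda>x. cis (ax x)) has_vector_derivative \<i> * of_real (- (j * R) / (sqrt 2 * ?N)) * cis (ax x)) (at x)"
    by (rule has_vector_derivative_cis[OF ax_deriv])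
  have 2: "((\<lambda>x. Complex (j * Cx x) (R * Sx x)) has_vector_derivative Complex (j * - (Sx x * Dx x / sqrt 2)) (R * (Cx x * Dx x / sqrt 2))) (at x)"
    unfolding has_vector_derivative_complex_iff has_real_derivative_iff_has_vector_derivative[symmetric] complex.sel
    by (intro conjI DERIV_cmult Cx_deriv Sx_deriv)
  have eq: "cis (ax x) * Complex (j * - (Sx x * Dx x / sqrt 2)) (R * (Cx x * Dx x / sqrt 2))
      + \<i> * of_real (- (j * R) / (sqrt 2 * ?N)) * cis (ax x) * Complex (j * Cx x) (R * Sx x) = W1 x"
  proof -
    have "Complex (j * - (Sx x * Dx x / sqrt 2)) (R * (Cx x * Dx x / sqrt 2))
      + \<i> * of_real (- (j * R) / (sqrt 2 * ?N)) * Complex (j * Cx x) (R * Sx x) = Complex (px x) (qx x)"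
    proof -
      have rot: "Complex a b + \<i> * of_real r * Complex c d = Complex (a - r * d) (b + r * c)" for a b c d r
        by (simp add: complex_eq_iff)
      have re: "j * - (S * D / q) - - (j * R) / (q * N) * (R * S) = j * S * (R\<^sup>2 / N - D) / q"
       and im: "R * (C * D / q) + - (j * R) / (q * N) * (j * C) = R * C * (D - j\<^sup>2 / N) / q"
        if "q \<noteq> 0" "N \<noteq> 0" for q N S C D :: real
        using that by (simp_all add: divide_simps power2_eq_square) (simp_all only: algebra_simps)
      have "?N \<noteq> 0" using N_pos[of x] by simp
      show ?thesis unfolding rot re[OF sqrt2_nz \<open>?N \<noteq> 0\<close>] im[OF sqrt2_nz \<open>?N \<noteq> 0\<close>] px_def qx_def ..
    qed
    moreover have "c * A + \<i> * r * c * B = c * (A + \<i> * r * B)" for c A B r :: complex by (simp add: algebra_simps)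
    ultimately show ?thesis by (simp only: W1_def)
  qed
  show ?thesis
    unfolding W_def[abs_def] using has_vector_derivative_mult[OF 1 2] unfolding eq .
qed

lemma cmod_W: "cmod2 (W x) = sx x"
  unfolding W_def norm_mult norm_cis cmod_power2 mult_1 complex.sel power_mult_distrib sx_eq ..

lemma cnj_cis_mult: "cnj (cis a * z) * (cis a * w) = cnj z * w"
proof -
  have "cnj (cis a * z) * (cis a * w) = (cnj (cis a) * cis a) * (cnj z * w)" by (simp add: mult_ac)
  thus ?thesis by (simp add: cis_cnj cis_mult)
qed

lemma WW1: "cnj (W x) * W1 x = Complex (j * Cx x * px x + R * Sx x * qx x) (j * Cx x * qx x - R * Sx x * px x)"
  unfolding W_def W1_def cnj_cis_mult by (simp add: complex_eq_iff)

lemma WW1_alg: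
  fixes N q S C D :: real
  assumes "N \<noteq> 0" "q \<noteq> 0"
  shows "j * C * (R * C * (D - j\<^sup>2 / N) / q) - R * S * (j * S * (R\<^sup>2 / N - D) / q)
     = (j * R / q) * (D * (S\<^sup>2 + C\<^sup>2) - (j\<^sup>2 * C\<^sup>2 + R\<^sup>2 * S\<^sup>2) / N)"
    and "j * C * (j * S * (R\<^sup>2 / N - D) / q) + R * S * (R * C * (D - j\<^sup>2 / N) / q)
    = (R\<^sup>2 - j\<^sup>2) * S * C * D / q"
proof -
  \<comment> \<open>With the reciprocals as independent variables both claims are polynomial
    identities.\<close>
  define I K where "I = 1 / N" and "K = 1 / q"
  have e: "a / N = a * I" "a / q = a * K" for a by (simp_all add: I_def K_def)
  show "j * C * (R * C * (D - j\<^sup>2 / N) / q) - R * S * (j * S * (R\<^sup>2 / N - D) / q)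
     = (j * R / q) * (D * (S\<^sup>2 + C\<^sup>2) - (j\<^sup>2 * C\<^sup>2 + R\<^sup>2 * S\<^sup>2) / N)"
    unfolding e by algebra
  show "j * C * (j * S * (R\<^sup>2 / N - D) / q) + R * S * (R * C * (D - j\<^sup>2 / N) / q)
    = (R\<^sup>2 - j\<^sup>2) * S * C * D / q"
    unfolding e by algebra
qed

text \<open>Constancy comes from \<open>s / (h + D) = D - h\<close>, the factored form of
  \<open>D^2 = h^2 + s\<close>.\<close>

lemma W_angular: "Im (cnj (W x) * W1 x) = J"
proof -
  let ?N = "h + Dx x"
  have N: "?N \<noteq> 0" using N_pos[of x] by simp
  have "Im (cnj (W x) * W1 x) = (j * R / sqrt 2) * (Dx x * ((Sx x)\<^sup>2 + (Cx x)\<^sup>2) - sx x / ?N)"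
    unfolding WW1 px_def qx_def complex.sel WW1_alg(1)[OF N sqrt2_nz] sx_eq ..
  also have "sx x / ?N = Dx x - h" using N by (simp add: sx_factor)
  finally show ?thesis unfolding SC by (simp add: J_def g_def)
qed

definition rx where "rx x = Re (cnj (W x) * W1 x)"

lemma rx_eq: "rx x = (R\<^sup>2 - j\<^sup>2) * Sx x * Cx x * Dx x / sqrt 2"
proof -
  have N: "h + Dx x \<noteq> 0" using N_pos[of x] by simp
  show ?thesis unfolding rx_def WW1 px_def qx_def complex.sel WW1_alg(2)[OF N sqrt2_nz] ..
qed

lemma sx_deriv: "(sx has_real_derivative 2 * rx x) (at x)"
proof -
  have "(sx has_real_derivative (2 * (R\<^sup>2 - j\<^sup>2) * sin (ph x) * cos (ph x)) * (Dl (ph x) / sqrt 2)) (at x)"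
    unfolding sx_def[abs_def] by (rule DERIV_chain2[OF sph_deriv ph_deriv])
  thus ?thesis by (rule DERIV_cong) (simp add: rx_eq Sx_def Cx_def Dx_def)
qed

text \<open>Differentiating \<open>W1\<close> in the rotating frame adds the terms with
  \<open>a\<close>, so these formulas say exactly that W'' = - (1 + |W|^2) W.\<close>

lemma px_qx_deriv:
  fixes x :: real
  defines "a \<equiv> - (j * R) / (sqrt 2 * (h + Dx x))"
  shows "(px has_real_derivative (a * qx x - (1 + sx x) * (j * Cx x))) (at x)"
    and "(qx has_real_derivative (- a * px x - (1 + sx x) * (R * Sx x))) (at x)"
proof -
  define N where "N = h + Dx x"
  define q :: real where "q = sqrt 2"
  define S C D where "S = Sx x" and "C = Cx x" and "D = Dx x"
  have N: "N \<noteq> 0" and q: "q \<noteq> 0" "q * q = 2" using N_pos[of x] by (auto simp: N_def q_def)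
  note d = Cx_deriv[of x] Sx_deriv[of x] Dx_deriv[of x]
  have dN: "((\<lambda>x. h + Dx x) has_real_derivative (R\<^sup>2 - j\<^sup>2) * S * C / q) (at x)"
    using d(3) by (auto intro!: derivative_eq_intros simp: S_def C_def q_def)
  have dI: "((\<lambda>x. c / (h + Dx x)) has_real_derivative - c * ((R\<^sup>2 - j\<^sup>2) * S * C / q) / N\<^sup>2) (at x)" for c
    by (rule DERIV_cong[OF DERIV_divide[OF DERIV_const dN]]) (use N in \<open>simp_all add: N_def power2_eq_square\<close>)
  have s1: "(R\<^sup>2 - j\<^sup>2) * S\<^sup>2 = sx x - j\<^sup>2" and s2: "(R\<^sup>2 - j\<^sup>2) * C\<^sup>2 = R\<^sup>2 - sx x"
    using sx_eq' by (auto simp: S_def C_def)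
  have sD: "sx x = (D - h) * N" by (simp add: sx_factor D_def N_def)
  have h2: "h * h = 2 + j\<^sup>2 + R\<^sup>2" using h_sq by (simp add: power2_eq_square eta_def)
  have DN: "D = N - h" by (simp add: D_def N_def)
  have p: "(px has_real_derivative (j * (C * D / q) * (R\<^sup>2 / N - D) + j * S * (- R\<^sup>2 * ((R\<^sup>2 - j\<^sup>2) * S * C / q) / N\<^sup>2 - (R\<^sup>2 - j\<^sup>2) * S * C / q)) / q) (at x)"
    unfolding px_def[abs_def]
    by (rule DERIV_cong[OF DERIV_cdivide[OF DERIV_mult[OF DERIV_cmult[OF d(2)] DERIV_diff[OF dI d(3)]]]])
       (simp add: S_def C_def D_def N_def q_def algebra_simps)
  have pe: "(j * (C * D / q) * (R\<^sup>2 / N - D) + j * S * (- R\<^sup>2 * ((R\<^sup>2 - j\<^sup>2) * S * C / q) / N\<^sup>2 - (R\<^sup>2 - j\<^sup>2) * S * C / q)) / q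
     = a * qx x - (1 + sx x) * (j * C)"
  proof -
    have "(j * (C * D / q) * (R\<^sup>2 / N - D) + j * S * (- R\<^sup>2 * ((R\<^sup>2 - j\<^sup>2) * S * C / q) / N\<^sup>2 - (R\<^sup>2 - j\<^sup>2) * S * C / q)) / q
      = j * C / (q * q) * (D * (R\<^sup>2 / N - D) - (R\<^sup>2 / N\<^sup>2 + 1) * ((R\<^sup>2 - j\<^sup>2) * S\<^sup>2))"
      using q N by (simp add: divide_simps) (simp add: power2_eq_square algebra_simps)
    also have "\<dots> = j * C / 2 * (D * (R\<^sup>2 / N - D) - (R\<^sup>2 / N\<^sup>2 + 1) * (sx x - j\<^sup>2))" by (simp add: s1 q)
    finally have L: "(j * (C * D / q) * (R\<^sup>2 / N - D) + j * S * (- R\<^sup>2 * ((R\<^sup>2 - j\<^sup>2) * S * C / q) / N\<^sup>2 - (R\<^sup>2 - j\<^sup>2) * S * C / q)) / q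
      = j * C / 2 * (D * (R\<^sup>2 / N - D) - (R\<^sup>2 / N\<^sup>2 + 1) * (sx x - j\<^sup>2))" .
    have "a * qx x = - (j * C) / (q * q) * (R\<^sup>2 / N * (D - j\<^sup>2 / N))"
    proof -
      have "- (j * R) / (q * M) * (R * c * Y / q) = - (j * c) / (q * q) * (R\<^sup>2 / M * Y)" for c M Y
        by (simp add: divide_inverse mult_ac power2_eq_square)
      thus ?thesis unfolding a_def qx_def C_def N_def D_def q_def .
    qed
    hence R: "a * qx x = - (j * C) / 2 * (R\<^sup>2 / N * (D - j\<^sup>2 / N))" by (simp add: q)
    \<comment> \<open>The fractions collapse through \<open>s = (D - h) * N\<close>, and the
      constant left over is \<open>j^2 + R^2 - h^2 = - 2\<close>.\<close>
    have "D * (R\<^sup>2 / N - D) - (R\<^sup>2 / N\<^sup>2 + 1) * (sx x - j\<^sup>2) + R\<^sup>2 / N * (D - j\<^sup>2 / N) = - 2 - 2 * sx x"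
    proof -
      have "D * (R\<^sup>2 / N - D) - (R\<^sup>2 / N\<^sup>2 + 1) * (sx x - j\<^sup>2) + R\<^sup>2 / N * (D - j\<^sup>2 / N)
        = 2 * R\<^sup>2 * D / N - R\<^sup>2 * (sx x / N) / N - D\<^sup>2 - sx x + j\<^sup>2"
        using N by (simp add: divide_simps) (simp add: power2_eq_square algebra_simps)
      also have "sx x / N = D - h" using N by (simp add: sD)
      also have "2 * R\<^sup>2 * D / N - R\<^sup>2 * (D - h) / N = R\<^sup>2"
        using N unfolding DN by (simp add: divide_simps) (simp add: algebra_simps)
      also have "D\<^sup>2 = h * h + sx x" using Dx_sq[of x] by (simp add: D_def power2_eq_square)
      finally show ?thesis using h2 by simp
    qed
    hence "D * (R\<^sup>2 / N - D) - (R\<^sup>2 / N\<^sup>2 + 1) * (sx x - j\<^sup>2) = - 2 - 2 * sx x - R\<^sup>2 / N * (D - j\<^sup>2 / N)" by linarith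
    moreover have "c / 2 * P = - c / 2 * Y - (1 + s) * c" if "P = - 2 - 2 * s - Y" for c P s Y :: real
      unfolding that by (simp add: field_simps)
    ultimately show ?thesis unfolding L R by blast
  qed
  show "(px has_real_derivative (a * qx x - (1 + sx x) * (j * Cx x))) (at x)"
    using p unfolding pe by (simp add: C_def)
  have qd: "(qx has_real_derivative (R * - (S * D / q) * (D - j\<^sup>2 / N) + R * C * ((R\<^sup>2 - j\<^sup>2) * S * C / q - - j\<^sup>2 * ((R\<^sup>2 - j\<^sup>2) * S * C / q) / N\<^sup>2)) / q) (at x)"
    unfolding qx_def[abs_def]
    by (rule DERIV_cong[OF DERIV_cdivide[OF DERIV_mult[OF DERIV_cmult[OF d(1)] DERIV_diff[OF d(3) dI]]]])
       (simp add: S_def C_def D_def N_def q_def algebra_simps)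
  have qe: "(R * - (S * D / q) * (D - j\<^sup>2 / N) + R * C * ((R\<^sup>2 - j\<^sup>2) * S * C / q - - j\<^sup>2 * ((R\<^sup>2 - j\<^sup>2) * S * C / q) / N\<^sup>2)) / q
     = - a * px x - (1 + sx x) * (R * S)"
  proof -
    have "(R * - (S * D / q) * (D - j\<^sup>2 / N) + R * C * ((R\<^sup>2 - j\<^sup>2) * S * C / q - - j\<^sup>2 * ((R\<^sup>2 - j\<^sup>2) * S * C / q) / N\<^sup>2)) / q
      = R * S / (q * q) * (- D * (D - j\<^sup>2 / N) + (1 + j\<^sup>2 / N\<^sup>2) * ((R\<^sup>2 - j\<^sup>2) * C\<^sup>2))"
      using q N by (simp add: divide_simps) (simp add: power2_eq_square algebra_simps)
    also have "\<dots> = R * S / 2 * (- D * (D - j\<^sup>2 / N) + (1 + j\<^sup>2 / N\<^sup>2) * (R\<^sup>2 - sx x))" by (simp add: s2 q)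
    finally have L: "(R * - (S * D / q) * (D - j\<^sup>2 / N) + R * C * ((R\<^sup>2 - j\<^sup>2) * S * C / q - - j\<^sup>2 * ((R\<^sup>2 - j\<^sup>2) * S * C / q) / N\<^sup>2)) / q
      = R * S / 2 * (- D * (D - j\<^sup>2 / N) + (1 + j\<^sup>2 / N\<^sup>2) * (R\<^sup>2 - sx x))" .
    have "- a * px x = R * S / (q * q) * (j\<^sup>2 / N * (R\<^sup>2 / N - D))"
    proof -
      have "- (- (j * R) / (q * M)) * (j * c * Y / q) = R * c / (q * q) * (j\<^sup>2 / M * Y)" for c M Y
        by (simp add: divide_inverse mult_ac power2_eq_square)
      thus ?thesis unfolding a_def px_def S_def N_def D_def q_def .
    qed
    hence R: "- a * px x = R * S / 2 * (j\<^sup>2 / N * (R\<^sup>2 / N - D))" by (simp add: q)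
    have "- D * (D - j\<^sup>2 / N) + (1 + j\<^sup>2 / N\<^sup>2) * (R\<^sup>2 - sx x) - j\<^sup>2 / N * (R\<^sup>2 / N - D) = - 2 - 2 * sx x"
    proof -
      have "- D * (D - j\<^sup>2 / N) + (1 + j\<^sup>2 / N\<^sup>2) * (R\<^sup>2 - sx x) - j\<^sup>2 / N * (R\<^sup>2 / N - D)
        = 2 * j\<^sup>2 * D / N - j\<^sup>2 * (sx x / N) / N - D\<^sup>2 + R\<^sup>2 - sx x"
        using N by (simp add: divide_simps) (simp add: power2_eq_square algebra_simps)
      also have "sx x / N = D - h" using N by (simp add: sD)
      also have "2 * j\<^sup>2 * D / N - j\<^sup>2 * (D - h) / N = j\<^sup>2"
        using N unfolding DN by (simp add: divide_simps) (simp add: algebra_simps)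
      also have "D\<^sup>2 = h * h + sx x" using Dx_sq[of x] by (simp add: D_def power2_eq_square)
      finally show ?thesis using h2 by simp
    qed
    hence "- D * (D - j\<^sup>2 / N) + (1 + j\<^sup>2 / N\<^sup>2) * (R\<^sup>2 - sx x) = - 2 - 2 * sx x + j\<^sup>2 / N * (R\<^sup>2 / N - D)" by linarith
    moreover have "c / 2 * P = c / 2 * Y - (1 + s) * c" if "P = - 2 - 2 * s + Y" for c P s Y :: real
      unfolding that by (simp add: field_simps)
    ultimately show ?thesis unfolding L R by blast
  qed
  show "(qx has_real_derivative (- a * px x - (1 + sx x) * (R * Sx x))) (at x)"
    using qd unfolding qe by (simp add: S_def)
qed

lemma W1_deriv: "(W1 has_vector_derivative - of_real (1 + sx x) * W x) (at x)"
proof -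
  define a where "a = - (j * R) / (sqrt 2 * (h + Dx x))"
  have 1: "((\<lambda>x. cis (ax x)) has_vector_derivative \<i> * of_real a * cis (ax x)) (at x)"
    unfolding a_def by (rule has_vector_derivative_cis[OF ax_deriv])
  have 2: "((\<lambda>x. Complex (px x) (qx x)) has_vector_derivative Complex (a * qx x - (1 + sx x) * (j * Cx x)) (- a * px x - (1 + sx x) * (R * Sx x))) (at x)"
    unfolding has_vector_derivative_complex_iff has_real_derivative_iff_has_vector_derivative[symmetric] complex.sel a_def
    by (intro conjI px_qx_deriv)
  have "Complex (a * qx x - (1 + sx x) * (j * Cx x)) (- a * px x - (1 + sx x) * (R * Sx x)) + \<i> * of_real a * Complex (px x) (qx x)
    = - of_real (1 + sx x) * Complex (j * Cx x) (R * Sx x)"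
    by (simp add: complex_eq_iff algebra_simps)
  moreover have "c * A + \<i> * r * c * B = c * (A + \<i> * r * B)" for c A B r :: complex by (simp add: algebra_simps)
  ultimately have eq: "cis (ax x) * Complex (a * qx x - (1 + sx x) * (j * Cx x)) (- a * px x - (1 + sx x) * (R * Sx x)) + \<i> * of_real a * cis (ax x) * Complex (px x) (qx x)
    = cis (ax x) * (- of_real (1 + sx x) * Complex (j * Cx x) (R * Sx x))" by (simp only:)
  have eq': "cis (ax x) * (- of_real (1 + sx x) * Complex (j * Cx x) (R * Sx x)) = - of_real (1 + sx x) * W x"
    by (simp add: W_def)
  show ?thesis
    unfolding W1_def[abs_def] using has_vector_derivative_mult[OF 1 2] unfolding eq eq' .
qed

lemma W_0: "W 0 = of_real j" and W1_0: "W1 0 = \<i> * of_real g"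
proof -
  have C0: "Cx 0 = 1" "Sx 0 = 0" "ax 0 = 0" by (simp_all add: Cx_def Sx_def ax_def ph_0 al_0)
  show "W 0 = of_real j" by (simp add: W_def C0 complex_eq_iff)
  have "sx 0 = j\<^sup>2" by (simp add: sx_eq C0)
  hence "j\<^sup>2 / (h + Dx 0) = Dx 0 - h" using sx_factor[of 0] N_pos[of 0] by (simp add: field_simps)
  thus "W1 0 = \<i> * of_real g"
    by (simp add: W1_def C0 complex_eq_iff px_def qx_def g_def)
qed

text \<open>The derivative vanishes by the equation, so the value at the origin decides.\<close>

lemma W_energy: "cmod2 (W1 x) / 2 + sx x / 2 + (sx x)\<^sup>2 / 4 = E"
proof -
  let ?f = "\<lambda>x. Re (cnj (W1 x) * W1 x) / 2 + sx x / 2 + (sx x)\<^sup>2 / 4"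
  have "(?f has_real_derivative 0) (at x)" for x
  proof -
    have c: "((\<lambda>x. cnj (W1 x)) has_vector_derivative cnj (- of_real (1 + sx x) * W x)) (at x)"
      by (rule bounded_linear.has_vector_derivative[OF bounded_linear_cnj W1_deriv])
    have "((\<lambda>x. Re (cnj (W1 x) * W1 x)) has_real_derivative Re (cnj (W1 x) * (- of_real (1 + sx x) * W x) + cnj (- of_real (1 + sx x) * W x) * W1 x)) (at x)"
      unfolding has_real_derivative_iff_has_vector_derivative
      by (rule bounded_linear.has_vector_derivative[OF bounded_linear_Re has_vector_derivative_mult[OF c W1_deriv]])
    moreover have "Re (cnj (W1 x) * (- of_real (1 + sx x) * W x) + cnj (- of_real (1 + sx x) * W x) * W1 x) = - 2 * (1 + sx x) * rx x"
      by (simp add: rx_def algebra_simps)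
    ultimately have d: "((\<lambda>x. Re (cnj (W1 x) * W1 x)) has_real_derivative - 2 * (1 + sx x) * rx x) (at x)" by simp
    show ?thesis
      by (rule DERIV_cong[OF DERIV_add[OF DERIV_add[OF DERIV_cdivide[OF d] DERIV_cdivide[OF sx_deriv]] DERIV_cdivide[OF DERIV_power[OF sx_deriv, of 2]]]])
         (simp add: field_simps)
  qed
  from DERIV_zero_eq[OF this, of x 0] have "?f x = ?f 0" .
  moreover have "sx 0 = j\<^sup>2" using cmod_W[of 0] by (simp add: W_0)
  ultimately show ?thesis
    unfolding Re_cnj_mult_self by (simp add: W1_0 E_def norm_mult)
qed

lemma W_shift: "W (x + T) = cis Th * W x" and W1_shift: "W1 (x + T) = cis Th * W1 x"
  and sx_shift: "sx (x + T) = sx x"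
proof -
  have e: "Cx (x + T) = - Cx x" "Sx (x + T) = - Sx x" "Dx (x + T) = Dx x" "ax (x + T) = ax x + al pi"
    by (simp_all add: Cx_def Sx_def Dx_def ax_def ph_shift Dl_periodic al_shift)
  have c: "cis (ax x + al pi) * (- z) = cis Th * (cis (ax x) * z)" for z
  proof -
    have "cis Th = - cis (al pi)" unfolding Th_def cis_mult[symmetric] by simp
    thus ?thesis by (simp add: cis_mult[symmetric])
  qed
  have "Complex (j * - Cx x) (R * - Sx x) = - Complex (j * Cx x) (R * Sx x)" by (simp add: complex_eq_iff)
  thus "W (x + T) = cis Th * W x" unfolding W_def e by (simp only: c)
  have "Complex (px (x + T)) (qx (x + T)) = - Complex (px x) (qx x)" by (simp add: complex_eq_iff px_def qx_def e)
  thus "W1 (x + T) = cis Th * W1 x" unfolding W1_def e by (simp only: c)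
  show "sx (x + T) = sx x" by (simp add: sx_eq e)
qed

lemma rx_sign: "0 < x \<Longrightarrow> x < T / 2 \<Longrightarrow> 0 < rx x" "T / 2 < x \<Longrightarrow> x < T \<Longrightarrow> rx x < 0"
  "rx 0 = 0" "rx (T / 2) = 0" "rx T = 0"
proof -
  have k: "(R\<^sup>2 - j\<^sup>2) * Dx x / sqrt 2 > 0" for x using j2_less Dx_pos[of x] by simp
  have e: "rx x = ((R\<^sup>2 - j\<^sup>2) * Dx x / sqrt 2) * (Sx x * Cx x)" for x by (simp add: rx_eq mult_ac)
  show "0 < rx x" if "0 < x" "x < T / 2"
  proof -
    have "0 < ph x" "ph x < pi / 2" using ph_mono[OF that(1)] ph_mono[OF that(2)] by (simp_all add: ph_0 ph_half)
    hence "0 < Sx x * Cx x" unfolding Sx_def Cx_def by (intro mult_pos_pos sin_gt_zero cos_gt_zero) auto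
    thus ?thesis unfolding e using k by (rule mult_pos_pos[rotated])
  qed
  show "rx x < 0" if "T / 2 < x" "x < T"
  proof -
    have p: "pi / 2 < ph x" "ph x < pi" using ph_mono[OF that(1)] ph_mono[OF that(2)] by (simp_all add: ph_T ph_half)
    hence "cos (ph x) < cos (pi / 2)" by (intro cos_monotone_0_pi) auto
    hence "Sx x * Cx x < 0" unfolding Sx_def Cx_def using p by (intro mult_pos_neg sin_gt_zero) auto
    thus ?thesis unfolding e using k mult_pos_neg by blast
  qed
qed (simp_all add: rx_eq Sx_def Cx_def ph_0 ph_half ph_T)

lemma sx_le: "sx x \<le> R\<^sup>2" "0 \<le> sx x" by (simp_all add: sx_def sph_le sph_nonneg)

lemma wave_is_profile: "is_profile J E W"
  unfolding is_profile_def
proof (intro exI allI conjI)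
  fix x
  show "(W has_vector_derivative W1 x) (at x)" by (rule W_deriv)
  show "(W1 has_vector_derivative - W x - cmod2 (W x) *\<^sub>R W x) (at x)"
    using W1_deriv[of x] unfolding cmod_W by (simp add: scaleR_conv_of_real algebra_simps)
  show "J = Im (cnj (W x) * W1 x)" by (simp only: W_angular)
  have "(cmod (W x))^4 = (sx x)\<^sup>2" unfolding cmod_W[symmetric] by simp
  thus "E = cmod2 (W1 x) / 2 + cmod2 (W x) / 2 + (cmod (W x))^4 / 4"
    unfolding cmod_W using W_energy[of x] by simp
qed

end

section \<open>Gronwall and Lipschitz estimates\<close>

lemma gronwall_zero:
  fixes Q :: "real \<Rightarrow> real"
  assumes d: "\<And>x. (Q has_real_derivative Q' x) (at x)" and b: "\<And>x. \<bar>Q' x\<bar> \<le> K * Q x"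
    and nn: "\<And>x. 0 \<le> Q x" and z: "Q 0 = 0"
  shows "Q x = 0"
proof -
  have e: "((\<lambda>x. Q x * exp (c * x)) has_real_derivative (Q' x + c * Q x) * exp (c * x)) (at x)" for c x
    by (rule DERIV_cong[OF DERIV_mult[OF d]]) (auto intro!: derivative_eq_intros simp: algebra_simps)
  have "Q x \<le> 0"
  proof (cases "0 \<le> x")
    case True
    have "Q x * exp (- K * x) \<le> Q 0 * exp (- K * 0)"
    proof (rule DERIV_nonpos_imp_nonincreasing[OF True])
      fix y
      have "(Q' y + - K * Q y) * exp (- K * y) \<le> 0"
        using b[of y] by (intro mult_nonpos_nonneg) auto
      thus "\<exists>t. ((\<lambda>x. Q x * exp (- K * x)) has_real_derivative t) (at y) \<and> t \<le> 0" using e by blast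
    qed
    thus ?thesis using z by (simp add: mult_le_0_iff)
  next
    case False
    have "Q x * exp (K * x) \<le> Q 0 * exp (K * 0)"
    proof (rule DERIV_nonneg_imp_nondecreasing[of x 0 "\<lambda>x. Q x * exp (K * x)"])
      fix y
      have "0 \<le> (Q' y + K * Q y) * exp (K * y)"
        using b[of y] by (intro mult_nonneg_nonneg) auto
      thus "\<exists>t. ((\<lambda>x. Q x * exp (K * x)) has_real_derivative t) (at y) \<and> 0 \<le> t" using e by blast
    qed (use False in simp)
    thus ?thesis using z by (simp add: mult_le_0_iff)
  qed
  thus ?thesis using nn[of x] by simp
qed

lemma cubic_lipschitz:
  fixes a b :: complex
  assumes "cmod a \<le> r" "cmod b \<le> r"
  shows "cmod (of_real (cmod2 a) * a - of_real (cmod2 b) * b) \<le> 3 * r\<^sup>2 * cmod (a - b)"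
proof -
  have r0: "0 \<le> r" using assms(1) norm_ge_zero order_trans by blast
  have e: "of_real (cmod2 a) * a - of_real (cmod2 b) * b
     = of_real (cmod2 a) * (a - b) + of_real ((cmod a - cmod b) * (cmod a + cmod b)) * b"
    by (simp add: algebra_simps power2_eq_square)
  have "cmod (of_real (cmod2 a) * (a - b)) \<le> r\<^sup>2 * cmod (a - b)"
    unfolding norm_mult norm_of_real using assms by (intro mult_right_mono) (auto intro: power_mono)
  moreover have "cmod (of_real ((cmod a - cmod b) * (cmod a + cmod b)) * b) \<le> 2 * r\<^sup>2 * cmod (a - b)"
  proof -
    have "cmod (of_real ((cmod a - cmod b) * (cmod a + cmod b)) * b) = \<bar>cmod a - cmod b\<bar> * ((cmod a + cmod b) * cmod b)"
      by (simp add: norm_mult abs_mult flip: of_real_mult of_real_add of_real_diff)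
    also have "\<dots> \<le> cmod (a - b) * ((r + r) * r)"
      using assms r0 by (intro mult_mono add_mono norm_triangle_ineq3) auto
    finally show ?thesis by (simp add: power2_eq_square algebra_simps)
  qed
  ultimately show ?thesis unfolding e by (intro order_trans[OF norm_triangle_ineq]) linarith
qed

context cn_wave
begin

section \<open>Roots, period and phase increment of the explicit wave\<close>

lemma twoJ2: "2 * J\<^sup>2 = j\<^sup>2 * R\<^sup>2 * eta"
  by (simp add: J_def power_mult_distrib g_sq)

lemma fourE: "4 * E = eta * (j\<^sup>2 + R\<^sup>2) - j\<^sup>2 * R\<^sup>2"
  unfolding E_def g_sq eta_def by (simp add: field_simps power4_eq_xxxx power2_eq_square)

lemma cubic_factor: "- (y^3) - 2 * y^2 + 4 * E * y - 2 * J\<^sup>2 = - (y - j\<^sup>2) * (y - R\<^sup>2) * (y + eta)"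
  unfolding fourE twoJ2 eta_def by (simp add: algebra_simps power2_eq_square power3_eq_cube)

lemma cubic_factor': "y * (2 * E - y - y\<^sup>2 / 2) - J\<^sup>2 = (y - j\<^sup>2) * (R\<^sup>2 - y) * (y + eta) / 2"
proof -
  have "2 * (y * (2 * E - y - y\<^sup>2 / 2) - J\<^sup>2) = - (y^3) - 2 * y^2 + 4 * E * y - 2 * J\<^sup>2"
    by (simp add: algebra_simps power2_eq_square power3_eq_cube)
  thus ?thesis unfolding cubic_factor by (simp add: algebra_simps)
qed

lemma roots_eq: "roots J E = (j\<^sup>2, R\<^sup>2, - eta)"
proof -
  have set: "{y. - (y^3) - 2 * y^2 + 4 * E * y - 2 * J\<^sup>2 = 0} = {j\<^sup>2, R\<^sup>2, - eta}"
    unfolding cubic_factor by auto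
  have e: "eta > 0" using eta_ge by simp
  show ?thesis
    unfolding roots_def set
  proof (rule the_equality)
    show "case (j\<^sup>2, R\<^sup>2, - eta) of (u, v, w) \<Rightarrow> w < 0 \<and> 0 \<le> u \<and> u < v \<and> {j\<^sup>2, R\<^sup>2, - eta} = {u, v, w}"
      using j2_less e by simp
    fix x :: "real \<times> real \<times> real"
    assume "case x of (u, v, w) \<Rightarrow> w < 0 \<and> 0 \<le> u \<and> u < v \<and> {j\<^sup>2, R\<^sup>2, - eta} = {u, v, w}"
    then obtain u v w where x: "x = (u, v, w)" and y: "w < 0" "0 \<le> u" "u < v" "{j\<^sup>2, R\<^sup>2, - eta} = {u, v, w}"
      by (cases x) auto
    have "- eta \<in> {u, v, w}" using y(4) by blast
    \<comment> \<open>The sign identifies the negative root, the order the other two.\<close>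
    hence 3: "w = - eta" using y e by auto
    have "j\<^sup>2 \<in> {u, v, w}" "R\<^sup>2 \<in> {u, v, w}" using y(4) by blast+
    hence "j\<^sup>2 = u \<or> j\<^sup>2 = v" "R\<^sup>2 = u \<or> R\<^sup>2 = v"
      using 3 e zero_le_power2[of j] zero_le_power2[of R] by (smt (verit) insertE singletonD)+
    thus "x = (j\<^sup>2, R\<^sup>2, - eta)" using 3 x j2_less y(3) by auto
  qed
qed

text \<open>At each angle \<open>s - y3\<close> is the square of \<open>Dl\<close>, so the defining
  integrands are those of \<open>X\<close> and \<open>al\<close> up to constants.\<close>

lemma T_per_eq: "T_per J E = T" and Psi_eq: "Psi J E = al pi"
proof -
  have y3: "y3 J E = - eta" by (simp add: y3_def roots_eq)
  have s: "sqrt (s_fun J E \<phi> - y3 J E) = Dl \<phi>" "sqrt (- y3 J E) = h" for \<phi>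
    by (simp_all add: s_fun_def y1_def y2_def y3 roots_eq sph_def Dl_def h_def add_ac)
  have c1: "continuous_on S (\<lambda>\<phi>. 1 / Dl \<phi>)" and c2: "continuous_on S (\<lambda>\<phi>. 1 / (h * Dl \<phi> * (h + Dl \<phi>)))" for S
    using Dl_pos h_pos by (intro continuous_intros Dl_continuous ballI; metis add_pos_pos less_irrefl mult_pos_pos)+
  have "(LINT \<phi>:{0..pi/2}|lborel. 1 / Dl \<phi>) = X (pi / 2) / sqrt 2 - X 0 / sqrt 2"
    unfolding set_lebesgue_integral_def
  proof (rule integral_FTC_Icc)
    fix x show "((\<lambda>x. X x / sqrt 2) has_vector_derivative 1 / Dl x) (at x within {0..pi/2})"
      unfolding has_real_derivative_iff_has_vector_derivative[symmetric]
      by (rule DERIV_subset[OF DERIV_cong[OF DERIV_cdivide[OF X_deriv]]]) auto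
  qed (auto intro: c1)
  thus "T_per J E = T"
    unfolding T_per_def s by (simp add: X_half X_0 field_simps)
  have "(LINT \<phi>:{0..pi/2}|lborel. - (2 * sqrt 2 * J) * (1 / (h * Dl \<phi> * (h + Dl \<phi>)))) = 2 * al (pi / 2) - 2 * al 0"
    unfolding set_lebesgue_integral_def
  proof (rule integral_FTC_Icc)
    fix x
    have "2 * (- (j * R) / (Dl x * (h + Dl x))) = - (2 * sqrt 2 * J) * (1 / (h * Dl x * (h + Dl x)))"
      using h_pos Dl_pos[of x] by (simp add: J_def g_def)
    hence "((\<lambda>x. 2 * al x) has_real_derivative - (2 * sqrt 2 * J) * (1 / (h * Dl x * (h + Dl x)))) (at x)"
      using DERIV_cmult[OF al_deriv, of 2 x] by simp
    thus "((\<lambda>x. 2 * al x) has_vector_derivative - (2 * sqrt 2 * J) * (1 / (h * Dl x * (h + Dl x)))) (at x within {0..pi/2})"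
      unfolding has_real_derivative_iff_has_vector_derivative[symmetric] by (rule DERIV_subset) simp
  qed (simp, intro continuous_on_mult_left c2)
  hence "- (2 * sqrt 2 * J) * (LINT \<phi>:{0..pi/2}|lborel. 1 / (h * Dl \<phi> * (h + Dl \<phi>))) = al pi"
    unfolding set_integral_mult_right by (simp add: al_half al_0)
  thus "Psi J E = al pi"
    unfolding Psi_def s by simp
qed

lemma k_par_eq: "k_par J E = pi / T" and p_par_eq: "p_par J E = Th / T"
  by (simp_all add: k_par_def p_par_def l_par_def T_per_eq Psi_eq Th_def add_divide_distrib)

section \<open>The mean density and the inequalities that fix the signs\<close>

definition Z where "Z = (SOME F. F 0 = 0 \<and> (\<forall>x. (F has_real_derivative sx x) (at x)))"
definition n where "n = Z T"
text \<open>The mean of |W|^2 over a period.\<close>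

definition sg where "sg = n / T"

lemma sx_continuous: "continuous_on S sx"
  using sx_deriv by (meson DERIV_isCont continuous_at_imp_continuous_on)

lemma Z_0: "Z 0 = 0" and Z_deriv: "(Z has_real_derivative sx x) (at x)"
proof -
  have "Z 0 = 0 \<and> (\<forall>x. (Z has_real_derivative sx x) (at x))"
    unfolding Z_def by (intro someI_ex[of "\<lambda>F. F 0 = 0 \<and> (\<forall>x. (F has_real_derivative sx x) (at x))"] real_antiderivative sx_continuous)
  thus "Z 0 = 0" "(Z has_real_derivative sx x) (at x)" by auto
qed

lemma n_eq: "n = sg * T" using T_pos by (simp add: sg_def)

lemma sg_le: "sg \<le> R\<^sup>2"
proof -
  have "Z T - R\<^sup>2 * T \<le> Z 0 - R\<^sup>2 * 0"
  proof (rule DERIV_nonpos_imp_nonincreasing[of 0 T "\<lambda>x. Z x - R\<^sup>2 * x"])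
    fix x show "\<exists>y. ((\<lambda>x. Z x - R\<^sup>2 * x) has_real_derivative y) (at x) \<and> y \<le> 0"
      using sx_le[of x] by (intro exI[of _ "sx x - R\<^sup>2"]) (auto intro!: derivative_eq_intros Z_deriv)
  qed (use T_pos in simp)
  thus ?thesis using T_pos by (simp add: Z_0 sg_def n_def field_simps)
qed

text \<open>The extreme values of \<open>Dl\<close>, attained where |W| is smallest and
  largest.\<close>

definition aa where "aa = sqrt (eta + j\<^sup>2)"
definition bb where "bb = sqrt (eta + R\<^sup>2)"

lemma aa_bb: "0 < aa" "aa < bb" "aa\<^sup>2 = eta + j\<^sup>2" "bb\<^sup>2 = eta + R\<^sup>2"
proof -
  have "0 < eta + j\<^sup>2" using eta_ge by (simp add: add_pos_nonneg)
  thus "0 < aa" "aa < bb" "aa\<^sup>2 = eta + j\<^sup>2" "bb\<^sup>2 = eta + R\<^sup>2"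
    using j2_less by (auto simp: aa_def bb_def)
qed

text \<open>The weight function \<open>f = b S\<^sup>2 - a C\<^sup>2\<close> satisfies \<open>s - (a b - \<eta>) = (b - a) f\<close>, and it is a square
  up to an exact derivative; hence the mean of \<open>s\<close> is at least \<open>a b - \<eta>\<close>.\<close>

lemma sg_ge: "aa * bb - eta \<le> sg"
proof -
  \<comment> \<open>This factor lets the derivative of the last term of \<open>F\<close> complete
    \<open>(bb - aa) * f\<close> to a square over \<open>2 * D^2\<close>. That term vanishes at both
    ends of the period, where \<open>Sx\<close> is zero.\<close>
  define c where "c = (bb - aa) * (aa + bb) / 2 * sqrt 2"
  define F where "F = (\<lambda>x. Z x - (aa * bb - eta) * x + c * (Sx x * Cx x / Dx x))"
  define f where "f = (\<lambda>x. bb * (Sx x)\<^sup>2 - aa * (Cx x)\<^sup>2)"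
  have der: "(F has_real_derivative ((bb - aa) * f x)\<^sup>2 / (2 * (Dx x)\<^sup>2)) (at x)" for x
  proof -
    define S C D where "S = Sx x" and "C = Cx x" and "D = Dx x"
    have D0: "D \<noteq> 0" using Dx_pos[of x] by (simp add: D_def)
    have SC1: "S\<^sup>2 + C\<^sup>2 = 1" using SC[of x] by (simp add: S_def C_def)
    have D2: "D\<^sup>2 = aa\<^sup>2 * C\<^sup>2 + bb\<^sup>2 * S\<^sup>2"
    proof -
      have "D\<^sup>2 = eta * (S\<^sup>2 + C\<^sup>2) + (j\<^sup>2 * C\<^sup>2 + R\<^sup>2 * S\<^sup>2)"
        using Dx_sq[of x] SC1 by (simp add: D_def S_def C_def h_sq sx_eq)
      thus ?thesis unfolding aa_bb by (simp add: algebra_simps)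
    qed
    have AB: "R\<^sup>2 - j\<^sup>2 = bb\<^sup>2 - aa\<^sup>2" unfolding aa_bb by simp
    have q: "((\<lambda>x. Sx x * Cx x / Dx x) has_real_derivative (aa\<^sup>2 * C^4 - bb\<^sup>2 * S^4) / (sqrt 2 * D\<^sup>2)) (at x)"
    proof (rule DERIV_cong[OF DERIV_divide[OF DERIV_mult[OF Sx_deriv Cx_deriv] Dx_deriv]])
      show "Dx x \<noteq> 0" using D0 by (simp add: D_def)
      have "(C * D / q * C + - (S * D / q) * S) * D - S * C * ((bb\<^sup>2 - aa\<^sup>2) * S * C / q) = (aa\<^sup>2 * C^4 - bb\<^sup>2 * S^4) / q" for q
      proof -
        have "(C * D / q * C + - (S * D / q) * S) * D - S * C * ((bb\<^sup>2 - aa\<^sup>2) * S * C / q)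
          = (D\<^sup>2 * (C\<^sup>2 - S\<^sup>2) - (bb\<^sup>2 - aa\<^sup>2) * S\<^sup>2 * C\<^sup>2) / q"
          by (simp add: divide_inverse power2_eq_square algebra_simps)
        also have "D\<^sup>2 * (C\<^sup>2 - S\<^sup>2) - (bb\<^sup>2 - aa\<^sup>2) * S\<^sup>2 * C\<^sup>2 = aa\<^sup>2 * C^4 - bb\<^sup>2 * S^4"
          unfolding D2 by algebra
        finally show ?thesis .
      qed
      from this[of "sqrt 2"] show "(((Cx x * Dx x / sqrt 2) * Cx x + - (Sx x * Dx x / sqrt 2) * Sx x) * Dx x - Sx x * Cx x * ((R\<^sup>2 - j\<^sup>2) * Sx x * Cx x / sqrt 2)) / (Dx x * Dx x) = (aa\<^sup>2 * C^4 - bb\<^sup>2 * S^4) / (sqrt 2 * D\<^sup>2)"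
        unfolding AB S_def[symmetric] C_def[symmetric] D_def[symmetric] by (simp add: power2_eq_square)
    qed
    have "(F has_real_derivative sx x - (aa * bb - eta) + c * ((aa\<^sup>2 * C^4 - bb\<^sup>2 * S^4) / (sqrt 2 * D\<^sup>2))) (at x)"
      unfolding F_def by (intro DERIV_add DERIV_diff Z_deriv DERIV_cmult q) (auto intro!: derivative_eq_intros)
    moreover have "sx x - (aa * bb - eta) + c * ((aa\<^sup>2 * C^4 - bb\<^sup>2 * S^4) / (sqrt 2 * D\<^sup>2)) = ((bb - aa) * f x)\<^sup>2 / (2 * (Dx x)\<^sup>2)"
    proof -
      have "sx x = D\<^sup>2 - eta" using Dx_sq[of x] by (simp add: D_def h_sq)
      hence "sx x - (aa * bb - eta) = D\<^sup>2 - aa * bb * (S\<^sup>2 + C\<^sup>2)" using SC1 by simp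
      also have "\<dots> = (bb - aa) * f x"
        unfolding D2 f_def S_def[symmetric] C_def[symmetric] by algebra
      finally have 1: "sx x - (aa * bb - eta) = (bb - aa) * f x" .
      have 2: "c * (y / (sqrt 2 * D\<^sup>2)) = (bb - aa) * (aa + bb) / 2 * (y / D\<^sup>2)" for y
        by (simp add: c_def)
      have 3: "2 * ((bb - aa) * f x * D\<^sup>2) + (bb - aa) * (aa + bb) * (aa\<^sup>2 * C^4 - bb\<^sup>2 * S^4) = ((bb - aa) * f x)\<^sup>2"
        unfolding D2 f_def S_def[symmetric] C_def[symmetric] by algebra
      have "(bb - aa) * f x + (bb - aa) * (aa + bb) / 2 * ((aa\<^sup>2 * C^4 - bb\<^sup>2 * S^4) / D\<^sup>2)
        = (2 * ((bb - aa) * f x * D\<^sup>2) + (bb - aa) * (aa + bb) * (aa\<^sup>2 * C^4 - bb\<^sup>2 * S^4)) / (2 * D\<^sup>2)"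
        using D0 by (simp add: field_simps)
      thus ?thesis unfolding D_def[symmetric] 1 2 3 .
    qed
    ultimately show ?thesis by simp
  qed
  have "F 0 \<le> F T"
  proof (rule DERIV_nonneg_imp_nondecreasing[of 0 T F])
    fix x show "\<exists>y. (F has_real_derivative y) (at x) \<and> 0 \<le> y" using der by (intro exI conjI) auto
  qed (use T_pos in simp)
  moreover have "F 0 = 0" "F T = n - (aa * bb - eta) * T"
    by (simp_all add: F_def Z_0 n_def Sx_def ph_0 ph_T)
  ultimately show ?thesis using T_pos by (simp add: n_eq mult_le_cancel_right)
qed

text \<open>Minus the determinant of the images of \<open>vm\<close> and \<open>fB\<close> under the
  linearized operator, in the basis \<open>2 W\<close>, \<open>2 i W1\<close>. Its sign is the sign
  of the kink \<open>kap\<close> of \<open>U\<close>.\<close>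

definition dl where "dl = 4 * E * sg - sg\<^sup>2 - 3 * J\<^sup>2"

text \<open>As a function of \<open>sg\<close>, \<open>- dl\<close> is a convex parabola, and
  \<open>sg\<close> lies between \<open>s0\<close> and \<open>R^2\<close>. Hence it lies below the
  chord \<open>L\<close>, which is negative at both ends.\<close>

lemma dl_pos: "dl > 0"
proof -
  define s0 where "s0 = aa * bb - eta"
  define L where "L = (\<lambda>x. x * (s0 + R\<^sup>2 - 4 * E) - s0 * R\<^sup>2 + 3 * J\<^sup>2)"
  have a2: "j\<^sup>2 = aa\<^sup>2 - eta" and b2: "R\<^sup>2 = bb\<^sup>2 - eta" unfolding aa_bb by simp_all
  have "2 + j\<^sup>2 + R\<^sup>2 = eta" by (simp add: eta_def)
  hence e3: "3 * eta = aa\<^sup>2 + bb\<^sup>2 + 2" unfolding aa_bb by simp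
  have E4: "4 * E = 2 * (aa\<^sup>2 + bb\<^sup>2) * eta - 3 * eta\<^sup>2 - aa\<^sup>2 * bb\<^sup>2"
    unfolding fourE a2 b2 by (simp add: algebra_simps power2_eq_square)
  have J2: "2 * J\<^sup>2 = eta * (aa\<^sup>2 * bb\<^sup>2 - (aa\<^sup>2 + bb\<^sup>2) * eta + eta\<^sup>2)"
    unfolding twoJ2 a2 b2 by (simp add: algebra_simps power2_eq_square)
  have q: "L s0 = s0\<^sup>2 - 4 * E * s0 + 3 * J\<^sup>2" by (simp add: L_def algebra_simps power2_eq_square)
  have "2 * (s0\<^sup>2 - 4 * E * s0 + 3 * J\<^sup>2) = (3 * eta - (aa\<^sup>2 + bb\<^sup>2)) * s0\<^sup>2 - 2 * (4 * E) * s0 + 3 * (2 * J\<^sup>2)"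
    unfolding e3 by simp
  \<comment> \<open>In terms of \<open>aa\<close> and \<open>bb\<close> the value at the lower end
    factors completely.\<close>
  also have "\<dots> = - (aa * bb) * (aa - bb)\<^sup>2 * (2 * eta + aa * bb)"
    unfolding E4 J2 s0_def by algebra
  also have "\<dots> < 0"
  proof -
    have "0 < (aa * bb) * (aa - bb)\<^sup>2 * (2 * eta + aa * bb)"
      using aa_bb(1,2) eta_ge by (intro mult_pos_pos) (auto intro!: add_pos_pos mult_pos_pos)
    thus ?thesis by simp
  qed
  finally have l1: "L s0 < 0" unfolding q by simp
  have l2: "L (R\<^sup>2) < 0"
  proof -
    have "2 * L (R\<^sup>2) = 2 * (R\<^sup>2 * R\<^sup>2) - 2 * R\<^sup>2 * (4 * E) + 3 * (2 * J\<^sup>2)"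
      by (simp add: L_def algebra_simps)
    also have "\<dots> = - (R\<^sup>2) * ((R\<^sup>2 - j\<^sup>2) * (2 + j\<^sup>2 + 2 * R\<^sup>2))"
      unfolding fourE twoJ2 eta_def by (simp add: algebra_simps power2_eq_square)
    also have "\<dots> < 0"
    proof -
      have "0 < R\<^sup>2 * ((R\<^sup>2 - j\<^sup>2) * (2 + j\<^sup>2 + 2 * R\<^sup>2))"
        using R_pos j2_less by (intro mult_pos_pos add_pos_nonneg) auto
      thus ?thesis by simp
    qed
    finally show ?thesis by simp
  qed
  have s0R: "s0 < R\<^sup>2"
  proof -
    have "aa * bb < bb * bb" using aa_bb(1,2) by (intro mult_strict_right_mono) auto
    thus ?thesis using b2 by (simp add: s0_def power2_eq_square)
  qed
  have "(R\<^sup>2 - s0) * L sg = (R\<^sup>2 - sg) * L s0 + (sg - s0) * L (R\<^sup>2)" unfolding L_def by algebra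
  also have "\<dots> < 0"
  proof (cases "sg = R\<^sup>2")
    case True
    thus ?thesis using l2 s0R by (simp add: mult_pos_neg)
  next
    case False
    have "(R\<^sup>2 - sg) * L s0 < 0" using False sg_le l1 by (intro mult_pos_neg) auto
    moreover have "(sg - s0) * L (R\<^sup>2) \<le> 0" using sg_ge l2 by (intro mult_nonneg_nonpos) (auto simp: s0_def)
    ultimately show ?thesis by linarith
  qed
  finally have Ls: "L sg < 0" using s0R by (simp add: mult_less_0_iff)
  have "(sg - s0) * (sg - R\<^sup>2) \<le> 0" using sg_ge sg_le by (intro mult_nonneg_nonpos) (auto simp: s0_def)
  moreover have "- dl = (sg - s0) * (sg - R\<^sup>2) + L sg"
    unfolding dl_def L_def by (simp add: algebra_simps power2_eq_square)
  ultimately show ?thesis using Ls by linarith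
qed

lemma sg_pos: "0 < sg"
proof -
  have "eta < aa * bb"
  proof -
    have "eta * eta \<le> (aa * bb) * (aa * bb)"
    proof -
      have "(aa * bb) * (aa * bb) = (eta + j\<^sup>2) * (eta + R\<^sup>2)"
        unfolding aa_bb(3,4)[symmetric] by (simp add: power2_eq_square algebra_simps)
      also have "\<dots> \<ge> eta * eta" using eta_ge by (intro mult_mono) auto
      finally show ?thesis .
    qed
    moreover have "(aa * bb) * (aa * bb) \<noteq> eta * eta"
    proof -
      have "(aa * bb) * (aa * bb) = (eta + j\<^sup>2) * (eta + R\<^sup>2)"
        unfolding aa_bb(3,4)[symmetric] by (simp add: power2_eq_square algebra_simps)
      also have "\<dots> \<ge> eta * (eta + R\<^sup>2)" using eta_ge by (intro mult_right_mono) auto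
      moreover have "eta * (eta + R\<^sup>2) > eta * eta" using eta_ge R_pos by simp
      ultimately show ?thesis by linarith
    qed
    ultimately have "eta\<^sup>2 < (aa * bb)\<^sup>2" by (simp add: power2_eq_square)
    thus ?thesis using aa_bb(1,2) by (intro power_less_imp_less_base[of eta 2]) (auto intro: less_imp_le mult_pos_pos)
  qed
  thus ?thesis using sg_ge by simp
qed

lemma fourE_ge: "R\<^sup>2 * R\<^sup>2 + 2 * R\<^sup>2 \<le> 4 * E"
proof -
  have "4 * E - (R\<^sup>2 * R\<^sup>2 + 2 * R\<^sup>2) = j\<^sup>2 * (2 + j\<^sup>2 + R\<^sup>2)"
    unfolding fourE eta_def by (simp add: algebra_simps)
  also have "\<dots> \<ge> 0" by simp
  finally show ?thesis by simp
qed

text \<open>Up to the factor \<open>2 * T\<close> this is the value of the form at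
  \<open>vm\<close>, see \<open>qn_pos\<close>. Positivity of \<open>dl\<close> bounds
  \<open>J^2\<close> by \<open>sg * (4 * E - sg) / 3\<close>; what remains is a multiple of
  \<open>4 * E - sg\<close> whose sign follows from \<open>sg <= R^2\<close> and
  \<open>fourE_ge\<close>.\<close>

lemma fneg: "(sg - 4 * E) * (sg\<^sup>2 / 2 + 2 * E) + 2 * J\<^sup>2 * (sg + 1) < 0"
proof -
  have s: "sg \<le> R\<^sup>2" "0 < sg" by (rule sg_le sg_pos)+
  have s2: "sg\<^sup>2 \<le> R\<^sup>2 * R\<^sup>2" using s by (simp add: power2_eq_square mult_mono)
  have e: "0 < 4 * E - sg" using fourE_ge s mult_nonneg_nonneg[of "R\<^sup>2" "R\<^sup>2", OF zero_le_power2 zero_le_power2] by linarith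
  have "3 * J\<^sup>2 < sg * (4 * E - sg)" using dl_pos by (simp add: dl_def algebra_simps power2_eq_square)
  hence "3 * J\<^sup>2 * (sg + 1) < sg * (4 * E - sg) * (sg + 1)" using s by (intro mult_strict_right_mono) auto
  hence "2 * J\<^sup>2 * (sg + 1) < (2 / 3) * (sg * (4 * E - sg) * (sg + 1))" by linarith
  moreover have "(sg - 4 * E) * (sg\<^sup>2 / 2 + 2 * E) + (2 / 3) * (sg * (4 * E - sg) * (sg + 1))
     = (4 * E - sg) * (sg\<^sup>2 / 6 + 2 * sg / 3 - 2 * E)" by (simp add: algebra_simps add_divide_distrib diff_divide_distrib power2_eq_square)
  ultimately have "(sg - 4 * E) * (sg\<^sup>2 / 2 + 2 * E) + 2 * J\<^sup>2 * (sg + 1)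
     < (4 * E - sg) * (sg\<^sup>2 / 6 + 2 * sg / 3 - 2 * E)"
    by linarith
  also have "\<dots> \<le> 0"
  proof (rule mult_nonneg_nonpos)
    have "sg\<^sup>2 + 4 * sg \<le> 12 * E" using s2 s fourE_ge mult_nonneg_nonneg[of "R\<^sup>2" "R\<^sup>2", OF zero_le_power2 zero_le_power2] by linarith
    thus "sg\<^sup>2 / 6 + 2 * sg / 3 - 2 * E \<le> 0" by linarith
  qed (use e in simp)
  finally show ?thesis .
qed

text \<open>The value of \<open>rp\<close>, half the second derivative of |W|^2, at the minimum.
  Strict positivity makes the zero of \<open>rx\<close> there simple.\<close>

lemma g2_gt: "g\<^sup>2 - j\<^sup>2 - j^4 > 0"
proof -
  have "j\<^sup>2 * (2 + 2 * j\<^sup>2) < R\<^sup>2 * (2 + j\<^sup>2 + R\<^sup>2)"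
    using j2_less R_pos by (intro mult_strict_mono) (auto intro: add_pos_nonneg)
  thus ?thesis unfolding g_sq eta_def by (simp add: field_simps power4_eq_xxxx power2_eq_square)
qed

text \<open>The second factor of \<open>u0\<close>, the value of \<open>U\<close> at the
  origin.\<close>

lemma four_g2: "4 * g\<^sup>2 - (j\<^sup>2 + 2) * sg > 0"
proof -
  have "(j\<^sup>2 + 2) * sg \<le> (j\<^sup>2 + 2) * R\<^sup>2" using sg_le by (intro mult_left_mono) auto
  also have "\<dots> < 2 * R\<^sup>2 * eta" 
  proof -
    have "(j\<^sup>2 + 2) * R\<^sup>2 < (2 * eta) * R\<^sup>2"
      using R_pos unfolding eta_def by (intro mult_strict_right_mono) (auto simp: algebra_simps add_nonneg_pos)
    thus ?thesis by (simp add: mult_ac)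
  qed
  finally show ?thesis using g_sq by simp
qed

section \<open>Uniqueness of profiles\<close>

lemma invariants_radial:
  fixes a b :: complex
  assumes "J = Im (cnj a * b)" "E = cmod2 b / 2 + cmod2 a / 2 + (cmod a)^4 / 4"
  shows "(Re (cnj a * b))\<^sup>2 = (cmod2 a - j\<^sup>2) * (R\<^sup>2 - cmod2 a) * (cmod2 a + eta) / 2"
    and "j\<^sup>2 \<le> cmod2 a" "cmod2 a \<le> R\<^sup>2" "cmod a \<le> R"
proof -
  let ?s = "cmod2 a"
  have b: "cmod2 b = 2 * E - ?s - ?s\<^sup>2 / 2" using assms(2) by simp
  \<comment> \<open>Splitting |conj a b|^2 into its real and imaginary parts eliminates
    \<open>b\<close> and leaves the cubic for |a|^2.\<close>
  have "(Re (cnj a * b))\<^sup>2 + (Im (cnj a * b))\<^sup>2 = ?s * cmod2 b"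
    unfolding cmod_power2[symmetric] norm_mult complex_mod_cnj power_mult_distrib ..
  hence "(Re (cnj a * b))\<^sup>2 = ?s * (2 * E - ?s - ?s\<^sup>2 / 2) - J\<^sup>2"
    unfolding b assms(1)[symmetric] by simp
  thus r: "(Re (cnj a * b))\<^sup>2 = (?s - j\<^sup>2) * (R\<^sup>2 - ?s) * (?s + eta) / 2"
    unfolding cubic_factor' .
  have "0 < ?s + eta" using eta_ge by (simp add: add_nonneg_pos)
  moreover have "0 \<le> (?s - j\<^sup>2) * (R\<^sup>2 - ?s) * (?s + eta)" using r zero_le_power2[of "Re (cnj a * b)"] by linarith
  ultimately have "0 \<le> (?s - j\<^sup>2) * (R\<^sup>2 - ?s)" by (simp add: zero_le_mult_iff)
  thus "j\<^sup>2 \<le> ?s" and s: "?s \<le> R\<^sup>2" using j2_less by (auto simp: zero_le_mult_iff)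
  show "cmod a \<le> R" using power2_le_imp_le[OF s] R_pos by simp
qed

text \<open>On each half period |W|^2 runs through all values between \<open>j^2\<close> and
  \<open>R^2\<close> with \<open>rx\<close> of one sign. A point with the same modulus and the same
  radial velocity gives the same product conj a b, so the two states differ by a phase.\<close>

lemma profile_phase_match:
  assumes "J = Im (cnj a * b)" "E = cmod2 b / 2 + cmod2 a / 2 + (cmod a)^4 / 4"
  shows "\<exists>c x. cmod c = 1 \<and> a = c * W x \<and> b = c * W1 x"
proof -
  let ?s = "cmod2 a" and ?r = "Re (cnj a * b)"
  note rad = invariants_radial[OF assms]
  have wE: "E = cmod2 (W1 x) / 2 + cmod2 (W x) / 2 + (cmod (W x))^4 / 4" for x
  proof -
    have "(cmod (W x))^4 = (sx x)\<^sup>2" unfolding cmod_W[symmetric] by simp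
    thus ?thesis unfolding cmod_W using W_energy[of x] by simp
  qed
  have wr: "(rx x)\<^sup>2 = (sx x - j\<^sup>2) * (R\<^sup>2 - sx x) * (sx x + eta) / 2" for x
    using invariants_radial(1)[OF W_angular[symmetric] wE] unfolding cmod_W rx_def .
  have ends: "sx 0 = j\<^sup>2" "sx (T / 2) = R\<^sup>2" "sx T = j\<^sup>2"
    by (simp_all add: sx_eq Cx_def Sx_def ph_0 ph_half ph_T)
  have "\<exists>x. sx x = ?s \<and> rx x = ?r"
  proof (cases "0 \<le> ?r")
    case True
    obtain x where x: "0 \<le> x" "x \<le> T / 2" "sx x = ?s"
      using IVT'[of sx 0 ?s "T / 2"] rad ends T_pos sx_continuous by auto
    have "0 \<le> rx x" using x(1,2) rx_sign(1,3,4) by (metis order_le_less)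
    moreover have "(rx x)\<^sup>2 = ?r\<^sup>2" unfolding wr x(3) rad(1) ..
    ultimately have "rx x = ?r" using True power2_eq_iff_nonneg[of "rx x" ?r] by simp
    thus ?thesis using x by blast
  next
    case False
    obtain x where x: "T / 2 \<le> x" "x \<le> T" "sx x = ?s"
      using IVT2'[of sx T ?s "T / 2"] rad ends T_pos sx_continuous by auto
    have "rx x \<le> 0" using x(1,2) rx_sign(2,4,5) by (metis order_le_less)
    moreover have "(- rx x)\<^sup>2 = (- ?r)\<^sup>2" unfolding power2_minus wr x(3) rad(1) ..
    ultimately have "- rx x = - ?r" using False power2_eq_iff_nonneg[of "- rx x" "- ?r"] by simp
    thus ?thesis using x by auto
  qed
  then obtain x where x: "sx x = ?s" "rx x = ?r" by blast
  have n: "cmod (W x) = cmod a" using x(1) unfolding cmod_W[symmetric] by simp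
  show ?thesis
  proof (cases "a = 0")
    case True
    \<comment> \<open>At a zero of the profile the phase has to be read off from the
      derivative.\<close>
    hence W0: "W x = 0" using n by simp
    have "cmod2 b = cmod2 (W1 x)" using assms(2) wE[of x] True W0 by simp
    hence e: "cmod b = cmod (W1 x)" by simp
    have "W1 x \<noteq> 0"
    proof
      assume "W1 x = 0"
      hence "E = 0" using wE[of x] W0 by simp
      moreover have "0 < E" using g_pos unfolding E_def by (intro add_pos_nonneg) auto
      ultimately show False by simp
    qed
    thus ?thesis using True W0 e by (intro exI[of _ "b / W1 x"] exI[of _ x]) (simp add: norm_divide)
  next
    case False
    hence W0: "W x \<noteq> 0" using n by auto
    have "cnj a * b = cnj (W x) * W1 x"
      using x(2) assms(1) W_angular[of x] by (simp add: complex_eq_iff rx_def)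
    moreover have "cnj a * a = cnj (W x) * W x"
      unfolding complex_norm_square[symmetric, unfolded mult.commute[of _ "cnj _"]] n ..
    ultimately have "(cnj a * b) * (cnj (W x) * W x) = (cnj (W x) * W1 x) * (cnj a * a)" by simp
    hence "(cnj a * cnj (W x)) * (b * W x) = (cnj a * cnj (W x)) * (a * W1 x)" by (simp only: mult_ac)
    hence "b * W x = a * W1 x" using False W0 by simp
    hence "b = a / W x * W1 x" using False W0 by (simp add: field_simps)
    thus ?thesis using W0 n False by (intro exI[of _ "a / W x"] exI[of _ x]) (simp add: norm_divide)
  qed
qed

text \<open>The invariants fix the Cauchy data up to symmetry and confine both solutions to the ball
  of radius \<open>R\<close>, where the cubic term is Lipschitz; Gronwall's estimate does the
  rest.\<close>

lemma profile_unique: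
  assumes "is_profile J E V"
  shows "\<exists>c x0. cmod c = 1 \<and> (\<forall>x. V x = c * W (x + x0))"
proof -
  obtain V1 where V: "\<And>x. (V has_vector_derivative V1 x) (at x)"
      "\<And>x. (V1 has_vector_derivative (- V x - cmod2 (V x) *\<^sub>R V x)) (at x)"
      "\<And>x. J = Im (cnj (V x) * V1 x)"
      "\<And>x. E = cmod2 (V1 x) / 2 + cmod2 (V x) / 2 + (cmod (V x))^4 / 4"
    using assms unfolding is_profile_def by blast
  obtain c x0 where c: "cmod c = 1" "V 0 = c * W x0" "V1 0 = c * W1 x0"
    using profile_phase_match[OF V(3) V(4)] by blast
  define U U1 where "U x = c * W (x + x0)" and "U1 x = c * W1 (x + x0)" for x
  have U: "(U has_vector_derivative U1 x) (at x)"
      "(U1 has_vector_derivative - U x - of_real (cmod2 (U x)) * U x) (at x)" for x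
  proof -
    have sh: "((\<lambda>x. x + x0) has_vector_derivative 1) (at x)"
      by (auto intro!: derivative_eq_intros)
    show "(U has_vector_derivative U1 x) (at x)"
      unfolding U_def U1_def
      using has_vector_derivative_mult_right[OF vector_diff_chain_at[OF sh W_deriv], of c] by (simp add: o_def)
    have "(U1 has_vector_derivative c * (- of_real (1 + sx (x + x0)) * W (x + x0))) (at x)"
      unfolding U1_def
      using has_vector_derivative_mult_right[OF vector_diff_chain_at[OF sh W1_deriv], of c] by (simp add: o_def)
    moreover have "c * (- of_real (1 + sx (x + x0)) * W (x + x0)) = - U x - of_real (cmod2 (U x)) * U x"
      unfolding U_def norm_mult c(1) mult_1 cmod_W by (simp add: algebra_simps)
    ultimately show "(U1 has_vector_derivative - U x - of_real (cmod2 (U x)) * U x) (at x)" by simp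
  qed
  define d e where "d x = V x - U x" and "e x = V1 x - U1 x" for x
  define k where "k x = of_real (cmod2 (V x)) * V x - of_real (cmod2 (U x)) * U x" for x
  have d: "(d has_vector_derivative e x) (at x)" for x
    unfolding d_def e_def by (intro has_vector_derivative_diff V U)
  have e: "(e has_vector_derivative - d x - k x) (at x)" for x
  proof -
    have "(e has_vector_derivative (- V x - cmod2 (V x) *\<^sub>R V x) - (- U x - of_real (cmod2 (U x)) * U x)) (at x)"
      unfolding e_def by (intro has_vector_derivative_diff V U)
    thus ?thesis by (simp add: d_def k_def scaleR_conv_of_real algebra_simps)
  qed
  have sq: "((\<lambda>x. cmod2 (w x)) has_real_derivative 2 * Re (cnj (w x) * w' x)) (at x)"
    if "\<And>x. (w has_vector_derivative w' x) (at x)" for w w' x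
  proof -
    have "((\<lambda>x. Re (cnj (w x) * w x)) has_vector_derivative Re (cnj (w x) * w' x + cnj (w' x) * w x)) (at x)"
      by (intro bounded_linear.has_vector_derivative[OF bounded_linear_Re] has_vector_derivative_mult
          bounded_linear.has_vector_derivative[OF bounded_linear_cnj] that)
    thus ?thesis
      unfolding has_real_derivative_iff_has_vector_derivative Re_cnj_mult_self by (simp add: algebra_simps)
  qed
  define Q where "Q x = cmod2 (d x) + cmod2 (e x)" for x
  have "Q x = 0" for x
  proof (rule gronwall_zero[where Q = Q and K = "3 * R\<^sup>2"
        and Q' = "\<lambda>x. 2 * Re (cnj (d x) * e x) + 2 * Re (cnj (e x) * (- d x - k x))"])
    show "(Q has_real_derivative 2 * Re (cnj (d x) * e x) + 2 * Re (cnj (e x) * (- d x - k x))) (at x)" for x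
      unfolding Q_def by (intro DERIV_add sq d e)
    show "0 \<le> Q x" for x by (simp add: Q_def)
    show "Q 0 = 0" by (simp add: Q_def d_def e_def U_def U1_def c)
    fix x
    have "cmod (k x) \<le> 3 * R\<^sup>2 * cmod (d x)"
      unfolding k_def d_def
    proof (rule cubic_lipschitz)
      show "cmod (V x) \<le> R" by (rule invariants_radial(4)[OF V(3) V(4)])
      have "cmod2 (W (x + x0)) \<le> R\<^sup>2" unfolding cmod_W by (rule sx_le)
      thus "cmod (U x) \<le> R" using R_pos power2_le_imp_le[of "cmod (W (x + x0))" R] by (simp add: U_def norm_mult c(1))
    qed
    moreover have "2 * Re (cnj (d x) * e x) + 2 * Re (cnj (e x) * (- d x - k x)) = - 2 * Re (cnj (e x) * k x)"
      by (simp add: algebra_simps)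
    moreover have "\<bar>Re (cnj (e x) * k x)\<bar> \<le> cmod (e x) * cmod (k x)"
      using abs_Re_le_cmod[of "cnj (e x) * k x"] by (simp add: norm_mult)
    moreover have "cmod (e x) * cmod (k x) \<le> cmod (e x) * (3 * R\<^sup>2 * cmod (d x))"
      using calculation(1) by (intro mult_left_mono) auto
    moreover have "2 * (cmod (e x) * (3 * R\<^sup>2 * cmod (d x))) \<le> 3 * R\<^sup>2 * Q x"
    proof -
      have "2 * cmod (d x) * cmod (e x) \<le> Q x" unfolding Q_def by (rule sum_squares_bound)
      hence "3 * R\<^sup>2 * (2 * cmod (d x) * cmod (e x)) \<le> 3 * R\<^sup>2 * Q x" by (intro mult_left_mono) auto
      thus ?thesis by (simp add: mult_ac)
    qed
    ultimately show "\<bar>2 * Re (cnj (d x) * e x) + 2 * Re (cnj (e x) * (- d x - k x))\<bar> \<le> 3 * R\<^sup>2 * Q x"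
      by linarith
  qed
  hence "d x = 0" for x by (simp add: Q_def add_nonneg_eq_0_iff)
  hence "V x = c * W (x + x0)" for x by (simp add: d_def U_def)
  thus ?thesis using c(1) by blast
qed

end

text \<open>For nonzero \<open>J\<close> the condition on \<open>E\<close> says that the cubic
  \<open>P\<close> is positive at \<open>m\<close>, the density of a plane wave with the same
  \<open>J\<close>. As \<open>P\<close> is nonpositive at 0 and for large arguments,
  \<open>m\<close> separates two nonnegative roots, which become \<open>j^2\<close> and
  \<open>R^2\<close>. For \<open>J = 0\<close> the roots are explicit.\<close>

lemma par_dom_cn_wave:
  assumes "(J, E) \<in> par_dom"
  shows "\<exists>j R. \<bar>j\<bar> < R \<and> J = cn_wave.J j R \<and> E = cn_wave.E j R"
proof -
  have cont: "continuous_on S (\<lambda>q::real. q * (q\<^sup>2 - 1))" for S by (intro continuous_intros)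
  have pos: "\<exists>q. 1 \<le> q \<and> q * (q\<^sup>2 - 1) = a" if "0 \<le> a" for a :: real
  proof -
    \<comment> \<open>The point \<open>1 + a\<close> serves as upper end for the intermediate value
      theorem.\<close>
    have "a \<le> (1 + a) * ((1 + a)\<^sup>2 - 1)"
    proof -
      have "(1 + a) * ((1 + a)\<^sup>2 - 1) - a = a * (a * a + 3 * a + 1)" by (simp add: algebra_simps power2_eq_square)
      moreover have "0 \<le> a * (a * a + 3 * a + 1)" using that by (intro mult_nonneg_nonneg add_nonneg_nonneg) auto
      ultimately show ?thesis by linarith
    qed
    hence "\<exists>q\<ge>1. q \<le> 1 + a \<and> q * (q\<^sup>2 - 1) = a"
      by (intro IVT'[OF _ _ _ cont]) (use that in simp_all)
    thus ?thesis by blast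
  qed
  have "\<exists>q. \<bar>q\<bar> \<ge> 1 \<and> J = q * (q\<^sup>2 - 1)"
  proof (cases "0 \<le> J")
    case True
    then obtain q where "1 \<le> q" "q * (q\<^sup>2 - 1) = J" using pos by blast
    thus ?thesis by (intro exI[of _ q]) auto
  next
    case False
    then obtain q where "1 \<le> q" "q * (q\<^sup>2 - 1) = - J" using pos[of "- J"] by auto
    thus ?thesis by (intro exI[of _ "- q"]) auto
  qed
  then obtain q where q: "\<bar>q\<bar> \<ge> 1" "J = q * (q\<^sup>2 - 1)" and Em: "E_minus J = (q\<^sup>2 - 1) * (3 * q\<^sup>2 + 1) / 4"
    unfolding E_minus_def Let_def by (metis (mono_tags, lifting) someI_ex)
  define m where "m = q\<^sup>2 - 1"
  have m0: "0 \<le> m" using q(1) by (simp add: m_def abs_le_square_iff[of 1 q, simplified])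
  have J2: "J\<^sup>2 = (m + 1) * m\<^sup>2" by (simp add: q(2) m_def power_mult_distrib)
  have Egt: "4 * E > m * (3 * m + 4)" using assms Em by (simp add: par_dom_def m_def algebra_simps)
  hence E0: "E > 0" using m0 mult_nonneg_nonneg[of m "3 * m + 4"] by linarith
  define P where "P = (\<lambda>y::real. - (y^3) - 2 * y^2 + 4 * E * y - 2 * J\<^sup>2)"
  have Pc: "continuous_on S P" for S unfolding P_def by (intro continuous_intros)
  have "\<exists>y1 y2. 0 \<le> y1 \<and> y1 < y2 \<and> P y1 = 0 \<and> P y2 = 0"
  proof (cases "m = 0")
    case True
    have J0: "J = 0" using J2 True by simp
    define y where "y = sqrt (1 + 4 * E) - 1"
    have y: "y > 0" using E0 by (simp add: y_def)
    have "(y + 1)\<^sup>2 = 1 + 4 * E" using E0 by (simp add: y_def)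
    hence "4 * E = y\<^sup>2 + 2 * y" by (simp add: power2_eq_square algebra_simps)
    hence "P y = 0" "P 0 = 0" by (simp_all add: P_def J0 power2_eq_square power3_eq_cube algebra_simps)
    thus ?thesis using y by (intro exI[of _ 0] exI[of _ y]) auto
  next
    case False
    hence m: "m > 0" using m0 by simp
    have "P m = m * (4 * E - m * (3 * m + 4))"
      unfolding P_def J2 by (simp add: power2_eq_square power3_eq_cube algebra_simps)
    hence Pm: "P m > 0" using m Egt by simp
    have P0: "P 0 \<le> 0" by (simp add: P_def)
    \<comment> \<open>Chosen so large that the cubic term outweighs the linear one.\<close>
    define M where "M = m + 4 * E + 1"
    have M: "M > m" "M \<ge> 1" "M \<ge> 4 * E" using m E0 by (auto simp: M_def)
    have "P M \<le> 0"
    proof -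
      have "4 * E * M \<le> M * M" using M by (intro mult_right_mono) auto
      moreover have "M * M * 1 \<le> M * M * M" using M by (intro mult_left_mono) auto
      ultimately have "4 * E * M \<le> M^3" by (simp add: power3_eq_cube)
      moreover have "0 \<le> M\<^sup>2" "0 \<le> J\<^sup>2" by simp_all
      ultimately show ?thesis unfolding P_def by linarith
    qed
    then obtain y2 where y2: "m \<le> y2" "P y2 = 0"
      using IVT2'[of P M 0 m] Pm M Pc by auto
    obtain y1 where y1: "0 \<le> y1" "y1 \<le> m" "P y1 = 0"
      using IVT'[of P 0 0 m] Pm P0 m Pc by auto
    have "y1 \<noteq> m" "y2 \<noteq> m" using y1 y2 Pm by auto
    thus ?thesis using y1 y2 by (intro exI[of _ y1] exI[of _ y2]) auto
  qed
  then obtain a b where ab: "0 \<le> a" "a < b" "P a = 0" "P b = 0" by blast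
  \<comment> \<open>Vieta's relations, obtained by dividing the difference of the two root equations
    by \<open>b - a\<close>.\<close>
  have "(b - a) * (4 * E - (a\<^sup>2 + a * b + b\<^sup>2 + 2 * a + 2 * b)) = P b - P a"
    by (simp add: P_def algebra_simps power2_eq_square power3_eq_cube)
  hence E4: "4 * E = a\<^sup>2 + a * b + b\<^sup>2 + 2 * a + 2 * b" using ab by simp
  have "P a = a * (4 * E - (a\<^sup>2 + 2 * a)) - 2 * J\<^sup>2"
    by (simp add: P_def power2_eq_square power3_eq_cube algebra_simps)
  hence J2': "2 * J\<^sup>2 = a * b * (2 + a + b)"
    using ab(3) unfolding E4 by (simp add: power2_eq_square algebra_simps)
  define R where "R = sqrt b"
  define j where "j = (if 0 \<le> J then sqrt a else - sqrt a)"
  have jR: "\<bar>j\<bar> < R" using ab by (simp add: j_def R_def)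
  interpret w: cn_wave j R by unfold_locales (rule jR)
  have j2: "j\<^sup>2 = a" and R2: "R\<^sup>2 = b" using ab by (simp_all add: j_def R_def)
  have "4 * E = 4 * w.E" unfolding w.fourE w.eta_def j2 R2 E4 by (simp add: power2_eq_square algebra_simps)
  hence "E = w.E" by simp
  moreover have "J = w.J"
  proof -
    have "2 * J\<^sup>2 = 2 * w.J\<^sup>2" unfolding w.twoJ2 w.eta_def j2 R2 J2' by simp
    hence "\<bar>J\<bar> = \<bar>w.J\<bar>" by (simp add: power2_eq_iff abs_eq_iff)
    moreover have "0 \<le> J \<Longrightarrow> 0 \<le> j" "J < 0 \<Longrightarrow> j \<le> 0" using ab by (auto simp: j_def)
    hence "0 \<le> J \<Longrightarrow> 0 \<le> w.J" "J < 0 \<Longrightarrow> w.J \<le> 0"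
      unfolding w.J_def using w.g_pos by (auto simp: mult_le_0_iff)
    ultimately show ?thesis by linarith
  qed
  ultimately show ?thesis using jR by blast
qed

section \<open>The second variation\<close>

text \<open>Defined through the complex embedding so that the rules for \<open>AC\<close>
  transfer.\<close>

definition ACr :: "(real \<Rightarrow> real) \<Rightarrow> (real \<Rightarrow> real) \<Rightarrow> bool" where
  "ACr f g \<longleftrightarrow> AC (\<lambda>x. complex_of_real (f x)) (\<lambda>x. complex_of_real (g x))"

lemma ACr_Re: "AC u v \<Longrightarrow> ACr (\<lambda>x. Re (u x)) (\<lambda>x. Re (v x))"
  unfolding ACr_def
  using AC_cmult[OF AC_add[OF _ AC_cnj], of u v u v "1 / 2"] by (simp add: complex_add_cnj)

lemma ACr_Im: "AC u v \<Longrightarrow> ACr (\<lambda>x. Im (u x)) (\<lambda>x. Im (v x))"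
  using ACr_Re[OF AC_cmult, of u v "- \<i>"] by simp

lemma ACr_diff: "ACr f f' \<Longrightarrow> ACr g g' \<Longrightarrow> ACr (\<lambda>x. f x - g x) (\<lambda>x. f' x - g' x)"
  unfolding ACr_def of_real_diff by (rule AC_diff)

lemma ACr_mult: "ACr f f' \<Longrightarrow> ACr g g' \<Longrightarrow> ACr (\<lambda>x. f x * g x) (\<lambda>x. f' x * g x + f x * g' x)"
  unfolding ACr_def of_real_add of_real_mult by (rule AC_mult)

lemma ACr_C1:
  assumes "\<And>x. (f has_real_derivative g x) (at x)" "continuous_on UNIV g"
  shows "ACr f g"
  unfolding ACr_def
proof (rule AC_C1)
  show "((\<lambda>x. complex_of_real (f x)) has_vector_derivative complex_of_real (g x)) (at x)" for x
    using assms(1)[of x] by (simp add: has_vector_derivative_of_real has_real_derivative_iff_has_vector_derivative)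
  show "continuous_on UNIV (\<lambda>x. complex_of_real (g x))" by (intro continuous_intros assms)
qed

lemma ACr_FTC:
  assumes "ACr f g" "a \<le> b"
  shows "f b - f a = (LINT x:{a..b}|lborel. g x)"
proof -
  have "complex_of_real (f b - f a) = of_real (LINT x:{a..b}|lborel. g x)"
    using AC_diff_eq[OF assms(1)[unfolded ACr_def] assms(2)]
    by (simp add: set_integral_complex_of_real)
  thus ?thesis unfolding of_real_eq_iff .
qed

lemma ACr_continuous: "ACr f g \<Longrightarrow> continuous_on S f"
  unfolding ACr_def
  using continuous_on_Re[OF continuous_on_subset[OF AC_continuous, of _ _ S]] by fastforce

lemma ACr_integrable: "ACr f g \<Longrightarrow> intg a b g"
  unfolding ACr_def
  using set_integrable_Re[OF L2_loc_integrable[OF AC_L2], of "\<lambda>x. of_real (f x)" "\<lambda>x. of_real (g x)" a b] by simp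

lemma set_integral_continuous_on:
  fixes f :: "real \<Rightarrow> real"
  assumes "\<And>a b. intg a b f"
  shows "continuous_on {a..b} (\<lambda>x. LINT y:{a..x}|lborel. f y)"
proof -
  have "f integrable_on {a..b}" "\<And>x. (LINT y:{a..x}|lborel. f y) = integral {a..x} f"
    using set_borel_integral_eq_integral[OF assms] by auto
  thus ?thesis by (simp add: indefinite_integral_continuous_1)
qed

text \<open>The Holder bound with the energy of the derivative on the shrinking interval between
  \<open>e\<close> and \<open>x\<close>, which tends to zero. It makes quotients with a simple zero
  in the denominator vanish.\<close>

lemma AC_sq_little:
  assumes u: "AC u v" and z: "u e = 0"
  shows "((\<lambda>x. cmod2 (u x) / (x - e)) \<longlongrightarrow> 0) (at e)"
proof -
  define S where "S x = (LINT y:{e-1..x}|lborel. cmod2 (v y))" for x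
  have int: "intg a b (\<lambda>y. cmod2 (v y))" for a b
    by (rule L2_loc_sq_integrable[OF AC_L2[OF u]])
  have "continuous_on {e-1..e+1} S" unfolding S_def by (rule set_integral_continuous_on[OF int])
  hence "isCont S e" by (rule continuous_on_interior) (simp add: interior_atLeastAtMost_real)
  hence "((\<lambda>x. \<bar>S x - S e\<bar>) \<longlongrightarrow> 0) (at e)"
    by (auto simp: isCont_def intro: tendsto_rabs_zero LIM_zero)
  moreover have "\<forall>\<^sub>F x in at e. norm (cmod2 (u x) / (x - e)) \<le> \<bar>S x - S e\<bar>"
  proof -
    have "norm (cmod2 (u x) / (x - e)) \<le> \<bar>S x - S e\<bar>" if x: "x \<in> {e-1<..<e+1}" for x
    proof -
      have split: "S q = S p + (LINT y:{p..q}|lborel. cmod2 (v y))" if "e - 1 \<le> p" "p \<le> q" for p q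
        unfolding S_def by (rule set_integral_split[OF that int])
      have nn: "0 \<le> (LINT y:{p..q}|lborel. cmod2 (v y))" for p q by (rule set_integral_nonneg) simp
      consider "x = e" | "e < x" | "x < e" by linarith
      thus ?thesis
      proof cases
        case 2
        hence "cmod2 (u x) \<le> (x - e) * (S x - S e)" using AC_Holder[OF u, of e x] z split[of e x] by simp
        thus ?thesis using 2 nn[of e x] split[of e x] by (simp add: field_simps)
      next
        case 3
        hence "cmod2 (u x) \<le> (e - x) * (S e - S x)"
          using AC_Holder[OF u, of x e] z split[of x e] x by (simp add: norm_minus_commute)
        hence "cmod2 (u x) / (e - x) \<le> S e - S x" using 3 by (simp add: pos_divide_le_eq mult.commute)
        moreover have "norm (cmod2 (u x) / (x - e)) = cmod2 (u x) / (e - x)" using 3 by simp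
        ultimately show ?thesis by linarith
      qed simp
    qed
    thus ?thesis
      by (intro eventually_mono[OF eventually_at_in_open'[of "{e-1<..<e+1}" e]]) auto
  qed
  ultimately show ?thesis by (rule Lim_null_comparison[rotated])
qed

text \<open>\<open>ACr\<close> speaks about the whole line, while \<open>1 / rx\<close> lives
  between two zeros. Freezing the derivative outside \<open>[c, d]\<close> produces a global
  function that agrees there.\<close>

lemma C1_extension:
  fixes u v :: "real \<Rightarrow> real"
  assumes "c \<le> d" "\<And>x. x \<in> {c..d} \<Longrightarrow> (u has_real_derivative v x) (at x)" "continuous_on {c..d} v"
  shows "\<exists>G G'. ACr G G' \<and> (\<forall>x\<in>{c..d}. G x = u x \<and> G' x = v x)"
proof -
  define w where "w x = v (max c (min d x))" for x
  have wc: "continuous_on UNIV w"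
    unfolding w_def by (rule continuous_on_compose2[OF assms(3)]) (use assms(1) in \<open>auto intro!: continuous_intros\<close>)
  have wv: "w x = v x" if "x \<in> {c..d}" for x using that by (simp add: w_def)
  obtain F where F: "\<And>x. (F has_real_derivative w x) (at x)" using real_antiderivative[OF wc] by blast
  define G where "G x = F x - F c + u c" for x
  have G: "(G has_real_derivative w x) (at x)" for x
    unfolding G_def by (auto intro!: derivative_eq_intros F)
  have "G x = u x" if x: "x \<in> {c..d}" for x
  proof (cases "c = d")
    case False
    have D: "((\<lambda>x. G x - u x) has_real_derivative 0) (at y)" if "y \<in> {c..d}" for y
      using DERIV_diff[OF G[of y] assms(2)[OF that]] wv[OF that] by simp
    have "G x - u x = G c - u c"
    proof (rule DERIV_isconst2[of c d "\<lambda>x. G x - u x" x])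
      show "continuous_on {c..d} (\<lambda>x. G x - u x)"
        using D by (meson DERIV_isCont continuous_at_imp_continuous_on)
    qed (use False assms(1) x D in auto)
    thus ?thesis by (simp add: G_def)
  qed (use x in \<open>simp add: G_def\<close>)
  thus ?thesis using ACr_C1[OF G wc] wv by blast
qed

section \<open>The Jacobi identity for the second variation\<close>

context cn_wave
begin

definition rp where "rp x = cmod2 (W1 x) - (1 + sx x) * sx x"

lemma W_continuous: "continuous_on S W" and W1_continuous: "continuous_on S W1"
  using W_deriv W1_deriv
  by (meson has_vector_derivative_continuous continuous_at_imp_continuous_on)+

lemma AC_W: "AC W W1" by (rule AC_C1[OF W_deriv W1_continuous])
lemma AC_W1: "AC W1 (\<lambda>x. - of_real (1 + sx x) * W x)"
  by (rule AC_C1[OF W1_deriv]) (intro continuous_intros sx_continuous W_continuous)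

lemma rp_continuous: "continuous_on S rp"
  unfolding rp_def by (intro continuous_intros sx_continuous W1_continuous)

lemma rx_deriv: "(rx has_real_derivative rp x) (at x)"
proof -
  have "((\<lambda>x. Re (cnj (W x) * W1 x)) has_vector_derivative
      Re (cnj (W x) * (- of_real (1 + sx x) * W x) + cnj (W1 x) * W1 x)) (at x)"
    by (intro bounded_linear.has_vector_derivative[OF bounded_linear_Re] has_vector_derivative_mult
        bounded_linear.has_vector_derivative[OF bounded_linear_cnj] W_deriv W1_deriv)
  moreover have "Re (cnj (W x) * (- of_real (1 + sx x) * W x) + cnj (W1 x) * W1 x) = rp x"
  proof -
    have "cnj (W x) * (- of_real (1 + sx x) * W x) = of_real (- (1 + sx x)) * (cnj (W x) * W x)" by simp
    thus ?thesis
      unfolding rp_def plus_complex.sel Re_cnj_mult_self by (simp only: Re_of_real_mult Re_cnj_mult_self cmod_W mult_minus_left)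
  qed
  ultimately show ?thesis unfolding has_real_derivative_iff_has_vector_derivative rx_def[abs_def] by simp
qed

lemma rx_continuous: "continuous_on S rx"
  using rx_deriv by (meson DERIV_isCont continuous_at_imp_continuous_on)

lemma rp_alt: "rp x = 2 * E - 2 * sx x - 3 / 2 * (sx x)\<^sup>2"
  unfolding rp_def using W_energy[of x] by (simp add: field_simps power2_eq_square)

text \<open>Divided by \<open>rx\<close>, \<open>al1\<close> and \<open>be1\<close> are the
  coordinates of \<open>P\<close> in the frame \<open>i W\<close>, \<open>W1\<close> of Jacobi
  fields, see \<open>frame\<close>.\<close>

definition al1 where "al1 P x = Im (cnj (W1 x) * P x)"
definition be1 where "be1 P x = Re (cnj (W x) * P x)"
definition qd where "qd P P' x = cmod2 (P' x) - (1 + sx x) * cmod2 (P x) - 2 * (be1 P x)\<^sup>2"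
text \<open>The derivative of \<open>P\<close> minus the derivative of its frame expansion with
  frozen coefficients: it measures how far these coefficients are from being constant.\<close>

definition res where
  "res P P' x = P' x - (of_real (al1 P x / rx x) * (\<i> * W1 x) - of_real (be1 P x / rx x * (1 + sx x)) * W x)"
text \<open>Boundary term of the Jacobi identity, in general singular at the zeros of
  \<open>rx\<close>.\<close>

definition Bf where "Bf P x = ((al1 P x)\<^sup>2 - (1 + sx x) * (be1 P x)\<^sup>2) / rx x"

lemma frame:
  assumes "rx x \<noteq> 0"
  shows "P x = of_real (al1 P x / rx x) * (\<i> * W x) + of_real (be1 P x / rx x) * W1 x"
proof -
  have "of_real (rx x) * P x = of_real (al1 P x) * (\<i> * W x) + of_real (be1 P x) * W1 x"
    unfolding rx_def al1_def be1_def by (simp add: complex_eq_iff algebra_simps)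
  hence "P x = (of_real (al1 P x) * (\<i> * W x) + of_real (be1 P x) * W1 x) / of_real (rx x)"
    using assms by (simp add: nonzero_eq_divide_eq mult.commute)
  thus ?thesis by (simp add: add_divide_distrib)
qed

lemma jacobi_algebra:
  fixes a b P Pd :: complex and f h t :: real
  assumes P: "P = of_real f * (\<i> * a) + of_real h * b"
  shows "cmod2 Pd - t * cmod2 P = cmod2 (Pd - (of_real f * (\<i> * b) - of_real (h * t) * a))
    + 2 * f * (Im (cnj b * Pd) - t * Im (cnj a * P)) - 2 * t * h * (Re (cnj b * P) + Re (cnj a * Pd))
    - (f\<^sup>2 - t * h\<^sup>2) * (cmod2 b - t * cmod2 a)"
proof -
  obtain a1 a2 b1 b2 p1 p2 where "a = Complex a1 a2" "b = Complex b1 b2" "Pd = Complex p1 p2"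
    by (metis complex.collapse)
  thus ?thesis
    unfolding P cmod_power2 by (simp add: power2_eq_square algebra_simps)
qed

lemma AC_al1: "AC P P' \<Longrightarrow> ACr (al1 P) (\<lambda>x. Im (cnj (W1 x) * P' x) - (1 + sx x) * Im (cnj (W x) * P x))"
  and AC_be1: "AC P P' \<Longrightarrow> ACr (be1 P) (\<lambda>x. Re (cnj (W1 x) * P x) + Re (cnj (W x) * P' x))"
proof -
  assume P: "AC P P'"
  have "cnj (- of_real (1 + sx x) * W x) * P x + cnj (W1 x) * P' x = cnj (W1 x) * P' x - of_real (1 + sx x) * (cnj (W x) * P x)" for x
    by (simp add: algebra_simps)
  thus "ACr (al1 P) (\<lambda>x. Im (cnj (W1 x) * P' x) - (1 + sx x) * Im (cnj (W x) * P x))"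
    using ACr_Im[OF AC_mult[OF AC_cnj[OF AC_W1] P]] unfolding al1_def[abs_def] by (simp only: minus_complex.sel Im_of_real_mult)
  show "ACr (be1 P) (\<lambda>x. Re (cnj (W1 x) * P x) + Re (cnj (W x) * P' x))"
    using ACr_Re[OF AC_mult[OF AC_cnj[OF AC_W] P]] unfolding be1_def[abs_def] by simp
qed

lemma be1_continuous: "continuous_on UNIV P \<Longrightarrow> continuous_on UNIV (be1 P)"
  unfolding be1_def[abs_def] by (intro continuous_intros W_continuous)

lemma qd_integrable:
  assumes "AC P P'" shows "intg a b (qd P P')"
  unfolding qd_def
  by (intro set_integral_diff(1) L2_loc_sq_integrable AC_L2[OF assms] set_integrable_continuous
      continuous_intros sx_continuous AC_continuous[OF assms] be1_continuous)

lemma inverse_rx_extension: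
  assumes cd: "c \<le> d" and r: "\<And>x. x \<in> {c..d} \<Longrightarrow> rx x \<noteq> 0"
  shows "\<exists>G G'. ACr G G' \<and> (\<forall>x\<in>{c..d}. G x = 1 / rx x \<and> G' x = - (rp x / (rx x)\<^sup>2))"
proof (rule C1_extension[OF cd])
  show "((\<lambda>x. 1 / rx x) has_real_derivative - (rp x / (rx x)\<^sup>2)) (at x)" if "x \<in> {c..d}" for x
    using DERIV_inverse_fun[OF rx_deriv r[OF that]] by (simp add: divide_inverse power2_eq_square mult_ac)
  show "continuous_on {c..d} (\<lambda>x. - (rp x / (rx x)\<^sup>2))"
    using r by (intro continuous_intros rp_continuous rx_continuous) auto
qed

abbreviation resn :: "real \<Rightarrow> real \<Rightarrow> (real \<Rightarrow> complex) \<Rightarrow> (real \<Rightarrow> complex) \<Rightarrow> real" where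
  "resn c d P P' \<equiv> (LINT x:{c..d}|lborel. cmod2 (res P P' x))"

lemma jacobi_integral:
  assumes P: "AC P P'" and cd: "c \<le> d" and r: "\<And>x. x \<in> {c..d} \<Longrightarrow> rx x \<noteq> 0"
  shows "(LINT x:{c..d}|lborel. qd P P' x) = resn c d P P' + Bf P d - Bf P c"
    and "intg c d (\<lambda>x. cmod2 (res P P' x))"
proof -
  \<comment> \<open>A global stand-in for \<open>1 / rx\<close>, which brings \<open>Bf\<close>
    under the product rule for \<open>ACr\<close>.\<close>
  obtain G G' where G: "ACr G G'" and GG: "\<And>x. x \<in> {c..d} \<Longrightarrow> G x = 1 / rx x"
      "\<And>x. x \<in> {c..d} \<Longrightarrow> G' x = - (rp x / (rx x)\<^sup>2)"
    using inverse_rx_extension[OF cd r] by blast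
  have one: "ACr (\<lambda>x. 1 + sx x) (\<lambda>x. 2 * rx x)"
    by (rule ACr_C1) (auto intro!: derivative_eq_intros sx_deriv continuous_intros rx_continuous)
  define a' where "a' x = Im (cnj (W1 x) * P' x) - (1 + sx x) * Im (cnj (W x) * P x)" for x
  define b' where "b' x = Re (cnj (W1 x) * P x) + Re (cnj (W x) * P' x)" for x
  have A: "ACr (al1 P) a'" and Bp: "ACr (be1 P) b'"
    unfolding a'_def b'_def by (rule AC_al1[OF P] AC_be1[OF P])+
  define H where "H x = (al1 P x * al1 P x - (1 + sx x) * (be1 P x * be1 P x)) * G x" for x
  define H' where "H' x = (a' x * al1 P x + al1 P x * a' x
     - (2 * rx x * (be1 P x * be1 P x) + (1 + sx x) * (b' x * be1 P x + be1 P x * b' x))) * G x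
     + (al1 P x * al1 P x - (1 + sx x) * (be1 P x * be1 P x)) * G' x" for x
  have H: "ACr H H'"
    unfolding H_def H'_def by (intro ACr_mult ACr_diff A Bp one G)
  have "Bf P d - Bf P c = H d - H c"
    using cd by (simp add: Bf_def H_def GG power2_eq_square)
  also have "\<dots> = (LINT x:{c..d}|lborel. H' x)" by (rule ACr_FTC[OF H cd])
  finally have 1: "Bf P d - Bf P c = (LINT x:{c..d}|lborel. H' x)" .
  have pt: "cmod2 (res P P' x) = qd P P' x - H' x" if x: "x \<in> {c..d}" for x
  proof -
    define f h where "f = al1 P x / rx x" and "h = be1 P x / rx x"
    note r0 = r[OF x]
    have f: "al1 P x = f * rx x" and h: "be1 P x = h * rx x" using r0 by (simp_all add: f_def h_def)
    have "cmod2 (P' x) - (1 + sx x) * cmod2 (P x) = cmod2 (res P P' x)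
      + 2 * f * a' x - 2 * (1 + sx x) * h * b' x - (f\<^sup>2 - (1 + sx x) * h\<^sup>2) * rp x"
      using jacobi_algebra[OF frame[OF r0, of P], of "P' x" "1 + sx x"]
      unfolding res_def a'_def b'_def rp_def cmod_W f_def h_def by simp
    moreover have "H' x = 2 * f * a' x - 2 * (1 + sx x) * h * b' x - (f\<^sup>2 - (1 + sx x) * h\<^sup>2) * rp x - 2 * (be1 P x)\<^sup>2"
      unfolding H'_def GG(1)[OF x] GG(2)[OF x] f h using r0
      by (simp add: divide_simps power2_eq_square) (simp add: algebra_simps)
    ultimately show ?thesis by (simp add: qd_def)
  qed
  have i: "intg c d (\<lambda>x. qd P P' x - H' x)"
    by (intro set_integral_diff(1) qd_integrable[OF P] ACr_integrable[OF H])
  show "intg c d (\<lambda>x. cmod2 (res P P' x))"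
    using i by (rule set_integrable_cong[THEN iffD1, rotated -1]) (simp_all add: pt)
  have "resn c d P P' = (LINT x:{c..d}|lborel. qd P P' x - H' x)"
    by (rule set_lebesgue_integral_cong) (auto simp: pt)
  also have "\<dots> = (LINT x:{c..d}|lborel. qd P P' x) - (LINT x:{c..d}|lborel. H' x)"
    by (intro set_integral_diff(2) qd_integrable[OF P] ACr_integrable[OF H])
  finally show "(LINT x:{c..d}|lborel. qd P P' x) = resn c d P P' + Bf P d - Bf P c"
    using 1 by simp
qed

text \<open>The numerator combines squares that are of smaller order than \<open>x - e\<close> by
  \<open>AC_sq_little\<close>, while \<open>rx\<close> has a simple zero.\<close>

lemma Bf_tendsto:
  assumes P: "AC P P'" and e: "al1 P e = 0" "be1 P e = 0" "rx e = 0" "rp e \<noteq> 0"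
  shows "(Bf P \<longlongrightarrow> 0) (at e)"
proof -
  have q: "((\<lambda>x. (f x)\<^sup>2 / (x - e)) \<longlongrightarrow> 0) (at e)" if "ACr f f'" "f e = 0" for f f'
    using AC_sq_little[OF that(1)[unfolded ACr_def], of e] that(2) by simp
  have "((\<lambda>x. rx x / (x - e)) \<longlongrightarrow> rp e) (at e)"
    using rx_deriv[of e] e(3) by (simp add: has_field_derivative_iff)
  hence "((\<lambda>x. ((al1 P x)\<^sup>2 / (x - e) - (1 + sx x) * ((be1 P x)\<^sup>2 / (x - e))) / (rx x / (x - e))) \<longlongrightarrow>
      (0 - (1 + sx e) * 0) / rp e) (at e)"
    using e(4) sx_continuous[of UNIV]
    by (intro tendsto_divide tendsto_diff tendsto_mult tendsto_add tendsto_const q[OF AC_al1[OF P] e(1)] q[OF AC_be1[OF P] e(2)])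
       (auto simp: continuous_on_def)
  moreover have "\<forall>\<^sub>F x in at e. ((al1 P x)\<^sup>2 / (x - e) - (1 + sx x) * ((be1 P x)\<^sup>2 / (x - e))) / (rx x / (x - e)) = Bf P x"
    unfolding eventually_at_filter by (rule always_eventually) (auto simp: Bf_def divide_simps)
  ultimately have "(Bf P \<longlongrightarrow> (0 - (1 + sx e) * 0) / rp e) (at e)" by (rule Lim_transform_eventually)
  thus ?thesis by simp
qed

text \<open>The inequality holds between the ends of larger and larger inner intervals up to
  boundary terms, and these disappear as the intervals fill the half period. The residual on a fixed
  inner interval is kept because it later identifies the limits of minimizing sequences.\<close>

lemma half_period:
  assumes P: "AC P P'" and ab: "a < c" "c \<le> d" "d < b"
    and r: "\<And>x. a < x \<Longrightarrow> x < b \<Longrightarrow> rx x \<noteq> 0"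
    and ea: "al1 P a = 0" "be1 P a = 0" "rx a = 0" "rp a \<noteq> 0"
    and eb: "al1 P b = 0" "be1 P b = 0" "rx b = 0" "rp b \<noteq> 0"
  shows "resn c d P P' \<le> (LINT x:{a..b}|lborel. qd P P' x)"
proof -
  define F where "F x = (LINT y:{a..x}|lborel. qd P P' y)" for x
  define G where "G x = F x - Bf P x" for x
  define I where "I = resn c d P P'"
  have Fc: "continuous_on {a..b} F" unfolding F_def by (rule set_integral_continuous_on[OF qd_integrable[OF P]])
  have Bc: "continuous_on {a..b} (Bf P)"
    unfolding continuous_on_def
  proof
    fix x assume x: "x \<in> {a..b}"
    show "(Bf P \<longlongrightarrow> Bf P x) (at x within {a..b})"
    proof (cases "x = a \<or> x = b")
      case True
      \<comment> \<open>At an endpoint \<open>Bf\<close> is a quotient by zero, hence 0 by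
        convention, which is also its limit.\<close>
      hence "(Bf P \<longlongrightarrow> 0) (at x)" "Bf P x = 0"
        using Bf_tendsto[OF P ea] Bf_tendsto[OF P eb] ea(3) eb(3) by (auto simp: Bf_def)
      thus ?thesis using tendsto_within_subset[OF _ subset_UNIV] by simp
    next
      case False
      have c: "isCont (al1 P) x" "isCont (be1 P) x" "isCont sx x" "isCont rx x"
        using ACr_continuous[OF AC_al1[OF P], of UNIV] ACr_continuous[OF AC_be1[OF P], of UNIV]
          sx_continuous[of UNIV] rx_continuous[of UNIV] by (simp_all add: continuous_on_eq_continuous_at)
      have "isCont (Bf P) x"
        unfolding Bf_def[abs_def] using r[of x] False x
        by (intro continuous_intros c) auto
      thus ?thesis unfolding isCont_def by (rule tendsto_within_subset) simp
    qed
  qed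
  have Gc: "continuous_on {a..b} G" unfolding G_def by (intro continuous_intros Fc Bc)
  have low: "I \<le> G d' - G c'" if "a < c'" "c' \<le> c" "d \<le> d'" "d' < b" for c' d'
  proof -
    have r': "rx x \<noteq> 0" if "x \<in> {c'..d'}" for x using r[of x] that \<open>a < c'\<close> \<open>d' < b\<close> by auto
    have cd': "c' \<le> d'" using that ab by linarith
    have "F d' = F c' + (LINT y:{c'..d'}|lborel. qd P P' y)"
      unfolding F_def by (rule set_integral_split) (use that ab qd_integrable[OF P] in auto)
    moreover have "(LINT y:{c'..d'}|lborel. qd P P' y) = (LINT x:{c'..d'}|lborel. cmod2 (res P P' x)) + Bf P d' - Bf P c'"
      by (rule jacobi_integral(1)[OF P cd' r'])
    moreover have "I \<le> (LINT x:{c'..d'}|lborel. cmod2 (res P P' x))"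
      unfolding I_def by (rule set_integral_mono_set) (use jacobi_integral(2)[OF P cd' r'] that in auto)
    ultimately show ?thesis by (simp add: G_def)
  qed
  have "I \<le> G d' - G a" if "d \<le> d'" "d' < b" for d'
  proof (rule tendsto_lowerbound)
    have "(G \<longlongrightarrow> G a) (at_right a)"
      using Gc ab by (auto simp: continuous_on_Icc_at_rightD)
    thus "((\<lambda>x. G d' - G x) \<longlongrightarrow> G d' - G a) (at_right a)" by (intro tendsto_intros)
    show "\<forall>\<^sub>F x in at_right a. I \<le> G d' - G x"
      using ab(1) that low by (intro eventually_at_rightI[of a c]) auto
  qed simp
  hence "I \<le> G b - G a"
  proof (intro tendsto_lowerbound)
    have "(G \<longlongrightarrow> G b) (at_left b)"
      using Gc ab by (auto simp: continuous_on_Icc_at_leftD)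
    thus "((\<lambda>x. G x - G a) \<longlongrightarrow> G b - G a) (at_left b)" by (intro tendsto_intros)
    assume *: "\<And>d'. d \<le> d' \<Longrightarrow> d' < b \<Longrightarrow> I \<le> G d' - G a"
    show "\<forall>\<^sub>F x in at_left b. I \<le> G x - G a"
      using ab(3) * by (intro eventually_at_leftI[of d b]) auto
  qed simp
  moreover have "G b = F b" "G a = F a" using ea(3) eb(3) by (simp_all add: G_def Bf_def)
  moreover have "F a = 0" using set_integral_split[OF order_refl order_refl qd_integrable[OF P], of a] by (simp add: F_def)
  ultimately show ?thesis by (simp add: I_def F_def)
qed

end

lemma AC_eqI: "AC u v \<Longrightarrow> (\<And>x. u x = u' x) \<Longrightarrow> (\<And>x. v x = v' x) \<Longrightarrow> AC u' v'"
  by (metis ext)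

lemma AC_const: "AC (\<lambda>_. c) (\<lambda>_. 0)"
  by (rule AC_C1) auto

section \<open>The bilinear form and solutions of the linearized equation\<close>

context cn_wave
begin

definition bd where
  "bd P P' S S' x = Re (cnj (P' x) * S' x) - (1 + sx x) * Re (cnj (P x) * S x) - 2 * be1 P x * be1 S x"
definition bf where "bf P P' S S' = (LINT x:{0..T}|lborel. bd P P' S S' x)"

lemma bd_self: "bd P P' P P' = qd P P'"
  unfolding bd_def qd_def Re_cnj_mult_self by (rule ext) (simp add: power2_eq_square)

lemma bd_integrable:
  assumes P: "AC P P'" and S: "AC S S'"
  shows "intg a b (bd P P' S S')"
  unfolding bd_def
  by (intro set_integral_diff(1) inner_integrable AC_L2[OF P] AC_L2[OF S] set_integrable_continuous
      continuous_intros sx_continuous AC_continuous[OF P] AC_continuous[OF S] be1_continuous)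

lemma bf_sym: "bf P P' S S' = bf S S' P P'"
  unfolding bf_def
  by (rule set_integral_pw_cong) (simp add: bd_def algebra_simps)

lemma bf_add_cmult:
  assumes "AC P P'" "AC S S'" "AC G G'"
  shows "bf (\<lambda>x. P x + of_real c * S x) (\<lambda>x. P' x + of_real c * S' x) G G' = bf P P' G G' + c * bf S S' G G'"
proof -
  have "bd (\<lambda>x. P x + of_real c * S x) (\<lambda>x. P' x + of_real c * S' x) G G' = (\<lambda>x. bd P P' G G' x + c * bd S S' G G' x)"
    by (rule ext) (simp add: bd_def be1_def algebra_simps)
  moreover have "(LINT x:{0..T}|lborel. bd P P' G G' x + c * bd S S' G G' x) = bf P P' G G' + c * bf S S' G G'"
    unfolding bf_def set_integral_mult_right[symmetric]
    by (intro set_integral_add(2) set_integrable_mult_right bd_integrable assms)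
  ultimately show ?thesis by (simp only: bf_def)
qed

lemma bf_quad:
  assumes P: "AC P P'" and S: "AC S S'"
  shows "bf (\<lambda>x. P x + of_real c * S x) (\<lambda>x. P' x + of_real c * S' x) (\<lambda>x. P x + of_real c * S x) (\<lambda>x. P' x + of_real c * S' x)
    = bf P P' P P' + 2 * c * bf P P' S S' + c\<^sup>2 * bf S S' S S'"
proof -
  have R: "AC (\<lambda>x. P x + of_real c * S x) (\<lambda>x. P' x + of_real c * S' x)" by (intro AC_add AC_cmult P S)
  show ?thesis
    unfolding bf_add_cmult[OF P S R]
    unfolding bf_sym[of P P' "\<lambda>x. P x + of_real c * S x"] bf_sym[of S S' "\<lambda>x. P x + of_real c * S x"]
    unfolding bf_add_cmult[OF P S P] bf_add_cmult[OF P S S] bf_sym[of S S' P P']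
    by (simp add: algebra_simps power2_eq_square)
qed

text \<open>The linearization of - W'' - W - |W|^2 W at the wave, real-linear in \<open>S\<close>;
  the argument \<open>S2\<close> stands for the second derivative.\<close>

definition Lop where
  "Lop S S2 x = - S2 x - of_real (1 + sx x) * S x - of_real (2 * be1 S x) * W x"

lemma bf_by_parts:
  assumes P: "AC P P'" and S: "AC S S1" and S1: "AC S1 S2"
  shows "bf P P' S S1 = Re (cnj (P T) * S1 T) - Re (cnj (P 0) * S1 0)
    + (LINT x:{0..T}|lborel. Re (cnj (P x) * Lop S S2 x))"
proof -
  have i1: "intg 0 T (\<lambda>x. Re (cnj (P' x) * S1 x + cnj (P x) * S2 x))"
    by (intro set_integrable_Re L2_loc_integrable AC_L2[OF AC_mult[OF AC_cnj[OF P] S1]])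
  have L2: "L2_loc (Lop S S2)"
    unfolding Lop_def
    by (intro L2_loc_diff L2_loc_minus AC_L2[OF S1] L2_loc_continuous continuous_intros be1_continuous
        AC_continuous[OF S] sx_continuous W_continuous)
  have i2: "intg 0 T (\<lambda>x. Re (cnj (P x) * Lop S S2 x))"
    by (intro inner_integrable L2 L2_loc_continuous AC_continuous[OF P])
  have "bd P P' S S1 = (\<lambda>x. Re (cnj (P' x) * S1 x + cnj (P x) * S2 x) + Re (cnj (P x) * Lop S S2 x))"
    unfolding bd_def Lop_def be1_def by (rule ext) (simp add: algebra_simps)
  hence "bf P P' S S1 = (LINT x:{0..T}|lborel. Re (cnj (P' x) * S1 x + cnj (P x) * S2 x))
     + (LINT x:{0..T}|lborel. Re (cnj (P x) * Lop S S2 x))"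
    unfolding bf_def by (simp only: set_integral_add(2)[OF i1 i2])
  moreover have "(LINT x:{0..T}|lborel. Re (cnj (P' x) * S1 x + cnj (P x) * S2 x)) = Re (cnj (P T) * S1 T) - Re (cnj (P 0) * S1 0)"
    using ACr_FTC[OF ACr_Re[OF AC_mult[OF AC_cnj[OF P] S1]], of 0 T] T_pos by simp
  ultimately show ?thesis by simp
qed

text \<open>Subtracting the mean makes this primitive vanish at both ends of the period, which keeps
  \<open>vm\<close> and \<open>fB\<close> quasi-periodic.\<close>

definition ze where "ze x = sg * x - Z x"

lemma ze_ends: "ze 0 = 0" "ze T = 0"
  using T_pos by (simp_all add: ze_def Z_0 n_def[symmetric] n_eq)

lemma ze_deriv: "(ze has_real_derivative sg - sx x) (at x)"
  unfolding ze_def by (auto intro!: derivative_eq_intros Z_deriv)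

definition comb where "comb f w x = f x * W x + w x * W1 x"

lemma AC_comb:
  assumes "AC f f'" "AC w w'"
  shows "AC (comb f w) (comb (\<lambda>x. f' x - of_real (1 + sx x) * w x) (\<lambda>x. f x + w' x))"
  by (rule AC_eqI[OF AC_add[OF AC_mult[OF assms(1) AC_W] AC_mult[OF assms(2) AC_W1]]])
     (simp_all add: comb_def algebra_simps)

lemma AC_coeffs: "AC (\<lambda>x. of_real (sx x)) (\<lambda>x. of_real (2 * rx x))" "AC (\<lambda>x. of_real (rx x)) (\<lambda>x. of_real (rp x))"
  "AC (\<lambda>x. of_real (ze x)) (\<lambda>x. of_real (sg - sx x))" "AC (\<lambda>x. of_real x) (\<lambda>_. of_real 1)"
  by (rule ACr_C1[unfolded ACr_def], (rule sx_deriv rx_deriv ze_deriv DERIV_ident),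
      (intro continuous_intros rx_continuous rp_continuous sx_continuous))+

lemma be1_comb: "be1 (comb f w) x = Re (f x) * sx x + Re (w x) * rx x - Im (w x) * J"
proof -
  have "cnj (W x) * comb f w x = f x * of_real (sx x) + w x * (cnj (W x) * W1 x)"
    unfolding comb_def cmod_W[symmetric] complex_norm_square by (simp add: algebra_simps)
  thus ?thesis
    unfolding be1_def rx_def W_angular[of x, symmetric] by simp
qed

lemma Lop_comb: "Lop (comb f w) (comb f2 g2) x
   = (- f2 x - of_real (1 + sx x) * f x - of_real (2 * (Re (f x) * sx x + Re (w x) * rx x - Im (w x) * J))) * W x
     + (- g2 x - of_real (1 + sx x) * w x) * W1 x"
  unfolding Lop_def be1_comb by (simp add: comb_def algebra_simps)

text \<open>Both come from conj W W1 = rx + i J, multiplied by \<open>W\<close>, or conjugated and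
  multiplied by \<open>W1\<close>. They remove the variable coefficients from the images under
  \<open>Lop\<close>.\<close>

lemma frame_relations:
  "of_real (rx x) * W1 x = of_real (2 * E - sx x - (sx x)\<^sup>2 / 2) * W x + \<i> * of_real J * W1 x"
  "of_real (sx x) * W1 x = of_real (rx x) * W x + \<i> * of_real J * W x"
proof -
  have c: "cnj (W x) * W1 x = of_real (rx x) + \<i> * of_real J"
    unfolding rx_def W_angular[of x, symmetric] by (simp add: complex_eq_iff)
  have "of_real (sx x) * W1 x = (cnj (W x) * W1 x) * W x"
    unfolding cmod_W[symmetric] complex_norm_square by simp
  thus "of_real (sx x) * W1 x = of_real (rx x) * W x + \<i> * of_real J * W x"
    unfolding c by (simp add: algebra_simps)
  have "cnj (cnj (W x) * W1 x) * W1 x = of_real (cmod2 (W1 x)) * W x"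
    unfolding complex_norm_square by simp
  moreover have "cmod2 (W1 x) = 2 * E - sx x - (sx x)\<^sup>2 / 2" using W_energy[of x] by simp
  ultimately show "of_real (rx x) * W1 x = of_real (2 * E - sx x - (sx x)\<^sup>2 / 2) * W x + \<i> * of_real J * W1 x"
    unfolding c by (simp add: algebra_simps)
qed

text \<open>\<open>sg\<close> times the scaling generator W + x W', plus (2 + |W|^2) W - Z W', so
  that the growing parts of the two compensate over a period. The image under \<open>Lop\<close> is
  a combination of \<open>W\<close> and \<open>i W1\<close>.\<close>

definition vm where "vm = comb (\<lambda>x. of_real (sg + 2 + sx x)) (\<lambda>x. of_real (ze x))"
definition vm1 where "vm1 = comb (\<lambda>x. of_real (2 * rx x - (1 + sx x) * ze x)) (\<lambda>x. of_real (2 * sg + 2))"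
definition vm2 where "vm2 = comb (\<lambda>x. of_real (2 * rp x - 2 * rx x * ze x - (1 + sx x) * (sg - sx x) - (1 + sx x) * (2 * sg + 2)))
   (\<lambda>x. of_real (2 * rx x - (1 + sx x) * ze x))"

lemma AC_vm: "AC vm vm1" and AC_vm1: "AC vm1 vm2"
proof -
  show "AC vm vm1"
    unfolding vm_def vm1_def
    by (rule AC_eqI[OF AC_comb[of "\<lambda>x. of_real (sg + 2) + of_real (sx x)", OF AC_add[OF AC_const AC_coeffs(1)] AC_coeffs(3)]])
       (simp_all add: comb_def algebra_simps)
  show "AC vm1 vm2"
    unfolding vm1_def vm2_def
    by (rule AC_eqI[OF AC_comb[where f = "\<lambda>x. 2 * of_real (rx x) - (1 + of_real (sx x)) * of_real (ze x)" and w = "\<lambda>_. of_real (2 * sg + 2)",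
          OF AC_diff[OF AC_cmult[OF AC_coeffs(2)] AC_mult[OF AC_add[OF AC_const AC_coeffs(1)] AC_coeffs(3)]] AC_const]])
       (simp_all add: comb_def algebra_simps)
qed

lemma Lop_vm: "Lop vm vm2 x = of_real (2 * (sg - 4 * E)) * W x - \<i> * of_real (2 * J) * W1 x"
proof -
  have "Lop vm vm2 x = of_real (2 * sg - 4 * E - 2 * sx x - (sx x)\<^sup>2) * W x - 2 * (of_real (rx x) * W1 x)"
    unfolding vm_def vm2_def Lop_comb rp_alt
    by (simp add: algebra_simps power2_eq_square)
  thus ?thesis unfolding frame_relations(1) by (simp add: algebra_simps)
qed

text \<open>Companion of \<open>vm\<close>: a multiple of the Galilei generator \<open>i x W\<close>
  with its growth compensated by \<open>Z\<close>. Its image also lies in the span of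
  \<open>W\<close> and \<open>i W1\<close>.\<close>

definition fB where "fB = comb (\<lambda>x. - \<i> * of_real (ze x)) (\<lambda>_. 2 * \<i>)"
definition fB1 where "fB1 = comb (\<lambda>x. - \<i> * of_real (sg + 2 + sx x)) (\<lambda>x. - \<i> * of_real (ze x))"
definition fB2 where "fB2 = comb (\<lambda>x. \<i> * of_real ((1 + sx x) * ze x - 2 * rx x)) (\<lambda>_. - \<i> * of_real (2 * sg + 2))"

lemma AC_fB: "AC fB fB1" and AC_fB1: "AC fB1 fB2"
proof -
  show "AC fB fB1"
    unfolding fB_def fB1_def
    by (rule AC_eqI[OF AC_comb[where f = "\<lambda>x. - \<i> * of_real (ze x)" and w = "\<lambda>_. 2 * \<i>",
          OF AC_cmult[OF AC_coeffs(3)] AC_const]]) (simp_all add: comb_def algebra_simps)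
  show "AC fB1 fB2"
    unfolding fB1_def fB2_def
    by (rule AC_eqI[OF AC_comb[where f = "\<lambda>x. - \<i> * (of_real (sg + 2) + of_real (sx x))" and w = "\<lambda>x. - \<i> * of_real (ze x)",
          OF AC_cmult[OF AC_add[OF AC_const AC_coeffs(1)]] AC_cmult[OF AC_coeffs(3)]]])
       (simp_all add: comb_def algebra_simps)
qed

lemma Lop_fB: "Lop fB fB2 x = of_real (6 * J) * W x + \<i> * of_real (2 * sg) * W1 x"
proof -
  have "Lop fB fB2 x = of_real (4 * J) * W x + \<i> * of_real (2 * sg) * W1 x
     + 2 * \<i> * (of_real (rx x) * W x) - 2 * \<i> * (of_real (sx x) * W1 x)"
    unfolding fB_def fB2_def Lop_comb
    by (simp add: algebra_simps)
  thus ?thesis unfolding frame_relations(2) by (simp add: algebra_simps)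
qed

text \<open>\<open>j (W + x W') - g (i x W)\<close>: scaling and Galilei generators weighted so that
  the coefficient \<open>j W' - i g W\<close> of \<open>x\<close> vanishes at the ends of the
  period. So the value of \<open>fC\<close> respects the quasi-periodicity there, while its
  derivative does not.\<close>

definition fC where "fC = comb (\<lambda>x. of_real j - \<i> * of_real g * of_real x) (\<lambda>x. of_real j * of_real x)"
definition fC1 where "fC1 = comb (\<lambda>x. - \<i> * of_real g - of_real ((1 + sx x) * j * x)) (\<lambda>x. of_real (2 * j) - \<i> * of_real g * of_real x)"
definition fC2 where "fC2 = comb (\<lambda>x. - of_real (2 * rx x * j * x + (1 + sx x) * j + (1 + sx x) * (2 * j)) + \<i> * of_real ((1 + sx x) * g * x))
   (\<lambda>x. - \<i> * of_real (2 * g) - of_real ((1 + sx x) * j * x))"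

lemma AC_fC: "AC fC fC1" and AC_fC1: "AC fC1 fC2"
proof -
  show "AC fC fC1"
    unfolding fC_def fC1_def
    by (rule AC_eqI[OF AC_comb[where f = "\<lambda>x. of_real j - \<i> * of_real g * of_real x" and w = "\<lambda>x. of_real j * of_real x",
          OF AC_diff[OF AC_const AC_cmult[OF AC_coeffs(4)]] AC_cmult[OF AC_coeffs(4)]]])
       (simp_all add: comb_def algebra_simps)
  show "AC fC1 fC2"
    unfolding fC1_def fC2_def
    by (rule AC_eqI[OF AC_comb[where f = "\<lambda>x. - \<i> * of_real g - (1 + of_real (sx x)) * (of_real j * of_real x)"
          and w = "\<lambda>x. of_real (2 * j) - \<i> * of_real g * of_real x",
          OF AC_diff[OF AC_const AC_mult[OF AC_add[OF AC_const AC_coeffs(1)] AC_cmult[OF AC_coeffs(4)]]]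
          AC_diff[OF AC_const AC_cmult[OF AC_coeffs(4)]]]])
       (simp_all add: comb_def algebra_simps)
qed

lemma Lop_fC: "Lop fC fC2 x = of_real (2 * j) * W x + \<i> * of_real (2 * g) * W1 x"
  unfolding fC_def fC2_def Lop_comb by (simp add: J_def algebra_simps)

text \<open>Cramer's rule: with these weights the images of \<open>vm\<close> and \<open>fB\<close>
  cancel that of \<open>dl\<close> times \<open>fC\<close>.\<close>

definition b0 where "b0 = j * (sg - 3 * g\<^sup>2)"
definition b1 where "b1 = g * (j\<^sup>2 + sg - 4 * E)"

definition U where "U x = of_real b0 * vm x + of_real b1 * fB x + of_real dl * fC x"
definition U1 where "U1 x = of_real b0 * vm1 x + of_real b1 * fB1 x + of_real dl * fC1 x"
definition U2 where "U2 x = of_real b0 * vm2 x + of_real b1 * fB2 x + of_real dl * fC2 x"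

lemma AC_U: "AC U U1" and AC_U1: "AC U1 U2"
  unfolding U_def[abs_def] U1_def[abs_def] U2_def[abs_def]
  by (intro AC_add AC_cmult AC_vm AC_vm1 AC_fB AC_fB1 AC_fC AC_fC1)+

lemma Lop_U: "Lop U U2 x = 0"
proof -
  have "Lop U U2 x = of_real b0 * Lop vm vm2 x + of_real b1 * Lop fB fB2 x + of_real dl * Lop fC fC2 x"
    unfolding Lop_def U_def U2_def be1_def by (simp add: algebra_simps)
  also have "\<dots> = of_real (2 * (b0 * (sg - 4 * E) + 3 * J * b1 + j * dl)) * W x
     + \<i> * of_real (2 * (- b0 * J + b1 * sg + g * dl)) * W1 x"
    unfolding Lop_vm Lop_fB Lop_fC by (simp add: algebra_simps)
  also have "b0 * (sg - 4 * E) + 3 * J * b1 + j * dl = 0"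
    unfolding b0_def b1_def dl_def J_def by (simp add: algebra_simps power2_eq_square)
  also have "- b0 * J + b1 * sg + g * dl = 0"
    unfolding b0_def b1_def dl_def J_def by (simp add: algebra_simps power2_eq_square)
  finally show ?thesis by simp
qed

text \<open>The value of \<open>U\<close> at the origin and the kink of \<open>U\<close> across a
  period, see \<open>U_0\<close> and \<open>U1_T\<close>.\<close>

definition u0 where "u0 = (g\<^sup>2 - j\<^sup>2 - j^4) * (4 * g\<^sup>2 - (j\<^sup>2 + 2) * sg)"
definition kap where "kap = T * dl * (g\<^sup>2 - j\<^sup>2 - j^4)"

lemma u0_pos: "0 < u0" and kap_pos: "0 < kap"
  unfolding u0_def kap_def by (intro mult_pos_pos g2_gt four_g2 T_pos dl_pos)+

lemma sx_0: "sx 0 = j\<^sup>2" "sx T = j\<^sup>2" "sx (T / 2) = R\<^sup>2"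
  by (simp_all add: sx_eq Cx_def Sx_def ph_0 ph_half ph_T)

lemma W_T: "W T = cis Th * of_real j" "W1 T = cis Th * (\<i> * of_real g)"
  using W_shift[of 0] W1_shift[of 0] by (simp_all add: W_0 W1_0)

lemma U_0: "U 0 = of_real u0"
proof -
  have "U 0 = of_real (b0 * ((sg + 2 + j\<^sup>2) * j) - 2 * g * b1 + dl * (j * j))"
    unfolding U_def vm_def fB_def fC_def comb_def W_0 W1_0 ze_ends sx_0 by (simp add: algebra_simps)
  also have "b0 * ((sg + 2 + j\<^sup>2) * j) - 2 * g * b1 + dl * (j * j) = u0"
    unfolding b0_def b1_def dl_def u0_def E_def J_def
    by (simp add: algebra_simps power2_eq_square power4_eq_xxxx)
  finally show ?thesis .
qed

lemma U_T: "U T = cis Th * U 0"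
  unfolding U_def vm_def fB_def fC_def comb_def W_0 W1_0 W_T ze_ends sx_0 by (simp add: algebra_simps)

lemma U1_T: "U1 T = cis Th * (U1 0 + of_real kap)"
proof -
  have "U1 T = cis Th * (U1 0 + of_real (T * dl) * (of_real (g * g - (1 + j\<^sup>2) * (j * j))))"
    unfolding U1_def vm1_def fB1_def fC1_def comb_def W_0 W1_0 W_T ze_ends sx_0 rx_sign by (simp add: algebra_simps)
  also have "of_real (T * dl) * (of_real (g * g - (1 + j\<^sup>2) * (j * j))) = complex_of_real kap"
    unfolding kap_def by (simp add: algebra_simps power2_eq_square power4_eq_xxxx)
  finally show ?thesis .
qed

lemma cnj_cis_self: "cnj (cis a) * (cis a * z) = z"
  by (simp add: cis_cnj cis_mult mult.assoc[symmetric])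

text \<open>\<open>U\<close> solves the homogeneous equation, so integration by parts leaves only
  the kink. In the form, \<open>U\<close> therefore represents evaluation of the real part at the
  origin.\<close>

lemma bf_U:
  assumes P: "AC P P'" and qp: "P T = cis Th * P 0"
  shows "bf P P' U U1 = kap * Re (P 0)"
proof -
  have "cnj (P T) * U1 T = cnj (P 0) * (U1 0 + of_real kap)"
    unfolding qp U1_T using cnj_cis_self[of Th] by (simp add: mult_ac)
  thus ?thesis
    unfolding bf_by_parts[OF P AC_U AC_U1] Lop_U by (simp add: algebra_simps set_lebesgue_integral_def)
qed

lemma vm_T: "vm T = cis Th * vm 0" "vm1 T = cis Th * vm1 0"
  unfolding vm_def vm1_def comb_def W_0 W1_0 W_T ze_ends sx_0 rx_sign by (simp_all add: algebra_simps)

text \<open>On quasi-periodic functions this is the form paired with \<open>vm\<close>; it is also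
  the first variation of the combination \<open>laP\<close> of mass and momentum.\<close>

definition ell where "ell P = (LINT x:{0..T}|lborel. Re (cnj (P x) * (of_real (2 * (sg - 4 * E)) * W x - \<i> * of_real (2 * J) * W1 x)))"

lemma bf_vm:
  assumes P: "AC P P'" and qp: "P T = cis Th * P 0"
  shows "bf P P' vm vm1 = ell P"
proof -
  have "cnj (P T) * vm1 T = cnj (P 0) * vm1 0"
    unfolding qp vm_T using cnj_cis_self[of Th] by (simp add: mult_ac)
  thus ?thesis
    unfolding bf_by_parts[OF P AC_vm AC_vm1] Lop_vm ell_def by simp
qed

definition qn where "qn = - bf vm vm1 vm vm1"

text \<open>By \<open>bf_vm\<close> the form at \<open>vm\<close> is an integral of explicit
  functions along the wave, and its value over a period is the quantity in
  \<open>fneg\<close>.\<close>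

lemma qn_pos: "0 < qn"
proof -
  \<comment> \<open>An explicit primitive: \<open>ze * rx\<close> is integrated by parts, and |W|^4
    is expressed by |W|^2 and \<open>rp\<close>, the derivative of \<open>rx\<close>.\<close>
  define F where "F x = 2 * (sg - 4 * E) * ((sg / 2 + 2) * Z x + ze x * sx x / 2 + 2 * E * x - 2 * Z x - rx x)
    + 2 * J\<^sup>2 * ((sg + 2) * x + Z x)" for x
  define f where "f x = 2 * (sg - 4 * E) * ((sg + 2 + sx x) * sx x + ze x * rx x) + 2 * J\<^sup>2 * (sg + 2 + sx x)" for x
  have "(F has_real_derivative 2 * (sg - 4 * E) * ((sg / 2 + 2) * sx x + ((sg - sx x) * sx x + ze x * (2 * rx x)) / 2 + 2 * E - 2 * sx x - rp x)
      + 2 * J\<^sup>2 * ((sg + 2) + sx x)) (at x)" for x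
    unfolding F_def by (auto intro!: derivative_eq_intros Z_deriv ze_deriv sx_deriv rx_deriv)
  moreover have "(sg / 2 + 2) * sx x + ((sg - sx x) * sx x + ze x * (2 * rx x)) / 2 + 2 * E - 2 * sx x - rp x
      = (sg + 2 + sx x) * sx x + ze x * rx x" for x
    unfolding rp_alt by (simp add: field_simps power2_eq_square)
  ultimately have F: "(F has_real_derivative f x) (at x)" for x by (simp add: f_def)
  have "ACr F f"
    by (rule ACr_C1[OF F]) (auto simp: f_def[abs_def] ze_def intro!: continuous_intros sx_continuous rx_continuous
        DERIV_continuous_on[OF DERIV_subset[OF Z_deriv]])
  from ACr_FTC[OF this, of 0 T] T_pos have "(LINT x:{0..T}|lborel. f x) = F T - F 0" by simp
  also have "\<dots> = 2 * T * ((sg - 4 * E) * (sg\<^sup>2 / 2 + 2 * E) + 2 * J\<^sup>2 * (sg + 1))"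
    unfolding F_def ze_ends Z_0 rx_sign n_def[symmetric] n_eq by (simp add: field_simps power2_eq_square)
  also have "\<dots> < 0" using fneg T_pos by (simp add: mult_pos_neg)
  finally have neg: "(LINT x:{0..T}|lborel. f x) < 0" .
  have "Re (cnj (vm x) * (of_real (2 * (sg - 4 * E)) * W x - \<i> * of_real (2 * J) * W1 x)) = f x" for x
  proof -
    have 1: "Re (cnj (vm x) * W x) = (sg + 2 + sx x) * sx x + ze x * rx x"
      using be1_comb[of "\<lambda>x. of_real (sg + 2 + sx x)" "\<lambda>x. of_real (ze x)" x, folded vm_def]
      by (simp add: be1_def algebra_simps)
    have e: "cnj (vm x) * W1 x = of_real (sg + 2 + sx x) * (cnj (W x) * W1 x) + of_real (ze x) * (cnj (W1 x) * W1 x)"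
      unfolding vm_def comb_def by (simp add: algebra_simps)
    have 2: "Im (cnj (vm x) * W1 x) = (sg + 2 + sx x) * J"
      unfolding e plus_complex.sel Im_of_real_mult W_angular by simp
    have "Re (cnj (vm x) * (of_real (2 * (sg - 4 * E)) * W x - \<i> * of_real (2 * J) * W1 x))
      = 2 * (sg - 4 * E) * Re (cnj (vm x) * W x) + 2 * J * Im (cnj (vm x) * W1 x)"
      by (simp add: algebra_simps)
    thus ?thesis unfolding 1 2 f_def by (simp add: power2_eq_square algebra_simps)
  qed
  hence "ell vm = (LINT x:{0..T}|lborel. f x)" by (simp add: ell_def)
  thus ?thesis using neg bf_vm[OF AC_vm vm_T(1)] by (simp add: qn_def)
qed

section \<open>Nonnegativity of the form and its negative direction\<close>

lemma rp_ends: "0 < rp 0" "0 < rp T" "rp (T / 2) < 0"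
proof -
  have "rp 0 = g\<^sup>2 - j\<^sup>2 - j^4"
    unfolding rp_def W1_0 sx_0 by (simp add: norm_mult power2_eq_square power4_eq_xxxx algebra_simps)
  thus "0 < rp 0" "0 < rp T" using g2_gt rp_alt[of 0] rp_alt[of T] by (simp_all add: sx_0)
  have "2 * rp (T / 2) = 4 * E - 4 * R\<^sup>2 - 3 * (R\<^sup>2)\<^sup>2" unfolding rp_alt sx_0 by simp
  also have "\<dots> = - ((R\<^sup>2 - j\<^sup>2) * (2 + 2 * R\<^sup>2 + j\<^sup>2))"
    unfolding fourE eta_def by (simp add: algebra_simps power2_eq_square)
  also have "\<dots> < 0"
  proof -
    have "0 < (R\<^sup>2 - j\<^sup>2) * (2 + 2 * R\<^sup>2 + j\<^sup>2)"
      using j2_less by (intro mult_pos_pos add_pos_nonneg) auto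
    thus ?thesis by simp
  qed
  finally show "rp (T / 2) < 0" by simp
qed

text \<open>The two conditions place \<open>P\<close> on the line spanned by the collapsed frame at
  the three zeros of \<open>rx\<close>, so \<open>half_period\<close> applies on both halves. At
  \<open>T\<close> this follows by quasi-periodicity.\<close>

lemma form_nonneg:
  assumes P: "AC P P'" and qp: "P T = cis Th * P 0" and z: "Re (P 0) = 0" "be1 P (T / 2) = 0"
    and cd: "c \<le> d" "0 < c \<and> d < T / 2 \<or> T / 2 < c \<and> d < T"
  shows "resn c d P P' \<le> bf P P' P P'"
proof -
  have e0: "al1 P 0 = 0" "be1 P 0 = 0"
    using z(1) by (simp_all add: al1_def be1_def W_0 W1_0)
  have eT: "al1 P T = 0" "be1 P T = 0"
  proof -
    have e: "cnj (cis Th * w) * P T = cnj w * P 0" for w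
      unfolding qp using cnj_cis_self[of Th] by (simp add: mult_ac)
    show "al1 P T = 0" "be1 P T = 0"
      unfolding al1_def be1_def W_T e using z(1) by simp_all
  qed
  \<comment> \<open>At the maximum of |W| the velocity is a real multiple of \<open>i W\<close>, so
    the vanishing of \<open>be1\<close> entails that of \<open>al1\<close>.\<close>
  have "of_real (R\<^sup>2) * W1 (T / 2) = \<i> * of_real J * W (T / 2)"
    using frame_relations(2)[of "T / 2"] rx_sign(4) sx_0 by simp
  hence "cnj (of_real (R\<^sup>2) * W1 (T / 2)) * P (T / 2) = cnj (\<i> * of_real J * W (T / 2)) * P (T / 2)" by simp
  hence "Im (of_real (R\<^sup>2) * (cnj (W1 (T / 2)) * P (T / 2))) = Im (- \<i> * of_real J * (cnj (W (T / 2)) * P (T / 2)))"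
    by (simp add: mult_ac)
  hence "R\<^sup>2 * al1 P (T / 2) = - J * be1 P (T / 2)"
    unfolding al1_def be1_def Im_of_real_mult by simp
  hence eh: "al1 P (T / 2) = 0" using z(2) R_pos by simp
  have r1: "rx x \<noteq> 0" if "0 < x" "x < T / 2" for x using rx_sign(1)[OF that] by simp
  have r2: "rx x \<noteq> 0" if "T / 2 < x" "x < T" for x using rx_sign(2)[OF that] by simp
  have rpn: "rp 0 \<noteq> 0" "rp (T / 2) \<noteq> 0" "rp T \<noteq> 0" using rp_ends by simp_all
  have A: "resn c d P P' \<le> (LINT x:{0..T/2}|lborel. qd P P' x)" if "0 < c" "c \<le> d" "d < T / 2" for c d
    by (rule half_period[OF P that r1 e0 rx_sign(3) rpn(1) eh z(2) rx_sign(4) rpn(2)])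
  have B: "resn c d P P' \<le> (LINT x:{T/2..T}|lborel. qd P P' x)" if "T / 2 < c" "c \<le> d" "d < T" for c d
    by (rule half_period[OF P that r2 eh z(2) rx_sign(4) rpn(2) eT rx_sign(5) rpn(3)])
  have nn: "0 \<le> resn c d P P'" for c d by (rule set_integral_nonneg) simp
  have "bf P P' P P' = (LINT x:{0..T}|lborel. qd P P' x)" unfolding bf_def bd_self ..
  also have "\<dots> = (LINT x:{0..T/2}|lborel. qd P P' x) + (LINT x:{T/2..T}|lborel. qd P P' x)"
    by (rule set_integral_split) (use T_pos qd_integrable[OF P] in auto)
  finally have s: "bf P P' P P' = (LINT x:{0..T/2}|lborel. qd P P' x) + (LINT x:{T/2..T}|lborel. qd P P' x)" .
  have "0 \<le> (LINT x:{0..T/2}|lborel. qd P P' x)" using A[of "T / 4" "T / 4"] nn[of "T / 4" "T / 4"] T_pos by linarith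
  moreover have "0 \<le> (LINT x:{T/2..T}|lborel. qd P P' x)" using B[of "3 * T / 4" "3 * T / 4"] nn[of "3 * T / 4" "3 * T / 4"] T_pos by linarith
  ultimately show ?thesis unfolding s using cd A[of c d] B[of c d] by auto
qed

text \<open>Once \<open>P\<close> is corrected by a multiple of \<open>U\<close> to be imaginary at
  the origin, \<open>chi P / u0\<close> is the value of \<open>be1\<close> at \<open>T / 2\<close>:
  the one remaining obstruction to \<open>form_nonneg\<close>.\<close>

definition chi where "chi P = u0 * be1 P (T / 2) - Re (P 0) * be1 U (T / 2)"

text \<open>Otherwise \<open>vm\<close> would be a function with nonnegative form plus a multiple of
  \<open>U\<close>, orthogonal to it in the form and itself of nonnegative form, against
  \<open>qn_pos\<close>.\<close>

lemma chi_vm: "chi vm \<noteq> 0"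
proof
  assume c: "chi vm = 0"
  define t where "t = Re (vm 0) / u0"
  define p p' where "p = (\<lambda>x. vm x + of_real (- t) * U x)" and "p' = (\<lambda>x. vm1 x + of_real (- t) * U1 x)"
  have p: "AC p p'" unfolding p_def p'_def by (intro AC_add AC_cmult AC_vm AC_U)
  have qp: "p T = cis Th * p 0" unfolding p_def U_T vm_T by (simp add: algebra_simps)
  have z: "Re (p 0) = 0" using u0_pos by (simp add: p_def U_0 t_def)
  have "be1 p (T / 2) = be1 vm (T / 2) - t * be1 U (T / 2)"
    unfolding be1_def p_def by (simp add: algebra_simps)
  also have "\<dots> = chi vm / u0" using u0_pos by (simp add: chi_def t_def field_simps)
  finally have z2: "be1 p (T / 2) = 0" using c by simp
  have "0 \<le> bf p p' p p'"
    using form_nonneg[OF p qp z z2, of "T / 4" "T / 4"] T_pos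
      set_integral_nonneg[of "{T / 4..T / 4}" "\<lambda>x. cmod2 (res p p' x)"] by simp
  moreover have "vm = (\<lambda>x. p x + of_real t * U x)" "vm1 = (\<lambda>x. p' x + of_real t * U1 x)"
    by (auto simp: p_def p'_def)
  hence "bf vm vm1 vm vm1 = bf p p' p p' + 2 * t * bf p p' U U1 + t\<^sup>2 * bf U U1 U U1"
    using bf_quad[OF p AC_U, of t] by simp
  moreover have "bf p p' U U1 = 0" using bf_U[OF p qp] z by simp
  moreover have "bf U U1 U U1 = kap * u0" using bf_U[OF AC_U U_T] by (simp add: U_0)
  moreover have "0 \<le> t\<^sup>2 * (kap * u0)" using kap_pos u0_pos by simp
  ultimately show False using qn_pos by (simp add: qn_def)
qed

text \<open>On \<open>chi = 0\<close> the form is nonnegative; the multiple of the square of \<open>ell\<close> (the form paired with the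
  negative direction \<open>vm\<close>) exactly reverses the sign in the remaining direction.\<close>

lemma form_decomposition:
  assumes P: "AC P P'" and qp: "P T = cis Th * P 0"
  shows "\<exists>t s p p' m. AC p p' \<and> p T = cis Th * p 0 \<and> Re (p 0) = 0 \<and> be1 p (T / 2) = 0
    \<and> (\<forall>x. P x = p x + of_real t * U x + of_real s * vm x) \<and> (\<forall>x. P' x = p' x + of_real t * U1 x + of_real s * vm1 x)
    \<and> bf P P' P P' + 2 / qn * (ell P)\<^sup>2 = bf p p' p p' + kap * u0 * t\<^sup>2 + qn * (s - m / qn)\<^sup>2 + m\<^sup>2 / qn"
proof -
  \<comment> \<open>First the multiple of \<open>vm\<close> that carries \<open>chi\<close> is
    removed, then the multiple of \<open>U\<close> that carries the real part at the origin.\<close>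
  define s where "s = chi P / chi vm"
  define w w' where "w = (\<lambda>x. P x + of_real (- s) * vm x)" and "w' = (\<lambda>x. P' x + of_real (- s) * vm1 x)"
  have w: "AC w w'" unfolding w_def w'_def by (intro AC_add AC_cmult AC_vm P)
  have wq: "w T = cis Th * w 0" unfolding w_def qp vm_T by (simp add: algebra_simps)
  define t where "t = Re (w 0) / u0"
  define p p' where "p = (\<lambda>x. w x + of_real (- t) * U x)" and "p' = (\<lambda>x. w' x + of_real (- t) * U1 x)"
  have p: "AC p p'" unfolding p_def p'_def by (intro AC_add AC_cmult AC_U w)
  have pq: "p T = cis Th * p 0" unfolding p_def wq U_T by (simp add: algebra_simps)
  have z: "Re (p 0) = 0" using u0_pos by (simp add: p_def U_0 t_def)
  have "chi w = chi P - s * chi vm" unfolding chi_def be1_def w_def by (simp add: algebra_simps)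
  hence "chi w = 0" using chi_vm by (simp add: s_def)
  moreover have "be1 p (T / 2) = be1 w (T / 2) - t * be1 U (T / 2)" unfolding be1_def p_def by (simp add: algebra_simps)
  moreover have "\<dots> = chi w / u0" using u0_pos by (simp add: chi_def t_def field_simps)
  ultimately have z2: "be1 p (T / 2) = 0" by simp
  define m where "m = bf w w' vm vm1"
  have Pw: "P = (\<lambda>x. w x + of_real s * vm x)" "P' = (\<lambda>x. w' x + of_real s * vm1 x)"
    and wp: "w = (\<lambda>x. p x + of_real t * U x)" "w' = (\<lambda>x. p' x + of_real t * U1 x)"
    by (auto simp: w_def w'_def p_def p'_def)
  have "bf w w' w w' = bf p p' p p' + 2 * t * bf p p' U U1 + t\<^sup>2 * bf U U1 U U1"
    using bf_quad[OF p AC_U, of t] unfolding wp .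
  moreover have "bf p p' U U1 = 0" using bf_U[OF p pq] z by simp
  moreover have "bf U U1 U U1 = kap * u0" using bf_U[OF AC_U U_T] by (simp add: U_0)
  ultimately have 1: "bf w w' w w' = bf p p' p p' + kap * u0 * t\<^sup>2" by simp
  have 2: "bf P P' P P' = bf w w' w w' + 2 * s * m - s\<^sup>2 * qn"
    using bf_quad[OF w AC_vm, of s] unfolding Pw m_def qn_def by simp
  have "bf P P' vm vm1 = m - s * qn"
    using bf_add_cmult[OF w AC_vm AC_vm, of s] unfolding Pw m_def qn_def by simp
  hence 3: "ell P = m - s * qn" using bf_vm[OF P qp] by simp
  \<comment> \<open>The \<open>vm\<close> part adds \<open>2 s m - s^2 qn\<close> to the form, and
    \<open>ell P\<close> equals \<open>m - s qn\<close>. The weight \<open>2 / qn\<close> turns the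
    sum into a square of \<open>s - m / qn\<close> and a positive multiple of
    \<open>m^2\<close>.\<close>
  have "bf P P' P P' + 2 / qn * (ell P)\<^sup>2 = bf p p' p p' + kap * u0 * t\<^sup>2 + qn * (s - m / qn)\<^sup>2 + m\<^sup>2 / qn"
    unfolding 1 2 3 using qn_pos by (simp add: field_simps power2_eq_square)
  moreover have "P x = p x + of_real t * U x + of_real s * vm x" "P' x = p' x + of_real t * U1 x + of_real s * vm1 x" for x
    by (simp_all add: p_def p'_def w_def w'_def)
  ultimately show ?thesis using p pq z z2 by blast
qed

end

section \<open>Coercivity\<close>

lemma power2_mono_abs: "\<bar>a\<bar> \<le> b \<Longrightarrow> a\<^sup>2 \<le> b\<^sup>2" for a b :: real
  using power_mono[of "\<bar>a\<bar>" b 2] by simp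

section \<open>Lifting periodic functions to the frame of the wave\<close>

context cn_wave
begin

lemma bf_AC_unique:
  assumes "AC P P'" "AC P P''" "AC S S'"
  shows "bf P P' S S' = bf P P'' S S'"
  unfolding bf_def
proof (rule set_integral_AE_cong')
  show "AE x in lborel. bd P P' S S' x = bd P P'' S S' x"
    using AC_unique[OF assms(1,2)] by eventually_elim (simp add: bd_def)
qed (intro bd_integrable assms)+

text \<open>\<open>aT\<close> and \<open>th\<close> are \<open>2 k\<close> and \<open>p\<close> in
  the notation of the equation.\<close>

definition aT where "aT = 2 * pi / T"
definition th where "th = Th / T"

lemma aT_pos: "0 < aT" and aT_T: "aT * T = 2 * pi" and th_T: "th * T = Th"
  using T_pos by (simp_all add: aT_def th_def)

text \<open>The lift maps \<open>Q\<close> to the function \<open>exp (i p x) Q (2 k x)\<close>, for which the profile becomes \<open>W\<close> itself.\<close>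

definition lf where "lf v x = cis (th * x) * fn v (aT * x)"
definition lf1 where "lf1 v x = cis (th * x) * (\<i> * of_real th * fn v (aT * x) + of_real aT * dv v (aT * x))"
abbreviation lfd where "lfd v x \<equiv> lf1 v x - \<i> * of_real th * lf v x"
definition un where "un V = H1 (\<lambda>z. cis (- (th / aT * z)) * V (z / aT))"

lemma AC_cis: "AC (\<lambda>x. cis (c * x)) (\<lambda>x. \<i> * of_real c * cis (c * x))"
proof (rule AC_C1)
  show "((\<lambda>x. cis (c * x)) has_vector_derivative \<i> * of_real c * cis (c * x)) (at x)" for x
    by (rule has_vector_derivative_cis) (auto intro!: derivative_eq_intros)
qed (intro continuous_intros)

lemma AC_lf: "AC (lf v) (lf1 v)"
proof -
  have "AC (\<lambda>x. fn v (0 + aT * x)) (\<lambda>x. of_real aT * dv v (0 + aT * x))"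
    by (rule AC_affine[OF AC_fn aT_pos])
  from AC_eqI[OF AC_mult[OF AC_cis[of th] this]] show ?thesis
    by (rule AC_eqI) (simp_all add: lf_def lf1_def algebra_simps)
qed

lemma lf_shift: "lf v (x + T) = cis Th * lf v x"
proof -
  have "fn v (aT * (x + T)) = fn v (aT * x)"
    using fn_periodic[of v "aT * x"] aT_T by (simp add: distrib_left)
  moreover have "cis (th * (x + T)) = cis Th * cis (th * x)" by (simp add: cis_mult distrib_left th_T add.commute)
  ultimately show ?thesis by (simp add: lf_def)
qed

lemma lf_T: "lf v T = cis Th * lf v 0"
  using lf_shift[of v 0] by simp

lemma cmod_lf: "cmod (lf v x) \<le> 4 * norm v"
  by (simp add: lf_def norm_mult fn_bound)

lemma lf_linear: "lf (u + v) x = lf u x + lf v x" "lf (r *\<^sub>R v) x = of_real r * lf v x" "lf (cmul c v) x = c * lf v x"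
  by (simp_all add: lf_def fn_simps algebra_simps)

lemma un_X:
  assumes "AC V V'" "\<And>x. V (x + T) = cis Th * V x"
  shows "(\<lambda>z. cis (- (th / aT * z)) * V (z / aT)) \<in> X_space"
proof (rule X_space_I)
  have "AC (\<lambda>z. cis (- (th / aT) * z) * V (0 + (1 / aT) * z))
     (\<lambda>z. \<i> * of_real (- (th / aT)) * cis (- (th / aT) * z) * V (0 + (1 / aT) * z)
        + cis (- (th / aT) * z) * (of_real (1 / aT) * V' (0 + (1 / aT) * z)))"
    by (intro AC_mult AC_cis AC_affine assms) (use aT_pos in simp)
  thus "AC (\<lambda>z. cis (- (th / aT * z)) * V (z / aT))
     (\<lambda>z. \<i> * of_real (- (th / aT)) * cis (- (th / aT) * z) * V (0 + (1 / aT) * z)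
        + cis (- (th / aT) * z) * (of_real (1 / aT) * V' (0 + (1 / aT) * z)))" by simp
  show "cis (- (th / aT * (z + 2 * pi))) * V ((z + 2 * pi) / aT) = cis (- (th / aT * z)) * V (z / aT)" for z
  proof -
    have e: "(z + 2 * pi) / aT = z / aT + T" "th / aT * (z + 2 * pi) = th / aT * z + Th"
      unfolding aT_T[symmetric] th_T[symmetric] using aT_pos by (simp_all add: field_simps)
    have "cis (- (th / aT * z + Th)) * (cis Th * V (z / aT)) = cis (- (th / aT * z)) * V (z / aT)"
      by (simp add: cis_mult mult.assoc[symmetric])
    thus ?thesis unfolding e assms(2) .
  qed
qed

lemma lf_un:
  assumes "AC V V'" "\<And>x. V (x + T) = cis Th * V x"
  shows "lf (un V) = V"
proof
  fix x
  show "lf (un V) x = V x"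
    unfolding lf_def un_def fn_H1[OF un_X[OF assms]] using aT_pos
    by (simp add: cis_mult mult.assoc[symmetric])
qed

lemma iper_lift:
  fixes f :: "real \<Rightarrow> real"
  shows "iper f = aT * (LINT x:{0..T}|lborel. f (aT * x))"
  using set_integral_affine[OF aT_pos, of 0 T f 0] aT_pos aT_T by simp

lemma L2_lift: "L2_loc (\<lambda>x. lfd u x)"
  by (intro L2_loc_diff L2_loc_cmult AC_L2[OF AC_lf] L2_loc_continuous AC_continuous[OF AC_lf])

lemma inner_lift: "inner v u = aT * (LINT x:{0..T}|lborel. Re (cnj (lf v x) * lf u x))
   + (1 / aT) * (LINT x:{0..T}|lborel. Re (cnj (lfd v x) * lfd u x))"
proof -
  have 1: "cnj (fn v (aT * x)) * fn u (aT * x) = cnj (lf v x) * lf u x" for x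
    unfolding lf_def using cnj_cis_self[of "th * x"] by (simp add: mult_ac)
  have "lfd v x = cis (th * x) * (of_real aT * dv v (aT * x))" for v x
    unfolding lf_def lf1_def by (simp add: algebra_simps)
  hence "cnj (lfd v x) * lfd u x
     = of_real (aT * aT) * (cnj (dv v (aT * x)) * dv u (aT * x))" for x
    using cnj_cis_self[of "th * x"] by (simp add: mult_ac)
  hence "(LINT x:{0..T}|lborel. Re (cnj (lfd v x) * lfd u x))
     = (LINT x:{0..T}|lborel. (aT * aT) * Re (cnj (dv v (aT * x)) * dv u (aT * x)))"
    by (simp only: Re_of_real_mult)
  hence 2: "(1 / aT) * (LINT x:{0..T}|lborel. Re (cnj (lfd v x) * lfd u x))
     = aT * (LINT x:{0..T}|lborel. Re (cnj (dv v (aT * x)) * dv u (aT * x)))"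
    using aT_pos by simp
  show ?thesis
    unfolding inner_h1_AC[OF AC_fn AC_fn, of v u] iper_lift 1 2 ..
qed

lemma norm_lift: "(norm v)\<^sup>2 = aT * (LINT x:{0..T}|lborel. cmod2 (lf v x))
   + (1 / aT) * (LINT x:{0..T}|lborel. cmod2 (lfd v x))"
  using inner_lift[of v v] unfolding Re_cnj_mult_self by (simp add: power2_norm_eq_inner)

lemma sq_norm_le2:
  fixes a b :: complex
  shows "cmod2 (a + b) \<le> 2 * cmod2 a + 2 * cmod2 b"
proof -
  have "cmod2 (a + b) \<le> (cmod a + cmod b)\<^sup>2" by (intro power_mono norm_triangle_ineq norm_ge_zero)
  thus ?thesis using sum_squares_bound[of "cmod a" "cmod b"] by (simp add: power2_sum)
qed

lemma lf1_bound: "\<exists>C\<ge>0. \<forall>v. (LINT x:{0..T}|lborel. cmod2 (lf1 v x)) \<le> C * (norm v)\<^sup>2"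
proof (intro exI conjI allI)
  fix v
  define A where "A = (LINT x:{0..T}|lborel. cmod2 (lf v x))"
  define B where "B = (LINT x:{0..T}|lborel. cmod2 (lfd v x))"
  have nn: "0 \<le> A" "0 \<le> B" unfolding A_def B_def by (intro set_integral_nonneg; simp)+
  have "(norm v)\<^sup>2 = aT * A + (1 / aT) * B" unfolding A_def B_def by (rule norm_lift)
  moreover have "0 \<le> aT * A" "0 \<le> (1 / aT) * B" using nn aT_pos by simp_all
  ultimately have "aT * A \<le> (norm v)\<^sup>2" "(1 / aT) * B \<le> (norm v)\<^sup>2" by linarith+
  hence AB: "A \<le> (norm v)\<^sup>2 / aT" "B \<le> aT * (norm v)\<^sup>2" using aT_pos by (simp_all add: field_simps)
  have iA: "intg 0 T (\<lambda>x. cmod2 (lf v x))"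
    by (intro L2_loc_sq_integrable L2_loc_continuous AC_continuous[OF AC_lf])
  have "(LINT x:{0..T}|lborel. cmod2 (lf1 v x))
     \<le> (LINT x:{0..T}|lborel. 2 * cmod2 (lfd v x) + 2 * th\<^sup>2 * cmod2 (lf v x))"
  proof (rule set_integral_mono)
    show "cmod2 (lf1 v x) \<le> 2 * cmod2 (lfd v x) + 2 * th\<^sup>2 * cmod2 (lf v x)" for x
      using sq_norm_le2[of "lfd v x" "\<i> * of_real th * lf v x"]
      by (simp add: norm_mult power_mult_distrib)
  qed (intro L2_loc_sq_integrable AC_L2[OF AC_lf] set_integral_add(1) set_integrable_mult_right L2_lift iA)+
  also have "\<dots> = 2 * B + 2 * th\<^sup>2 * A"
    unfolding A_def B_def
    by (subst set_integral_add(2)) (auto intro!: L2_loc_sq_integrable set_integrable_mult_right L2_lift iA)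
  also have "\<dots> \<le> 2 * (aT * (norm v)\<^sup>2) + 2 * th\<^sup>2 * ((norm v)\<^sup>2 / aT)"
    using AB by (intro add_mono mult_left_mono) auto
  also have "\<dots> = (2 * aT + 2 * th\<^sup>2 / aT) * (norm v)\<^sup>2" by (simp add: algebra_simps)
  finally show "(LINT x:{0..T}|lborel. cmod2 (lf1 v x)) \<le> (2 * aT + 2 * th\<^sup>2 / aT) * (norm v)\<^sup>2" .
qed (use aT_pos in simp)

lemma sup_sq_integral:
  assumes "AC P P'" "\<And>x. x \<in> {0..T} \<Longrightarrow> cmod (P x) \<le> e"
  shows "(LINT x:{0..T}|lborel. cmod2 (P x)) \<le> T * e\<^sup>2"
proof -
  have "(LINT x:{0..T}|lborel. cmod2 (P x)) \<le> (LINT x:{0..T}|lborel. e\<^sup>2)"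
    by (rule set_integral_mono[OF L2_loc_sq_integrable[OF L2_loc_continuous[OF AC_continuous[OF assms(1)]]]])
       (use assms(2) in \<open>auto intro: power_mono set_integrable_continuous\<close>)
  thus ?thesis using T_pos by (simp add: set_lebesgue_integral_def)
qed

lemma be1_le: "(be1 P x)\<^sup>2 \<le> R\<^sup>2 * cmod2 (P x)"
proof -
  have "\<bar>be1 P x\<bar> \<le> cmod (W x) * cmod (P x)"
    unfolding be1_def using abs_Re_le_cmod[of "cnj (W x) * P x"] by (simp add: norm_mult)
  hence "(be1 P x)\<^sup>2 \<le> (cmod (W x) * cmod (P x))\<^sup>2" by (rule power2_mono_abs)
  also have "\<dots> \<le> R\<^sup>2 * cmod2 (P x)"
    unfolding power_mult_distrib cmod_W by (intro mult_right_mono sx_le) simp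
  finally show ?thesis .
qed

lemma form_lower:
  assumes P: "AC P P'"
  shows "(LINT x:{0..T}|lborel. cmod2 (P' x)) \<le> bf P P' P P' + (1 + 3 * R\<^sup>2) * (LINT x:{0..T}|lborel. cmod2 (P x))"
proof -
  have i: "intg 0 T (\<lambda>x. cmod2 (P x))"
    by (intro L2_loc_sq_integrable L2_loc_continuous AC_continuous[OF P])
  have "(LINT x:{0..T}|lborel. cmod2 (P' x)) \<le> (LINT x:{0..T}|lborel. qd P P' x + (1 + 3 * R\<^sup>2) * cmod2 (P x))"
  proof (rule set_integral_mono)
    show "cmod2 (P' x) \<le> qd P P' x + (1 + 3 * R\<^sup>2) * cmod2 (P x)" for x
    proof -
      have "sx x * cmod2 (P x) \<le> R\<^sup>2 * cmod2 (P x)" by (intro mult_right_mono sx_le) simp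
      thus ?thesis using be1_le[of P x] by (simp add: qd_def algebra_simps)
    qed
  qed (intro L2_loc_sq_integrable AC_L2[OF P] set_integral_add(1) set_integrable_mult_right i qd_integrable[OF P])+
  also have "\<dots> = bf P P' P P' + (1 + 3 * R\<^sup>2) * (LINT x:{0..T}|lborel. cmod2 (P x))"
    unfolding bf_def bd_self set_integral_mult_right[symmetric]
    by (intro set_integral_add(2) set_integrable_mult_right i qd_integrable[OF P])
  finally show ?thesis .
qed

text \<open>A Garding inequality: the form controls the derivative up to the size of the function.
  It prevents unit vectors with vanishing form from tending to zero uniformly.\<close>

lemma norm_le_form:
  "\<exists>C\<ge>0. \<forall>v e. (\<forall>x\<in>{0..T}. cmod (lf v x) \<le> e) \<longrightarrow> (norm v)\<^sup>2 \<le> C * e\<^sup>2 + 2 / aT * bf (lf v) (lf1 v) (lf v) (lf1 v)"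
proof (intro exI conjI allI impI)
  fix v e assume e: "\<forall>x\<in>{0..T}. cmod (lf v x) \<le> e"
  define A where "A = (LINT x:{0..T}|lborel. cmod2 (lf v x))"
  define B where "B = (LINT x:{0..T}|lborel. cmod2 (lf1 v x))"
  have iA: "intg 0 T (\<lambda>x. cmod2 (lf v x))"
    by (intro L2_loc_sq_integrable L2_loc_continuous AC_continuous[OF AC_lf])
  have A: "A \<le> T * e\<^sup>2" unfolding A_def by (rule sup_sq_integral[OF AC_lf]) (use e in auto)
  have "(LINT x:{0..T}|lborel. cmod2 (lfd v x))
      \<le> (LINT x:{0..T}|lborel. 2 * cmod2 (lf1 v x) + 2 * th\<^sup>2 * cmod2 (lf v x))"
  proof (rule set_integral_mono)
    show "cmod2 (lfd v x) \<le> 2 * cmod2 (lf1 v x) + 2 * th\<^sup>2 * cmod2 (lf v x)" for x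
      using sq_norm_le2[of "lf1 v x" "- (\<i> * of_real th * lf v x)"]
      by (simp add: norm_mult power_mult_distrib)
  qed (intro L2_loc_sq_integrable AC_L2[OF AC_lf] set_integral_add(1) set_integrable_mult_right L2_lift iA)+
  also have "\<dots> = 2 * B + 2 * th\<^sup>2 * A"
    unfolding A_def B_def
    by (subst set_integral_add(2)) (auto intro!: L2_loc_sq_integrable set_integrable_mult_right AC_L2[OF AC_lf] iA)
  finally have "(1 / aT) * (LINT x:{0..T}|lborel. cmod2 (lfd v x)) \<le> (1 / aT) * (2 * B + 2 * th\<^sup>2 * A)"
    using aT_pos by (intro mult_left_mono) auto
  moreover have "(1 / aT) * (2 * B + 2 * th\<^sup>2 * A) \<le> (1 / aT) * (2 * (bf (lf v) (lf1 v) (lf v) (lf1 v) + (1 + 3 * R\<^sup>2) * A) + 2 * th\<^sup>2 * A)"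
    using form_lower[OF AC_lf, of v] aT_pos by (intro mult_left_mono add_mono) (auto simp: A_def B_def)
  ultimately have "(norm v)\<^sup>2 \<le> aT * A + (1 / aT) * (2 * (bf (lf v) (lf1 v) (lf v) (lf1 v) + (1 + 3 * R\<^sup>2) * A) + 2 * th\<^sup>2 * A)"
    unfolding norm_lift A_def by linarith
  also have "\<dots> = (aT + (2 * (1 + 3 * R\<^sup>2) + 2 * th\<^sup>2) / aT) * A + 2 / aT * bf (lf v) (lf1 v) (lf v) (lf1 v)"
    using aT_pos by (simp add: field_simps)
  also have "\<dots> \<le> (aT + (2 * (1 + 3 * R\<^sup>2) + 2 * th\<^sup>2) / aT) * (T * e\<^sup>2) + 2 / aT * bf (lf v) (lf1 v) (lf v) (lf1 v)"
    using A aT_pos by (intro add_right_mono mult_left_mono) auto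
  finally show "(norm v)\<^sup>2 \<le> ((aT + (2 * (1 + 3 * R\<^sup>2) + 2 * th\<^sup>2) / aT) * T) * e\<^sup>2 + 2 / aT * bf (lf v) (lf1 v) (lf v) (lf1 v)"
    by (simp add: mult.assoc)
qed (use aT_pos T_pos in simp)

text \<open>Makes the constraint functionals continuous under uniform convergence.\<close>

lemma inner_un:
  assumes V: "AC V V1" and V1: "AC V1 V2" and q: "\<And>x. V (x + T) = cis Th * V x" "\<And>x. V1 (x + T) = cis Th * V1 x"
  shows "\<exists>\<Psi>. L2_loc \<Psi> \<and> (\<forall>v. inner v (un V) = (LINT x:{0..T}|lborel. Re (cnj (lf v x) * \<Psi> x)))"
proof -
  define B B' where "B = (\<lambda>x. V1 x - \<i> * of_real th * V x)" and "B' = (\<lambda>x. V2 x - \<i> * of_real th * V1 x)"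
  have B: "AC B B'" unfolding B_def B'_def by (intro AC_diff AC_cmult V V1)
  have BT: "B T = cis Th * B 0" using q[of 0] by (simp add: B_def algebra_simps)
  \<comment> \<open>The derivative part of the inner product is integrated by parts; there is no
    boundary term since \<open>lf v\<close> and \<open>B\<close> have the same
    quasi-periodicity.\<close>
  define \<Psi> where "\<Psi> x = of_real aT * V x + of_real (1 / aT) * (\<i> * of_real th * B x - B' x)" for x
  have Psi: "L2_loc \<Psi>"
    unfolding \<Psi>_def by (intro L2_loc_add L2_loc_cmult L2_loc_diff AC_L2[OF B] L2_loc_continuous AC_continuous[OF B] AC_continuous[OF V])
  have "inner v (un V) = (LINT x:{0..T}|lborel. Re (cnj (lf v x) * \<Psi> x))" for v
  proof -
    note c = L2_loc_continuous[OF AC_continuous[OF AC_lf[of v]]]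
    have "AE x in lborel. lf1 (un V) x = V1 x"
      by (rule AC_unique[OF AC_lf]) (use V in \<open>simp add: lf_un[OF V q(1)]\<close>)
    hence ae: "AE x in lborel. Re (cnj (lfd v x) * lfd (un V) x)
       = Re (cnj (lfd v x) * B x)"
      by eventually_elim (simp add: B_def lf_un[OF V q(1)])
    have i1: "intg 0 T (\<lambda>x. Re (cnj (lfd v x) * B x))"
      by (intro inner_integrable L2_lift L2_loc_continuous AC_continuous[OF B])
    have e1: "(LINT x:{0..T}|lborel. Re (cnj (lfd v x) * lfd (un V) x))
      = (LINT x:{0..T}|lborel. Re (cnj (lfd v x) * B x))"
      by (rule set_integral_AE_cong'[OF ae _ i1]) (intro inner_integrable L2_lift)
    have z: "(LINT x:{0..T}|lborel. Re (cnj (lf1 v x) * B x + cnj (lf v x) * B' x)) = 0"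
    proof -
      have "cnj (lf v T) * B T = cnj (lf v 0) * B 0"
        unfolding BT lf_T using cnj_cis_self[of Th] by (simp add: mult_ac)
      thus ?thesis
        using ACr_FTC[OF ACr_Re[OF AC_mult[OF AC_cnj[OF AC_lf] B]], of 0 T v] T_pos by simp
    qed
    have i2: "intg 0 T (\<lambda>x. Re (cnj (lf1 v x) * B x + cnj (lf v x) * B' x))"
      by (intro set_integrable_Re L2_loc_integrable AC_L2[OF AC_mult[OF AC_cnj[OF AC_lf] B]])
    have i3: "intg 0 T (\<lambda>x. Re (cnj (lf v x) * (\<i> * of_real th * B x - B' x)))"
      by (intro inner_integrable c L2_loc_diff L2_loc_cmult AC_L2[OF B] L2_loc_continuous AC_continuous[OF B])
    have "Re (cnj (lfd v x) * B x)
       = Re (cnj (lf1 v x) * B x + cnj (lf v x) * B' x) + Re (cnj (lf v x) * (\<i> * of_real th * B x - B' x))" for x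
      by (simp add: algebra_simps)
    hence e2: "(LINT x:{0..T}|lborel. Re (cnj (lfd v x) * B x))
       = (LINT x:{0..T}|lborel. Re (cnj (lf v x) * (\<i> * of_real th * B x - B' x)))"
      using set_integral_add(2)[OF i2 i3] z by simp
    have i4: "intg 0 T (\<lambda>x. Re (cnj (lf v x) * V x))"
      by (intro inner_integrable c L2_loc_continuous AC_continuous[OF V])
    have dist: "u * (a * y + c * z) = a * (u * y) + c * (u * z)" for u a y c z :: complex by (simp add: algebra_simps)
    have "(LINT x:{0..T}|lborel. Re (cnj (lf v x) * \<Psi> x))
      = (LINT x:{0..T}|lborel. aT * Re (cnj (lf v x) * V x) + (1 / aT) * Re (cnj (lf v x) * (\<i> * of_real th * B x - B' x)))"
      unfolding \<Psi>_def dist plus_complex.sel Re_of_real_mult ..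
    also have "\<dots> = aT * (LINT x:{0..T}|lborel. Re (cnj (lf v x) * V x))
       + (1 / aT) * (LINT x:{0..T}|lborel. Re (cnj (lf v x) * (\<i> * of_real th * B x - B' x)))"
      by (subst set_integral_add(2)[OF set_integrable_mult_right[OF i4] set_integrable_mult_right[OF i3]])
         (simp only: set_integral_mult_right)
    also have "\<dots> = inner v (un V)"
      unfolding inner_lift e1 e2 unfolding lf_un[OF V q(1)] ..
    finally show ?thesis ..
  qed
  thus ?thesis using Psi by blast
qed

text \<open>The derivatives of the frame coefficients are linear in the residual, with factors that
  are bounded away from the zeros of \<open>rx\<close>. A small residual thus means almost constant
  coefficients.\<close>

lemma frame_coeff_bound:
  assumes cd: "c \<le> d" and r: "\<And>x. x \<in> {c..d} \<Longrightarrow> rx x \<noteq> 0"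
  shows "\<exists>K. \<forall>P P'. AC P P' \<longrightarrow>
     (al1 P d / rx d - al1 P c / rx c)\<^sup>2 \<le> K * resn c d P P'
     \<and> (be1 P d / rx d - be1 P c / rx c)\<^sup>2 \<le> K * resn c d P P'"
proof -
  obtain G G' where G: "ACr G G'" and GG: "\<And>x. x \<in> {c..d} \<Longrightarrow> G x = 1 / rx x"
      "\<And>x. x \<in> {c..d} \<Longrightarrow> G' x = - (rp x / (rx x)\<^sup>2)"
    using inverse_rx_extension[OF cd r] by blast
  define A where "A x = (cmod (W1 x) + cmod (W x)) * \<bar>G x\<bar>" for x
  have Ac: "continuous_on UNIV A"
    unfolding A_def by (intro continuous_intros W_continuous W1_continuous ACr_continuous[OF G])
  define K where "K = (LINT x:{c..d}|lborel. (A x)\<^sup>2)"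
  have key: "(f d - f c)\<^sup>2 \<le> K * resn c d P P'"
    if P: "AC P P'" and f: "ACr f f'" and b: "\<And>x. x \<in> {c..d} \<Longrightarrow> \<bar>f' x\<bar> \<le> A x * cmod (res P P' x)" for P P' f f'
  proof -
    have [measurable]: "P \<in> borel_measurable borel" "P' \<in> borel_measurable borel" "rx \<in> borel_measurable borel"
       "W \<in> borel_measurable borel" "W1 \<in> borel_measurable borel"
       "(\<lambda>x. cnj (W x)) \<in> borel_measurable borel" "(\<lambda>x. cnj (W1 x)) \<in> borel_measurable borel" "sx \<in> borel_measurable borel" "A \<in> borel_measurable borel"
      using AC_continuous[OF P] L2_loc_measurable[OF AC_L2[OF P]] rx_continuous W_continuous W1_continuous sx_continuous Ac
      by (auto intro!: borel_measurable_continuous_onI continuous_intros)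
    have [measurable]: "(\<lambda>x. res P P' x) \<in> borel_measurable borel"
      unfolding res_def al1_def be1_def by measurable
    have iA: "intg c d (\<lambda>x. (A x)\<^sup>2)" by (intro set_integrable_continuous continuous_intros Ac)
    note ir = jacobi_integral(2)[OF P cd r]
    have iAr: "intg c d (\<lambda>x. A x * cmod (res P P' x))"
    proof (rule set_integrable_dominated[OF set_integral_add(1)[OF iA ir]])
      show "(\<lambda>x. A x * cmod (res P P' x)) \<in> borel_measurable borel" by measurable
      show "norm (A x * cmod (res P P' x)) \<le> (A x)\<^sup>2 + cmod2 (res P P' x)" for x
      proof -
        have "0 \<le> A x * cmod (res P P' x)" by (simp add: A_def)
        thus ?thesis using sum_squares_bound[of "A x" "cmod (res P P' x)"] by simp
      qed
    qed
    have "\<bar>f d - f c\<bar> = \<bar>LINT x:{c..d}|lborel. f' x\<bar>" using ACr_FTC[OF f cd] by simp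
    also have "\<dots> \<le> (LINT x:{c..d}|lborel. \<bar>f' x\<bar>)"
      using set_integral_norm_bound[OF ACr_integrable[OF f]] by simp
    also have "\<dots> \<le> (LINT x:{c..d}|lborel. A x * cmod (res P P' x))"
      by (rule set_integral_mono[OF _ iAr b]) (use set_integrable_norm[OF ACr_integrable[OF f]] in simp)
    finally have "(f d - f c)\<^sup>2 \<le> (LINT x:{c..d}|lborel. A x * cmod (res P P' x))\<^sup>2" by (rule power2_mono_abs)
    also have "\<dots> \<le> K * resn c d P P'"
      unfolding K_def by (rule set_integral_Cauchy_Schwarz[OF iA ir iAr])
    finally show ?thesis .
  qed
  have main: "(al1 P d / rx d - al1 P c / rx c)\<^sup>2 \<le> K * resn c d P P'
     \<and> (be1 P d / rx d - be1 P c / rx c)\<^sup>2 \<le> K * resn c d P P'" if P: "AC P P'" for P P'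
  proof -
    have pt: "(Im (cnj (W1 x) * P' x) - (1 + sx x) * Im (cnj (W x) * P x)) * G x + al1 P x * G' x = Im (cnj (W1 x) * res P P' x) * G x"
      "(Re (cnj (W1 x) * P x) + Re (cnj (W x) * P' x)) * G x + be1 P x * G' x = Re (cnj (W x) * res P P' x) * G x"
      if x: "x \<in> {c..d}" for x
    proof -
      define f h where "f = al1 P x / rx x" and "h = be1 P x / rx x"
      note r0 = r[OF x]
      have P: "P x = of_real f * (\<i> * W x) + of_real h * W1 x" unfolding f_def h_def by (rule frame[OF r0])
      have fh: "al1 P x = f * rx x" "be1 P x = h * rx x" using r0 by (simp_all add: f_def h_def)
      have res: "res P P' x = P' x - (of_real f * (\<i> * W1 x) - of_real (h * (1 + sx x)) * W x)"
        unfolding res_def f_def h_def by simp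
      have WW: "cnj (W x) * W x = of_real (sx x)" "cnj (W1 x) * W1 x = of_real (cmod2 (W1 x))"
        unfolding cmod_W[symmetric] complex_norm_square by (simp_all add: mult.commute)
      have WW1: "cnj (W x) * W1 x = of_real (rx x) + \<i> * of_real J" "cnj (W1 x) * W x = of_real (rx x) - \<i> * of_real J"
        using W_angular[of x] by (simp_all add: complex_eq_iff rx_def algebra_simps)
      have a: "cnj (W x) * P x = of_real f * \<i> * (cnj (W x) * W x) + of_real h * (cnj (W x) * W1 x)"
         "cnj (W1 x) * P x = of_real f * \<i> * (cnj (W1 x) * W x) + of_real h * (cnj (W1 x) * W1 x)"
         "cnj (W1 x) * res P P' x = cnj (W1 x) * P' x - (of_real f * \<i> * (cnj (W1 x) * W1 x) - of_real (h * (1 + sx x)) * (cnj (W1 x) * W x))"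
         "cnj (W x) * res P P' x = cnj (W x) * P' x - (of_real f * \<i> * (cnj (W x) * W1 x) - of_real (h * (1 + sx x)) * (cnj (W x) * W x))"
        unfolding P res by (simp_all add: algebra_simps)
      have im: "Im (cnj (W x) * P x) = f * sx x + h * J" "Re (cnj (W1 x) * P x) = f * J + h * cmod2 (W1 x)"
          "Im (cnj (W1 x) * res P P' x) = Im (cnj (W1 x) * P' x) - f * cmod2 (W1 x) - h * (1 + sx x) * J"
          "Re (cnj (W x) * res P P' x) = Re (cnj (W x) * P' x) + f * J + h * (1 + sx x) * sx x"
        unfolding a WW WW1 by simp_all
      have G0: "G x = 1 / rx x" "rx x * G' x = - (rp x * G x)" using GG[OF x] r0 by (simp_all add: power2_eq_square)
      have c: "al1 P x * G' x = - f * rp x * G x" "be1 P x * G' x = - h * rp x * G x"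
        using G0(2) unfolding fh by (simp_all add: mult.assoc)
      show "(Im (cnj (W1 x) * P' x) - (1 + sx x) * Im (cnj (W x) * P x)) * G x + al1 P x * G' x = Im (cnj (W1 x) * res P P' x) * G x"
        unfolding c im rp_def by (simp add: algebra_simps)
      show "(Re (cnj (W1 x) * P x) + Re (cnj (W x) * P' x)) * G x + be1 P x * G' x = Re (cnj (W x) * res P P' x) * G x"
        unfolding c im rp_def by (simp add: algebra_simps)
    qed
    have "(al1 P d * G d - al1 P c * G c)\<^sup>2 \<le> K * resn c d P P'"
    proof (rule key[OF P ACr_mult[OF AC_al1[OF P] G]])
      fix x assume x: "x \<in> {c..d}"
      have "\<bar>Im (cnj (W1 x) * res P P' x)\<bar> \<le> cmod (W1 x) * cmod (res P P' x)"
        using abs_Im_le_cmod[of "cnj (W1 x) * res P P' x"] by (simp add: norm_mult)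
      also have "\<dots> \<le> (cmod (W1 x) + cmod (W x)) * cmod (res P P' x)" by (intro mult_right_mono) auto
      finally have "\<bar>Im (cnj (W1 x) * res P P' x)\<bar> * \<bar>G x\<bar> \<le> (cmod (W1 x) + cmod (W x)) * cmod (res P P' x) * \<bar>G x\<bar>"
        by (rule mult_right_mono) simp
      thus "\<bar>(Im (cnj (W1 x) * P' x) - (1 + sx x) * Im (cnj (W x) * P x)) * G x + al1 P x * G' x\<bar> \<le> A x * cmod (res P P' x)"
        unfolding pt(1)[OF x] abs_mult A_def by (simp add: mult_ac)
    qed
    moreover have "(be1 P d * G d - be1 P c * G c)\<^sup>2 \<le> K * resn c d P P'"
    proof (rule key[OF P ACr_mult[OF AC_be1[OF P] G]])
      fix x assume x: "x \<in> {c..d}"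
      have "\<bar>Re (cnj (W x) * res P P' x)\<bar> \<le> cmod (W x) * cmod (res P P' x)"
        using abs_Re_le_cmod[of "cnj (W x) * res P P' x"] by (simp add: norm_mult)
      also have "\<dots> \<le> (cmod (W1 x) + cmod (W x)) * cmod (res P P' x)" by (intro mult_right_mono) auto
      finally have "\<bar>Re (cnj (W x) * res P P' x)\<bar> * \<bar>G x\<bar> \<le> (cmod (W1 x) + cmod (W x)) * cmod (res P P' x) * \<bar>G x\<bar>"
        by (rule mult_right_mono) simp
      thus "\<bar>(Re (cnj (W1 x) * P x) + Re (cnj (W x) * P' x)) * G x + be1 P x * G' x\<bar> \<le> A x * cmod (res P P' x)"
        unfolding pt(2)[OF x] abs_mult A_def by (simp add: mult_ac)
    qed
    ultimately show ?thesis using GG(1)[of c] GG(1)[of d] cd by simp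
  qed
  thus ?thesis by blast
qed


text \<open>\<open>phi1\<close> and \<open>phi2\<close> are the tangent vectors of the orbit at the
  profile, for phase rotation and translation.\<close>

definition phi1 where "phi1 = un (\<lambda>x. \<i> * W x)"
definition phi2 where "phi2 = un W1"

lemma lf_phi: "lf phi1 = (\<lambda>x. \<i> * W x)" "lf phi2 = W1"
  unfolding phi1_def phi2_def
  by (rule lf_un[OF AC_cmult[OF AC_W]] lf_un[OF AC_W1]; simp add: W_shift W1_shift)+

lemma AC_W2: "AC (\<lambda>x. - of_real (1 + sx x) * W x) (\<lambda>x. - of_real (2 * rx x) * W x - of_real (1 + sx x) * W1 x)"
  by (rule AC_eqI[OF AC_mult[OF AC_minus[OF AC_add[OF AC_const[of 1] AC_coeffs(1)]] AC_W]]) (simp_all add: algebra_simps)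

lemma phi_pairing:
  "\<exists>\<Psi>. L2_loc \<Psi> \<and> (\<forall>v. inner v phi1 = (LINT x:{0..T}|lborel. Re (cnj (lf v x) * \<Psi> x)))"
  "\<exists>\<Psi>. L2_loc \<Psi> \<and> (\<forall>v. inner v phi2 = (LINT x:{0..T}|lborel. Re (cnj (lf v x) * \<Psi> x)))"
proof -
  show "\<exists>\<Psi>. L2_loc \<Psi> \<and> (\<forall>v. inner v phi1 = (LINT x:{0..T}|lborel. Re (cnj (lf v x) * \<Psi> x)))"
    unfolding phi1_def by (rule inner_un[OF AC_cmult[OF AC_W] AC_cmult[OF AC_W1]]) (simp_all add: W_shift W1_shift)
  show "\<exists>\<Psi>. L2_loc \<Psi> \<and> (\<forall>v. inner v phi2 = (LINT x:{0..T}|lborel. Re (cnj (lf v x) * \<Psi> x)))"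
    unfolding phi2_def by (rule inner_un[OF AC_W1 AC_W2]) (simp_all add: W_shift W1_shift sx_shift)
qed

definition Qt where "Qt v = bf (lf v) (lf1 v) (lf v) (lf1 v) + 2 / qn * (ell (lf v))\<^sup>2"

lemma Qt_scaleR: "Qt (r *\<^sub>R v) = r\<^sup>2 * Qt v"
proof -
  let ?P = "\<lambda>x. of_real r * lf v x" and ?P' = "\<lambda>x. of_real r * lf1 v x"
  have P: "lf (r *\<^sub>R v) = ?P" by (rule ext) (rule lf_linear)
  have A: "AC ?P ?P'" by (intro AC_cmult AC_lf)
  have A': "AC ?P (lf1 (r *\<^sub>R v))" using AC_lf[of "r *\<^sub>R v"] unfolding P .
  have "bf ?P (lf1 (r *\<^sub>R v)) ?P (lf1 (r *\<^sub>R v)) = bf ?P ?P' ?P ?P'"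
    using bf_AC_unique[OF A' A A'] bf_AC_unique[OF A' A A] bf_sym[of ?P ?P' ?P "lf1 (r *\<^sub>R v)"] by simp
  also have "\<dots> = (LINT x:{0..T}|lborel. r\<^sup>2 * bd (lf v) (lf1 v) (lf v) (lf1 v) x)"
    unfolding bf_def
    by (rule set_integral_pw_cong)
       (simp add: bd_def be1_def algebra_simps power2_eq_square)
  finally have 1: "bf ?P (lf1 (r *\<^sub>R v)) ?P (lf1 (r *\<^sub>R v)) = r\<^sup>2 * bf (lf v) (lf1 v) (lf v) (lf1 v)"
    by (simp add: bf_def)
  have "ell ?P = (LINT x:{0..T}|lborel. r * Re (cnj (lf v x) * (of_real (2 * (sg - 4 * E)) * W x - \<i> * of_real (2 * J) * W1 x)))"
    unfolding ell_def
    by (rule set_integral_pw_cong) (simp add: algebra_simps)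
  hence 2: "ell ?P = r * ell (lf v)" by (simp add: ell_def)
  show ?thesis unfolding Qt_def P 1 2 by (simp add: power_mult_distrib algebra_simps)
qed

section \<open>Compactness and the kernel of the form\<close>

lemma lf_equicontinuous:
  "\<exists>C\<ge>0. \<forall>v x y. x \<in> {0..T} \<longrightarrow> y \<in> {0..T} \<longrightarrow> cmod2 (lf v x - lf v y) \<le> C * (norm v)\<^sup>2 * \<bar>x - y\<bar>"
proof -
  obtain C where C: "C \<ge> 0" "\<And>v. (LINT x:{0..T}|lborel. cmod2 (lf1 v x)) \<le> C * (norm v)\<^sup>2"
    using lf1_bound by blast
  have ord: "cmod2 (lf v y - lf v x) \<le> C * (norm v)\<^sup>2 * (y - x)" if "x \<in> {0..T}" "y \<in> {0..T}" "x \<le> y" for v x y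
  proof -
    have "(LINT z:{x..y}|lborel. cmod2 (lf1 v z)) \<le> (LINT z:{0..T}|lborel. cmod2 (lf1 v z))"
      by (rule set_integral_mono_set) (use that in \<open>auto intro: L2_loc_sq_integrable AC_L2[OF AC_lf]\<close>)
    hence "(LINT z:{x..y}|lborel. cmod2 (lf1 v z)) \<le> C * (norm v)\<^sup>2" using C(2)[of v] by linarith
    hence "(y - x) * (LINT z:{x..y}|lborel. cmod2 (lf1 v z)) \<le> (y - x) * (C * (norm v)\<^sup>2)"
      using that(3) by (intro mult_left_mono) auto
    thus ?thesis using AC_Holder[OF AC_lf that(3), of v] by (simp add: mult_ac)
  qed
  have "cmod2 (lf v x - lf v y) \<le> C * (norm v)\<^sup>2 * \<bar>x - y\<bar>" if "x \<in> {0..T}" "y \<in> {0..T}" for v x y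
    using ord[of x y v] ord[of y x v] that by (cases "x \<le> y") (auto simp: norm_minus_commute)
  thus ?thesis using C(1) by blast
qed

text \<open>Arzela-Ascoli: after lifting, unit vectors of X are uniformly bounded and uniformly
  Holder continuous of exponent 1/2.\<close>

lemma lf_compactness:
  assumes w: "\<And>n. norm (w n) = 1"
  shows "\<exists>G k. continuous_on {0..T} G \<and> strict_mono (k :: nat \<Rightarrow> nat)
    \<and> (\<forall>e>0. \<exists>N. \<forall>n\<ge>N. \<forall>x\<in>{0..T}. cmod (lf (w (k n)) x - G x) < e)"
proof -
  obtain C where C: "C \<ge> 0" "\<And>v x y. x \<in> {0..T} \<Longrightarrow> y \<in> {0..T} \<Longrightarrow> cmod2 (lf v x - lf v y) \<le> C * (norm v)\<^sup>2 * \<bar>x - y\<bar>"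
    using lf_equicontinuous by blast
  have M: "norm (lf (w n) x) \<le> 4" for n x using cmod_lf[of "w n" x] unfolding w by simp
  have eq: "\<exists>d. 0 < d \<and> (\<forall>n y. y \<in> {0..T} \<and> norm (x - y) < d \<longrightarrow> norm (lf (w n) x - lf (w n) y) < e)"
    if x: "x \<in> {0..T}" and e: "0 < e" for x e
  proof -
    define d where "d = e\<^sup>2 / (C + 1)"
    have d: "0 < d" using e C(1) by (simp add: d_def)
    have "norm (lf (w n) x - lf (w n) y) < e" if "y \<in> {0..T}" "norm (x - y) < d" for n y
    proof -
      have "cmod2 (lf (w n) x - lf (w n) y) \<le> C * \<bar>x - y\<bar>" using C(2)[OF x that(1), of "w n"] unfolding w by simp
      also have "\<dots> \<le> C * d" using that(2) C(1) by (intro mult_left_mono) auto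
      also have "\<dots> < (C + 1) * d" using d by (simp add: distrib_right)
      also have "\<dots> = e\<^sup>2" using C(1) by (simp add: d_def)
      finally show ?thesis using e by (simp add: power_less_imp_less_base)
    qed
    thus ?thesis using d by blast
  qed
  show ?thesis
  proof (rule Arzela_Ascoli[of "{0..T}" "\<lambda>n. lf (w n)" 4, OF compact_Icc M eq])
    fix G and k :: "nat \<Rightarrow> nat"
    assume *: "continuous_on {0..T} G" "strict_mono k"
      "\<And>e. 0 < e \<Longrightarrow> \<exists>N. \<forall>n x. n \<ge> N \<and> x \<in> {0..T} \<longrightarrow> norm (lf (w (k n)) x - G x) < e"
    have "\<exists>N. \<forall>n\<ge>N. \<forall>x\<in>{0..T}. cmod (lf (w (k n)) x - G x) < e" if "e > 0" for e
      using *(3)[OF that] by blast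
    with *(1,2) show ?thesis by blast
  qed
qed

lemma tendsto_zero_of_square:
  fixes x X :: "nat \<Rightarrow> real"
  assumes "\<And>n. (x n)\<^sup>2 \<le> K * X n" "X \<longlonglongrightarrow> 0"
  shows "x \<longlonglongrightarrow> 0"
proof -
  have "(\<lambda>n. (x n)\<^sup>2) \<longlonglongrightarrow> 0"
  proof (rule tendsto_sandwich[of "\<lambda>_. 0" _ _ "\<lambda>n. K * X n"])
    show "(\<lambda>n. K * X n) \<longlonglongrightarrow> 0" using tendsto_mult_right_zero[OF assms(2)] .
  qed (use assms(1) in auto)
  hence "(\<lambda>n. sqrt ((x n)\<^sup>2)) \<longlonglongrightarrow> sqrt 0" by (rule tendsto_real_sqrt)
  thus ?thesis by (simp add: tendsto_rabs_zero_iff)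
qed

text \<open>All summands in \<open>form_decomposition\<close> are nonnegative, so each tends to
  zero: the parts along \<open>U\<close> and \<open>vm\<close> die out and the residual disappears
  on inner intervals. The frame coefficients of the limit are then constant on each half period, and
  matching makes the constants equal.\<close>

lemma limit_in_kernel:
  assumes G: "continuous_on {0..T} G" and lim: "\<And>x. x \<in> {0..T} \<Longrightarrow> (\<lambda>n. lf (v n) x) \<longlonglongrightarrow> G x"
    and Q: "(\<lambda>n. Qt (v n)) \<longlonglongrightarrow> 0"
  shows "\<exists>a c. \<forall>x\<in>{0..T}. G x = of_real a * (\<i> * W x) + of_real c * W1 x"
proof -
  have "\<forall>n. \<exists>t s p p' m. AC p p' \<and> p T = cis Th * p 0 \<and> Re (p 0) = 0 \<and> be1 p (T / 2) = 0
    \<and> (\<forall>x. lf (v n) x = p x + of_real t * U x + of_real s * vm x)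
    \<and> Qt (v n) = bf p p' p p' + kap * u0 * t\<^sup>2 + qn * (s - m / qn)\<^sup>2 + m\<^sup>2 / qn"
    using form_decomposition[OF AC_lf lf_T] unfolding Qt_def by blast
  then obtain t s p p' m where p: "\<And>n. AC (p n) (p' n)" "\<And>n. p n T = cis Th * p n 0" "\<And>n. Re (p n 0) = 0" "\<And>n. be1 (p n) (T / 2) = 0"
    and lp: "\<And>n x. lf (v n) x = p n x + of_real (t n) * U x + of_real (s n) * vm x"
    and Qd: "\<And>n. Qt (v n) = bf (p n) (p' n) (p n) (p' n) + kap * u0 * (t n)\<^sup>2 + qn * (s n - m n / qn)\<^sup>2 + (m n)\<^sup>2 / qn"
    by metis
  define X where "X n = Qt (v n)" for n
  have res_le: "resn c d (p n) (p' n) \<le> bf (p n) (p' n) (p n) (p' n)"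
    if "c \<le> d" "0 < c \<and> d < T / 2 \<or> T / 2 < c \<and> d < T" for c d n
    by (rule form_nonneg[OF p that])
  have nn: "0 \<le> bf (p n) (p' n) (p n) (p' n)" "0 \<le> kap * u0 * (t n)\<^sup>2" "0 \<le> qn * (s n - m n / qn)\<^sup>2" "0 \<le> (m n)\<^sup>2 / qn" for n
  proof -
    show "0 \<le> bf (p n) (p' n) (p n) (p' n)"
      using res_le[of "T / 4" "T / 4" n] T_pos set_integral_nonneg[of "{T / 4..T / 4}" "\<lambda>x. cmod2 (res (p n) (p' n) x)"]
      by simp
  qed (use kap_pos u0_pos qn_pos in simp_all)
  have le: "bf (p n) (p' n) (p n) (p' n) \<le> X n" "kap * u0 * (t n)\<^sup>2 \<le> X n" "qn * (s n - m n / qn)\<^sup>2 \<le> X n" "(m n)\<^sup>2 / qn \<le> X n" for n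
    using nn[of n] Qd[of n] unfolding X_def by linarith+
  have X: "X \<longlonglongrightarrow> 0" using Q by (simp add: X_def[abs_def])
  have t0: "t \<longlonglongrightarrow> 0"
    by (rule tendsto_zero_of_square[of t "1 / (kap * u0)", OF _ X]) (use le(2) kap_pos u0_pos in \<open>simp add: field_simps\<close>)
  have m0: "m \<longlonglongrightarrow> 0"
    by (rule tendsto_zero_of_square[of m qn, OF _ X]) (use le(4) qn_pos in \<open>simp add: field_simps\<close>)
  have "(\<lambda>n. s n - m n / qn) \<longlonglongrightarrow> 0"
    by (rule tendsto_zero_of_square[of _ "1 / qn", OF _ X]) (use le(3) qn_pos in \<open>simp add: pos_le_divide_eq mult.commute\<close>)
  from tendsto_add[OF this tendsto_divide[OF m0 tendsto_const[of qn]]] have s0: "s \<longlonglongrightarrow> 0" using qn_pos by simp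
  have plim: "(\<lambda>n. p n x) \<longlonglongrightarrow> G x" if "x \<in> {0..T}" for x
  proof -
    have "(\<lambda>n. lf (v n) x - of_real (t n) * U x - of_real (s n) * vm x) \<longlonglongrightarrow> G x - of_real 0 * U x - of_real 0 * vm x"
      by (intro tendsto_intros lim[OF that] t0 s0)
    thus ?thesis unfolding lp by simp
  qed
  have coef: "\<exists>a c. \<forall>x\<in>{x0..x1}. G x = of_real a * (\<i> * W x) + of_real c * W1 x"
    if ix: "0 \<le> x0" "x0 < x1" "x1 \<le> T" and r: "\<And>x. x0 < x \<Longrightarrow> x < x1 \<Longrightarrow> rx x \<noteq> 0"
      and iv: "\<And>c d. x0 < c \<Longrightarrow> d < x1 \<Longrightarrow> 0 < c \<and> d < T / 2 \<or> T / 2 < c \<and> d < T" for x0 x1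
  proof -
    have ord: "al1 G d / rx d = al1 G c / rx c \<and> be1 G d / rx d = be1 G c / rx c" if cd: "x0 < c" "c \<le> d" "d < x1" for c d
    proof -
      have r': "rx x \<noteq> 0" if "x \<in> {c..d}" for x using r[of x] that cd by auto
      obtain K where K: "\<And>P P'. AC P P' \<Longrightarrow> (al1 P d / rx d - al1 P c / rx c)\<^sup>2 \<le> K * resn c d P P'"
         "\<And>P P'. AC P P' \<Longrightarrow> (be1 P d / rx d - be1 P c / rx c)\<^sup>2 \<le> K * resn c d P P'"
        using frame_coeff_bound[OF cd(2) r'] by blast
      define I where "I n = resn c d (p n) (p' n)" for n
      have I: "I \<longlonglongrightarrow> 0"
      proof (rule tendsto_sandwich[of "\<lambda>_. 0" _ _ X])
        show "\<forall>\<^sub>F n in sequentially. 0 \<le> I n" by (simp add: I_def set_integral_nonneg)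
        show "\<forall>\<^sub>F n in sequentially. I n \<le> X n"
          using order_trans[OF res_le[OF cd(2) iv[OF cd(1,3)]] le(1)] by (simp add: I_def)
      qed (use X in auto)
      have cT: "c \<in> {0..T}" "d \<in> {0..T}" using cd ix by auto
      have l: "(\<lambda>n. al1 (p n) d / rx d - al1 (p n) c / rx c) \<longlonglongrightarrow> al1 G d / rx d - al1 G c / rx c"
        "(\<lambda>n. be1 (p n) d / rx d - be1 (p n) c / rx c) \<longlonglongrightarrow> be1 G d / rx d - be1 G c / rx c"
        unfolding al1_def be1_def using r'[of c] r'[of d] cd(2) by (intro tendsto_intros plim cT; simp)+
      have z: "(\<lambda>n. al1 (p n) d / rx d - al1 (p n) c / rx c) \<longlonglongrightarrow> 0" "(\<lambda>n. be1 (p n) d / rx d - be1 (p n) c / rx c) \<longlonglongrightarrow> 0"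
        by (rule tendsto_zero_of_square[where K = K, OF _ I], use K p(1) in \<open>simp add: I_def\<close>)+
      show ?thesis using LIMSEQ_unique[OF l(1) z(1)] LIMSEQ_unique[OF l(2) z(2)] unfolding right_minus_eq by (intro conjI)
    qed
    define y where "y = (x0 + x1) / 2"
    have y: "x0 < y" "y < x1" using ix by (simp_all add: y_def)
    define a c where "a = al1 G y / rx y" and "c = be1 G y / rx y"
    have inn: "G x = of_real a * (\<i> * W x) + of_real c * W1 x" if x: "x0 < x" "x < x1" for x
    proof -
      have "al1 G x / rx x = a \<and> be1 G x / rx x = c"
      proof (cases "x \<le> y")
        case True
        show ?thesis unfolding a_def c_def using ord[OF x(1) True y(2)] by (intro conjI) (rule sym, blast)+
      next
        case False
        thus ?thesis unfolding a_def c_def by (intro ord[OF y(1) _ x(2)]) simp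
      qed
      thus ?thesis using frame[OF r[OF x], of G] by simp
    qed
    \<comment> \<open>The identity extends from the open interval to its ends by continuity.\<close>
    have "G x - (of_real a * (\<i> * W x) + of_real c * W1 x) = 0" if "x \<in> {x0..x1}" for x
    proof (rule continuous_constant_on_closure[of "{x0<..<x1}"])
      show "continuous_on (closure {x0<..<x1}) (\<lambda>x. G x - (of_real a * (\<i> * W x) + of_real c * W1 x))"
        using ix by (intro continuous_intros continuous_on_subset[OF G] W_continuous W1_continuous) auto
    qed (use that ix inn in auto)
    thus ?thesis by (intro exI[of _ a] exI[of _ c]) auto
  qed
  have r1: "rx x \<noteq> 0" if "0 < x" "x < T / 2" for x using rx_sign(1)[OF that] by simp
  have r2: "rx x \<noteq> 0" if "T / 2 < x" "x < T" for x using rx_sign(2)[OF that] by simp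
  obtain a1 c1 where 1: "\<And>x. x \<in> {0..T/2} \<Longrightarrow> G x = of_real a1 * (\<i> * W x) + of_real c1 * W1 x"
    using coef[of 0 "T / 2", OF _ _ _ r1] T_pos by auto
  obtain a2 c2 where 2: "\<And>x. x \<in> {T/2..T} \<Longrightarrow> G x = of_real a2 * (\<i> * W x) + of_real c2 * W1 x"
    using coef[of "T / 2" T, OF _ _ _ r2] T_pos by auto
  \<comment> \<open>The two expressions are matched at \<open>T / 2\<close> by continuity and
    between \<open>0\<close> and \<open>T\<close> by quasi-periodicity. The resulting system has
    determinant \<open>g * (R^2 - j^2)\<close>.\<close>
  define da dc where "da = a1 - a2" and "dc = c1 - c2"
  have "of_real da * (\<i> * W (T / 2)) + of_real dc * W1 (T / 2) = 0"
    using 1[of "T / 2"] 2[of "T / 2"] T_pos by (simp add: da_def dc_def algebra_simps)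
  hence "Im (cnj (W (T / 2)) * (of_real da * (\<i> * W (T / 2)) + of_real dc * W1 (T / 2))) = 0" by simp
  moreover have "cnj (W (T / 2)) * (of_real da * (\<i> * W (T / 2)) + of_real dc * W1 (T / 2))
     = of_real da * (\<i> * (cnj (W (T / 2)) * W (T / 2))) + of_real dc * (cnj (W (T / 2)) * W1 (T / 2))"
    by (simp add: algebra_simps)
  moreover have "Im (\<i> * (cnj (W (T / 2)) * W (T / 2))) = R\<^sup>2"
    unfolding sx_0(3)[symmetric] cmod_W[symmetric] Re_cnj_mult_self[symmetric] by simp
  ultimately have h: "da * R\<^sup>2 + dc * J = 0"
    by (simp only: plus_complex.sel Im_of_real_mult W_angular)
  have "G T = cis Th * G 0"
  proof (rule LIMSEQ_unique)
    show "(\<lambda>n. lf (v n) T) \<longlonglongrightarrow> G T" using lim T_pos by simp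
    show "(\<lambda>n. lf (v n) T) \<longlonglongrightarrow> cis Th * G 0" unfolding lf_T using lim[of 0] T_pos by (intro tendsto_intros) auto
  qed
  hence "cis Th * (of_real (a2 * j + c2 * g) * \<i>) = cis Th * (of_real (a1 * j + c1 * g) * \<i>)"
    using 1[of 0] 2[of T] T_pos unfolding W_T W_0 W1_0 by (simp add: algebra_simps)
  hence "complex_of_real (a2 * j + c2 * g) = of_real (a1 * j + c1 * g)" by (simp only: mult_cancel_left mult_cancel_right) simp
  hence e: "da * j + dc * g = 0" unfolding of_real_eq_iff da_def dc_def by (simp add: algebra_simps)
  have "da * (R\<^sup>2 - j\<^sup>2) = (da * R\<^sup>2 + dc * J) - (da * j + dc * g) * j"
    unfolding J_def by (simp add: algebra_simps power2_eq_square)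
  hence "da * (R\<^sup>2 - j\<^sup>2) = 0" unfolding h e by simp
  hence "da = 0" using j2_less by simp
  moreover hence "dc = 0" using e g_pos by simp
  ultimately have "a1 = a2" "c1 = c2" by (simp_all add: da_def dc_def)
  hence "G x = of_real a1 * (\<i> * W x) + of_real c1 * W1 x" if "x \<in> {0..T}" for x
    using 1[of x] 2[of x] that by (cases "x \<le> T / 2") auto
  thus ?thesis by blast
qed

lemma pairing_tendsto:
  assumes Psi: "L2_loc \<Psi>" and P: "\<And>n. continuous_on UNIV (P n)" "continuous_on UNIV P0"
    and u: "\<And>e. e > 0 \<Longrightarrow> \<exists>N. \<forall>n\<ge>N. \<forall>x\<in>{0..T}. cmod (P n x - P0 x) < e"
  shows "(\<lambda>n. LINT x:{0..T}|lborel. Re (cnj (P n x) * \<Psi> x)) \<longlonglongrightarrow> (LINT x:{0..T}|lborel. Re (cnj (P0 x) * \<Psi> x))"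
proof (rule LIMSEQ_I)
  fix e :: real assume e: "0 < e"
  define I where "I = (LINT x:{0..T}|lborel. cmod (\<Psi> x))"
  have I0: "0 \<le> I" unfolding I_def by (rule set_integral_nonneg) simp
  define d where "d = e / (I + 1)"
  have d: "0 < d" using e I0 by (simp add: d_def)
  obtain N where N: "\<And>n x. n \<ge> N \<Longrightarrow> x \<in> {0..T} \<Longrightarrow> cmod (P n x - P0 x) < d" using u[OF d] by blast
  have "norm ((LINT x:{0..T}|lborel. Re (cnj (P n x) * \<Psi> x)) - (LINT x:{0..T}|lborel. Re (cnj (P0 x) * \<Psi> x))) < e" if n: "n \<ge> N" for n
  proof -
    have i: "intg 0 T (\<lambda>x. Re (cnj (P n x) * \<Psi> x))" "intg 0 T (\<lambda>x. Re (cnj (P0 x) * \<Psi> x))"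
      by (intro inner_integrable Psi L2_loc_continuous P)+
    note id = set_integral_diff(1)[OF i]
    have "norm ((LINT x:{0..T}|lborel. Re (cnj (P n x) * \<Psi> x)) - (LINT x:{0..T}|lborel. Re (cnj (P0 x) * \<Psi> x)))
      \<le> (LINT x:{0..T}|lborel. norm (Re (cnj (P n x) * \<Psi> x) - Re (cnj (P0 x) * \<Psi> x)))"
      unfolding set_integral_diff(2)[OF i, symmetric] by (rule set_integral_norm_bound[OF id])
    also have "\<dots> \<le> (LINT x:{0..T}|lborel. d * cmod (\<Psi> x))"
    proof (rule set_integral_mono[OF set_integrable_norm[OF id]])
      show "intg 0 T (\<lambda>x. d * cmod (\<Psi> x))"
        by (intro set_integrable_mult_right L2_loc_norm_integrable Psi)
      fix x assume x: "x \<in> {0..T}"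
      have "norm (Re (cnj (P n x) * \<Psi> x) - Re (cnj (P0 x) * \<Psi> x)) = \<bar>Re (cnj (P n x - P0 x) * \<Psi> x)\<bar>"
        by (simp add: algebra_simps)
      also have "\<dots> \<le> cmod (P n x - P0 x) * cmod (\<Psi> x)"
        using abs_Re_le_cmod[of "cnj (P n x - P0 x) * \<Psi> x"] by (simp only: norm_mult complex_mod_cnj)
      also have "\<dots> \<le> d * cmod (\<Psi> x)" using N[OF n x] by (intro mult_right_mono) auto
      finally show "norm (Re (cnj (P n x) * \<Psi> x) - Re (cnj (P0 x) * \<Psi> x)) \<le> d * cmod (\<Psi> x)" .
    qed
    also have "\<dots> = d * I" by (simp add: I_def)
    also have "\<dots> < d * (I + 1)" using d by (intro mult_strict_left_mono) auto
    also have "\<dots> = e" using I0 by (simp add: d_def)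
    finally show ?thesis .
  qed
  thus "\<exists>N. \<forall>n\<ge>N. norm ((LINT x:{0..T}|lborel. Re (cnj (P n x) * \<Psi> x)) - (LINT x:{0..T}|lborel. Re (cnj (P0 x) * \<Psi> x))) < e"
    by blast
qed

theorem coercive: "\<exists>c>0. \<forall>v. inner v phi1 = 0 \<longrightarrow> inner v phi2 = 0 \<longrightarrow> c * (norm v)\<^sup>2 \<le> Qt v"
proof (rule ccontr)
  assume neg: "\<not> ?thesis"
  have "\<exists>w. norm w = 1 \<and> inner w phi1 = 0 \<and> inner w phi2 = 0 \<and> Qt w \<le> 1 / Suc n" for n
  proof -
    have "0 < 1 / real (Suc n)" by simp
    with neg obtain v where v: "inner v phi1 = 0" "inner v phi2 = 0" "Qt v < 1 / Suc n * (norm v)\<^sup>2"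
      by (metis not_le)
    have v0: "v \<noteq> 0" using v(3) Qt_scaleR[of 0 0] by auto
    have "Qt (inverse (norm v) *\<^sub>R v) \<le> 1 / Suc n"
      unfolding Qt_scaleR using v(3) v0 by (simp add: field_simps del: of_nat_Suc)
    thus ?thesis using v v0 by (intro exI[of _ "inverse (norm v) *\<^sub>R v"]) simp
  qed
  then obtain w where w: "\<And>n. norm (w n) = 1" "\<And>n. inner (w n) phi1 = 0" "\<And>n. inner (w n) phi2 = 0" "\<And>n. Qt (w n) \<le> 1 / Suc n"
    by metis
  obtain G k where G: "continuous_on {0..T} G" and k: "strict_mono (k :: nat \<Rightarrow> nat)"
    and unif: "\<And>e. e > 0 \<Longrightarrow> \<exists>N. \<forall>n\<ge>N. \<forall>x\<in>{0..T}. cmod (lf (w (k n)) x - G x) < e"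
    using lf_compactness[of w, OF w(1)] by blast
  define v where "v n = w (k n)" for n
  have Qnn: "0 \<le> Qt (v n)" for n
  proof -
    obtain t s p p' m where p: "AC p p'" "p T = cis Th * p 0" "Re (p 0) = 0" "be1 p (T / 2) = 0"
      and Qd: "Qt (v n) = bf p p' p p' + kap * u0 * t\<^sup>2 + qn * (s - m / qn)\<^sup>2 + m\<^sup>2 / qn"
      using form_decomposition[OF AC_lf lf_T, of "v n"] unfolding Qt_def by blast
    have "0 \<le> bf p p' p p'"
      using form_nonneg[OF p, of "T / 4" "T / 4"] T_pos set_integral_nonneg[of "{T / 4..T / 4}" "\<lambda>x. cmod2 (res p p' x)"]
      by simp
    moreover have "0 \<le> kap * u0 * t\<^sup>2" "0 \<le> qn * (s - m / qn)\<^sup>2" "0 \<le> m\<^sup>2 / qn" using kap_pos u0_pos qn_pos by simp_all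
    ultimately show ?thesis unfolding Qd by linarith
  qed
  have Q0: "(\<lambda>n. Qt (v n)) \<longlonglongrightarrow> 0"
  proof (rule tendsto_sandwich[of "\<lambda>_. 0" _ _ "\<lambda>n. 1 / Suc (k n)"])
    show "(\<lambda>n. 1 / Suc (k n)) \<longlonglongrightarrow> 0"
      using LIMSEQ_subseq_LIMSEQ[OF LIMSEQ_inverse_real_of_nat k] by (simp add: o_def inverse_eq_divide del: of_nat_Suc)
  qed (use Qnn w(4) in \<open>auto simp: v_def simp del: of_nat_Suc\<close>)
  have lim: "(\<lambda>n. lf (v n) x) \<longlonglongrightarrow> G x" if "x \<in> {0..T}" for x
    using unif that unfolding v_def lim_sequentially dist_norm by blast
  obtain a c where ac: "\<And>x. x \<in> {0..T} \<Longrightarrow> G x = of_real a * (\<i> * W x) + of_real c * W1 x"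
    using limit_in_kernel[of G v, OF G lim Q0] by blast
  define u where "u = a *\<^sub>R phi1 + c *\<^sub>R phi2"
  have lu: "lf u x = of_real a * (\<i> * W x) + of_real c * W1 x" for x
    by (simp add: u_def lf_linear lf_phi)
  have unif': "\<exists>N. \<forall>n\<ge>N. \<forall>x\<in>{0..T}. cmod (lf (v n) x - lf u x) < e" if "e > 0" for e
    using unif[OF that] ac unfolding v_def lu by (metis (no_types, lifting))
  have orth: "inner u phi = 0"
    if ex: "\<exists>\<Psi>. L2_loc \<Psi> \<and> (\<forall>v. inner v phi = (LINT x:{0..T}|lborel. Re (cnj (lf v x) * \<Psi> x)))" and z: "\<And>n. inner (v n) phi = 0" for phi
  proof -
    obtain \<Psi> where Psi: "L2_loc \<Psi>" "\<And>v. inner v phi = (LINT x:{0..T}|lborel. Re (cnj (lf v x) * \<Psi> x))" using ex by blast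
    have "(\<lambda>n. inner (v n) phi) \<longlonglongrightarrow> inner u phi"
      unfolding Psi(2) by (rule pairing_tendsto[OF Psi(1) AC_continuous[OF AC_lf] AC_continuous[OF AC_lf] unif'])
    thus ?thesis unfolding z by (simp add: LIMSEQ_const_iff)
  qed
  have "inner u phi1 = 0" "inner u phi2 = 0" by (rule orth[OF phi_pairing(1)] orth[OF phi_pairing(2)], simp add: v_def w)+
  hence "inner u u = 0" by (simp add: u_def inner_add_right)
  hence "u = 0" by simp
  hence lz: "lf u x = 0" for x by (simp add: lf_def fn_zero)
  obtain C where C: "C \<ge> 0" "\<And>v e. (\<forall>x\<in>{0..T}. cmod (lf v x) \<le> e) \<Longrightarrow> (norm v)\<^sup>2 \<le> C * e\<^sup>2 + 2 / aT * bf (lf v) (lf1 v) (lf v) (lf1 v)"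
    using norm_le_form by blast
  \<comment> \<open>Makes \<open>C * e^2\<close> at most 1/4; with another 1/4 from the form, the
    squared norm of a unit vector comes out below 1/2.\<close>
  define e where "e = sqrt (1 / (4 * (C + 1)))"
  have e: "0 < e" "e\<^sup>2 = 1 / (4 * (C + 1))" using C(1) by (simp_all add: e_def)
  obtain N where N: "\<And>n x. n \<ge> N \<Longrightarrow> x \<in> {0..T} \<Longrightarrow> cmod (lf (v n) x) < e"
    using unif'[OF e(1)] unfolding lz diff_zero by blast
  have "(\<lambda>n. 2 / aT * Qt (v n)) \<longlonglongrightarrow> 0" by (rule tendsto_mult_right_zero[OF Q0])
  hence "\<forall>\<^sub>F n in sequentially. 2 / aT * Qt (v n) < 1 / 4" by (rule order_tendstoD(2)) simp
  then obtain M where M: "\<And>n. n \<ge> M \<Longrightarrow> 2 / aT * Qt (v n) < 1 / 4"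
    unfolding eventually_sequentially by blast
  define n where "n = max N M"
  have "(norm (v n))\<^sup>2 \<le> C * e\<^sup>2 + 2 / aT * bf (lf (v n)) (lf1 (v n)) (lf (v n)) (lf1 (v n))"
    by (rule C(2)) (use N[of n] in \<open>auto simp: n_def intro: less_imp_le\<close>)
  also have "2 / aT * bf (lf (v n)) (lf1 (v n)) (lf (v n)) (lf1 (v n)) \<le> 2 / aT * Qt (v n)"
    using aT_pos qn_pos by (intro mult_left_mono) (auto simp: Qt_def)
  also have "\<dots> < 1 / 4" by (rule M) (simp add: n_def)
  also have "C * e\<^sup>2 \<le> 1 / 4" unfolding e(2) using C(1) by (simp add: field_simps)
  finally have "(norm (v n))\<^sup>2 < 1 / 2" by simp
  thus False using w(1) by (simp add: v_def)
qed

section \<open>The Lyapunov functional\<close>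


text \<open>The action over one period of |W|. In the lifted frame \<open>k\<close> and
  \<open>p\<close> have disappeared, and its critical points solve the profile equation.\<close>

definition enP where "enP P P' = (LINT x:{0..T}|lborel. cmod2 (P' x) / 2 - cmod2 (P x) / 2 - (cmod (P x))^4 / 4)"
text \<open>A combination of mass and momentum, with weights read off from \<open>Lop_vm\<close> so
  that its first variation at the wave is \<open>ell\<close>.\<close>

definition laP where "laP P P' = (LINT x:{0..T}|lborel. (sg - 4 * E) * cmod2 (P x) + J * Im (cnj (P x) * P' x))"
text \<open>The terms of order three and four in the expansion of the action.\<close>

definition rem where "rem P = (LINT x:{0..T}|lborel. (cmod2 (P x))\<^sup>2 / 4 + be1 P x * cmod2 (P x))"

lemma enP_integrable:
  assumes "AC P P'"
  shows "intg a b (\<lambda>x. cmod2 (P' x) / 2 - cmod2 (P x) / 2 - (cmod (P x))^4 / 4)"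
proof -
  have "intg a b (\<lambda>x. (1 / 2) * cmod2 (P' x) - (cmod2 (P x) / 2 + (cmod (P x))^4 / 4))"
    by (intro set_integral_diff(1) set_integrable_mult_right L2_loc_sq_integrable AC_L2[OF assms]
        set_integrable_continuous continuous_intros AC_continuous[OF assms]) simp_all
  thus ?thesis by (simp add: algebra_simps)
qed

lemma laP_integrable:
  assumes "AC P P'"
  shows "intg a b (\<lambda>x. (sg - 4 * E) * cmod2 (P x) + J * Im (cnj (P x) * P' x))"
  by (intro set_integral_add(1) set_integrable_mult_right set_integrable_Im L2_loc_mult_integrable L2_loc_cnj
      AC_L2[OF assms] set_integrable_continuous L2_loc_continuous continuous_intros AC_continuous[OF assms])

lemma enP_unique:
  assumes "AC P P'" "AC P P''" shows "enP P P' = enP P P''"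
  unfolding enP_def
proof (rule set_integral_AE_cong'[OF _ enP_integrable[OF assms(1)] enP_integrable[OF assms(2)]])
  show "AE x in lborel. cmod2 (P' x) / 2 - cmod2 (P x) / 2 - (cmod (P x))^4 / 4
      = cmod2 (P'' x) / 2 - cmod2 (P x) / 2 - (cmod (P x))^4 / 4"
    using AC_unique[OF assms] by eventually_elim simp
qed

lemma laP_unique:
  assumes "AC P P'" "AC P P''" shows "laP P P' = laP P P''"
  unfolding laP_def
proof (rule set_integral_AE_cong'[OF _ laP_integrable[OF assms(1)] laP_integrable[OF assms(2)]])
  show "AE x in lborel. (sg - 4 * E) * cmod2 (P x) + J * Im (cnj (P x) * P' x)
      = (sg - 4 * E) * cmod2 (P x) + J * Im (cnj (P x) * P'' x)"
    using AC_unique[OF assms] by eventually_elim simp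
qed

text \<open>The linear term is the integral of the derivative of the real part of conj W1 P, zero
  because both factors have the same quasi-periodicity.\<close>

lemma enP_expand:
  assumes P: "AC P P'" and qp: "P T = cis Th * P 0"
  shows "enP (\<lambda>x. W x + P x) (\<lambda>x. W1 x + P' x) - enP W W1 = bf P P' P P' / 2 - rem P"
proof -
  have WP: "AC (\<lambda>x. W x + P x) (\<lambda>x. W1 x + P' x)" by (intro AC_add AC_W P)
  define D where "D x = Re (cnj (- of_real (1 + sx x) * W x) * P x + cnj (W1 x) * P' x)" for x
  define m where "m x = (cmod2 (P x))\<^sup>2 / 4 + be1 P x * cmod2 (P x)" for x
  have "cnj (W1 T) * P T = cnj (W1 0) * P 0"
    unfolding qp W1_shift[of 0, simplified] using cnj_cis_self[of Th] by (simp add: mult_ac)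
  hence D0: "(LINT x:{0..T}|lborel. D x) = 0"
    using ACr_FTC[OF ACr_Re[OF AC_mult[OF AC_cnj[OF AC_W1] P]], of 0 T] T_pos by (simp add: D_def)
  have iD: "intg 0 T D"
    unfolding D_def by (intro set_integrable_Re L2_loc_integrable AC_L2[OF AC_mult[OF AC_cnj[OF AC_W1] P]])
  have im: "intg 0 T m"
    unfolding m_def by (intro set_integrable_continuous continuous_intros be1_continuous AC_continuous[OF P]) simp
  have iq: "intg 0 T (\<lambda>x. (1 / 2) * qd P P' x)"
    by (intro set_integrable_mult_right qd_integrable[OF P])
  have pt: "(cmod2 (W1 x + P' x) / 2 - cmod2 (W x + P x) / 2 - (cmod (W x + P x))^4 / 4)
      - (cmod2 (W1 x) / 2 - cmod2 (W x) / 2 - (cmod (W x))^4 / 4) = D x + (1 / 2) * qd P P' x - m x" for x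
  proof -
    have sq: "cmod2 (a + b) = cmod2 a + 2 * Re (cnj a * b) + cmod2 b" for a b :: complex
      unfolding cmod_power2 by (simp add: power2_eq_square algebra_simps)
    have p4: "(cmod z)^4 = (cmod2 z)\<^sup>2" for z :: complex by simp
    have "D x = Re (cnj (W1 x) * P' x) - (1 + sx x) * be1 P x"
      unfolding D_def be1_def by (simp add: algebra_simps)
    thus ?thesis
      unfolding p4 sq m_def qd_def be1_def[symmetric] cmod_W
      by (simp add: field_simps power2_eq_square)
  qed
  have "enP (\<lambda>x. W x + P x) (\<lambda>x. W1 x + P' x) - enP W W1 = (LINT x:{0..T}|lborel. D x + (1 / 2) * qd P P' x - m x)"
    unfolding enP_def pt[symmetric] by (rule set_integral_diff(2)[symmetric, OF enP_integrable[OF WP] enP_integrable[OF AC_W]])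
  also have "\<dots> = (LINT x:{0..T}|lborel. D x + (1 / 2) * qd P P' x) - (LINT x:{0..T}|lborel. m x)"
    by (rule set_integral_diff(2)[OF set_integral_add(1)[OF iD iq] im])
  also have "(LINT x:{0..T}|lborel. D x + (1 / 2) * qd P P' x) = (LINT x:{0..T}|lborel. D x) + (LINT x:{0..T}|lborel. (1 / 2) * qd P P' x)"
    by (rule set_integral_add(2)[OF iD iq])
  finally show ?thesis unfolding D0 by (simp add: bf_def bd_self rem_def m_def[abs_def])
qed

text \<open>The total derivative \<open>D\<close> moves the derivative from \<open>P\<close> to
  \<open>W\<close>, which brings the linear term into the form of \<open>ell\<close>.\<close>

lemma laP_expand:
  assumes P: "AC P P'" and qp: "P T = cis Th * P 0"
  shows "laP (\<lambda>x. W x + P x) (\<lambda>x. W1 x + P' x) - laP W W1 = ell P + laP P P'"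
proof -
  have WP: "AC (\<lambda>x. W x + P x) (\<lambda>x. W1 x + P' x)" by (intro AC_add AC_W P)
  define D where "D x = J * Im (cnj (W1 x) * P x + cnj (W x) * P' x)" for x
  define e where "e x = Re (cnj (P x) * (of_real (2 * (sg - 4 * E)) * W x - \<i> * of_real (2 * J) * W1 x))" for x
  define q where "q x = (sg - 4 * E) * cmod2 (P x) + J * Im (cnj (P x) * P' x)" for x
  have "cnj (W T) * P T = cnj (W 0) * P 0"
    unfolding qp W_shift[of 0, simplified] using cnj_cis_self[of Th] by (simp add: mult_ac)
  hence D0: "(LINT x:{0..T}|lborel. D x) = 0"
    unfolding D_def set_integral_mult_right
    using ACr_FTC[OF ACr_Im[OF AC_mult[OF AC_cnj[OF AC_W] P]], of 0 T] T_pos by simp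
  have iD: "intg 0 T D"
    unfolding D_def by (intro set_integrable_mult_right set_integrable_Im L2_loc_integrable AC_L2[OF AC_mult[OF AC_cnj[OF AC_W] P]])
  have ie: "intg 0 T e"
    unfolding e_def by (intro inner_integrable L2_loc_continuous continuous_intros W_continuous W1_continuous AC_continuous[OF P])
  have iq: "intg 0 T q" unfolding q_def by (rule laP_integrable[OF P])
  have pt: "((sg - 4 * E) * cmod2 (W x + P x) + J * Im (cnj (W x + P x) * (W1 x + P' x)))
     - ((sg - 4 * E) * cmod2 (W x) + J * Im (cnj (W x) * W1 x)) = D x + e x + q x" for x
  proof -
    have sq: "cmod2 (a + b) = cmod2 a + 2 * Re (cnj b * a) + cmod2 b" for a b :: complex
      unfolding cmod_power2 by (simp add: power2_eq_square algebra_simps)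
    show ?thesis unfolding sq D_def e_def q_def by (simp add: algebra_simps)
  qed
  have "laP (\<lambda>x. W x + P x) (\<lambda>x. W1 x + P' x) - laP W W1 = (LINT x:{0..T}|lborel. D x + e x + q x)"
    unfolding laP_def pt[symmetric] by (rule set_integral_diff(2)[symmetric, OF laP_integrable[OF WP] laP_integrable[OF AC_W]])
  also have "\<dots> = (LINT x:{0..T}|lborel. D x) + (LINT x:{0..T}|lborel. e x) + (LINT x:{0..T}|lborel. q x)"
    by (rule set_integral_add3[OF iD ie iq])
  finally show ?thesis unfolding D0 by (simp add: ell_def laP_def e_def[abs_def] q_def[abs_def])
qed

definition qw where "qw = un W"
text \<open>With the weight \<open>1 / qn\<close> the quadratic part at the profile is half of
  \<open>Qt\<close>.\<close>

definition Ly where "Ly v = enP (lf v) (lf1 v) + (laP (lf v) (lf1 v) - laP W W1)\<^sup>2 / qn"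

lemma lf_qw: "lf qw = W"
  unfolding qw_def by (rule lf_un[OF AC_W W_shift])

lemma Ly_expand:
  "Ly (qw + v) - Ly qw = Qt v / 2 - rem (lf v) + (2 * ell (lf v) * laP (lf v) (lf1 v) + (laP (lf v) (lf1 v))\<^sup>2) / qn"
proof -
  have l: "lf (qw + v) = (\<lambda>x. W x + lf v x)" by (rule ext) (simp add: lf_linear lf_qw)
  have A: "AC (\<lambda>x. W x + lf v x) (lf1 (qw + v))" using AC_lf[of "qw + v"] unfolding l .
  have A': "AC (\<lambda>x. W x + lf v x) (\<lambda>x. W1 x + lf1 v x)" by (intro AC_add AC_W AC_lf)
  have B: "AC W (lf1 qw)" using AC_lf[of qw] unfolding lf_qw .
  have 1: "Ly (qw + v) = enP W W1 + (bf (lf v) (lf1 v) (lf v) (lf1 v) / 2 - rem (lf v))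
      + (ell (lf v) + laP (lf v) (lf1 v))\<^sup>2 / qn"
    unfolding Ly_def l enP_unique[OF A A'] laP_unique[OF A A']
    using enP_expand[OF AC_lf lf_T, of v] laP_expand[OF AC_lf lf_T, of v] by simp
  have 2: "Ly qw = enP W W1"
    unfolding Ly_def lf_qw enP_unique[OF B AC_W] laP_unique[OF B AC_W] by simp
  show ?thesis unfolding 1 2 Qt_def using qn_pos by (simp add: field_simps power2_eq_square)
qed

section \<open>Two-sided estimates near the profile\<close>

lemma rem_bound:
  assumes "norm v \<le> 1" shows "\<bar>rem (lf v)\<bar> \<le> T * (64 + 64 * R) * norm v ^ 3"
proof -
  let ?P = "lf v"
  have c: "continuous_on UNIV ?P" by (rule AC_continuous[OF AC_lf])
  have i: "intg 0 T (\<lambda>x. (cmod2 (?P x))\<^sup>2 / 4 + be1 ?P x * cmod2 (?P x))"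
    by (intro set_integrable_continuous continuous_intros be1_continuous c) simp
  have "\<bar>rem ?P\<bar> \<le> (LINT x:{0..T}|lborel. norm ((cmod2 (?P x))\<^sup>2 / 4 + be1 ?P x * cmod2 (?P x)))"
    unfolding rem_def using set_integral_norm_bound[OF i] by simp
  also have "\<dots> \<le> (LINT x:{0..T}|lborel. (64 + 64 * R) * norm v ^ 3)"
  proof (rule set_integral_mono[OF set_integrable_norm[OF i]])
    show "intg 0 T (\<lambda>x. (64 + 64 * R) * norm v ^ 3)"
      by (intro set_integrable_continuous continuous_intros)
    fix x
    have b: "cmod (?P x) \<le> 4 * norm v" by (rule cmod_lf)
    have "(cmod (?P x))^4 \<le> (4 * norm v)^4" using b by (intro power_mono) auto
    also have "\<dots> = 256 * (norm v * norm v ^ 3)" by (simp add: power_mult_distrib power4_eq_xxxx power3_eq_cube)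
    \<comment> \<open>For norm at most 1 the quartic term counts as cubic.\<close>
    also have "\<dots> \<le> 256 * (1 * norm v ^ 3)" using assms by (intro mult_left_mono mult_right_mono) auto
    finally have 1: "(cmod (?P x))^4 / 4 \<le> 64 * norm v ^ 3" by simp
    have "\<bar>be1 ?P x\<bar> \<le> R * cmod (?P x)"
      using power2_le_imp_le[of "\<bar>be1 ?P x\<bar>" "R * cmod (?P x)"] be1_le[of ?P x] R_pos by (simp add: power_mult_distrib)
    hence "\<bar>be1 ?P x\<bar> * cmod2 (?P x) \<le> (R * cmod (?P x)) * cmod2 (?P x)" by (intro mult_right_mono) auto
    also have "\<dots> = R * (cmod (?P x))^3" by (simp add: power2_eq_square power3_eq_cube)
    also have "\<dots> \<le> R * (4 * norm v)^3" using b R_pos by (intro mult_left_mono power_mono) auto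
    also have "\<dots> = 64 * R * norm v ^ 3" by (simp add: power_mult_distrib)
    finally have 2: "\<bar>be1 ?P x\<bar> * cmod2 (?P x) \<le> 64 * R * norm v ^ 3" .
    have "norm ((cmod2 (?P x))\<^sup>2 / 4 + be1 ?P x * cmod2 (?P x)) \<le> (cmod (?P x))^4 / 4 + \<bar>be1 ?P x\<bar> * cmod2 (?P x)"
      by (rule order_trans[OF norm_triangle_ineq]) (simp add: abs_mult)
    thus "norm ((cmod2 (?P x))\<^sup>2 / 4 + be1 ?P x * cmod2 (?P x)) \<le> (64 + 64 * R) * norm v ^ 3"
      using 1 2 by (simp add: distrib_right)
  qed
  also have "\<dots> = T * (64 + 64 * R) * norm v ^ 3" using T_pos by (simp add: set_lebesgue_integral_def)
  finally show ?thesis .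
qed

lemma ell_bound: "\<exists>C\<ge>0. \<forall>v. \<bar>ell (lf v)\<bar> \<le> C * norm v"
proof -
  define F where "F x = of_real (2 * (sg - 4 * E)) * W x - \<i> * of_real (2 * J) * W1 x" for x
  have F: "L2_loc F" unfolding F_def by (intro L2_loc_continuous continuous_intros W_continuous W1_continuous)
  define I where "I = (LINT x:{0..T}|lborel. cmod (F x))"
  have I0: "0 \<le> I" unfolding I_def by (rule set_integral_nonneg) simp
  have "\<bar>ell (lf v)\<bar> \<le> (4 * I) * norm v" for v
  proof -
    have i: "intg 0 T (\<lambda>x. Re (cnj (lf v x) * F x))"
      by (intro inner_integrable F L2_loc_continuous AC_continuous[OF AC_lf])
    have "\<bar>ell (lf v)\<bar> \<le> (LINT x:{0..T}|lborel. norm (Re (cnj (lf v x) * F x)))"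
      unfolding ell_def F_def[symmetric] using set_integral_norm_bound[OF i] by simp
    also have "\<dots> \<le> (LINT x:{0..T}|lborel. (4 * norm v) * cmod (F x))"
    proof (rule set_integral_mono[OF set_integrable_norm[OF i]])
      show "intg 0 T (\<lambda>x. (4 * norm v) * cmod (F x))"
        by (intro set_integrable_mult_right L2_loc_norm_integrable F)
      fix x
      have "norm (Re (cnj (lf v x) * F x)) \<le> cmod (lf v x) * cmod (F x)"
        using abs_Re_le_cmod[of "cnj (lf v x) * F x"] by (simp only: norm_mult complex_mod_cnj real_norm_def)
      also have "\<dots> \<le> (4 * norm v) * cmod (F x)" by (intro mult_right_mono cmod_lf) simp
      finally show "norm (Re (cnj (lf v x) * F x)) \<le> (4 * norm v) * cmod (F x)" .
    qed
    finally show ?thesis unfolding set_integral_mult_right I_def by (simp only: mult_ac)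
  qed
  thus ?thesis using I0 by (intro exI[of _ "4 * I"]) simp
qed

lemma laP_bound: "\<exists>C\<ge>0. \<forall>v. \<bar>laP (lf v) (lf1 v)\<bar> \<le> C * (norm v)\<^sup>2"
proof -
  obtain C where C: "C \<ge> 0" "\<And>v. (LINT x:{0..T}|lborel. cmod2 (lf1 v x)) \<le> C * (norm v)\<^sup>2"
    using lf1_bound by blast
  define K where "K = \<bar>sg - 4 * E\<bar> + \<bar>J\<bar>"
  have K0: "0 \<le> K" by (simp add: K_def)
  have "\<bar>laP (lf v) (lf1 v)\<bar> \<le> (K * (T * 16) + K * C) * (norm v)\<^sup>2" for v
  proof -
    let ?P = "lf v" and ?P' = "lf1 v"
    have iP: "intg 0 T (\<lambda>x. cmod2 (?P x))"
      by (intro L2_loc_sq_integrable L2_loc_continuous AC_continuous[OF AC_lf])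
    have iP': "intg 0 T (\<lambda>x. cmod2 (?P' x))" by (intro L2_loc_sq_integrable AC_L2[OF AC_lf])
    have "\<bar>laP ?P ?P'\<bar> \<le> (LINT x:{0..T}|lborel. norm ((sg - 4 * E) * cmod2 (?P x) + J * Im (cnj (?P x) * ?P' x)))"
      unfolding laP_def using set_integral_norm_bound[OF laP_integrable[OF AC_lf]] by simp
    also have "\<dots> \<le> (LINT x:{0..T}|lborel. K * cmod2 (?P x) + K * cmod2 (?P' x))"
    proof (rule set_integral_mono[OF set_integrable_norm[OF laP_integrable[OF AC_lf]]])
      show "intg 0 T (\<lambda>x. K * cmod2 (?P x) + K * cmod2 (?P' x))"
        by (intro set_integral_add(1) set_integrable_mult_right iP iP')
      fix x
      let ?a = "cmod (?P x)" and ?b = "cmod (?P' x)"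
      have "\<bar>Im (cnj (?P x) * ?P' x)\<bar> \<le> ?a * ?b"
        using abs_Im_le_cmod[of "cnj (?P x) * ?P' x"] by (simp only: norm_mult complex_mod_cnj)
      also have "\<dots> \<le> ?a\<^sup>2 + ?b\<^sup>2"
      proof -
        have "0 \<le> ?a * ?b" by simp
        thus ?thesis using sum_squares_bound[of ?a ?b] by linarith
      qed
      finally have "\<bar>J\<bar> * \<bar>Im (cnj (?P x) * ?P' x)\<bar> \<le> \<bar>J\<bar> * (?a\<^sup>2 + ?b\<^sup>2)" by (rule mult_left_mono) simp
      moreover have "0 \<le> \<bar>sg - 4 * E\<bar> * ?b\<^sup>2" by simp
      ultimately have "\<bar>sg - 4 * E\<bar> * ?a\<^sup>2 + \<bar>J\<bar> * \<bar>Im (cnj (?P x) * ?P' x)\<bar> \<le> K * ?a\<^sup>2 + K * ?b\<^sup>2"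
        unfolding K_def distrib_right distrib_left by linarith
      moreover have "norm ((sg - 4 * E) * ?a\<^sup>2 + J * Im (cnj (?P x) * ?P' x)) \<le> \<bar>sg - 4 * E\<bar> * ?a\<^sup>2 + \<bar>J\<bar> * \<bar>Im (cnj (?P x) * ?P' x)\<bar>"
        by (rule order_trans[OF norm_triangle_ineq]) (simp only: real_norm_def abs_mult abs_power2 abs_norm_cancel order_refl)
      ultimately show "norm ((sg - 4 * E) * ?a\<^sup>2 + J * Im (cnj (?P x) * ?P' x)) \<le> K * ?a\<^sup>2 + K * ?b\<^sup>2" by linarith
    qed
    also have "\<dots> = K * (LINT x:{0..T}|lborel. cmod2 (?P x)) + K * (LINT x:{0..T}|lborel. cmod2 (?P' x))"
      unfolding set_integral_mult_right[symmetric] by (intro set_integral_add(2) set_integrable_mult_right iP iP')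
    also have "\<dots> \<le> K * (T * (4 * norm v)\<^sup>2) + K * (C * (norm v)\<^sup>2)"
      by (intro add_mono mult_left_mono K0 C(2) sup_sq_integral[OF AC_lf] cmod_lf)
    also have "\<dots> = (K * (T * 16) + K * C) * (norm v)\<^sup>2" by (simp add: power_mult_distrib algebra_simps)
    finally show ?thesis .
  qed
  moreover have "0 \<le> K * (T * 16) + K * C" using K0 C(1) T_pos by simp
  ultimately show ?thesis by blast
qed

text \<open>The mixed term is cubic because \<open>ell\<close> is linear and \<open>laP\<close>
  quadratic, and the square of \<open>laP\<close> has the favourable sign.\<close>

lemma Ly_lower: "\<exists>C\<ge>0. \<forall>v. norm v \<le> 1 \<longrightarrow> Qt v / 2 - C * norm v ^ 3 \<le> Ly (qw + v) - Ly qw"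
proof -
  obtain C1 where C1': "C1 \<ge> 0 \<and> (\<forall>v. \<bar>ell (lf v)\<bar> \<le> C1 * norm v)" using ell_bound by (elim exE)
  obtain C2 where C2': "C2 \<ge> 0 \<and> (\<forall>v. \<bar>laP (lf v) (lf1 v)\<bar> \<le> C2 * (norm v)\<^sup>2)" using laP_bound by (elim exE)
  note C1 = conjunct1[OF C1'] spec[OF conjunct2[OF C1']] and C2 = conjunct1[OF C2'] spec[OF conjunct2[OF C2']]
  define C where "C = T * (64 + 64 * R) + 2 * (C1 * C2) / qn"
  have "Qt v / 2 - C * norm v ^ 3 \<le> Ly (qw + v) - Ly qw" if v: "norm v \<le> 1" for v
  proof -
    have "\<bar>ell (lf v) * laP (lf v) (lf1 v)\<bar> \<le> (C1 * norm v) * (C2 * (norm v)\<^sup>2)"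
      unfolding abs_mult using C1 C2 by (intro mult_mono) auto
    also have "\<dots> = (C1 * C2) * norm v ^ 3" by (simp add: power2_eq_square power3_eq_cube)
    finally have "- (2 * (C1 * C2) * norm v ^ 3) \<le> 2 * ell (lf v) * laP (lf v) (lf1 v)" by linarith
    hence "- (2 * (C1 * C2) * norm v ^ 3) \<le> 2 * ell (lf v) * laP (lf v) (lf1 v) + (laP (lf v) (lf1 v))\<^sup>2"
      using zero_le_power2[of "laP (lf v) (lf1 v)"] by linarith
    hence "- (2 * (C1 * C2) * norm v ^ 3) / qn \<le> (2 * ell (lf v) * laP (lf v) (lf1 v) + (laP (lf v) (lf1 v))\<^sup>2) / qn"
      using qn_pos by (intro divide_right_mono) auto
    moreover have "C * norm v ^ 3 = T * (64 + 64 * R) * norm v ^ 3 + 2 * (C1 * C2) * norm v ^ 3 / qn"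
      by (simp add: C_def distrib_right)
    ultimately show ?thesis using rem_bound[OF v] unfolding Ly_expand by (simp add: abs_le_iff)
  qed
  moreover have "0 \<le> C" using C1 C2 T_pos R_pos qn_pos by (simp add: C_def)
  ultimately show ?thesis by blast
qed

lemma Ly_upper: "\<exists>C\<ge>0. \<forall>v. norm v \<le> 1 \<longrightarrow> Ly (qw + v) - Ly qw \<le> C * (norm v)\<^sup>2"
proof -
  obtain C1 where C1': "C1 \<ge> 0 \<and> (\<forall>v. \<bar>ell (lf v)\<bar> \<le> C1 * norm v)" using ell_bound by (elim exE)
  obtain C2 where C2': "C2 \<ge> 0 \<and> (\<forall>v. \<bar>laP (lf v) (lf1 v)\<bar> \<le> C2 * (norm v)\<^sup>2)" using laP_bound by (elim exE)
  note C1 = conjunct1[OF C1'] spec[OF conjunct2[OF C1']] and C2 = conjunct1[OF C2'] spec[OF conjunct2[OF C2']]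
  obtain C3 where C3': "C3 \<ge> 0 \<and> (\<forall>v. (LINT x:{0..T}|lborel. cmod2 (lf1 v x)) \<le> C3 * (norm v)\<^sup>2)"
    using lf1_bound by (elim exE)
  note C3 = conjunct1[OF C3'] spec[OF conjunct2[OF C3']]
  define C where "C = C3 / 2 + T * (64 + 64 * R) + (C1 + C2)\<^sup>2 / qn"
  have "Ly (qw + v) - Ly qw \<le> C * (norm v)\<^sup>2" if v: "norm v \<le> 1" for v
  proof -
    have n2: "(norm v)\<^sup>2 \<le> norm v" "norm v ^ 3 \<le> (norm v)\<^sup>2"
      using v power_decreasing[of 1 2 "norm v"] power_decreasing[of 2 3 "norm v"] by simp_all
    have "qd (lf v) (lf1 v) x \<le> cmod2 (lf1 v x)" for x
    proof -
      have "0 \<le> (1 + sx x) * cmod2 (lf v x) + 2 * (be1 (lf v) x)\<^sup>2" using sx_le(2)[of x] by simp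
      thus ?thesis unfolding qd_def by linarith
    qed
    hence "bf (lf v) (lf1 v) (lf v) (lf1 v) \<le> (LINT x:{0..T}|lborel. cmod2 (lf1 v x))"
      unfolding bf_def bd_self
      by (intro set_integral_mono[OF qd_integrable[OF AC_lf] L2_loc_sq_integrable[OF AC_L2[OF AC_lf]]])
    hence b: "bf (lf v) (lf1 v) (lf v) (lf1 v) / 2 \<le> C3 / 2 * (norm v)\<^sup>2" using C3(2)[of v] by simp
    have "\<bar>rem (lf v)\<bar> \<le> T * (64 + 64 * R) * (norm v)\<^sup>2"
      using T_pos R_pos by (intro order_trans[OF rem_bound[OF v]] mult_left_mono[OF n2(2)]) simp
    hence r: "- rem (lf v) \<le> T * (64 + 64 * R) * (norm v)\<^sup>2" by linarith
    have "C2 * (norm v)\<^sup>2 \<le> C2 * norm v" using n2(1) C2(1) by (rule mult_left_mono)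
    hence "\<bar>ell (lf v) + laP (lf v) (lf1 v)\<bar> \<le> (C1 + C2) * norm v"
      using C1(2)[of v] C2(2)[of v] by (simp add: distrib_right)
    hence "(ell (lf v) + laP (lf v) (lf1 v))\<^sup>2 \<le> ((C1 + C2) * norm v)\<^sup>2" by (rule power2_mono_abs)
    hence l: "(ell (lf v) + laP (lf v) (lf1 v))\<^sup>2 / qn \<le> (C1 + C2)\<^sup>2 / qn * (norm v)\<^sup>2"
      using qn_pos by (simp add: power_mult_distrib divide_right_mono)
    have "Ly (qw + v) - Ly qw = bf (lf v) (lf1 v) (lf v) (lf1 v) / 2 - rem (lf v) + (ell (lf v) + laP (lf v) (lf1 v))\<^sup>2 / qn"
      unfolding Ly_expand Qt_def using qn_pos by (simp add: field_simps power2_eq_square)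
    thus ?thesis using b r l unfolding C_def distrib_right by linarith
  qed
  moreover have "0 \<le> C" using C3 T_pos R_pos qn_pos by (simp add: C_def)
  ultimately show ?thesis by blast
qed

end

section \<open>Orbital stability\<close>

lemma AC_bound_interval:
  assumes "AC f f1" "a \<le> b" "\<And>t. t \<in> {a..b} \<Longrightarrow> cmod (f1 t) \<le> C"
  shows "cmod (f b - f a) \<le> C * (b - a)"
proof -
  have "cmod (f b - f a) \<le> (LINT t:{a..b}|lborel. cmod (f1 t))"
    unfolding AC_diff_eq[OF assms(1,2)] by (rule set_integral_norm_bound[OF L2_loc_integrable[OF AC_L2[OF assms(1)]]])
  also have "\<dots> \<le> (LINT t:{a..b}|lborel. C)"
    by (rule set_integral_mono[OF L2_loc_norm_integrable[OF AC_L2[OF assms(1)]]])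
       (auto intro!: set_integrable_continuous assms(3))
  finally show ?thesis using assms(2) by (simp add: set_lebesgue_integral_def mult.commute)
qed

lemma AC_lipschitz:
  assumes "AC f f1" "\<And>t. cmod (f1 t) \<le> C"
  shows "cmod (f x - f y) \<le> C * \<bar>x - y\<bar>"
proof (cases "x \<le> y")
  case True
  thus ?thesis using AC_bound_interval[OF assms(1) True assms(2)] by (simp add: norm_minus_commute)
next
  case False
  thus ?thesis using AC_bound_interval[OF assms(1) _ assms(2), of y x] by simp
qed

lemma AC_taylor:
  assumes f: "AC f f1" and L: "\<And>x y. cmod (f1 x - f1 y) \<le> C * \<bar>x - y\<bar>"
  shows "cmod (f (x + y) - f x - of_real y * f1 x) \<le> C * y\<^sup>2"
proof -
  define h h1 where "h = (\<lambda>t. f t - f1 x * of_real t)" and "h1 = (\<lambda>t. f1 t - f1 x * of_real 1)"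
  have h: "AC h h1"
    unfolding h_def h1_def
    by (rule AC_diff[OF f AC_cmult[OF ACr_C1[unfolded ACr_def, OF DERIV_ident continuous_on_const]]])
  have C0: "0 \<le> C" using order_trans[OF norm_ge_zero L[of 0 1]] by simp
  have b: "cmod (h1 t) \<le> C * \<bar>y\<bar>" if "t \<in> {min x (x + y)..max x (x + y)}" for t
  proof -
    have "cmod (h1 t) \<le> C * \<bar>t - x\<bar>" using L[of t x] by (simp add: h1_def)
    also have "\<dots> \<le> C * \<bar>y\<bar>" using that by (intro mult_left_mono C0) auto
    finally show ?thesis .
  qed
  have "cmod (h (max x (x + y)) - h (min x (x + y))) \<le> C * \<bar>y\<bar> * (max x (x + y) - min x (x + y))"
    by (rule AC_bound_interval[OF h _ b]) auto
  also have "\<dots> = C * y\<^sup>2" by (auto simp: max_def min_def power2_eq_square)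
  finally have "cmod (h (x + y) - h x) \<le> C * y\<^sup>2" by (auto simp: max_def min_def norm_minus_commute split: if_splits)
  thus ?thesis by (simp add: h_def algebra_simps)
qed

text \<open>Along a curve that is linear up to a quadratic remainder, the first variation of the
  squared distance vanishes at a minimum.\<close>

lemma first_order_condition:
  fixes v \<phi> :: "'a::real_inner"
  assumes min: "\<And>t. norm v \<le> norm (v - (t *\<^sub>R \<phi> + r t))" and r: "\<And>t. norm (r t) \<le> C * t\<^sup>2"
  shows "inner v \<phi> = 0"
proof (rule ccontr)
  assume a0: "inner v \<phi> \<noteq> 0"
  define a where "a = inner v \<phi>"
  define D where "D = 2 * (norm v * C) + (norm \<phi> + C)\<^sup>2"
  have C0: "0 \<le> C" using r[of 1] norm_ge_zero[of "r 1"] by (simp del: norm_ge_zero)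
  have D0: "0 \<le> D" using C0 by (simp add: D_def)
  have key: "2 * t * a \<le> D * t\<^sup>2" if "\<bar>t\<bar> \<le> 1" for t
  proof -
    let ?w = "t *\<^sub>R \<phi> + r t"
    have "(norm v)\<^sup>2 \<le> (norm (v - ?w))\<^sup>2" by (intro power_mono min) simp
    hence "2 * inner v ?w \<le> (norm ?w)\<^sup>2"
      unfolding power2_norm_eq_inner by (simp add: inner_diff_left inner_diff_right inner_commute)
    hence 1: "2 * t * a + 2 * inner v (r t) \<le> (norm ?w)\<^sup>2" by (simp add: inner_add_right a_def)
    have "- inner v (r t) \<le> norm v * norm (r t)" using Cauchy_Schwarz_ineq2[of v "r t"] by linarith
    also have "\<dots> \<le> norm v * (C * t\<^sup>2)" by (intro mult_left_mono r) simp
    finally have 2: "- inner v (r t) \<le> (norm v * C) * t\<^sup>2" by (simp only: mult.assoc)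
    have t2: "t\<^sup>2 \<le> \<bar>t\<bar>" using mult_right_mono[OF that, of "\<bar>t\<bar>"] by (simp add: power2_eq_square)
    have "norm ?w \<le> \<bar>t\<bar> * norm \<phi> + C * t\<^sup>2"
      using norm_triangle_ineq[of "t *\<^sub>R \<phi>" "r t"] r[of t] unfolding norm_scaleR by linarith
    also have "\<dots> \<le> \<bar>t\<bar> * norm \<phi> + C * \<bar>t\<bar>" using t2 C0 by (intro add_left_mono mult_left_mono)
    finally have "norm ?w \<le> (norm \<phi> + C) * \<bar>t\<bar>" by (simp add: algebra_simps)
    hence "(norm ?w)\<^sup>2 \<le> ((norm \<phi> + C) * \<bar>t\<bar>)\<^sup>2" by (intro power_mono) auto
    hence "(norm ?w)\<^sup>2 \<le> (norm \<phi> + C)\<^sup>2 * t\<^sup>2" by (simp add: power_mult_distrib)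
    thus ?thesis using 1 2 unfolding D_def distrib_right by linarith
  qed
  \<comment> \<open>The parameter \<open>t = a / d\<close> has modulus at most 1 and turns the
    estimate into \<open>2 d <= D\<close>, which is impossible since
    \<open>d > D >= 0\<close>.\<close>
  define d where "d = D + \<bar>a\<bar>"
  have d: "0 < d" "\<bar>a\<bar> \<le> d" using a0 D0 by (simp_all add: a_def d_def)
  have "2 * (a / d) * a \<le> D * (a / d)\<^sup>2"
    by (rule key) (use d in \<open>simp add: abs_divide\<close>)
  hence "(2 * (a / d) * a) * d\<^sup>2 \<le> (D * (a / d)\<^sup>2) * d\<^sup>2" by (rule mult_right_mono) simp
  moreover have "(2 * (a / d) * a) * d\<^sup>2 = a\<^sup>2 * (2 * d)" "(D * (a / d)\<^sup>2) * d\<^sup>2 = a\<^sup>2 * D"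
    using d by (simp_all add: power2_eq_square)
  ultimately have "a\<^sup>2 * (2 * d) \<le> a\<^sup>2 * D" by simp
  hence "2 * d \<le> D" using a0 by (simp add: a_def)
  thus False using d by (simp add: d_def)
qed

section \<open>Conserved functionals in the original variables\<close>

definition mass :: "h1 \<Rightarrow> real" where "mass u = iper (\<lambda>z. cmod2 (fn u z))"
definition mom :: "h1 \<Rightarrow> real" where "mom u = Im (iper (\<lambda>z. cnj (fn u z) * dv u z))"
definition dir :: "h1 \<Rightarrow> real" where "dir u = iper (\<lambda>z. cmod2 (dv u z))"
definition qua :: "h1 \<Rightarrow> real" where "qua u = iper (\<lambda>z. (cmod (fn u z))^4)"

lemma functionals_invariant:
  fixes c :: complex and t :: real and u :: h1
  assumes c: "cmod c = 1"
  defines "w \<equiv> cmul c (shift t u)"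
  shows "mass w = mass u" "mom w = mom u" "dir w = dir u" "qua w = qua u"
proof -
  have fw: "fn w z = c * fn u (z + t)" for z by (simp add: w_def fn_simps)
  have "AC (fn w) (\<lambda>z. c * dv u (z + t))"
    using AC_cmult[OF AC_fn_shift[of t u], of c] by (simp add: w_def fn_cmul[abs_def])
  hence dw: "AE z in lborel. dv w z = c * dv u (z + t)" by (rule dv_AE)
  have L: "L2_loc (\<lambda>z. dv u (z + t))" using L2_loc_affine[OF L2_dv, of 1 u t] by (simp add: add.commute)
  have Lf: "L2_loc (\<lambda>z. fn u (z + t))" using L2_loc_affine[OF L2_fn, of 1 u t] by (simp add: add.commute)
  have cc: "cnj c * c = 1" using c complex_norm_square[of c] by (simp add: mult.commute)
  show "mass w = mass u"
    unfolding mass_def fw norm_mult c mult_1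
    by (rule iper_shift[where f = "\<lambda>z. cmod2 (fn u z)"]) (auto intro: L2_loc_sq_integrable L2_fn simp: fn_periodic)
  show "qua w = qua u"
    unfolding qua_def fw norm_mult c mult_1
    by (rule iper_shift[where f = "\<lambda>z. (cmod (fn u z))^4"])
       (auto intro!: set_integrable_continuous continuous_intros fn_continuous simp: fn_periodic)
  have "dir w = iper (\<lambda>z. cmod2 (dv u (z + t)))"
    unfolding dir_def
    by (rule set_integral_AE_cong'[OF _ L2_loc_sq_integrable[OF L2_dv] L2_loc_sq_integrable[OF L]])
       (use dw in eventually_elim, simp add: norm_mult c)
  also have "\<dots> = dir u"
    unfolding dir_def
    by (rule iper_shift[where f = "\<lambda>z. cmod2 (dv u z)"], intro L2_loc_sq_integrable L2_dv)
       (use dv_periodic[of u] in eventually_elim, simp)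
  finally show "dir w = dir u" .
  have "iper (\<lambda>z. cnj (fn w z) * dv w z) = iper (\<lambda>z. cnj (fn u (z + t)) * dv u (z + t))"
  proof (rule set_integral_AE_cong')
    show "AE z in lborel. cnj (fn w z) * dv w z = cnj (fn u (z + t)) * dv u (z + t)"
      using dw
    proof eventually_elim
      case (elim z)
      have "cnj (fn w z) * dv w z = (cnj c * c) * (cnj (fn u (z + t)) * dv u (z + t))" unfolding elim fw by simp
      thus ?case unfolding cc by simp
    qed
  qed (intro L2_loc_mult_integrable L2_loc_cnj L2_fn L2_dv L Lf)+
  also have "\<dots> = iper (\<lambda>z. cnj (fn u z) * dv u z)"
  proof (rule iper_shift[where f = "\<lambda>z. cnj (fn u z) * dv u z"])
    show "AE z in lborel. cnj (fn u (z + 2 * pi)) * dv u (z + 2 * pi) = cnj (fn u z) * dv u z"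
      using dv_periodic[of u] by eventually_elim (simp add: fn_periodic)
  qed (intro L2_loc_mult_integrable L2_loc_cnj L2_fn L2_dv)
  finally show "mom w = mom u" by (simp add: mom_def)
qed

context cn_wave
begin

lemma lf_sq: "cmod2 (lf u x) = cmod2 (fn u (aT * x))"
  by (simp add: lf_def norm_mult)

text \<open>Undoing the lift expresses the action through mass, momentum and energy. With
  \<open>aT = 2 k\<close> the last bracket is the energy of the equation, so \<open>Ly\<close> is a
  function of conserved quantities.\<close>

lemma enP_functionals:
  "enP (lf u) (lf1 u) = (1 / aT) * ((th\<^sup>2 / 2 - 1 / 2) * mass u + th * aT * mom u + (aT\<^sup>2 / 2 * dir u - qua u / 4))"
  and laP_functionals: "laP (lf u) (lf1 u) = (1 / aT) * ((sg - 4 * E + J * th) * mass u + J * aT * mom u)"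
proof -
  have i: "intg 0 (2*pi) (\<lambda>z. cmod2 (fn u z))" "intg 0 (2*pi) (\<lambda>z. cmod2 (dv u z))"
      "intg 0 (2*pi) (\<lambda>z. Im (cnj (fn u z) * dv u z))" "intg 0 (2*pi) (\<lambda>z. (cmod (fn u z))^4)"
    by (intro L2_loc_sq_integrable L2_fn L2_dv set_integrable_Im L2_loc_mult_integrable L2_loc_cnj
        set_integrable_continuous continuous_intros fn_continuous)+
  have mom: "mom u = iper (\<lambda>z. Im (cnj (fn u z) * dv u z))"
    unfolding mom_def by (rule set_integral_Im[symmetric]) (intro L2_loc_mult_integrable L2_loc_cnj L2_fn L2_dv)
  have lf1: "lf1 u x = cis (th * x) * (\<i> * of_real th * a + of_real aT * b)"
    if "a = fn u (aT * x)" "b = dv u (aT * x)" for x a b by (simp add: lf1_def that)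
  have m: "cmod2 (lf1 u x) = th\<^sup>2 * cmod2 (fn u (aT * x)) + 2 * th * aT * Im (cnj (fn u (aT * x)) * dv u (aT * x)) + aT\<^sup>2 * cmod2 (dv u (aT * x))" for x
    unfolding lf1[OF refl refl] norm_mult norm_cis mult_1 cmod_power2 by (simp add: power2_eq_square algebra_simps)
  have n: "Im (cnj (lf u x) * lf1 u x) = th * cmod2 (fn u (aT * x)) + aT * Im (cnj (fn u (aT * x)) * dv u (aT * x))" for x
  proof -
    have "cnj (lf u x) * lf1 u x = cnj (fn u (aT * x)) * (\<i> * of_real th * fn u (aT * x) + of_real aT * dv u (aT * x))"
      unfolding lf_def lf1_def using cnj_cis_self[of "th * x"] by (simp add: mult_ac)
    thus ?thesis unfolding cmod_power2 by (simp add: power2_eq_square algebra_simps)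
  qed
  have p4: "(cmod (lf u x))^4 = (cmod (fn u (aT * x)))^4" for x by (simp add: lf_def norm_mult)
  define e where "e z = (th\<^sup>2 / 2 - 1 / 2) * cmod2 (fn u z) + th * aT * Im (cnj (fn u z) * dv u z) + (aT\<^sup>2 / 2 * cmod2 (dv u z) - 1 / 4 * (cmod (fn u z))^4)" for z
  have "enP (lf u) (lf1 u) = (LINT x:{0..T}|lborel. e (aT * x))"
    unfolding enP_def m lf_sq p4 e_def
    by (rule set_integral_pw_cong) (simp add: field_simps)
  also have "\<dots> = (1 / aT) * iper e" using iper_lift[of e] aT_pos by simp
  also have "iper e = (th\<^sup>2 / 2 - 1 / 2) * mass u + th * aT * mom u + (aT\<^sup>2 / 2 * dir u - 1 / 4 * qua u)"
    unfolding e_def mass_def mom dir_def qua_def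
    using i by (simp only: set_integral_add(2) set_integral_diff(2) set_integral_add(1) set_integral_diff(1)
        set_integrable_mult_right set_integral_mult_right simp_thms)
  finally show "enP (lf u) (lf1 u) = (1 / aT) * ((th\<^sup>2 / 2 - 1 / 2) * mass u + th * aT * mom u + (aT\<^sup>2 / 2 * dir u - qua u / 4))"
    by simp
  define l where "l z = (sg - 4 * E + J * th) * cmod2 (fn u z) + J * aT * Im (cnj (fn u z) * dv u z)" for z
  have "laP (lf u) (lf1 u) = (LINT x:{0..T}|lborel. l (aT * x))"
    unfolding laP_def n lf_sq l_def
    by (rule set_integral_pw_cong) (simp add: algebra_simps)
  also have "\<dots> = (1 / aT) * iper l" using iper_lift[of l] aT_pos by simp
  also have "iper l = (sg - 4 * E + J * th) * mass u + J * aT * mom u"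
    unfolding l_def mass_def mom
    using i by (simp only: set_integral_add(2) set_integrable_mult_right set_integral_mult_right simp_thms)
  finally show "laP (lf u) (lf1 u) = (1 / aT) * ((sg - 4 * E + J * th) * mass u + J * aT * mom u)" .
qed

lemma Ly_cong:
  assumes "mass u = mass v" "mom u = mom v" "aT\<^sup>2 / 2 * dir u - qua u / 4 = aT\<^sup>2 / 2 * dir v - qua v / 4"
  shows "Ly u = Ly v"
  unfolding Ly_def enP_functionals laP_functionals assms ..

text \<open>The phase \<open>th * y\<close> compensates the factor of the lift, so that on lifted
  functions the action is rotation by \<open>a\<close> and translation by \<open>y\<close>, see
  \<open>lf_act\<close>.\<close>

definition act where "act a y u = cmul (cis (a + th * y)) (shift (aT * y) u)"

lemma fn_act: "fn (act a y u) z = cis (a + th * y) * fn u (z + aT * y)"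
  by (simp add: act_def fn_simps)

lemma lf_act: "lf (act a y u) x = cis a * lf u (x + y)"
  unfolding lf_def fn_act by (simp add: cis_mult[symmetric] distrib_left)

lemma act_act: "act a y (act b z u) = act (a + b) (y + z) u"
proof (rule fn_eqI)
  fix x
  have 1: "cis (a + th * y) * cis (b + th * z) = cis (a + b + th * (y + z))" by (simp add: cis_mult distrib_left add_ac)
  have 2: "x + aT * y + aT * z = x + aT * (y + z)" by (simp add: distrib_left)
  show "fn (act a y (act b z u)) x = fn (act (a + b) (y + z) u) x"
    unfolding fn_act mult.assoc[symmetric] 1 2 ..
qed

lemma act_zero: "act 0 0 u = u"
  by (rule fn_eqI) (simp add: fn_act)

lemma act_diff: "act a y (u - v) = act a y u - act a y v"
  by (rule fn_eqI) (simp add: fn_act fn_simps algebra_simps)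

lemma norm_act: "norm (act a y u) = norm u"
  by (simp add: act_def norm_cmul norm_shift)

lemma Ly_act: "Ly (act a y u) = Ly u"
  by (rule Ly_cong) (simp_all add: act_def functionals_invariant)

lemma lf_diff: "lf (u - v) x = lf u x - lf v x"
  by (simp add: lf_def fn_simps algebra_simps)

lemma lf_inj: "lf u = lf v \<Longrightarrow> u = v"
proof (rule fn_eqI)
  fix z assume "lf u = lf v"
  hence "lf u (z / aT) = lf v (z / aT)" by simp
  thus "fn u z = fn v z" using aT_pos by (simp add: lf_def)
qed

text \<open>A translation by \<open>T\<close> acts on the profile as the phase \<open>Th\<close>, so
  the orbit is the image of a compact rectangle.\<close>

lemma act_reduce: "\<exists>a'\<in>{0..2*pi}. \<exists>y'\<in>{0..T}. act a y qw = act a' y' qw"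
proof -
  have sh: "act b (x + T) qw = act (b + Th) x qw" for b x
    by (rule lf_inj) (simp add: lf_act[abs_def] lf_qw add.assoc[symmetric] W_shift cis_mult[symmetric] mult.assoc)
  \<comment> \<open>Reducing the translation alters the phase; what is periodic in the translation
    is the set of all rotations.\<close>
  have per: "range (\<lambda>b. act b ((z + 2 * pi) / aT) qw) = range (\<lambda>b. act b (z / aT) qw)" for z
  proof -
    have e: "(z + 2 * pi) / aT = z / aT + T" unfolding aT_T[symmetric] using aT_pos by (simp add: add_divide_distrib)
    show ?thesis unfolding e
    proof (intro equalityI subsetI; elim rangeE)
      fix u b assume "u = act b (z / aT + T) qw"
      thus "u \<in> range (\<lambda>b. act b (z / aT) qw)" unfolding sh by blast
    next
      fix u b assume "u = act b (z / aT) qw"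
      thus "u \<in> range (\<lambda>b. act b (z / aT + T) qw)" using sh[of "b - Th" "z / aT"] by (intro range_eqI[of _ _ "b - Th"]) simp
    qed
  qed
  have "\<exists>w\<in>{0..2*pi}. range (\<lambda>b. act b ((aT * y) / aT) qw) = range (\<lambda>b. act b (w / aT) qw)"
    by (rule periodic_reduce[where f = "\<lambda>z. range (\<lambda>b. act b (z / aT) qw)"]) (rule per)
  then obtain w where w: "w \<in> {0..2*pi}" "range (\<lambda>b. act b ((aT * y) / aT) qw) = range (\<lambda>b. act b (w / aT) qw)" by (elim bexE)
  have "(aT * y) / aT = y" using aT_pos by simp
  hence "act a y qw \<in> range (\<lambda>b. act b (w / aT) qw)" using w(2) by auto
  then obtain b where b: "act a y qw = act b (w / aT) qw" by blast
  have "w / aT \<in> {0..T}" using w(1) aT_pos aT_T by (auto simp: field_simps)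
  moreover have "\<exists>c\<in>{0..2*pi}. act b (w / aT) qw = act c (w / aT) qw"
  proof (rule periodic_reduce[where f = "\<lambda>c. act c (w / aT) qw"])
    show "act (c + 2 * pi) (w / aT) qw = act c (w / aT) qw" for c
      by (rule lf_inj, rule ext) (simp add: lf_act cis_mult[symmetric])
  qed
  ultimately show ?thesis unfolding b by blast
qed

text \<open>Turns pointwise Taylor estimates for the wave and its derivative into estimates in the
  norm of X.\<close>

lemma norm_le_sup:
  "\<exists>K\<ge>0. \<forall>u P' B. AC (lf u) P' \<longrightarrow> (\<forall>x. cmod (lf u x) \<le> B) \<longrightarrow> (\<forall>x. cmod (P' x) \<le> B) \<longrightarrow> norm u \<le> K * B"
proof (intro exI conjI allI impI)
  define k where "k = aT * T + 1 / aT * (T * (1 + \<bar>th\<bar>)\<^sup>2)"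
  have k0: "0 \<le> k" using aT_pos T_pos by (simp add: k_def)
  thus "0 \<le> sqrt k" by simp
  fix u P' B assume P: "AC (lf u) P'" and B: "\<forall>x. cmod (lf u x) \<le> B" "\<forall>x. cmod (P' x) \<le> B"
  have B0: "0 \<le> B" using B(1) norm_ge_zero order_trans by blast
  have 1: "(LINT x:{0..T}|lborel. cmod2 (lf u x)) \<le> T * B\<^sup>2" by (rule sup_sq_integral[OF AC_lf]) (use B in auto)
  have L: "L2_loc (\<lambda>x. P' x - \<i> * of_real th * lf u x)"
    by (intro L2_loc_diff L2_loc_cmult AC_L2[OF P] L2_loc_continuous AC_continuous[OF P])
  have "(LINT x:{0..T}|lborel. cmod2 (lfd u x)) = (LINT x:{0..T}|lborel. cmod2 (P' x - \<i> * of_real th * lf u x))"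
    by (rule set_integral_AE_cong'[OF _ L2_loc_sq_integrable[OF L2_lift] L2_loc_sq_integrable[OF L]])
       (use AC_unique[OF AC_lf P] in eventually_elim, simp)
  also have "\<dots> \<le> (LINT x:{0..T}|lborel. ((1 + \<bar>th\<bar>) * B)\<^sup>2)"
  proof (rule set_integral_mono[OF L2_loc_sq_integrable[OF L]])
    show "intg 0 T (\<lambda>x. ((1 + \<bar>th\<bar>) * B)\<^sup>2)" by (intro set_integrable_continuous continuous_intros)
    fix x
    have "cmod (P' x - \<i> * of_real th * lf u x) \<le> cmod (P' x) + \<bar>th\<bar> * cmod (lf u x)"
      by (rule order_trans[OF norm_triangle_ineq4]) (simp add: norm_mult)
    also have "\<dots> \<le> B + \<bar>th\<bar> * B" using B by (intro add_mono mult_left_mono) auto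
    finally show "cmod2 (P' x - \<i> * of_real th * lf u x) \<le> ((1 + \<bar>th\<bar>) * B)\<^sup>2"
      by (intro power_mono) (auto simp: algebra_simps)
  qed
  also have "\<dots> = T * (1 + \<bar>th\<bar>)\<^sup>2 * B\<^sup>2" using T_pos by (simp add: set_lebesgue_integral_def power_mult_distrib)
  finally have 2: "(LINT x:{0..T}|lborel. cmod2 (lfd u x)) \<le> T * (1 + \<bar>th\<bar>)\<^sup>2 * B\<^sup>2" .
  have "(norm u)\<^sup>2 \<le> aT * (T * B\<^sup>2) + 1 / aT * (T * (1 + \<bar>th\<bar>)\<^sup>2 * B\<^sup>2)"
    unfolding norm_lift using 1 2 aT_pos by (intro add_mono mult_left_mono) auto
  also have "\<dots> = k * B\<^sup>2" by (simp add: k_def algebra_simps)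
  also have "\<dots> = (sqrt k * B)\<^sup>2" using k0 by (simp add: power_mult_distrib)
  finally show "norm u \<le> sqrt k * B" by (rule power2_le_imp_le) (use k0 B0 in simp)
qed

text \<open>The four functions are W and its first three derivatives. The third enters since the
  Taylor remainder of a translation is measured in the norm of X, which differentiates once
  more.\<close>

lemma W_bounds: "\<exists>C. \<forall>x. cmod (W x) \<le> C \<and> cmod (W1 x) \<le> C \<and> cmod (- of_real (1 + sx x) * W x) \<le> C
    \<and> cmod (- of_real (2 * rx x) * W x - of_real (1 + sx x) * W1 x) \<le> C"
proof -
  define w where "w = sqrt (2 * E)"
  define C where "C = R + w + (1 + R\<^sup>2) * R + (2 * (R * w) * R + (1 + R\<^sup>2) * w)"
  have "cmod (W x) \<le> C \<and> cmod (W1 x) \<le> C \<and> cmod (- of_real (1 + sx x) * W x) \<le> C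
    \<and> cmod (- of_real (2 * rx x) * W x - of_real (1 + sx x) * W1 x) \<le> C" for x
  proof -
    have s: "0 \<le> sx x" "sx x \<le> R\<^sup>2" by (rule sx_le)+
    have a: "cmod (W x) \<le> R" using power2_le_imp_le[OF s(2)[folded cmod_W]] R_pos by simp
    have "cmod2 (W1 x) \<le> 2 * E" using W_energy[of x] s(1) zero_le_power2[of "sx x"] by linarith
    hence b: "cmod (W1 x) \<le> w" unfolding w_def by (rule real_le_rsqrt)
    have w0: "0 \<le> w" using b norm_ge_zero order_trans by blast
    have "\<bar>rx x\<bar> \<le> cmod (W x) * cmod (W1 x)"
      unfolding rx_def using abs_Re_le_cmod[of "cnj (W x) * W1 x"] by (simp only: norm_mult complex_mod_cnj)
    also have "\<dots> \<le> R * w" using a b R_pos by (intro mult_mono) auto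
    finally have r: "\<bar>rx x\<bar> \<le> R * w" .
    have c: "cmod (- of_real (1 + sx x) * W x) \<le> (1 + R\<^sup>2) * R"
      unfolding norm_mult norm_minus_cancel norm_of_real using s a by (intro mult_mono) auto
    have "cmod (- of_real (2 * rx x) * W x) \<le> 2 * (R * w) * R"
      unfolding norm_mult norm_minus_cancel norm_of_real using r a R_pos w0 by (intro mult_mono) auto
    moreover have "cmod (of_real (1 + sx x) * W1 x) \<le> (1 + R\<^sup>2) * w"
      unfolding norm_mult norm_of_real using s b by (intro mult_mono) auto
    ultimately have d: "cmod (- of_real (2 * rx x) * W x - of_real (1 + sx x) * W1 x) \<le> 2 * (R * w) * R + (1 + R\<^sup>2) * w"
      by (intro order_trans[OF norm_triangle_ineq4] add_mono)
    have nn: "0 \<le> (1 + R\<^sup>2) * R" "0 \<le> 2 * (R * w) * R + (1 + R\<^sup>2) * w" using R_pos w0 by simp_all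
    show ?thesis using a b c d nn w0 R_pos unfolding C_def by (intro conjI) linarith+
  qed
  thus ?thesis by blast
qed

lemma act_taylor:
  "\<exists>C. \<forall>y. norm (act 0 y qw - qw - y *\<^sub>R phi2) \<le> C * y\<^sup>2" "\<exists>C. \<forall>a. norm (act a 0 qw - qw - a *\<^sub>R phi1) \<le> C * a\<^sup>2"
proof -
  obtain K where K: "K \<ge> 0 \<and> (\<forall>u P' B. AC (lf u) P' \<longrightarrow> (\<forall>x. cmod (lf u x) \<le> B) \<longrightarrow> (\<forall>x. cmod (P' x) \<le> B) \<longrightarrow> norm u \<le> K * B)"
    using norm_le_sup by (elim exE)
  obtain C where C: "\<And>x. cmod (W x) \<le> C" "\<And>x. cmod (W1 x) \<le> C" "\<And>x. cmod (- of_real (1 + sx x) * W x) \<le> C"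
      "\<And>x. cmod (- of_real (2 * rx x) * W x - of_real (1 + sx x) * W1 x) \<le> C"
    using W_bounds by blast
  have sh: "AC (\<lambda>x. f (x + y)) (\<lambda>x. f' (x + y))" if "AC f f'" for f f' y
    using AC_affine[OF that, of 1 y] by (simp add: add.commute)
  show "\<exists>C. \<forall>y. norm (act 0 y qw - qw - y *\<^sub>R phi2) \<le> C * y\<^sup>2"
  proof (intro exI allI)
    fix y
    let ?u = "act 0 y qw - qw - y *\<^sub>R phi2"
    have l: "lf ?u = (\<lambda>x. W (x + y) - W x - of_real y * W1 x)"
      by (rule ext) (simp add: lf_diff lf_linear lf_act lf_qw lf_phi)
    let ?P' = "\<lambda>x. W1 (x + y) - W1 x - of_real y * (- of_real (1 + sx x) * W x)"
    have A: "AC (lf ?u) ?P'" unfolding l by (intro AC_diff AC_cmult sh AC_W AC_W1)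
    have "cmod (lf ?u x) \<le> C * y\<^sup>2" for x
      unfolding l by (rule AC_taylor[OF AC_W AC_lipschitz[OF AC_W1 C(3)]])
    moreover have "cmod (?P' x) \<le> C * y\<^sup>2" for x
      by (rule AC_taylor[OF AC_W1 AC_lipschitz[OF AC_W2 C(4)]])
    ultimately have "norm ?u \<le> K * (C * y\<^sup>2)" using K A by blast
    thus "norm ?u \<le> (K * C) * y\<^sup>2" by (simp add: mult.assoc)
  qed
  have lip: "cmod (\<i> * of_real 1 * cis (1 * x) - \<i> * of_real 1 * cis (1 * y)) \<le> 1 * \<bar>x - y\<bar>" for x y
    using AC_lipschitz[OF AC_cis, of 1 1 x y] by (simp add: norm_mult right_diff_distrib[symmetric])
  have ce: "cmod (cis a - 1 - \<i> * of_real a) \<le> a\<^sup>2" for a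
    using AC_taylor[OF AC_cis lip, of 0 a] by (simp add: mult.commute)
  show "\<exists>C. \<forall>a. norm (act a 0 qw - qw - a *\<^sub>R phi1) \<le> C * a\<^sup>2"
  proof (intro exI allI)
    fix a
    \<comment> \<open>A rotation acts by a scalar, so its remainder is that of the
      exponential.\<close>
    have "act a 0 qw - qw - a *\<^sub>R phi1 = cmul (cis a - 1 - \<i> * of_real a) qw"
      by (rule lf_inj, rule ext) (simp add: lf_diff lf_linear lf_act lf_qw lf_phi algebra_simps)
    thus "norm (act a 0 qw - qw - a *\<^sub>R phi1) \<le> norm qw * a\<^sup>2"
      using mult_right_mono[OF ce, of "norm qw" a] by (simp add: norm_cmul mult.commute)
  qed
qed


lemma act_taylor_dist:
  "\<exists>C. \<forall>a y b z. norm (act a y qw - act b z qw) \<le> \<bar>y - z\<bar> * norm phi2 + C * (y - z)\<^sup>2 + (\<bar>a - b\<bar> * norm phi1 + C * (a - b)\<^sup>2)"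
proof -
  obtain C1 where C1: "\<forall>y. norm (act 0 y qw - qw - y *\<^sub>R phi2) \<le> C1 * y\<^sup>2" using act_taylor(1) by (elim exE)
  obtain C2 where C2: "\<forall>a. norm (act a 0 qw - qw - a *\<^sub>R phi1) \<le> C2 * a\<^sup>2" using act_taylor(2) by (elim exE)
  define C where "C = max C1 C2"
  have n2: "norm (act 0 y qw - qw) \<le> \<bar>y\<bar> * norm phi2 + C * y\<^sup>2" for y
  proof -
    have "C1 * y\<^sup>2 \<le> C * y\<^sup>2" by (intro mult_right_mono) (auto simp: C_def)
    thus ?thesis
      using spec[OF C1, of y] norm_triangle_sub[of "act 0 y qw - qw" "y *\<^sub>R phi2"] unfolding norm_scaleR by linarith
  qed
  have n1: "norm (act a 0 qw - qw) \<le> \<bar>a\<bar> * norm phi1 + C * a\<^sup>2" for a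
  proof -
    have "C2 * a\<^sup>2 \<le> C * a\<^sup>2" by (intro mult_right_mono) (auto simp: C_def)
    thus ?thesis
      using spec[OF C2, of a] norm_triangle_sub[of "act a 0 qw - qw" "a *\<^sub>R phi1"] unfolding norm_scaleR by linarith
  qed
  have "norm (act a y qw - act b z qw) \<le> \<bar>y - z\<bar> * norm phi2 + C * (y - z)\<^sup>2 + (\<bar>a - b\<bar> * norm phi1 + C * (a - b)\<^sup>2)" for a y b z
  proof -
    have "act a y qw - act b z qw = act a z (act 0 (y - z) qw - qw) + act b z (act (a - b) 0 qw - qw)"
      unfolding act_diff act_act by simp
    hence "norm (act a y qw - act b z qw) \<le> norm (act 0 (y - z) qw - qw) + norm (act (a - b) 0 qw - qw)"
      using norm_triangle_ineq[of "act a z (act 0 (y - z) qw - qw)" "act b z (act (a - b) 0 qw - qw)"] by (simp add: norm_act)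
    thus ?thesis using n2[of "y - z"] n1[of "a - b"] by linarith
  qed
  thus ?thesis by blast
qed

lemma act_continuous: "continuous_on UNIV (\<lambda>p. act (fst p) (snd p) qw)"
proof -
  obtain C where C: "\<And>a y b z. norm (act a y qw - act b z qw) \<le> \<bar>y - z\<bar> * norm phi2 + C * (y - z)\<^sup>2 + (\<bar>a - b\<bar> * norm phi1 + C * (a - b)\<^sup>2)"
    using act_taylor_dist by blast
  have "((\<lambda>p. act (fst p) (snd p) qw) \<longlongrightarrow> act (fst q) (snd q) qw) (at q)" for q :: "real \<times> real"
  proof (rule LIM_zero_cancel, rule Lim_null_comparison[OF always_eventually])
    let ?h = "\<lambda>p. \<bar>snd p - snd q\<bar> * norm phi2 + C * (snd p - snd q)\<^sup>2 + (\<bar>fst p - fst q\<bar> * norm phi1 + C * (fst p - fst q)\<^sup>2)"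
    show "\<forall>p. norm (act (fst p) (snd p) qw - act (fst q) (snd q) qw) \<le> ?h p" using C by blast
    have "(?h \<longlongrightarrow> ?h q) (at q)" by (intro tendsto_intros)
    thus "(?h \<longlongrightarrow> 0) (at q)" by simp
  qed
  thus ?thesis by (simp add: continuous_on_def)
qed

section \<open>Distance to the orbit and stability\<close>

definition md where "md u = Inf (range (\<lambda>p. norm (u - act (fst p) (snd p) qw)))"

text \<open>By \<open>act_reduce\<close> the infimum runs over the continuous image of a compact
  rectangle.\<close>

lemma md_attained: "\<exists>a y. md u = norm (u - act a y qw)" and md_le: "md u \<le> norm (u - act a y qw)"
proof -
  let ?f = "\<lambda>p. norm (u - act (fst p) (snd p) qw)"
  have c: "continuous_on ({0..2*pi} \<times> {0..T}) ?f"
    by (intro continuous_intros continuous_on_subset[OF act_continuous]) auto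
  have ne: "{0..2*pi} \<times> {0..T} \<noteq> {}" using T_pos by simp
  obtain p where p: "p \<in> {0..2*pi} \<times> {0..T}" "\<forall>q\<in>{0..2*pi} \<times> {0..T}. ?f p \<le> ?f q"
    using continuous_attains_inf[OF compact_Times[OF compact_Icc compact_Icc] ne c] by (elim bexE)
  have min: "?f p \<le> norm (u - act a y qw)" for a y
  proof -
    obtain b z where bz: "b \<in> {0..2*pi}" "z \<in> {0..T}" "act a y qw = act b z qw" using act_reduce by blast
    hence "(b, z) \<in> {0..2*pi} \<times> {0..T}" by simp
    from bspec[OF p(2) this] show ?thesis by (simp add: bz(3))
  qed
  have m: "md u = ?f p"
    unfolding md_def by (rule cInf_eq_minimum) (use min in auto)
  thus "\<exists>a y. md u = norm (u - act a y qw)" by blast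
  show "md u \<le> norm (u - act a y qw)" unfolding m by (rule min)
qed

lemma md_lipschitz: "md u \<le> md v + norm (u - v)"
proof -
  obtain a y where "md v = norm (v - act a y qw)" using md_attained by blast
  moreover have "md u \<le> norm (u - act a y qw)" by (rule md_le)
  moreover have "norm (u - act a y qw) \<le> norm (u - v) + norm (v - act a y qw)"
    using norm_triangle_ineq[of "u - v" "v - act a y qw"] by simp
  ultimately show ?thesis by linarith
qed

lemma md_nonneg: "0 \<le> md u"
  using md_attained[of u] by auto

text \<open>A nearest point of the orbit is carried to the profile by the group. Minimality along
  the two one-parameter families, whose remainders are quadratic by \<open>act_taylor\<close>, gives
  the two orthogonality relations.\<close>

lemma orthogonal_decomposition:
  "\<exists>a y v. u = act a y (qw + v) \<and> norm v = md u \<and> inner v phi1 = 0 \<and> inner v phi2 = 0"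
proof -
  obtain a y where m: "md u = norm (u - act a y qw)" using md_attained by blast
  define v where "v = act (- a) (- y) u - qw"
  have u: "u = act a y (act (- a) (- y) u)" by (simp add: act_act act_zero)
  have v: "act (- a) (- y) (u - act a y qw) = v" unfolding act_diff act_act v_def by (simp add: act_zero)
  hence nv: "norm v = md u" unfolding m by (metis norm_act)
  have min: "norm v \<le> norm (v - (act b z qw - qw))" for b z
  proof -
    have "md u \<le> norm (u - act (a + b) (y + z) qw)" by (rule md_le)
    also have "u - act (a + b) (y + z) qw = act a y (v - (act b z qw - qw))"
      unfolding v_def act_diff act_act by (simp add: act_zero)
    finally show ?thesis unfolding nv norm_act .
  qed
  have "inner v phi1 = 0"
  proof -
    obtain C where C: "\<forall>a. norm (act a 0 qw - qw - a *\<^sub>R phi1) \<le> C * a\<^sup>2" using act_taylor(2) by (elim exE)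
    show ?thesis
      by (rule first_order_condition[where r = "\<lambda>b. act b 0 qw - qw - b *\<^sub>R phi1" and C = C])
         (use min[of _ 0] C in simp_all)
  qed
  moreover have "inner v phi2 = 0"
  proof -
    obtain C where C: "\<forall>z. norm (act 0 z qw - qw - z *\<^sub>R phi2) \<le> C * z\<^sup>2" using act_taylor(1) by (elim exE)
    show ?thesis
      by (rule first_order_condition[where r = "\<lambda>z. act 0 z qw - qw - z *\<^sub>R phi2" and C = C])
         (use min[of 0] C in simp_all)
  qed
  moreover have "u = act a y (qw + v)" using u by (simp add: v_def)
  ultimately show ?thesis using nv by blast
qed

lemma orbital_stability:
  "\<exists>K>0. \<exists>\<delta>>0. \<forall>q :: real \<Rightarrow> h1. (\<forall>t. isCont q t) \<longrightarrow> (\<forall>t. Ly (q t) = Ly (q 0)) \<longrightarrow> md (q 0) \<le> \<delta> \<longrightarrow> (\<forall>t. md (q t) \<le> K * md (q 0))"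
proof -
  obtain c where c: "c > 0 \<and> (\<forall>v. inner v phi1 = 0 \<longrightarrow> inner v phi2 = 0 \<longrightarrow> c * (norm v)\<^sup>2 \<le> Qt v)"
    using coercive by (elim exE)
  obtain C1 where C1: "C1 \<ge> 0 \<and> (\<forall>v. norm v \<le> 1 \<longrightarrow> Qt v / 2 - C1 * norm v ^ 3 \<le> Ly (qw + v) - Ly qw)"
    using Ly_lower by (elim exE)
  obtain C2 where C2: "C2 \<ge> 0 \<and> (\<forall>v. norm v \<le> 1 \<longrightarrow> Ly (qw + v) - Ly qw \<le> C2 * (norm v)\<^sup>2)"
    using Ly_upper by (elim exE)
  \<comment> \<open>Within distance \<open>d\<close> the cubic error is at most \<open>c / 4\<close>
    times the squared distance, half of what coercivity provides.\<close>
  define d where "d = min 1 (c / (4 * (C1 + 1)))"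
  have d: "0 < d" "d \<le> 1" "C1 * d \<le> c / 4"
  proof -
    show "0 < d" "d \<le> 1" using c C1 by (simp_all add: d_def)
    have "C1 * d \<le> (C1 + 1) * (c / (4 * (C1 + 1)))" using C1 c \<open>0 < d\<close> by (intro mult_mono) (auto simp: d_def)
    moreover have x: "x * (c / (4 * x)) = c / 4" if "0 < x" for x using that by simp
    have "(C1 + 1) * (c / (4 * (C1 + 1))) = c / 4" using conjunct1[OF C1] by (intro x) linarith
    ultimately show "C1 * d \<le> c / 4" by linarith
  qed
  have low: "c / 4 * (md u)\<^sup>2 \<le> Ly u - Ly qw" if md: "md u \<le> d" for u
  proof -
    obtain a y v where v: "u = act a y (qw + v)" "norm v = md u" "inner v phi1 = 0" "inner v phi2 = 0"
      using orthogonal_decomposition by blast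
    have n1: "norm v \<le> 1" using v(2) md d by linarith
    have "C1 * norm v ^ 3 = (C1 * norm v) * (norm v)\<^sup>2" by (simp add: power2_eq_square power3_eq_cube)
    also have "\<dots> \<le> c / 4 * (norm v)\<^sup>2"
    proof (rule mult_right_mono)
      have "C1 * norm v \<le> C1 * d" unfolding v(2) by (rule mult_left_mono[OF md conjunct1[OF C1]])
      thus "C1 * norm v \<le> c / 4" using d(3) by linarith
    qed simp
    finally have "C1 * norm v ^ 3 \<le> c / 4 * (norm v)\<^sup>2" .
    moreover have "c * (norm v)\<^sup>2 \<le> Qt v" using conjunct2[OF c, rule_format, OF v(3,4)] .
    moreover have "Qt v / 2 - C1 * norm v ^ 3 \<le> Ly (qw + v) - Ly qw" using conjunct2[OF C1, rule_format, OF n1] .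
    ultimately have "c / 4 * (norm v)\<^sup>2 \<le> Ly (qw + v) - Ly qw" by linarith
    thus ?thesis unfolding v(1)[THEN arg_cong, of Ly] Ly_act v(2) .
  qed
  have up: "Ly u - Ly qw \<le> C2 * (md u)\<^sup>2" if md: "md u \<le> d" for u
  proof -
    obtain a y v where v: "u = act a y (qw + v)" "norm v = md u"
      using orthogonal_decomposition by blast
    have n1: "norm v \<le> 1" using v(2) md d by linarith
    have "Ly (qw + v) - Ly qw \<le> C2 * (norm v)\<^sup>2" using conjunct2[OF C2, rule_format, OF n1] .
    thus ?thesis unfolding v(1)[THEN arg_cong, of Ly] Ly_act v(2) .
  qed
  \<comment> \<open>Comparing the lower and the upper bound for \<open>Ly\<close> gives the factor
    \<open>sqrt (4 * C2 / c)\<close>; adding 1 makes \<open>K\<close> at least 1.\<close>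
  define K where "K = sqrt (4 * C2 / c) + 1"
  have K: "1 \<le> K" using C2 c by (simp add: K_def)
  \<comment> \<open>Then \<open>K * \<delta> <= d / 2\<close>, so distances at most \<open>d\<close>
    are automatically at most \<open>d / 2\<close>.\<close>
  define \<delta> where "\<delta> = d / (2 * K)"
  have del: "0 < \<delta>" "\<delta> \<le> d / 2" "K * \<delta> \<le> d / 2" using d K by (simp_all add: \<delta>_def field_simps)
  have "md (q t) \<le> K * md (q 0)" if cont: "\<And>t. isCont q t" and L: "\<And>t. Ly (q t) = Ly (q 0)" and q0: "md (q 0) \<le> \<delta>" for q :: "real \<Rightarrow> h1" and t
  proof -
    have gap: "md (q t) \<le> K * md (q 0)" if "md (q t) \<le> d" for t
    proof -
      have "c / 4 * (md (q t))\<^sup>2 \<le> C2 * (md (q 0))\<^sup>2"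
        using low[OF that] up[of "q 0"] q0 del d L[of t] by linarith
      hence "(md (q t))\<^sup>2 \<le> 4 * C2 / c * (md (q 0))\<^sup>2" using c by (simp add: field_simps)
      also have "\<dots> = (sqrt (4 * C2 / c) * md (q 0))\<^sup>2" using C2 c by (simp add: power_mult_distrib)
      finally have "md (q t) \<le> sqrt (4 * C2 / c) * md (q 0)"
        by (rule power2_le_imp_le) (use C2 c md_nonneg in simp)
      also have "\<dots> \<le> K * md (q 0)" by (intro mult_right_mono md_nonneg) (simp add: K_def)
      finally show ?thesis .
    qed
    have half: "md (q t) \<le> d / 2" if "md (q t) \<le> d" for t
    proof -
      have "K * md (q 0) \<le> K * \<delta>" using q0 K by (intro mult_left_mono) auto
      thus ?thesis using gap[OF that] del(3) by linarith
    qed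
    have mc: "continuous_on S (\<lambda>t. md (q t))" for S
    proof -
      have "isCont (\<lambda>t. md (q t)) t" for t
        unfolding isCont_def
      proof (rule LIM_zero_cancel, rule Lim_null_comparison[OF always_eventually])
        show "\<forall>s. norm (md (q s) - md (q t)) \<le> norm (q s - q t)"
          using md_lipschitz[of "q _" "q t"] md_lipschitz[of "q t" "q _"]
          by (intro allI) (simp add: abs_le_iff norm_minus_commute algebra_simps)
        show "((\<lambda>s. norm (q s - q t)) \<longlongrightarrow> 0) (at t)"
          using cont[of t] unfolding isCont_def by (intro tendsto_norm_zero LIM_zero)
      qed
      thus ?thesis by (simp add: continuous_at_imp_continuous_on)
    qed
    \<comment> \<open>Leaving the \<open>d\<close>-neighbourhood would force the continuous distance
      through \<open>3 / 4 * d\<close>, which lies in the forbidden gap.\<close>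
    have "md (q t) \<le> d"
    proof (rule ccontr)
      assume n: "\<not> md (q t) \<le> d"
      have q0': "md (q 0) \<le> 3 / 4 * d" using q0 del d by linarith
      have "\<exists>s. md (q s) = 3 / 4 * d"
      proof (cases "0 \<le> t")
        case True
        thus ?thesis using IVT'[of "\<lambda>t. md (q t)" 0 "3 / 4 * d" t, OF q0' _ _ mc] n d by auto
      next
        case False
        thus ?thesis using IVT2'[of "\<lambda>t. md (q t)" 0 "3 / 4 * d" t, OF q0' _ _ mc] n d by auto
      qed
      then obtain s where s: "md (q s) = 3 / 4 * d" by blast
      hence "md (q s) \<le> d" using d by linarith
      from half[OF this] show False using s d by linarith
    qed
    thus ?thesis by (rule gap)
  qed
  thus ?thesis using K del(1) by (intro exI[of _ K] conjI exI[of _ \<delta>]) auto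
qed

end

section \<open>Transfer to the evolution equation\<close>

theorem proposition4p3:
  fixes J E :: real
  assumes "(J, E) \<in> par_dom"
    and "det (H_mat J E) < 0"
  shows "\<exists>C0>0. \<exists>\<epsilon>0>0. \<forall>\<epsilon>\<le>\<epsilon>0. \<forall>Q0\<in>X_space.
           orbit_dist Q0 (Q_prof J E) \<le> \<epsilon> \<longrightarrow>
           (\<forall>Q. is_solution J E Q \<and> Q 0 = Q0 \<longrightarrow>
              (\<forall>t. orbit_dist (Q t) (Q_prof J E) \<le> C0 * \<epsilon>))"
proof -
  obtain j R where jR: "\<bar>j\<bar> < R" and JE: "J = cn_wave.J j R" "E = cn_wave.E j R"
    using par_dom_cn_wave[OF assms(1)] by blast
  interpret w: cn_wave j R by unfold_locales (rule jR)
  have kp: "k_par J E = w.aT / 2" "p_par J E = w.th"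
    unfolding JE w.k_par_eq w.p_par_eq w.aT_def w.th_def by simp_all
  have "is_profile J E (W_prof J E)"
    unfolding W_prof_def JE by (rule someI[of "is_profile w.J w.E"]) (rule w.wave_is_profile)
  then obtain c x0 where c: "cmod c = 1" and Wp: "\<And>x. W_prof J E x = c * w.W (x + x0)"
    using w.profile_unique unfolding JE by blast
  obtain \<theta> where th: "c = cis \<theta>" using c by (metis complex_norm_eq_1_exp cis_conv_exp)
  have Qp: "Q_prof J E = fn (w.act \<theta> x0 w.qw)"
  proof
    fix z
    have a0: "w.aT \<noteq> 0" using w.aT_pos by simp
    have "Q_prof J E z = cis (- (w.th * (z / w.aT))) * w.lf (w.act \<theta> x0 w.qw) (z / w.aT)"
      unfolding Q_prof_def kp Wp w.lf_act w.lf_qw th by simp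
    also have "\<dots> = fn (w.act \<theta> x0 w.qw) z"
      unfolding w.lf_def using a0 by (simp add: cis_mult mult.assoc[symmetric])
    finally show "Q_prof J E z = fn (w.act \<theta> x0 w.qw) z" .
  qed
  \<comment> \<open>The substitution between the two parametrizations by phase and shift is a
    bijection of the plane, so both infima run over the same set of distances.\<close>
  have od: "orbit_dist (fn u) (Q_prof J E) = w.md u" for u
  proof -
    have X: "X_dist (fn u) (\<lambda>z. cis (- \<phi>) * Q_prof J E (z + \<xi>)) = norm (u - w.act (- \<phi> - w.th * (\<xi> / w.aT) + \<theta>) (\<xi> / w.aT + x0) w.qw)" for \<phi> \<xi>
    proof -
      have a1: "w.aT * (\<xi> / w.aT) = \<xi>" using w.aT_pos by simp
      have "(\<lambda>z. cis (- \<phi>) * Q_prof J E (z + \<xi>)) = fn (w.act (- \<phi> - w.th * (\<xi> / w.aT)) (\<xi> / w.aT) (w.act \<theta> x0 w.qw))"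
        unfolding Qp w.fn_act[of "- \<phi> - w.th * (\<xi> / w.aT)", abs_def] a1 by simp
      thus ?thesis by (simp add: X_dist_fn w.act_act)
    qed
    have "range (\<lambda>(\<phi>, \<xi>). X_dist (fn u) (\<lambda>z. cis (- \<phi>) * Q_prof J E (z + \<xi>))) = range (\<lambda>p. norm (u - w.act (fst p) (snd p) w.qw))"
    proof (intro equalityI subsetI; elim rangeE)
      fix r and p :: "real \<times> real" assume "r = (case p of (\<phi>, \<xi>) \<Rightarrow> X_dist (fn u) (\<lambda>z. cis (- \<phi>) * Q_prof J E (z + \<xi>)))"
      thus "r \<in> range (\<lambda>p. norm (u - w.act (fst p) (snd p) w.qw))"
        by (intro range_eqI[of _ _ "(- fst p - w.th * (snd p / w.aT) + \<theta>, snd p / w.aT + x0)"]) (simp add: X split_beta)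
    next
      fix r p assume r: "r = norm (u - w.act (fst p) (snd p) w.qw)"
      have "w.aT \<noteq> 0" using w.aT_pos by simp
      thus "r \<in> range (\<lambda>(\<phi>, \<xi>). X_dist (fn u) (\<lambda>z. cis (- \<phi>) * Q_prof J E (z + \<xi>)))"
        unfolding r
        by (intro range_eqI[of _ _ "(\<theta> - w.th * (snd p - x0) - fst p, w.aT * (snd p - x0))"]) (simp add: X)
    qed
    thus ?thesis by (simp add: orbit_dist_def w.md_def)
  qed
  obtain K \<delta> where K: "K > 0" "\<delta> > 0"
    and stab: "\<forall>q :: real \<Rightarrow> h1. (\<forall>t. isCont q t) \<longrightarrow> (\<forall>t. w.Ly (q t) = w.Ly (q 0)) \<longrightarrow> w.md (q 0) \<le> \<delta> \<longrightarrow> (\<forall>t. w.md (q t) \<le> K * w.md (q 0))"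
    using w.orbital_stability by (elim exE conjE)
  have main: "orbit_dist (Q t) (Q_prof J E) \<le> K * \<epsilon>"
    if e: "\<epsilon> \<le> \<delta>" "orbit_dist (Q 0) (Q_prof J E) \<le> \<epsilon>" and sol: "is_solution J E Q" for \<epsilon> Q t
  proof -
    define q where "q t = H1 (Q t)" for t
    note sol' = sol[unfolded is_solution_def Let_def kp]
    have X: "Q t \<in> X_space" for t using conjunct1[OF sol'] by blast
    have fq: "fn (q t) = Q t" for t unfolding q_def by (rule fn_H1[OF X])
    have cont: "isCont q t" for t
    proof -
      have "((\<lambda>\<tau>. X_dist (Q \<tau>) (Q t)) \<longlongrightarrow> 0) (at t)" by (rule conjunct1[OF conjunct2[OF sol'], rule_format])
      hence "((\<lambda>\<tau>. norm (q \<tau> - q t)) \<longlongrightarrow> 0) (at t)" unfolding X_dist_fn[symmetric] fq .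
      thus ?thesis unfolding isCont_def by (rule LIM_zero_cancel[OF tendsto_norm_zero_cancel])
    qed
    have wk: "((\<lambda>\<tau>. iper (\<lambda>z. fn (q \<tau>) z * fn \<phi> z)) has_vector_derivative pair_form (w.aT / 2) w.th (q t) \<phi>) (at t)" for \<phi> t
    proof -
      have "fn \<phi> \<in> X_space" by (rule fn)
      hence "((\<lambda>\<tau>. iper (\<lambda>z. Q \<tau> z * fn \<phi> z)) has_vector_derivative
           \<i> * iper (\<lambda>z. 4 * \<i> * of_real (w.th * (w.aT / 2)) * wderiv (Q t) z * fn \<phi> z
                 - 4 * of_real ((w.aT / 2)\<^sup>2) * wderiv (Q t) z * wderiv (fn \<phi>) z
                 + of_real (1 - w.th\<^sup>2) * Q t z * fn \<phi> z
                 + of_real (cmod2 (Q t z)) * Q t z * fn \<phi> z)) (at t)"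
        by (rule conjunct2[OF conjunct2[OF sol'], rule_format])
      thus ?thesis unfolding fq pair_form_def dv_def .
    qed
    interpret f: weak_flow "w.aT / 2" w.th q by unfold_locales (rule cont wk)+
    have Ly: "w.Ly (q t) = w.Ly (q 0)" for t
    proof (rule w.Ly_cong)
      show "mass (q t) = mass (q 0)" unfolding mass_def by (rule f.mass_conserved)
      show "mom (q t) = mom (q 0)" unfolding mom_def by (rule f.momentum_conserved)
      \<comment> \<open>This matches the coefficient \<open>2 * k^2\<close> of the conserved energy,
        with \<open>k = aT / 2\<close>.\<close>
      have "w.aT\<^sup>2 / 2 = 2 * (w.aT / 2)\<^sup>2" by (simp add: power2_eq_square)
      thus "w.aT\<^sup>2 / 2 * dir (q t) - qua (q t) / 4 = w.aT\<^sup>2 / 2 * dir (q 0) - qua (q 0) / 4"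
        using f.energy_conserved[of t 0] unfolding f.quart_def dir_def qua_def by simp
    qed
    have m0: "w.md (q 0) \<le> \<epsilon>" using e(2) unfolding od[symmetric] fq .
    have "w.md (q t) \<le> K * w.md (q 0)"
      using m0 e(1) by (intro stab[rule_format] cont Ly) linarith
    also have "\<dots> \<le> K * \<epsilon>" using m0 K by (intro mult_left_mono) auto
    finally show ?thesis unfolding od[symmetric] fq .
  qed
  show ?thesis
    using K main by (intro exI[of _ K] exI[of _ \<delta>] conjI allI impI ballI) auto
qed

end
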